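(* Let $u_0\in H^1_0(\Omega)$ and $f\in L^\infty(0,\infty;L^2(\Omega))$, and let $u$ be the strong solution of $u_t-(1+\|\nabla u(t)\|^2)\Delta u=f$ in $\Omega\times(0,\infty)$, $u=0$ on $\partial\Omega\times(0,\infty)$, $u(\cdot,0)=u_0$. Then for $0<\alpha<\frac{\lambda_1}{2}$ and all $t>0$, $$2e^{-2\alpha t}\int_0^te^{2\alpha s}\|u_s\|^2ds+(2+\|\nabla u(t)\|^2)\|\nabla u(t)\|^2\le(2+\|\nabla u_0\|^2)\|\nabla u_0\|^2e^{-2\alpha t}+\frac1\alpha\|f\|^2_{L^\infty(L^2)}(1-e^{-2\alpha t})+\alpha\Big(1+\frac4\beta\Big)\widehat K_0(t)$$ $$\le(2+\|\nabla u_0\|^2)\|\nabla u_0\|^2+\frac1\alpha\|f\|^2_{L^\infty(L^2)}+\alpha\Big(1+\frac4\beta\Big)K_0,$$ where $\beta=1-\frac{2\alpha}{\lambda_1}$, $\widehat K_0(t)=e^{-2\alpha t}\|u_0\|^2+\frac1{2\alpha}\|f\|^2_{L^\infty(H^{-1})}(1-e^{-2\alpha t})$ and $K_0=\|u_0\|^2+\frac1{2\alpha}\|f\|^2_{L^\infty(H^{-1})}$.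
   Context: $\Omega\subset\mathbb{R}^d$ ($d=2$ or $3$) is a bounded convex polygonal or polyhedral domain; $\|\cdot\|$ is the $L^2(\Omega)$-norm; $H^{-1}(\Omega)$ carries the norm dual to $\|\nabla\cdot\|$ on $H^1_0(\Omega)$. $\lambda_1>0$ is the smallest eigenvalue of $-\Delta$ with homogeneous Dirichlet boundary condition. $u_s=\partial u/\partial s$. The strong solution satisfies, for every $T>0$, $u\in C([0,T];H^1_0(\Omega))\cap L^2(0,T;H^2(\Omega))$ and $u_t\in L^2(0,T;L^2(\Omega))$, with the equation holding almost everywhere. *)

theory Defs
  imports "HOL-Analysis.Analysis" "HOL-Probability.Essential_Supremum"
begin

text \<open>
  Elements of Lebesgue and Sobolev spaces are represented by functions, and equality in such a
  space is equality almost everywhere on the domain. A function of time with values in a space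
  over \<open>\<Omega>\<close> is a map \<open>real \<Rightarrow> 'a \<Rightarrow> real\<close>, the first argument being the time.
\<close>

definition convex_polytopal_domain :: "'a::euclidean_space set \<Rightarrow> bool" where
  "convex_polytopal_domain \<Omega> \<longleftrightarrow>
     \<Omega> \<noteq> {} \<and> open \<Omega> \<and> convex \<Omega> \<and> bounded \<Omega> \<and> polytope (closure \<Omega>)"

section \<open>Square integrable functions\<close>

definition L2_space :: "'a::euclidean_space set \<Rightarrow> ('a \<Rightarrow> 'b::euclidean_space) set" where
  "L2_space \<Omega> = {v. v \<in> borel_measurable (lebesgue_on \<Omega>) \<and>
                     integrable (lebesgue_on \<Omega>) (\<lambda>x. (norm (v x))\<^sup>2)}"

definition L2_inner ::
  "'a::euclidean_space set \<Rightarrow> ('a \<Rightarrow> 'b::euclidean_space) \<Rightarrow> ('a \<Rightarrow> 'b) \<Rightarrow> real" where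
  "L2_inner \<Omega> v w = (LINT x|lebesgue_on \<Omega>. v x \<bullet> w x)"

definition L2_norm :: "'a::euclidean_space set \<Rightarrow> ('a \<Rightarrow> 'b::euclidean_space) \<Rightarrow> real" where
  "L2_norm \<Omega> v = sqrt (LINT x|lebesgue_on \<Omega>. (norm (v x))\<^sup>2)"

section \<open>Test functions and weak derivatives\<close>

fun C_k :: "nat \<Rightarrow> ('a::euclidean_space \<Rightarrow> real) \<Rightarrow> bool" where
  "C_k 0 \<phi> \<longleftrightarrow> continuous_on UNIV \<phi>"
| "C_k (Suc k) \<phi> \<longleftrightarrow> (\<forall>x. \<phi> differentiable (at x)) \<and>
     (\<forall>b\<in>Basis. C_k k (\<lambda>x. frechet_derivative \<phi> (at x) b))"

text \<open>\<open>C\<^sub>c\<^sup>\<infinity>(\<Omega>)\<close>; its elements are extended by zero to the whole space.\<close>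

definition test_function :: "'a::euclidean_space set \<Rightarrow> ('a \<Rightarrow> real) \<Rightarrow> bool" where
  "test_function \<Omega> \<phi> \<longleftrightarrow> (\<forall>k. C_k k \<phi>) \<and>
     compact (closure {x. \<phi> x \<noteq> 0}) \<and> closure {x. \<phi> x \<noteq> 0} \<subseteq> \<Omega>"

text \<open>\<open>g \<in> L\<^sup>2(\<Omega>)\<close> is the weak derivative of \<open>v \<in> L\<^sup>2(\<Omega>)\<close> in the coordinate direction \<open>b\<close>.\<close>

definition has_wderiv ::
  "'a::euclidean_space set \<Rightarrow> 'a \<Rightarrow> ('a \<Rightarrow> real) \<Rightarrow> ('a \<Rightarrow> real) \<Rightarrow> bool" where
  "has_wderiv \<Omega> b v g \<longleftrightarrow> v \<in> L2_space \<Omega> \<and> g \<in> L2_space \<Omega> \<and>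
     (\<forall>\<phi>. test_function \<Omega> \<phi> \<longrightarrow>
        (LINT x|lebesgue_on \<Omega>. v x * frechet_derivative \<phi> (at x) b) =
        - (LINT x|lebesgue_on \<Omega>. g x * \<phi> x))"

text \<open>
  A weak derivative is unique up to null sets, so that the choice of a representative does not
  matter. The value is unspecified if there is no weak derivative in \<open>L\<^sup>2(\<Omega>)\<close>.
\<close>

definition wderiv :: "'a::euclidean_space set \<Rightarrow> 'a \<Rightarrow> ('a \<Rightarrow> real) \<Rightarrow> 'a \<Rightarrow> real" where
  "wderiv \<Omega> b v = (SOME g. has_wderiv \<Omega> b v g)"

definition wgrad :: "'a::euclidean_space set \<Rightarrow> ('a \<Rightarrow> real) \<Rightarrow> 'a \<Rightarrow> 'a" where
  "wgrad \<Omega> v x = (\<Sum>b\<in>Basis. wderiv \<Omega> b v x *\<^sub>R b)"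

definition wlaplacian :: "'a::euclidean_space set \<Rightarrow> ('a \<Rightarrow> real) \<Rightarrow> 'a \<Rightarrow> real" where
  "wlaplacian \<Omega> v x = (\<Sum>b\<in>Basis. wderiv \<Omega> b (wderiv \<Omega> b v) x)"

section \<open>Sobolev spaces\<close>

definition H1_space :: "'a::euclidean_space set \<Rightarrow> ('a \<Rightarrow> real) set" where
  "H1_space \<Omega> = {v \<in> L2_space \<Omega>. \<forall>b\<in>Basis. \<exists>g. has_wderiv \<Omega> b v g}"

definition H1_norm :: "'a::euclidean_space set \<Rightarrow> ('a \<Rightarrow> real) \<Rightarrow> real" where
  "H1_norm \<Omega> v = sqrt ((L2_norm \<Omega> v)\<^sup>2 + (L2_norm \<Omega> (wgrad \<Omega> v))\<^sup>2)"

definition H10_space :: "'a::euclidean_space set \<Rightarrow> ('a \<Rightarrow> real) set" where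
  "H10_space \<Omega> = {v \<in> H1_space \<Omega>. \<exists>\<phi>. (\<forall>n. test_function \<Omega> (\<phi> n)) \<and>
     (\<lambda>n. H1_norm \<Omega> (\<lambda>x. v x - \<phi> n x)) \<longlonglongrightarrow> 0}"

definition H2_space :: "'a::euclidean_space set \<Rightarrow> ('a \<Rightarrow> real) set" where
  "H2_space \<Omega> = {v \<in> H1_space \<Omega>. \<forall>b\<in>Basis. wderiv \<Omega> b v \<in> H1_space \<Omega>}"

definition H2_norm :: "'a::euclidean_space set \<Rightarrow> ('a \<Rightarrow> real) \<Rightarrow> real" where
  "H2_norm \<Omega> v = sqrt ((H1_norm \<Omega> v)\<^sup>2 +
     (\<Sum>b\<in>Basis. \<Sum>c\<in>Basis. (L2_norm \<Omega> (wderiv \<Omega> c (wderiv \<Omega> b v)))\<^sup>2))"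

text \<open>
  The norm in \<open>H\<^sup>-\<^sup>1(\<Omega>)\<close>, dual to \<open>v \<mapsto> \<parallel>\<nabla>v\<parallel>\<close> on \<open>H\<^sub>0\<^sup>1(\<Omega>)\<close>, of \<open>g \<in> L\<^sup>2(\<Omega>)\<close> regarded as
  the functional \<open>v \<mapsto> (g, v)\<close>.
\<close>

definition Hm1_norm :: "'a::euclidean_space set \<Rightarrow> ('a \<Rightarrow> real) \<Rightarrow> real" where
  "Hm1_norm \<Omega> g =
     (SUP v\<in>{v \<in> H10_space \<Omega>. L2_norm \<Omega> (wgrad \<Omega> v) \<le> 1}. \<bar>L2_inner \<Omega> g v\<bar>)"

text \<open>
  Eigenvalues of \<open>-\<Delta>\<close> with homogeneous Dirichlet boundary condition, in the weak formulation
  \<open>(\<nabla>v, \<nabla>w) = \<mu> (v, w)\<close> for all \<open>w \<in> H\<^sub>0\<^sup>1(\<Omega>)\<close>.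
\<close>

definition dirichlet_eigenvalue :: "'a::euclidean_space set \<Rightarrow> real \<Rightarrow> bool" where
  "dirichlet_eigenvalue \<Omega> \<mu> \<longleftrightarrow>
     (\<exists>v\<in>H10_space \<Omega>. \<not> (AE x in lebesgue_on \<Omega>. v x = 0) \<and>
        (\<forall>w\<in>H10_space \<Omega>. L2_inner \<Omega> (wgrad \<Omega> v) (wgrad \<Omega> w) = \<mu> * L2_inner \<Omega> v w))"

definition dirichlet_eigenvalue1 :: "'a::euclidean_space set \<Rightarrow> real" where
  "dirichlet_eigenvalue1 \<Omega> = (LEAST \<mu>. dirichlet_eigenvalue \<Omega> \<mu>)"

section \<open>Functions of time with values in a function space\<close>

text \<open>
  Throughout, \<open>I\<close> is an interval and \<open>X\<close> a space of functions with norm \<open>N\<close>. Strong measurability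
  is approximability almost everywhere, in the norm \<open>N\<close>, by \<open>X\<close>-valued simple functions.
\<close>

definition strongly_measurable ::
  "real set \<Rightarrow> ('a \<Rightarrow> real) set \<Rightarrow> (('a \<Rightarrow> real) \<Rightarrow> real) \<Rightarrow> (real \<Rightarrow> 'a \<Rightarrow> real) \<Rightarrow> bool" where
  "strongly_measurable I X N u \<longleftrightarrow>
     (AE t in lebesgue_on I. u t \<in> X) \<and>
     (\<exists>s. (\<forall>n. simple_function (lebesgue_on I) (s n) \<and> s n ` I \<subseteq> X) \<and>
          (AE t in lebesgue_on I. (\<lambda>n. N (\<lambda>x. u t x - s n t x)) \<longlonglongrightarrow> 0))"

definition Bochner_L2 ::
  "real set \<Rightarrow> ('a \<Rightarrow> real) set \<Rightarrow> (('a \<Rightarrow> real) \<Rightarrow> real) \<Rightarrow> (real \<Rightarrow> 'a \<Rightarrow> real) set" where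
  "Bochner_L2 I X N =
     {u. strongly_measurable I X N u \<and> integrable (lebesgue_on I) (\<lambda>t. (N (u t))\<^sup>2)}"

definition Bochner_Linf ::
  "real set \<Rightarrow> ('a \<Rightarrow> real) set \<Rightarrow> (('a \<Rightarrow> real) \<Rightarrow> real) \<Rightarrow> (real \<Rightarrow> 'a \<Rightarrow> real) set" where
  "Bochner_Linf I X N =
     {u. strongly_measurable I X N u \<and> (\<exists>C. AE t in lebesgue_on I. N (u t) \<le> C)}"

definition Linf_norm ::
  "real set \<Rightarrow> (('a \<Rightarrow> real) \<Rightarrow> real) \<Rightarrow> (real \<Rightarrow> 'a \<Rightarrow> real) \<Rightarrow> real" where
  "Linf_norm I N u = real_of_ereal (esssup (lebesgue_on I) (\<lambda>t. ereal (N (u t))))"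

definition continuous_into ::
  "real set \<Rightarrow> ('a \<Rightarrow> real) set \<Rightarrow> (('a \<Rightarrow> real) \<Rightarrow> real) \<Rightarrow> (real \<Rightarrow> 'a \<Rightarrow> real) \<Rightarrow> bool" where
  "continuous_into I X N u \<longleftrightarrow> (\<forall>t\<in>I. u t \<in> X \<and>
     ((\<lambda>s. N (\<lambda>x. u s x - u t x)) \<longlongrightarrow> 0) (at t within I))"

text \<open>
  Weak time derivative on \<open>(0,\<infinity>)\<close>. The identity \<open>\<integral> \<phi>'(t) u(t) dt = - \<integral> \<phi>(t) g(t) dt\<close> between
  Bochner integrals in \<open>L\<^sup>2(\<Omega>)\<close> is expressed by taking inner products with all \<open>w \<in> L\<^sup>2(\<Omega>)\<close>.
\<close>

definition has_time_deriv ::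
  "'a::euclidean_space set \<Rightarrow> (real \<Rightarrow> 'a \<Rightarrow> real) \<Rightarrow> (real \<Rightarrow> 'a \<Rightarrow> real) \<Rightarrow> bool" where
  "has_time_deriv \<Omega> u g \<longleftrightarrow>
     (\<forall>T>0. g \<in> Bochner_L2 {0<..<T} (L2_space \<Omega>) (L2_norm \<Omega>)) \<and>
     (\<forall>w\<in>L2_space \<Omega>. \<forall>\<phi>. test_function {0<..} \<phi> \<longrightarrow>
        (LINT t|lebesgue_on {0<..}. deriv \<phi> t * L2_inner \<Omega> (u t) w) =
        - (LINT t|lebesgue_on {0<..}. \<phi> t * L2_inner \<Omega> (g t) w))"

definition time_deriv ::
  "'a::euclidean_space set \<Rightarrow> (real \<Rightarrow> 'a \<Rightarrow> real) \<Rightarrow> real \<Rightarrow> 'a \<Rightarrow> real" where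
  "time_deriv \<Omega> u = (SOME g. has_time_deriv \<Omega> u g)"

section \<open>The Kirchhoff type problem\<close>

text \<open>
  The homogeneous boundary condition is contained in \<open>u(t) \<in> H\<^sub>0\<^sup>1(\<Omega>)\<close>, and the existence of
  \<open>g\<close> with \<^term>\<open>has_time_deriv \<Omega> u g\<close> states that \<open>u\<^sub>t \<in> L\<^sup>2(0,T;L\<^sup>2(\<Omega>))\<close> for every \<open>T > 0\<close>.
\<close>

definition strong_solution ::
  "'a::euclidean_space set \<Rightarrow> ('a \<Rightarrow> real) \<Rightarrow> (real \<Rightarrow> 'a \<Rightarrow> real) \<Rightarrow> (real \<Rightarrow> 'a \<Rightarrow> real) \<Rightarrow> bool"
  where
  "strong_solution \<Omega> u0 f u \<longleftrightarrow>
     (\<forall>T>0. continuous_into {0..T} (H10_space \<Omega>) (H1_norm \<Omega>) u) \<and>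
     (\<forall>T>0. u \<in> Bochner_L2 {0<..<T} (H2_space \<Omega>) (H2_norm \<Omega>)) \<and>
     (\<exists>g. has_time_deriv \<Omega> u g) \<and>
     (AE t in lebesgue_on {0<..}. AE x in lebesgue_on \<Omega>.
        time_deriv \<Omega> u t x
          - (1 + (L2_norm \<Omega> (wgrad \<Omega> (u t)))\<^sup>2) * wlaplacian \<Omega> (u t) x = f t x) \<and>
     (AE x in lebesgue_on \<Omega>. u 0 x = u0 x)"

end

theory Submission
  imports Defs "HOL-Complex_Analysis.Great_Picard" "HOL-Real_Asymp.Real_Asymp"
begin

text \<open>
  Put \<open>z = \<parallel>\<nabla>u\<parallel>\<^sup>2\<close>. Testing with \<open>e\<^bsup>2\<alpha>s\<^esup> u\<close> and absorbing \<open>2\<alpha>\<parallel>u\<parallel>\<^sup>2\<close> by the Poincare inequality with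
  its best constant \<open>\<lambda>\<^sub>1\<close> bounds the integral of \<open>e\<^bsup>2\<alpha>s\<^esup> (\<beta> z + 2 z\<^sup>2)\<close> by \<open>e\<^bsup>2\<alpha>t\<^esup>\<close> times the quantity called
  \<open>K\<^sub>0(t)\<close> with a hat in the statement. Testing with \<open>e\<^bsup>2\<alpha>s\<^esup> u\<^sub>t\<close> leaves the integral of
  \<open>2\<alpha> e\<^bsup>2\<alpha>s\<^esup> (2 + z) z\<close> on the right-hand side, which is at most \<open>\<alpha> (1 + 4/\<beta>)\<close> times the former.

  No chain rule for \<open>\<parallel>u\<parallel>\<^sup>2\<close> or \<open>z\<close> is needed: \<open>\<parallel>u\<parallel>\<^sup>2\<close> and \<open>(2 + z) z\<close> are convex in \<open>u\<close>, so their backward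
  increments are bounded by an inner product with \<open>u(t) - u(s)\<close>, and these bounds are integrated by
  passing to the limit in difference quotients. That \<open>\<lambda>\<^sub>1\<close> is the infimum of the Rayleigh quotient
  follows from Rellich compactness, obtained here by comparing a test function with its averages over
  small balls.
\<close>

section \<open>Square-integrable functions\<close>

text \<open>The obstacle is regularity in time: \<open>u\<close> has only a weak time derivative
  with values in L^2, while the energy involves the gradient. Increments are taken backward because
  the tangent of a convex functional at the later time t bounds \<open>\<Phi> t - \<Phi> s\<close>
  from above. At almost every t this tangent is represented by an element of L^2, namely a multiple
  of u(t) or of f - u_t, so it can be paired with the L^2 difference quotients of \<open>u\<close>.
  One-sided bounds suffice since only inequalities are claimed. The constant 1 + 4/\<beta> comes
  from comparing 2 (2 + z) z = 4 z + 2 z^2 with the controlled integrand \<beta> z + 2 z^2: the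
  linear term costs the factor 4/\<beta>, the quadratic one the factor 1. Elements of the spaces are
  functions, so that even linearity of the weak gradient holds only almost everywhere; and the
  exceptional times of the equation must not depend on the function it is tested with.\<close>

lemma L2_spaceD:
  assumes "v \<in> L2_space S"
  shows "v \<in> borel_measurable (lebesgue_on S)" "integrable (lebesgue_on S) (\<lambda>x. (norm (v x))\<^sup>2)"
  using assms by (auto simp: L2_space_def)

lemma L2_space_bounded:
  assumes "v \<in> borel_measurable (lebesgue_on S)" "integrable (lebesgue_on S) g"
    and "AE x in lebesgue_on S. (norm (v x))\<^sup>2 \<le> g x"
  shows "v \<in> L2_space S"
proof -
  have "integrable (lebesgue_on S) (\<lambda>x. (norm (v x))\<^sup>2)"
  proof (rule Bochner_Integration.integrable_bound[OF assms(2)])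
    show "(\<lambda>x. (norm (v x))\<^sup>2) \<in> borel_measurable (lebesgue_on S)" using assms(1) by measurable
    show "AE x in lebesgue_on S. norm ((norm (v x))\<^sup>2) \<le> norm (g x)" using assms(3) by eventually_elim auto
  qed
  then show ?thesis using assms(1) by (auto simp: L2_space_def)
qed

lemma L2_space_0 [simp]: "(\<lambda>x. 0) \<in> L2_space S"
  by (auto simp: L2_space_def)

lemma L2_space_scaleR [intro]:
  assumes "v \<in> L2_space S" shows "(\<lambda>x. c *\<^sub>R v x) \<in> L2_space S"
  using assms by (auto simp: L2_space_def power_mult_distrib)

lemma L2_space_cmult [intro]:
  fixes v :: "'a::euclidean_space \<Rightarrow> real"
  assumes "v \<in> L2_space S" shows "(\<lambda>x. c * v x) \<in> L2_space S"
  using L2_space_scaleR[OF assms, of c] by simp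

lemma L2_space_add [intro]:
  assumes "v \<in> L2_space S" "w \<in> L2_space S" shows "(\<lambda>x. v x + w x) \<in> L2_space S"
proof (rule L2_space_bounded)
  note [measurable] = L2_spaceD(1)[OF assms(1)] L2_spaceD(1)[OF assms(2)]
  show "(\<lambda>x. v x + w x) \<in> borel_measurable (lebesgue_on S)" by measurable
  show "integrable (lebesgue_on S) (\<lambda>x. 2 * (norm (v x))\<^sup>2 + 2 * (norm (w x))\<^sup>2)"
    using L2_spaceD(2)[OF assms(1)] L2_spaceD(2)[OF assms(2)] by auto
  show "AE x in lebesgue_on S. (norm (v x + w x))\<^sup>2 \<le> 2 * (norm (v x))\<^sup>2 + 2 * (norm (w x))\<^sup>2"
  proof (rule AE_I2)
    fix x
    have "(norm (v x + w x))\<^sup>2 \<le> (norm (v x) + norm (w x))\<^sup>2"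
      by (intro power_mono norm_triangle_ineq) auto
    also have "\<dots> \<le> 2 * (norm (v x))\<^sup>2 + 2 * (norm (w x))\<^sup>2"
      using sum_squares_bound[of "norm (v x)" "norm (w x)"] by (simp add: power2_sum)
    finally show "(norm (v x + w x))\<^sup>2 \<le> 2 * (norm (v x))\<^sup>2 + 2 * (norm (w x))\<^sup>2" .
  qed
qed

lemma L2_space_uminus [intro]:
  assumes "v \<in> L2_space S" shows "(\<lambda>x. - v x) \<in> L2_space S"
  using L2_space_scaleR[OF assms, of "-1"] by simp

lemma L2_space_diff [intro]:
  assumes "v \<in> L2_space S" "w \<in> L2_space S" shows "(\<lambda>x. v x - w x) \<in> L2_space S"
  using L2_space_add[OF assms(1) L2_space_uminus[OF assms(2)]] by simp

lemma L2_space_sum [intro]: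
  assumes "\<And>i. i \<in> I \<Longrightarrow> v i \<in> L2_space S" shows "(\<lambda>x. \<Sum>i\<in>I. v i x) \<in> L2_space S"
  using assms by (induction I rule: infinite_finite_induct) auto

lemma integrable_L2_inner:
  assumes "v \<in> L2_space S" "w \<in> L2_space S"
  shows "integrable (lebesgue_on S) (\<lambda>x. v x \<bullet> w x)"
proof (rule Bochner_Integration.integrable_bound)
  note [measurable] = L2_spaceD(1)[OF assms(1)] L2_spaceD(1)[OF assms(2)]
  show "(\<lambda>x. v x \<bullet> w x) \<in> borel_measurable (lebesgue_on S)" by measurable
  show "integrable (lebesgue_on S) (\<lambda>x. (norm (v x))\<^sup>2 + (norm (w x))\<^sup>2)"
    using L2_spaceD(2)[OF assms(1)] L2_spaceD(2)[OF assms(2)] by auto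
  show "AE x in lebesgue_on S. norm (v x \<bullet> w x) \<le> norm ((norm (v x))\<^sup>2 + (norm (w x))\<^sup>2)"
  proof (rule AE_I2)
    fix x
    have "\<bar>v x \<bullet> w x\<bar> \<le> norm (v x) * norm (w x)" by (rule Cauchy_Schwarz_ineq2)
    also have "\<dots> \<le> (norm (v x))\<^sup>2 + (norm (w x))\<^sup>2"
      using sum_squares_bound[of "norm (v x)" "norm (w x)"]
        mult_nonneg_nonneg[OF norm_ge_zero[of "v x"] norm_ge_zero[of "w x"]] by linarith
    finally show "norm (v x \<bullet> w x) \<le> norm ((norm (v x))\<^sup>2 + (norm (w x))\<^sup>2)" by simp
  qed
qed

lemma integrable_L2_mult:
  fixes v w :: "'a::euclidean_space \<Rightarrow> real"
  assumes "v \<in> L2_space S" "w \<in> L2_space S"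
  shows "integrable (lebesgue_on S) (\<lambda>x. v x * w x)"
  using integrable_L2_inner[OF assms] by simp

lemma L2_norm_nonneg [simp]: "0 \<le> L2_norm S v"
  by (simp add: L2_norm_def)

lemma L2_norm_power2: "(L2_norm S v)\<^sup>2 = L2_inner S v v"
  by (simp add: L2_norm_def L2_inner_def power2_norm_eq_inner)

lemma L2_inner_commute: "L2_inner S v w = L2_inner S w v"
  by (simp add: L2_inner_def inner_commute)

lemma L2_inner_add_left:
  assumes "u \<in> L2_space S" "v \<in> L2_space S" "w \<in> L2_space S"
  shows "L2_inner S (\<lambda>x. u x + v x) w = L2_inner S u w + L2_inner S v w"
  unfolding L2_inner_def inner_add_left
  using assms by (intro Bochner_Integration.integral_add integrable_L2_inner)

lemma L2_inner_diff_left: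
  assumes "u \<in> L2_space S" "v \<in> L2_space S" "w \<in> L2_space S"
  shows "L2_inner S (\<lambda>x. u x - v x) w = L2_inner S u w - L2_inner S v w"
  unfolding L2_inner_def inner_diff_left
  using assms by (intro Bochner_Integration.integral_diff integrable_L2_inner)

lemma L2_inner_scaleR_left: "L2_inner S (\<lambda>x. c *\<^sub>R v x) w = c * L2_inner S v w"
  by (simp add: L2_inner_def)

lemma L2_inner_cmult_left:
  fixes v :: "'a::euclidean_space \<Rightarrow> real"
  shows "L2_inner S (\<lambda>x. c * v x) w = c * L2_inner S v w"
  using L2_inner_scaleR_left[of S c v w] by simp

lemma L2_inner_add_right:
  assumes "u \<in> L2_space S" "v \<in> L2_space S" "w \<in> L2_space S"
  shows "L2_inner S w (\<lambda>x. u x + v x) = L2_inner S w u + L2_inner S w v"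
  using L2_inner_add_left[OF assms] by (simp add: L2_inner_commute)

lemma L2_inner_diff_right:
  assumes "u \<in> L2_space S" "v \<in> L2_space S" "w \<in> L2_space S"
  shows "L2_inner S w (\<lambda>x. u x - v x) = L2_inner S w u - L2_inner S w v"
  using L2_inner_diff_left[OF assms] by (simp add: L2_inner_commute)

lemma L2_inner_scaleR_right: "L2_inner S w (\<lambda>x. c *\<^sub>R v x) = c * L2_inner S w v"
  by (simp add: L2_inner_def)

lemma L2_inner_cong_AE:
  assumes "AE x in lebesgue_on S. u x = u' x" "AE x in lebesgue_on S. v x = v' x"
    and "u \<in> L2_space S" "v \<in> L2_space S" "u' \<in> L2_space S" "v' \<in> L2_space S"
  shows "L2_inner S u v = L2_inner S u' v'"
  unfolding L2_inner_def
proof (rule integral_cong_AE)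
  note [measurable] = assms(3-6)[THEN L2_spaceD(1)]
  show "(\<lambda>x. u x \<bullet> v x) \<in> borel_measurable (lebesgue_on S)"
    "(\<lambda>x. u' x \<bullet> v' x) \<in> borel_measurable (lebesgue_on S)" by measurable
  show "AE x in lebesgue_on S. u x \<bullet> v x = u' x \<bullet> v' x"
    using assms(1,2) by eventually_elim auto
qed

lemma L2_norm_cong_AE:
  assumes "AE x in lebesgue_on S. u x = v x" "u \<in> L2_space S" "v \<in> L2_space S"
  shows "L2_norm S u = L2_norm S v"
proof -
  have "(L2_norm S u)\<^sup>2 = (L2_norm S v)\<^sup>2"
    unfolding L2_norm_power2 using assms by (intro L2_inner_cong_AE)
  then show ?thesis by (simp add: power2_eq_iff_nonneg)
qed

lemma L2_inner_self_nonneg [simp]: "0 \<le> L2_inner S v v"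
  by (simp flip: L2_norm_power2)

text \<open>The discriminant of a nonnegative quadratic polynomial. It yields the Cauchy-Schwarz
  inequality and later the eigenvalue equation of a minimiser, where A = 0 forces B = 0.\<close>

lemma nonneg_quadratic_imp:
  fixes A B C :: real
  assumes "\<And>t. 0 \<le> A + 2 * t * B + t\<^sup>2 * C" and "0 \<le> C"
  shows "B\<^sup>2 \<le> A * C"
proof (cases "C = 0")
  case True
  have "B = 0"
  proof (rule ccontr)
    assume "B \<noteq> 0"
    \<comment> \<open>At this argument the polynomial, affine because C = 0, takes the value
      -1.\<close>
    then show False using assms(1)[of "- (A + 1) / (2 * B)"] True by (simp add: field_simps)
  qed
  then show ?thesis using True by simp
next
  case False
  then have C: "C > 0" using assms(2) by simp
  \<comment> \<open>The polynomial is evaluated at its minimiser.\<close>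
  have "0 \<le> A + 2 * (- B / C) * B + (- B / C)\<^sup>2 * C" by (rule assms(1))
  also have "\<dots> = A - B\<^sup>2 / C" using C by (simp add: field_simps power2_eq_square)
  finally show ?thesis using C by (simp add: field_simps)
qed

lemma L2_inner_expand:
  assumes "v \<in> L2_space S" "w \<in> L2_space S"
  shows "L2_inner S (\<lambda>x. v x + t *\<^sub>R w x) (\<lambda>x. v x + t *\<^sub>R w x)
    = L2_inner S v v + 2 * t * L2_inner S v w + t\<^sup>2 * L2_inner S w w"
proof -
  have t: "(\<lambda>x. t *\<^sub>R w x) \<in> L2_space S" and s: "(\<lambda>x. v x + t *\<^sub>R w x) \<in> L2_space S"
    using assms by auto
  show ?thesis
    unfolding L2_inner_add_left[OF assms(1) t s] L2_inner_add_right[OF assms(1) t assms(1)]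
      L2_inner_scaleR_left L2_inner_add_right[OF assms(1) t assms(2)] L2_inner_scaleR_right
    using L2_inner_commute[of S v w] by (simp add: algebra_simps power2_eq_square)
qed

lemma L2_Cauchy_Schwarz:
  assumes "v \<in> L2_space S" "w \<in> L2_space S"
  shows "\<bar>L2_inner S v w\<bar> \<le> L2_norm S v * L2_norm S w"
proof -
  have "(L2_inner S v w)\<^sup>2 \<le> L2_inner S v v * L2_inner S w w"
    by (rule nonneg_quadratic_imp) (simp_all flip: L2_inner_expand[OF assms])
  also have "\<dots> = (L2_norm S v * L2_norm S w)\<^sup>2"
    by (simp add: power_mult_distrib L2_norm_power2)
  finally have "\<bar>L2_inner S v w\<bar> \<le> \<bar>L2_norm S v * L2_norm S w\<bar>"
    by (rule abs_le_square_iff[THEN iffD2])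
  then show ?thesis by (simp add: abs_mult)
qed

lemma L2_norm_triangle:
  assumes "v \<in> L2_space S" "w \<in> L2_space S"
  shows "L2_norm S (\<lambda>x. v x + w x) \<le> L2_norm S v + L2_norm S w"
proof (rule power2_le_imp_le)
  have "(L2_norm S (\<lambda>x. v x + w x))\<^sup>2 = L2_inner S v v + 2 * L2_inner S v w + L2_inner S w w"
    using L2_inner_expand[OF assms, of 1] by (simp add: L2_norm_power2)
  also have "\<dots> \<le> (L2_norm S v + L2_norm S w)\<^sup>2"
    using L2_Cauchy_Schwarz[OF assms] by (simp add: power2_sum L2_norm_power2)
  finally show "(L2_norm S (\<lambda>x. v x + w x))\<^sup>2 \<le> (L2_norm S v + L2_norm S w)\<^sup>2" .
qed simp

lemma L2_norm_scaleR: "L2_norm S (\<lambda>x. c *\<^sub>R v x) = \<bar>c\<bar> * L2_norm S v"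
proof -
  have "(L2_norm S (\<lambda>x. c *\<^sub>R v x))\<^sup>2 = (\<bar>c\<bar> * L2_norm S v)\<^sup>2"
    by (simp add: L2_norm_power2 L2_inner_scaleR_left L2_inner_scaleR_right power_mult_distrib)
      (simp add: power2_eq_square)
  then show ?thesis by (simp add: power2_eq_iff_nonneg)
qed

lemma L2_norm_uminus: "L2_norm S (\<lambda>x. - v x) = L2_norm S v"
  using L2_norm_scaleR[of S "-1" v] by simp

lemma L2_norm_minus_commute: "L2_norm S (\<lambda>x. v x - w x) = L2_norm S (\<lambda>x. w x - v x)"
  using L2_norm_uminus[of S "\<lambda>x. v x - w x"] by simp

lemma L2_norm_triangle_sub:
  assumes "v \<in> L2_space S" "w \<in> L2_space S"
  shows "L2_norm S v \<le> L2_norm S (\<lambda>x. v x - w x) + L2_norm S w"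
  using L2_norm_triangle[OF L2_space_diff[OF assms] assms(2)] by simp

lemma L2_norm_diff_triangle:
  assumes "u \<in> L2_space S" "v \<in> L2_space S" "w \<in> L2_space S"
  shows "L2_norm S (\<lambda>x. u x - w x) \<le> L2_norm S (\<lambda>x. u x - v x) + L2_norm S (\<lambda>x. v x - w x)"
  using L2_norm_triangle[OF L2_space_diff[OF assms(1,2)] L2_space_diff[OF assms(2,3)]] by simp

lemma L2_norm_triangle_rev:
  assumes "v \<in> L2_space S" "w \<in> L2_space S"
  shows "\<bar>L2_norm S v - L2_norm S w\<bar> \<le> L2_norm S (\<lambda>x. v x - w x)"
  using L2_norm_triangle_sub[OF assms] L2_norm_triangle_sub[OF assms(2,1)]
    L2_norm_minus_commute[of S v w] by simp

lemma L2_norm_tendsto: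
  assumes "((\<lambda>i. L2_norm S (\<lambda>x. v i x - w x)) \<longlongrightarrow> 0) F"
    and "\<forall>\<^sub>F i in F. v i \<in> L2_space S" "w \<in> L2_space S"
  shows "((\<lambda>i. L2_norm S (v i)) \<longlongrightarrow> L2_norm S w) F"
proof (rule LIM_zero_cancel, rule Lim_null_comparison[OF _ assms(1)])
  show "\<forall>\<^sub>F i in F. norm (L2_norm S (v i) - L2_norm S w) \<le> L2_norm S (\<lambda>x. v i x - w x)"
    using assms(2) by eventually_elim (simp add: L2_norm_triangle_rev assms(3))
qed

lemma L2_inner_tendsto:
  assumes "((\<lambda>i. L2_norm S (\<lambda>x. v i x - w x)) \<longlongrightarrow> 0) F"
    and "\<forall>\<^sub>F i in F. v i \<in> L2_space S" "w \<in> L2_space S" "q \<in> L2_space S"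
  shows "((\<lambda>i. L2_inner S (v i) q) \<longlongrightarrow> L2_inner S w q) F"
proof (rule LIM_zero_cancel, rule Lim_null_comparison[OF _ tendsto_mult_left_zero[OF assms(1), of "L2_norm S q"]])
  show "\<forall>\<^sub>F i in F. norm (L2_inner S (v i) q - L2_inner S w q)
      \<le> L2_norm S (\<lambda>x. v i x - w x) * L2_norm S q"
    using assms(2)
  proof eventually_elim
    case (elim i)
    then show ?case
      using L2_Cauchy_Schwarz[OF L2_space_diff[OF elim assms(3)] assms(4)]
        L2_inner_diff_left[OF elim assms(3,4)] by simp
  qed
qed

lemma L2_norm_eq_0_iff:
  assumes "v \<in> L2_space S"
  shows "L2_norm S v = 0 \<longleftrightarrow> (AE x in lebesgue_on S. v x = 0)"
proof -
  have "L2_norm S v = 0 \<longleftrightarrow> (LINT x|lebesgue_on S. (norm (v x))\<^sup>2) = 0"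
    by (simp add: L2_norm_def)
  also have "\<dots> \<longleftrightarrow> (AE x in lebesgue_on S. (norm (v x))\<^sup>2 = 0)"
    by (rule integral_nonneg_eq_0_iff_AE[OF L2_spaceD(2)[OF assms]]) auto
  finally show ?thesis by simp
qed

text \<open>Finite measure turns an L^2-Cauchy sequence into an L^1-Cauchy one, which has a
  subsequence converging almost everywhere. Fatou's lemma carries the L^2 Cauchy bound to the limit
  along it, which gives both membership and convergence of the whole sequence.\<close>

lemma L2_space_complete:
  fixes v :: "nat \<Rightarrow> 'a::euclidean_space \<Rightarrow> real"
  assumes S: "S \<in> lmeasurable"
    and v: "\<And>n. v n \<in> L2_space S"
    and Cauchy: "\<And>e. e > 0 \<Longrightarrow> \<exists>N. \<forall>i\<ge>N. \<forall>j\<ge>N. L2_norm S (\<lambda>x. v i x - v j x) < e"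
  obtains w where "w \<in> L2_space S" "(\<lambda>n. L2_norm S (\<lambda>x. v n x - w x)) \<longlonglongrightarrow> 0"
proof -
  define c where "c = L2_norm S (\<lambda>x. 1 :: real)"
  interpret finite_measure "lebesgue_on S" by (rule finite_measure_lebesgue_on[OF S])
  have one: "(\<lambda>x. 1 :: real) \<in> L2_space S" by (auto simp: L2_space_def)
  \<comment> \<open>Cauchy-Schwarz against the constant 1, whose norm is c.\<close>
  have L1: "integrable (lebesgue_on S) u \<and> (LINT x|lebesgue_on S. norm (u x)) \<le> c * L2_norm S u"
    if u: "u \<in> L2_space S" for u :: "'a \<Rightarrow> real"
  proof -
    have a: "(\<lambda>x. \<bar>u x\<bar>) \<in> L2_space S" using u by (auto simp: L2_space_def)
    have "(LINT x|lebesgue_on S. norm (u x)) = L2_inner S (\<lambda>x. 1) (\<lambda>x. \<bar>u x\<bar>)"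
      by (simp add: L2_inner_def)
    also have "\<dots> \<le> c * L2_norm S (\<lambda>x. \<bar>u x\<bar>)"
      using L2_Cauchy_Schwarz[OF one a] by (simp add: c_def)
    also have "L2_norm S (\<lambda>x. \<bar>u x\<bar>) = L2_norm S u" by (simp add: L2_norm_def)
    finally show ?thesis using integrable_L2_mult[OF one u] by simp
  qed
  have "\<exists>N. \<forall>i\<ge>N. \<forall>j\<ge>N. LINT x|lebesgue_on S. norm (v i x - v j x) < e" if e: "e > 0" for e
  proof -
    have c: "c \<ge> 0" by (simp add: c_def)
    \<comment> \<open>The summand 1 covers c = 0.\<close>
    obtain N where N: "\<And>i j. i \<ge> N \<Longrightarrow> j \<ge> N \<Longrightarrow> L2_norm S (\<lambda>x. v i x - v j x) < e / (c + 1)"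
      using Cauchy[of "e / (c + 1)"] divide_pos_pos[OF e, of "c + 1"] c by auto
    have "LINT x|lebesgue_on S. norm (v i x - v j x) < e" if "i \<ge> N" "j \<ge> N" for i j
    proof -
      have "LINT x|lebesgue_on S. norm (v i x - v j x) \<le> c * L2_norm S (\<lambda>x. v i x - v j x)"
        using L1[OF L2_space_diff[OF v v]] by blast
      also have "\<dots> \<le> c * (e / (c + 1))"
        using N[OF that] c by (intro mult_left_mono) auto
      also have "\<dots> < e" using \<open>e > 0\<close> c by (simp add: field_simps)
      finally show ?thesis .
    qed
    then show ?thesis by blast
  qed
  note L1_Cauchy = this
  obtain r where r: "strict_mono r" and ae: "AE x in lebesgue_on S. Cauchy (\<lambda>i. v (r i) x)"
    using L1[OF v] L1_Cauchy by (rule_tac cauchy_L1_AE_cauchy_subseq[of "lebesgue_on S" v]) auto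
  define w where "w x = lim (\<lambda>i. v (r i) x)" for x
  note [measurable] = L2_spaceD(1)[OF v]
  have wm [measurable]: "w \<in> borel_measurable (lebesgue_on S)"
    unfolding w_def by measurable
  have lim: "AE x in lebesgue_on S. (\<lambda>i. v (r i) x) \<longlonglongrightarrow> w x"
    using ae by eventually_elim (simp add: w_def Cauchy_convergent_iff convergent_LIMSEQ_iff)
  \<comment> \<open>Stated with nonnegative integrals, since integrability of the square of
    \<open>v n - w\<close> is derived from it.\<close>
  have key: "(\<integral>\<^sup>+x. ennreal ((norm (v n x - w x))\<^sup>2) \<partial>lebesgue_on S) \<le> ennreal (e\<^sup>2)"
    if N: "\<And>i j. i \<ge> N \<Longrightarrow> j \<ge> N \<Longrightarrow> L2_norm S (\<lambda>x. v i x - v j x) < e" and n: "n \<ge> N" and e: "e > 0"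
    for N n e
  proof -
    have "(\<integral>\<^sup>+x. ennreal ((norm (v n x - w x))\<^sup>2) \<partial>lebesgue_on S)
      = (\<integral>\<^sup>+x. liminf (\<lambda>i. ennreal ((norm (v n x - v (r i) x))\<^sup>2)) \<partial>lebesgue_on S)"
    proof (rule nn_integral_cong_AE)
      show "AE x in lebesgue_on S. ennreal ((norm (v n x - w x))\<^sup>2)
          = liminf (\<lambda>i. ennreal ((norm (v n x - v (r i) x))\<^sup>2))"
        using lim
      proof eventually_elim
        case (elim x)
        have "(\<lambda>i. ennreal ((norm (v n x - v (r i) x))\<^sup>2)) \<longlonglongrightarrow> ennreal ((norm (v n x - w x))\<^sup>2)"
          by (intro tendsto_ennrealI tendsto_intros elim)
        from lim_imp_Liminf[OF _ this] show ?case by simp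
      qed
    qed
    also have "\<dots> \<le> liminf (\<lambda>i. \<integral>\<^sup>+x. ennreal ((norm (v n x - v (r i) x))\<^sup>2) \<partial>lebesgue_on S)"
      by (rule nn_integral_liminf) measurable
    also have "\<dots> \<le> ennreal (e\<^sup>2)"
    proof (rule Liminf_le)
      show "\<forall>\<^sub>F i in sequentially. (\<integral>\<^sup>+x. ennreal ((norm (v n x - v (r i) x))\<^sup>2) \<partial>lebesgue_on S) \<le> ennreal (e\<^sup>2)"
      proof (rule eventually_sequentiallyI[of N])
        fix i assume "i \<ge> N"
        then have "r i \<ge> N" using seq_suble[OF r, of i] by simp
        have "(\<integral>\<^sup>+x. ennreal ((norm (v n x - v (r i) x))\<^sup>2) \<partial>lebesgue_on S)
          = ennreal ((L2_norm S (\<lambda>x. v n x - v (r i) x))\<^sup>2)"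
          unfolding L2_norm_def
          by (subst nn_integral_eq_integral[OF L2_spaceD(2)[OF L2_space_diff[OF v v]]]) auto
        also have "\<dots> \<le> ennreal (e\<^sup>2)"
          using N[OF n \<open>r i \<ge> N\<close>] by (intro ennreal_leI power_mono) auto
        finally show "(\<integral>\<^sup>+x. ennreal ((norm (v n x - v (r i) x))\<^sup>2) \<partial>lebesgue_on S) \<le> ennreal (e\<^sup>2)" .
      qed
    qed simp
    finally show ?thesis .
  qed
  have key2: "(\<lambda>x. v n x - w x) \<in> L2_space S \<and> L2_norm S (\<lambda>x. v n x - w x) \<le> e"
    if N: "\<And>i j. i \<ge> N \<Longrightarrow> j \<ge> N \<Longrightarrow> L2_norm S (\<lambda>x. v i x - v j x) < e" and n: "n \<ge> N" and e: "e > 0"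
    for N n e
  proof -
    have k: "(\<integral>\<^sup>+x. ennreal ((norm (v n x - w x))\<^sup>2) \<partial>lebesgue_on S) \<le> ennreal (e\<^sup>2)"
      by (rule key[OF N n e])
    have i: "integrable (lebesgue_on S) (\<lambda>x. (norm (v n x - w x))\<^sup>2)"
      using k by (intro integrableI_bounded) (auto simp: less_top[symmetric] top_unique)
    then have "ennreal (LINT x|lebesgue_on S. (norm (v n x - w x))\<^sup>2) \<le> ennreal (e\<^sup>2)"
      using k nn_integral_eq_integral[OF i] by simp
    then have "(L2_norm S (\<lambda>x. v n x - w x))\<^sup>2 \<le> e\<^sup>2"
      by (simp add: L2_norm_def)
    then show ?thesis using i e by (auto simp: L2_space_def intro: power2_le_imp_le)
  qed
  \<comment> \<open>\<open>w\<close> is the difference of \<open>v N1\<close> and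
    \<open>v N1 - w\<close>, both square-integrable.\<close>
  obtain N1 where "\<And>i j. i \<ge> N1 \<Longrightarrow> j \<ge> N1 \<Longrightarrow> L2_norm S (\<lambda>x. v i x - v j x) < 1"
    using Cauchy[of 1] by auto
  then have "(\<lambda>x. v N1 x - w x) \<in> L2_space S" using key2[of N1 1 N1] by auto
  from L2_space_diff[OF v[of N1] this] have w: "w \<in> L2_space S" by simp
  have "(\<lambda>n. L2_norm S (\<lambda>x. v n x - w x)) \<longlonglongrightarrow> 0"
  proof (rule LIMSEQ_I)
    fix e :: real assume e: "e > 0"
    obtain N where N: "\<And>i j. i \<ge> N \<Longrightarrow> j \<ge> N \<Longrightarrow> L2_norm S (\<lambda>x. v i x - v j x) < e / 2"
      using Cauchy[of "e/2"] e by auto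
    have "norm (L2_norm S (\<lambda>x. v n x - w x) - 0) < e" if "n \<ge> N" for n
      using key2[OF N that] e by simp
    then show "\<exists>N. \<forall>n\<ge>N. norm (L2_norm S (\<lambda>x. v n x - w x) - 0) < e" by blast
  qed
  with w show ?thesis by (rule that)
qed

section \<open>Smooth functions with compact support\<close>

lemma C_k_differentiable: "C_k (Suc k) \<phi> \<Longrightarrow> \<phi> differentiable (at x)"
  by simp

lemma C_k_has_derivative: "C_k (Suc k) \<phi> \<Longrightarrow> (\<phi> has_derivative frechet_derivative \<phi> (at x)) (at x)"
  using C_k_differentiable frechet_derivative_works by blast

text \<open>Replaces the chosen \<open>frechet_derivative\<close> by an explicit derivative, so that
  inductions over k work with formulas.\<close>

lemma C_k_SucI:
  assumes "\<And>x. (\<phi> has_derivative D x) (at x)"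
    and "\<And>b. b \<in> Basis \<Longrightarrow> C_k k (\<lambda>x. D x b)"
  shows "C_k (Suc k) \<phi>"
proof -
  have "frechet_derivative \<phi> (at x) = D x" for x
    using frechet_derivative_at[OF assms(1)] by simp
  then show ?thesis using assms by (auto simp: differentiable_def)
qed

lemma C_k_continuous: "C_k k \<phi> \<Longrightarrow> continuous_on S \<phi>"
proof (cases k)
  case (Suc j)
  assume "C_k k \<phi>"
  then have "\<phi> differentiable_on UNIV" using Suc by (auto simp: differentiable_on_def)
  from differentiable_imp_continuous_on[OF this] show ?thesis
    by (rule continuous_on_subset) auto
qed (auto intro: continuous_on_subset)

lemma C_k_Suc_imp: "C_k (Suc k) \<phi> \<Longrightarrow> C_k k \<phi>"
proof (induction k arbitrary: \<phi>)
  case 0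
  then show ?case using C_k_continuous[of "Suc 0" \<phi> UNIV] by simp
next
  case (Suc k)
  from Suc.prems show ?case by (subst C_k.simps) (auto intro: Suc.IH)
qed

lemma C_k_const: "C_k k (\<lambda>x. c)"
  by (induction k arbitrary: c) auto

lemma C_k_add: "C_k k f \<Longrightarrow> C_k k g \<Longrightarrow> C_k k (\<lambda>x. f x + g x)"
proof (induction k arbitrary: f g)
  case 0
  then show ?case by (simp add: continuous_on_add)
next
  case (Suc k)
  show ?case
  proof (rule C_k_SucI)
    show "((\<lambda>x. f x + g x) has_derivative
        (\<lambda>b. frechet_derivative f (at x) b + frechet_derivative g (at x) b)) (at x)" for x
      using Suc.prems by (intro has_derivative_add C_k_has_derivative)
  qed (use Suc in auto)
qed

lemma C_k_mult: "C_k k f \<Longrightarrow> C_k k g \<Longrightarrow> C_k k (\<lambda>x. f x * g x)"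
proof (induction k arbitrary: f g)
  case 0
  then show ?case by (simp add: continuous_on_mult)
next
  case (Suc k)
  show ?case
  proof (rule C_k_SucI)
    show "((\<lambda>x. f x * g x) has_derivative
        (\<lambda>b. f x * frechet_derivative g (at x) b + frechet_derivative f (at x) b * g x)) (at x)" for x
      using Suc.prems by (intro has_derivative_mult C_k_has_derivative)
    show "C_k k (\<lambda>x. f x * frechet_derivative g (at x) b + frechet_derivative f (at x) b * g x)"
      if "b \<in> Basis" for b
      using Suc.prems that C_k_Suc_imp[OF Suc.prems(1)] C_k_Suc_imp[OF Suc.prems(2)]
      by (intro C_k_add Suc.IH) auto
  qed
qed

lemma C_k_cmult: "C_k k f \<Longrightarrow> C_k k (\<lambda>x. c * f x)"
  by (intro C_k_mult C_k_const)

lemma C_k_diff: "C_k k f \<Longrightarrow> C_k k g \<Longrightarrow> C_k k (\<lambda>x. f x - g x)"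
  using C_k_add[OF _ C_k_cmult[of k g "-1"], of f] by simp

lemma C_k_power: "C_k k f \<Longrightarrow> C_k k (\<lambda>x. f x ^ n)"
  by (induction n) (auto intro: C_k_mult C_k_const)

lemma C_k_prod: "(\<And>i. i \<in> I \<Longrightarrow> C_k k (f i)) \<Longrightarrow> C_k k (\<lambda>x. \<Prod>i\<in>I. f i x)"
  by (induction I rule: infinite_finite_induct) (auto intro: C_k_mult C_k_const)

text \<open>The inner map has a constant derivative, so each partial derivative is a constant times
  a composition of the same kind with g', and the induction closes.\<close>

lemma C_k_compose_affine:
  fixes g :: "real \<Rightarrow> real"
  shows "C_k k g \<Longrightarrow> C_k k (\<lambda>x. g (x \<bullet> a + d))"
proof (induction k arbitrary: g)
  case 0
  then have "continuous_on UNIV (g \<circ> (\<lambda>x. x \<bullet> a + d))"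
    by (intro continuous_on_compose continuous_intros) (auto intro: continuous_on_subset)
  then show ?case by (simp add: o_def)
next
  case (Suc k)
  show ?case
  proof (rule C_k_SucI)
    fix x :: 'a
    have "((\<lambda>x. x \<bullet> a + d) has_derivative (\<lambda>b. b \<bullet> a)) (at x)"
      by (auto intro!: derivative_eq_intros)
    from diff_chain_at[OF this C_k_has_derivative[OF Suc.prems]]
    have "((\<lambda>x. g (x \<bullet> a + d)) has_derivative (\<lambda>b. frechet_derivative g (at (x \<bullet> a + d)) (b \<bullet> a))) (at x)"
      by (simp add: o_def)
    moreover have fd: "frechet_derivative g (at y) z = z * frechet_derivative g (at y) 1" for y z
      using linear_cmul[OF linear_frechet_derivative[OF C_k_differentiable[OF Suc.prems]], of y z 1] by simp
    ultimately show "((\<lambda>x. g (x \<bullet> a + d)) has_derivative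
        (\<lambda>b. (b \<bullet> a) * frechet_derivative g (at (x \<bullet> a + d)) 1)) (at x)"
      by (subst (asm) fd)
    show "C_k k (\<lambda>x. (b \<bullet> a) * frechet_derivative g (at (x \<bullet> a + d)) 1)" for b
      using Suc.prems by (intro C_k_cmult Suc.IH) auto
  qed
qed

section \<open>A flat function and bump functions on boxes\<close>

text \<open>The parameter p makes the family p(1/x) exp(-1/x), extended by zero, closed under
  differentiation, so that smoothness is a single induction; \<open>flat 1\<close> is the classical
  flat function.\<close>

definition flat :: "real poly \<Rightarrow> real \<Rightarrow> real" where
  "flat p x = (if x > 0 then poly p (inverse x) * exp (- inverse x) else 0)"

lemma poly_exp_tendsto_0: "((\<lambda>y. poly p y * exp (- y)) \<longlongrightarrow> (0::real)) at_top"
proof -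
  have "((\<lambda>y. \<Sum>i\<le>degree p. coeff p i * (y ^ i / exp y)) \<longlongrightarrow> (\<Sum>i\<le>degree p. coeff p i * 0)) at_top"
    by (intro tendsto_sum tendsto_mult tendsto_const tendsto_power_div_exp_0)
  then show ?thesis
    by (simp add: poly_altdef sum_distrib_right sum_divide_distrib exp_minus divide_inverse mult.assoc)
qed

text \<open>For x > 0 the derivative of p(1/x) exp(-1/x) is x^-2 (p - p')(1/x) exp(-1/x), and x^-2
  is the polynomial \<open>[:0, 0, 1:]\<close> at 1/x. Only x = 0 needs a limit.\<close>

lemma flat_has_derivative:
  "(flat p has_real_derivative flat ([:0, 0, 1:] * (p - pderiv p)) x) (at x)"
proof -
  consider "x < 0" | "x > 0" | "x = 0" by linarith
  then show ?thesis
  proof cases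
    case 1
    have "((\<lambda>x. 0) has_real_derivative 0) (at x)" by simp
    then have "(flat p has_real_derivative 0) (at x)"
      by (rule has_field_derivative_transform_within_open[of _ _ _ "{..<0}"]) (use 1 in \<open>auto simp: flat_def\<close>)
    then show ?thesis using 1 by (simp add: flat_def)
  next
    case 2
    have "((\<lambda>x. poly p (inverse x) * exp (- inverse x)) has_real_derivative
        flat ([:0, 0, 1:] * (p - pderiv p)) x) (at x)"
    proof (rule DERIV_cong)
      have inv: "(inverse has_real_derivative - (inverse x * inverse x)) (at x)"
        using 2 DERIV_inverse[of x] by (simp add: power2_eq_square)
      show "((\<lambda>x. poly p (inverse x) * exp (- inverse x)) has_real_derivative
          (poly (pderiv p) (inverse x) * - (inverse x * inverse x)) * exp (- inverse x)
          + (exp (- inverse x) * - (- (inverse x * inverse x))) * poly p (inverse x)) (at x)"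
        by (rule DERIV_mult[OF DERIV_chain2[OF poly_DERIV inv] DERIV_chain2[OF DERIV_exp DERIV_minus[OF inv]]])
      show "(poly (pderiv p) (inverse x) * - (inverse x * inverse x)) * exp (- inverse x)
          + (exp (- inverse x) * - (- (inverse x * inverse x))) * poly p (inverse x)
          = flat ([:0, 0, 1:] * (p - pderiv p)) x"
        using 2 by (simp add: flat_def del: mult_pCons_left) (simp add: algebra_simps)
    qed
    then show ?thesis
      by (rule has_field_derivative_transform_within_open[of _ _ _ "{0<..}"]) (use 2 in \<open>auto simp: flat_def\<close>)
  next
    case 3
    have r: "((\<lambda>h. (flat p (0 + h) - flat p 0) / h) \<longlongrightarrow> 0) (at_right 0)"
    proof (rule Lim_transform_eventually)
      \<comment> \<open>Dividing by h multiplies p by its variable, so the right difference quotient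
        at 0 is again a polynomial in 1/h times the exponential.\<close>
      show "((\<lambda>h. poly (pCons 0 p) (inverse h) * exp (- inverse h)) \<longlongrightarrow> 0) (at_right 0)"
        by (rule filterlim_compose[OF poly_exp_tendsto_0 filterlim_inverse_at_top_right])
      show "\<forall>\<^sub>F h in at_right 0. poly (pCons 0 p) (inverse h) * exp (- inverse h) = (flat p (0 + h) - flat p 0) / h"
        by (auto simp: eventually_at_filter flat_def field_simps)
    qed
    have l: "((\<lambda>h. (flat p (0 + h) - flat p 0) / h) \<longlongrightarrow> 0) (at_left 0)"
      by (rule Lim_transform_eventually[OF tendsto_const]) (auto simp: eventually_at_filter flat_def)
    have "(flat p has_real_derivative 0) (at 0)"
      unfolding DERIV_def using filterlim_split_at[OF l r] by simp
    then show ?thesis using 3 by (simp add: flat_def)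
  qed
qed

lemma C_k_flat: "C_k k (flat p)"
proof (induction k arbitrary: p)
  case 0
  show ?case
    using DERIV_isCont[OF flat_has_derivative] by (simp add: continuous_at_imp_continuous_on)
next
  case (Suc k)
  show ?case
  proof (rule C_k_SucI)
    show "(flat p has_derivative (\<lambda>b. flat ([:0, 0, 1:] * (p - pderiv p)) x * b)) (at x)" for x
      using flat_has_derivative unfolding has_field_derivative_def .
    show "C_k k (\<lambda>x. flat ([:0, 0, 1:] * (p - pderiv p)) x * b)" if "b \<in> Basis" for b :: real
      using Suc[of "[:0, 0, 1:] * (p - pderiv p)"] that by (simp only: Basis_real_def singleton_iff mult_1_right)
  qed
qed

declare C_k.simps [simp del]

definition box_bump :: "'a::euclidean_space \<Rightarrow> 'a \<Rightarrow> 'a \<Rightarrow> real" where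
  "box_bump a b x = (\<Prod>i\<in>Basis. flat 1 ((x - a) \<bullet> i) * flat 1 ((b - x) \<bullet> i))"

lemma flat_1: "0 \<le> flat 1 x" "flat 1 x \<le> 1" "flat 1 x > 0 \<longleftrightarrow> x > 0"
  by (auto simp: flat_def)

lemma box_bump_bounds: "0 \<le> box_bump a b x" "box_bump a b x \<le> 1"
  unfolding box_bump_def by (auto intro!: prod_nonneg prod_le_1 mult_le_one simp: flat_1)

lemma box_bump_pos: "x \<in> box a b \<Longrightarrow> 0 < box_bump a b x"
  unfolding box_bump_def by (intro prod_pos) (auto simp: mem_box flat_1 inner_diff_left)

lemma box_bump_eq_0: "x \<notin> box a b \<Longrightarrow> box_bump a b x = 0"
proof -
  assume "x \<notin> box a b"
  then obtain i where i: "i \<in> Basis" "\<not> (a \<bullet> i < x \<bullet> i \<and> x \<bullet> i < b \<bullet> i)" by (auto simp: mem_box)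
  then have "flat 1 ((x - a) \<bullet> i) * flat 1 ((b - x) \<bullet> i) = 0"
    by (auto simp: flat_def inner_diff_left)
  then show ?thesis unfolding box_bump_def using i(1) by (intro prod_zero) auto
qed

lemma C_k_box_bump: "C_k k (box_bump a b)"
proof -
  have "C_k k (\<lambda>x. \<Prod>i\<in>Basis. flat 1 (x \<bullet> i + (- (a \<bullet> i))) * flat 1 (x \<bullet> (- i) + b \<bullet> i))"
    by (intro C_k_prod C_k_mult C_k_compose_affine C_k_flat)
  moreover have "box_bump a b =
      (\<lambda>x. \<Prod>i\<in>Basis. flat 1 (x \<bullet> i + (- (a \<bullet> i))) * flat 1 (x \<bullet> (- i) + b \<bullet> i))"
    by (rule ext) (simp add: box_bump_def inner_diff_left)
  ultimately show ?thesis by (simp only:)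
qed

lemma test_function_supportI:
  assumes "\<And>k. C_k k \<phi>" "compact K" "K \<subseteq> S" "\<And>x. x \<notin> K \<Longrightarrow> \<phi> x = 0"
  shows "test_function S \<phi>"
proof -
  have "closure {x. \<phi> x \<noteq> 0} \<subseteq> K"
    using assms(4) compact_imp_closed[OF assms(2)] by (intro closure_minimal) auto
  moreover from this have "compact (closure {x. \<phi> x \<noteq> 0})"
    using bounded_subset[OF compact_imp_bounded[OF assms(2)]] by (simp add: compact_eq_bounded_closed)
  ultimately show ?thesis using assms(1,3) unfolding test_function_def by blast
qed

lemma test_function_support:
  assumes "test_function S \<phi>"
  obtains K where "compact K" "K \<subseteq> S" "\<And>x. x \<notin> K \<Longrightarrow> \<phi> x = 0"
  using assms closure_subset[of "{x. \<phi> x \<noteq> 0}"] unfolding test_function_def by blast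

lemma test_functionD: "test_function S \<phi> \<Longrightarrow> C_k k \<phi>"
  by (auto simp: test_function_def)

text \<open>The bump lies in (0, 1] on the open box and vanishes outside, so these functions tend to
  the indicator of the box as n grows, with values in [0, 1]. Powers take the place of
  mollification.\<close>

lemma test_function_box:
  assumes "cbox a b \<subseteq> S"
  shows "test_function S (\<lambda>x. 1 - (1 - box_bump a b x) ^ n)"
proof (rule test_function_supportI[of _ "cbox a b"])
  show "C_k k (\<lambda>x. 1 - (1 - box_bump a b x) ^ n)" for k
    by (intro C_k_diff C_k_const C_k_power C_k_box_bump)
  show "1 - (1 - box_bump a b x) ^ n = 0" if "x \<notin> cbox a b" for x
    using that box_subset_cbox[of a b] by (subst box_bump_eq_0) auto
qed (use assms in auto)

lemma box_bump_power_tendsto: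
  "(\<lambda>n. 1 - (1 - box_bump a b x) ^ n) \<longlonglongrightarrow> indicator (box a b) x"
proof (cases "x \<in> box a b")
  case True
  have "(\<lambda>n. 1 - (1 - box_bump a b x) ^ n) \<longlonglongrightarrow> 1 - 0"
    using box_bump_pos[OF True] box_bump_bounds[of a b x]
    by (intro tendsto_intros LIMSEQ_abs_realpow_zero2) auto
  then show ?thesis using True by simp
qed (simp add: box_bump_eq_0)

section \<open>The fundamental lemma of the calculus of variations\<close>

text \<open>Open boxes form an intersection-stable generator of the Borel sets, and the sets over
  which g integrates to zero form a Dynkin system. A Lebesgue set differs from a Borel set by a null
  set, so g has the same integrals as 0 over all of them.\<close>

lemma AE_zero_if_box_integrals_zero:
  fixes g :: "'a::euclidean_space \<Rightarrow> real"
  assumes g: "integrable lebesgue g"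
    and zero: "\<And>a b. (LINT x|lebesgue. indicator (box a b) x * g x) = 0"
  shows "AE x in lebesgue. g x = 0"
proof -
  have int: "integrable lebesgue (\<lambda>x. indicator A x * g x)" if "A \<in> sets lebesgue" for A
    using integrable_mult_indicator[OF that g] by simp
  \<comment> \<open>Complements need the integral over the whole space, which is exhausted by
    boxes.\<close>
  have UNIV0: "(LINT x|lebesgue. g x) = 0"
  proof (rule LIMSEQ_unique)
    show "(\<lambda>n::nat. LINT x|lebesgue. indicator (box (- real n *\<^sub>R One) (real n *\<^sub>R One)) x * g x) \<longlonglongrightarrow> (LINT x|lebesgue. g x)"
    proof (rule integral_dominated_convergence[where w = "\<lambda>x. norm (g x)"])
      show "AE x in lebesgue. (\<lambda>n::nat. indicator (box (- real n *\<^sub>R One) (real n *\<^sub>R One)) x * g x) \<longlonglongrightarrow> g x"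
      proof (rule AE_I2, rule tendsto_eventually)
        fix x :: 'a
        obtain n :: nat where n: "norm x < real n" using reals_Archimedean2 by blast
        show "\<forall>\<^sub>F n in sequentially. indicator (box (- real n *\<^sub>R One) (real n *\<^sub>R One)) x * g x = g x"
        proof (rule eventually_sequentiallyI[of n])
          fix m assume "m \<ge> n"
          then have "\<bar>x \<bullet> i\<bar> < real m" if "i \<in> Basis" for i
            using Basis_le_norm[OF that, of x] n by linarith
          then have "x \<in> box (- real m *\<^sub>R One) (real m *\<^sub>R One)"
            by (fastforce simp: mem_box inner_sum_left inner_Basis if_distrib abs_less_iff cong: if_cong)
          then show "indicator (box (- real m *\<^sub>R One) (real m *\<^sub>R One)) x * g x = g x" by simp
        qed
      qed
        show "(\<lambda>x. indicator (box (- real n *\<^sub>R One) (real n *\<^sub>R One)) x * g x) \<in> borel_measurable lebesgue" for n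
        using int[of "box (- real n *\<^sub>R One) (real n *\<^sub>R One)"] by auto
    qed (use g in \<open>auto simp: indicator_def\<close>)
  qed (simp add: zero)
  have borel: "(LINT x|lebesgue. indicator A x * g x) = 0" if A: "A \<in> sets borel" for A :: "'a set"
  proof -
    have "Int_stable (range (\<lambda>(a, b). box a b :: 'a set))"
      by (auto simp: Int_stable_def box_Int_box)
    moreover have "(range (\<lambda>(a, b). box a b :: 'a set)) \<subseteq> Pow UNIV" by auto
    moreover have "A \<in> sigma_sets UNIV (range (\<lambda>(a, b). box a b))"
      using A unfolding borel_eq_box by simp
    ultimately show ?thesis
    proof (induction rule: sigma_sets_induct_disjoint)
      case (basic A)
      then show ?case by (auto simp: zero)
    next
      case empty
      then show ?case by simp
    next
      case (compl A)
      then have [measurable]: "A \<in> sets borel" by (simp add: borel_eq_box)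
      have "(LINT x|lebesgue. indicator (UNIV - A) x * g x) = (LINT x|lebesgue. g x - indicator A x * g x)"
        by (intro Bochner_Integration.integral_cong) (auto simp: indicator_def)
      also have "\<dots> = 0"
        using compl UNIV0 g int[of A] by (subst Bochner_Integration.integral_diff) auto
      finally show ?case .
    next
      case (union F)
      then have F: "\<And>i. F i \<in> sets borel" by (auto simp: borel_eq_box)
      have "(LINT x:(\<Union>i. F i)|lebesgue. g x) = (\<Sum>i. LINT x:F i|lebesgue. g x)"
        using union(1) F int[of "\<Union>i. F i"]
        by (intro lebesgue_integral_countable_add) (auto simp: disjoint_family_on_def set_integrable_def)
      then show ?case using union by (simp add: set_lebesgue_integral_def)
    qed
  qed
  show ?thesis
  proof (rule density_unique_real[where f' = "\<lambda>x. 0"])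
    fix A :: "'a set" assume "A \<in> sets lebesgue"
    then obtain B N N' where A: "A = B \<union> N" "N \<subseteq> N'" "N' \<in> null_sets lborel" "B \<in> sets lborel"
      by (rule sets_completionE)
    have [measurable]: "A \<in> sets lebesgue" "B \<in> sets lebesgue" using \<open>A \<in> sets lebesgue\<close> A by auto
    have "AE x in lebesgue. x \<notin> N'" using A(3) by (intro AE_completion AE_not_in)
    then have "AE x in lebesgue. indicator A x * g x = indicator B x * g x"
      by eventually_elim (use A in \<open>auto simp: indicator_def\<close>)
    then have "(LINT x|lebesgue. indicator A x * g x) = (LINT x|lebesgue. indicator B x * g x)"
      using g by (intro integral_cong_AE) auto
    then show "(LINT x:A|lebesgue. g x) = (LINT x:A|lebesgue. 0)"
      using borel[of B] A by (simp add: set_lebesgue_integral_def)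
  qed (use g in auto)
qed

lemma borel_measurable_lebesgue_on_continuous:
  "continuous_on UNIV f \<Longrightarrow> f \<in> borel_measurable (lebesgue_on S)"
  for f :: "'a::euclidean_space \<Rightarrow> 'b::euclidean_space"
  by (intro measurable_restrict_space1 measurable_completion)
    (simp add: borel_measurable_continuous_onI)

lemma indicator_cbox_L2:
  assumes "S \<in> sets lebesgue"
  shows "(\<lambda>x. indicator (cbox c d) x :: real) \<in> L2_space S"
proof -
  have sq: "(\<lambda>x. (norm (indicator (cbox c d) x :: real))\<^sup>2) = indicator (cbox c d)"
    by (auto simp: indicator_def fun_eq_iff)
  have "integrable lebesgue (\<lambda>x. indicator (S \<inter> cbox c d) x :: real)"
  proof (rule integrable_real_indicator)
    have "emeasure lebesgue (S \<inter> cbox c d) \<le> emeasure lebesgue (cbox c d)"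
      using assms by (intro emeasure_mono) auto
    then show "emeasure lebesgue (S \<inter> cbox c d) < \<infinity>"
      using emeasure_lborel_cbox_finite[of c d] by (simp add: order_le_less_trans)
  qed (use assms in auto)
  moreover have "(\<lambda>x. indicat_real S x *\<^sub>R indicat_real (cbox c d) x) = indicator (S \<inter> cbox c d)"
    by (auto simp: indicator_def fun_eq_iff)
  ultimately have "integrable (lebesgue_on S) (indicat_real (cbox c d))"
    using assms by (subst integrable_restrict_space) (auto simp del: indicator_inter_arith)
  moreover have "indicat_real (cbox c d) \<in> borel_measurable (lebesgue_on S)"
    by (intro measurable_restrict_space1 borel_measurable_indicator) auto
  ultimately show ?thesis unfolding L2_space_def mem_Collect_eq sq by simp
qed

text \<open>S is a countable union of closed boxes. On each of them g is integrable, and indicators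
  of smaller open boxes are bounded limits of test functions, so that all integrals of g over open
  boxes vanish there.\<close>

lemma AE_zero_if_test_integrals_zero:
  fixes g :: "'a::euclidean_space \<Rightarrow> real"
  assumes S: "open S" and g: "g \<in> L2_space S"
    and zero: "\<And>\<phi>. test_function S \<phi> \<Longrightarrow> (LINT x|lebesgue_on S. g x * \<phi> x) = 0"
  shows "AE x in lebesgue_on S. g x = 0"
proof -
  have [measurable]: "S \<in> sets lebesgue" using S by auto
  note [measurable] = L2_spaceD(1)[OF g]
  have cb: "AE x in lebesgue. x \<in> cbox c d \<longrightarrow> g x = 0" if cd: "cbox c d \<subseteq> S" for c d
  proof -
    have one: "(\<lambda>x. indicator (cbox c d) x :: real) \<in> L2_space S"
      using \<open>S \<in> sets lebesgue\<close> by (rule indicator_cbox_L2)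
    have "integrable (lebesgue_on S) (\<lambda>x. indicator (cbox c d) x * g x)"
      using integrable_L2_mult[OF one g] .
    then have int: "integrable lebesgue (\<lambda>x. indicator (cbox c d) x * g x)"
    proof (subst (asm) integrable_restrict_space)
      assume "integrable lebesgue (\<lambda>x. indicat_real S x *\<^sub>R (indicat_real (cbox c d) x * g x))"
      moreover have "(\<lambda>x. indicat_real S x *\<^sub>R (indicat_real (cbox c d) x * g x)) = (\<lambda>x. indicator (cbox c d) x * g x)"
        using cd by (auto simp: fun_eq_iff indicator_def)
      ultimately show ?thesis by simp
    qed auto
    have "AE x in lebesgue. indicator (cbox c d) x * g x = 0"
    proof (rule AE_zero_if_box_integrals_zero[OF int])
      fix a b :: 'a
      \<comment> \<open>An arbitrary box is first cut down to the inside of the given one, so that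
        the approximating test functions are supported in S.\<close>
      obtain a' b' where ab: "box a b \<inter> box c d = box a' b'"
        by (simp add: box_Int_box)
      have ne: "(LINT x|lebesgue. indicator (box a' b') x * g x) = 0"
      proof (cases "box a' b' = {}")
        case False
        then have "cbox a' b' \<subseteq> cbox c d"
          using ab by (metis closure_box closure_cbox box_subset_cbox closure_mono inf.cobounded2 order_trans)
        then have sub: "cbox a' b' \<subseteq> S" using cd by auto
        let ?\<psi> = "\<lambda>n x. 1 - (1 - box_bump a' b' x) ^ n"
        have bd: "\<bar>?\<psi> n x\<bar> \<le> indicator (box a' b') x" for n x
          using box_bump_bounds[of a' b' x] box_bump_eq_0[of x a' b']
          by (cases "x \<in> box a' b'") (auto simp: power_le_one)
        have "(\<lambda>n. LINT x|lebesgue_on S. g x * ?\<psi> n x) \<longlonglongrightarrow> (LINT x|lebesgue_on S. g x * indicator (box a' b') x)"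
        proof (rule integral_dominated_convergence[where w = "\<lambda>x. norm (indicator (cbox c d) x * g x)"])
          show "(\<lambda>x. g x * ?\<psi> n x) \<in> borel_measurable (lebesgue_on S)" for n
            by (rule borel_measurable_times[OF L2_spaceD(1)[OF g] borel_measurable_lebesgue_on_continuous])
              (rule C_k_continuous[OF test_functionD[OF test_function_box[OF sub]]])
          show "(\<lambda>x. g x * indicator (box a' b') x) \<in> borel_measurable (lebesgue_on S)"
            by (intro borel_measurable_times L2_spaceD(1)[OF g] measurable_restrict_space1 borel_measurable_indicator) auto
          show "integrable (lebesgue_on S) (\<lambda>x. norm (indicator (cbox c d) x * g x))"
            using integrable_L2_mult[OF one g] by auto
          show "AE x in lebesgue_on S. (\<lambda>n. g x * ?\<psi> n x) \<longlonglongrightarrow> g x * indicator (box a' b') x"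
            by (intro AE_I2 tendsto_mult tendsto_const box_bump_power_tendsto)
          show "AE x in lebesgue_on S. norm (g x * ?\<psi> n x) \<le> norm (indicator (cbox c d) x * g x)" for n
          proof (rule AE_I2)
            fix x
            have "indicator (box a' b') x \<le> (indicator (cbox c d) x :: real)"
              using \<open>cbox a' b' \<subseteq> cbox c d\<close> box_subset_cbox[of a' b'] by (auto simp: indicator_def)
            then have "\<bar>?\<psi> n x\<bar> \<le> indicator (cbox c d) x" using bd[of x n] by linarith
            from mult_right_mono[OF this abs_ge_zero[of "g x"]]
            show "norm (g x * ?\<psi> n x) \<le> norm (indicator (cbox c d) x * g x)"
              by (simp add: abs_mult mult.commute)
          qed
        qed
        then have "(LINT x|lebesgue_on S. g x * indicator (box a' b') x) = 0"
          using zero[OF test_function_box[OF sub]] by (simp add: LIMSEQ_const_iff)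
        also have "(LINT x|lebesgue_on S. g x * indicator (box a' b') x)
            = (LINT x|lebesgue. indicator (box a' b') x * g x)"
          using subsetD[OF subset_trans[OF box_subset_cbox sub]]
          by (subst integral_restrict_space) (auto simp: indicator_def intro!: Bochner_Integration.integral_cong)
        finally show ?thesis .
      qed simp
      \<comment> \<open>The integrand carries the indicator of the closed box, the intersection
        above is with the open one; they differ by a null set.\<close>
      have "AE x in lebesgue. x \<notin> cbox c d - box c d"
        using negligible_frontier_interval[of c d] by (intro AE_not_in) (simp add: negligible_iff_null_sets)
      then have "AE x in lebesgue. indicator (box a b) x * (indicator (cbox c d) x * g x)
          = indicator (box a' b') x * (indicator (cbox c d) x * g x)"
      proof eventually_elim
        case (elim x)
        then have "x \<in> box a b \<and> x \<in> cbox c d \<longleftrightarrow> x \<in> box a' b' \<and> x \<in> cbox c d"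
          using ab box_subset_cbox[of c d] by blast
        then show ?case by (auto simp: indicator_def)
      qed
      moreover have "(\<lambda>x. indicator (box p q) x * (indicator (cbox c d) x * g x)) \<in> borel_measurable lebesgue" for p q
        by (intro borel_measurable_times[OF borel_measurable_indicator borel_measurable_integrable[OF int]]) auto
      ultimately have "(LINT x|lebesgue. indicator (box a b) x * (indicator (cbox c d) x * g x))
          = (LINT x|lebesgue. indicator (box a' b') x * (indicator (cbox c d) x * g x))"
        by (intro integral_cong_AE)
      also have "\<dots> = (LINT x|lebesgue. indicator (box a' b') x * g x)"
        using ab box_subset_cbox[of c d] by (intro Bochner_Integration.integral_cong) (auto simp: indicator_def)
      finally show "(LINT x|lebesgue. indicator (box a b) x * (indicator (cbox c d) x * g x)) = 0"
        using ne by simp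
    qed
    then show ?thesis by eventually_elim (auto simp: indicator_def split: if_splits)
  qed
  obtain \<D> where D: "countable \<D>" "\<D> \<subseteq> Pow S" "\<And>X. X \<in> \<D> \<Longrightarrow> \<exists>a b. X = cbox a b" "\<Union>\<D> = S"
    using open_countable_Union_open_cbox[OF S] by metis
  have "AE x in lebesgue. \<forall>X\<in>\<D>. x \<in> X \<longrightarrow> g x = 0"
    unfolding AE_ball_countable[OF D(1)]
  proof
    fix X assume X: "X \<in> \<D>"
    then obtain a b where "X = cbox a b" using D(3) by blast
    then show "AE x in lebesgue. x \<in> X \<longrightarrow> g x = 0" using cb[of a b] D(2) X by auto
  qed
  then have "AE x in lebesgue. x \<in> S \<longrightarrow> g x = 0"
    by eventually_elim (use D(4) in auto)
  then show ?thesis by (subst AE_restrict_space_iff) auto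
qed

section \<open>Compactly supported functions and integration by parts\<close>

lemma frechet_derivative_Basis_sum:
  fixes \<phi> :: "'a::euclidean_space \<Rightarrow> real"
  assumes "\<phi> differentiable (at x)"
  shows "frechet_derivative \<phi> (at x) z = (\<Sum>b\<in>Basis. (z \<bullet> b) * frechet_derivative \<phi> (at x) b)"
proof -
  interpret linear "frechet_derivative \<phi> (at x)" by (rule linear_frechet_derivative[OF assms])
  have "frechet_derivative \<phi> (at x) z = frechet_derivative \<phi> (at x) (\<Sum>b\<in>Basis. (z \<bullet> b) *\<^sub>R b)"
    by (simp add: euclidean_representation)
  then show ?thesis by (simp add: sum scale)
qed

lemma continuous_on_frechet_derivative:
  fixes \<phi> :: "'a::euclidean_space \<Rightarrow> real"
  assumes "C_k (Suc 0) \<phi>"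
  shows "continuous_on UNIV (\<lambda>x. frechet_derivative \<phi> (at x) z)"
proof -
  have eq: "(\<lambda>x. frechet_derivative \<phi> (at x) z) = (\<lambda>x. \<Sum>b\<in>Basis. (z \<bullet> b) * frechet_derivative \<phi> (at x) b)"
    using frechet_derivative_Basis_sum[OF C_k_differentiable[OF assms]] by (intro ext)
  show ?thesis
    unfolding eq using assms by (auto intro!: continuous_on_sum continuous_on_mult simp: C_k.simps)
qed

lemma frechet_derivative_zero_outside:
  fixes \<phi> :: "'a::euclidean_space \<Rightarrow> real"
  assumes "compact K" "\<And>x. x \<notin> K \<Longrightarrow> \<phi> x = 0" "x \<notin> K"
  shows "frechet_derivative \<phi> (at x) z = 0"
proof -
  have "open (- K)" using compact_imp_closed[OF assms(1)] by (simp add: open_Compl)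
  have "((\<lambda>x. 0 :: real) has_derivative (\<lambda>z. 0)) (at x)" by simp
  then have "(\<phi> has_derivative (\<lambda>z. 0)) (at x)"
    by (rule has_derivative_transform_within_open[OF _ \<open>open (- K)\<close>]) (use assms in auto)
  from frechet_derivative_at[OF this] show ?thesis by metis
qed

lemma compact_support_bounded:
  fixes f :: "'a::euclidean_space \<Rightarrow> real"
  assumes "continuous_on UNIV f" "compact K" "\<And>x. x \<notin> K \<Longrightarrow> f x = 0"
  obtains M where "M \<ge> 0" "\<And>x. \<bar>f x\<bar> \<le> M"
proof -
  have "bounded (f ` K)"
    using assms by (intro compact_imp_bounded compact_continuous_image) (auto intro: continuous_on_subset)
  then obtain M where M: "\<And>x. x \<in> K \<Longrightarrow> \<bar>f x\<bar> \<le> M" by (auto simp: bounded_iff)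
  have "\<bar>f x\<bar> \<le> max M 0" for x using M[of x] assms(3)[of x] by (cases "x \<in> K") auto
  then show ?thesis by (intro that[of "max M 0"]) auto
qed

lemma compact_support_L2:
  fixes f :: "'a::euclidean_space \<Rightarrow> real"
  assumes "continuous_on UNIV f" "compact K" "\<And>x. x \<notin> K \<Longrightarrow> f x = 0" "S \<in> sets lebesgue"
  shows "f \<in> L2_space S"
proof -
  obtain M where M: "M \<ge> 0" "\<And>x. \<bar>f x\<bar> \<le> M" using compact_support_bounded[OF assms(1-3)] by metis
  obtain a where a: "K \<subseteq> cbox (-a) a" using bounded_subset_cbox_symmetric[OF compact_imp_bounded[OF assms(2)]] by blast
  show ?thesis
  proof (rule L2_space_bounded)
  show "f \<in> borel_measurable (lebesgue_on S)" by (rule borel_measurable_lebesgue_on_continuous[OF assms(1)])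
  show "integrable (lebesgue_on S) (\<lambda>x. M\<^sup>2 * (norm (indicator (cbox (-a) a) x :: real))\<^sup>2)"
    using L2_spaceD(2)[OF indicator_cbox_L2[OF assms(4)], of "-a" a] by simp
  show "AE x in lebesgue_on S. (norm (f x))\<^sup>2 \<le> M\<^sup>2 * (norm (indicator (cbox (-a) a) x :: real))\<^sup>2"
  proof (rule AE_I2)
    fix x
    show "(norm (f x))\<^sup>2 \<le> M\<^sup>2 * (norm (indicator (cbox (-a) a) x :: real))\<^sup>2"
      using power_mono[OF M(2)[of x], of 2] a assms(3)[of x] M(1)
      by (cases "x \<in> K") (auto simp: indicator_def)
  qed
  qed
qed

lemma compact_support_integrable:
  fixes f :: "'a::euclidean_space \<Rightarrow> real"
  assumes "continuous_on UNIV f" "compact K" "\<And>x. x \<notin> K \<Longrightarrow> f x = 0"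
  shows "integrable lebesgue f"
proof -
  obtain a where a: "K \<subseteq> cbox (-a) a" using bounded_subset_cbox_symmetric[OF compact_imp_bounded[OF assms(2)]] by blast
  have "integrable (lebesgue_on UNIV) (\<lambda>x. indicator (cbox (-a) a) x * f x)"
    by (intro integrable_L2_mult indicator_cbox_L2 compact_support_L2[OF assms]) auto
  moreover have "(\<lambda>x. indicator (cbox (-a) a) x * f x) = f"
    using a assms(3) by (auto simp: indicator_def fun_eq_iff)
  ultimately show ?thesis by (simp add: lebesgue_on_UNIV_eq)
qed

lemma integral_lebesgue_translation:
  fixes f :: "'a::euclidean_space \<Rightarrow> real"
  assumes "f \<in> borel_measurable borel"
  shows "(LINT x|lebesgue. f (x + z)) = (LINT x|lebesgue. f x)"
proof -
  have "(LINT x|lebesgue. f x) = (LINT x|distr lborel borel ((+) z). f x)"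
    using assms by (simp add: integral_completion lborel_distr_plus)
  also have "\<dots> = (LINT x|lborel. f (z + x))"
    using assms by (subst integral_distr) auto
  also have "\<dots> = (LINT x|lebesgue. f (x + z))"
    using assms by (subst integral_completion) (auto simp: add.commute)
  finally show ?thesis by simp
qed

lemma integrable_lebesgue_translation:
  fixes f :: "'a::euclidean_space \<Rightarrow> real"
  assumes "f \<in> borel_measurable borel" "integrable lebesgue f"
  shows "integrable lebesgue (\<lambda>x. f (x + z))"
proof -
  have "integrable (distr lborel borel ((+) z)) f"
    using assms by (simp add: integrable_completion lborel_distr_plus)
  then have "integrable lborel (\<lambda>x. f (z + x))"
    using assms by (subst (asm) integrable_distr_eq) auto
  then show ?thesis
    using assms by (subst integrable_completion) (auto simp: add.commute)
qed

text \<open>The mean value theorem bounds the quotients by the supremum of the derivative. For steps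
  h \<le> 1 they all vanish outside one box, which makes the majorant integrable and uniform in
  h.\<close>

lemma difference_quotient_bound:
  fixes \<phi> :: "'a::euclidean_space \<Rightarrow> real"
  assumes C: "C_k (Suc 0) \<phi>" and K: "compact K" "\<And>x. x \<notin> K \<Longrightarrow> \<phi> x = 0"
  obtains M a where "M \<ge> 0"
    "\<And>x h. 0 < h \<Longrightarrow> h \<le> 1 \<Longrightarrow> \<bar>(\<phi> (x + h *\<^sub>R z) - \<phi> x) / h\<bar> \<le> M * indicator (cbox (-a) a) x"
proof -
  obtain M where M: "M \<ge> 0" "\<And>x. \<bar>frechet_derivative \<phi> (at x) z\<bar> \<le> M"
    using compact_support_bounded[OF continuous_on_frechet_derivative[OF C] K(1) frechet_derivative_zero_outside[OF K]]
    by metis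
  \<comment> \<open>The points from which the support is reached along \<open>z\<close> with a
    parameter in [0, 1].\<close>
  have "compact ((\<lambda>(x, s). x - s *\<^sub>R z) ` (K \<times> {0..1::real}))"
    using K(1) by (intro compact_continuous_image compact_Times) (auto simp: split_beta intro!: continuous_intros)
  then obtain a where a: "(\<lambda>(x, s). x - s *\<^sub>R z) ` (K \<times> {0..1::real}) \<subseteq> cbox (-a) a"
    using bounded_subset_cbox_symmetric[OF compact_imp_bounded] by metis
  have out: "x + s *\<^sub>R z \<notin> K" if "x \<notin> cbox (-a) a" "0 \<le> s" "s \<le> 1" for x s
  proof
    assume "x + s *\<^sub>R z \<in> K"
    then have "(\<lambda>(x, s). x - s *\<^sub>R z) (x + s *\<^sub>R z, s) \<in> cbox (-a) a"
      using that(2,3) by (intro subsetD[OF a] imageI) auto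
    then show False using that(1) by simp
  qed
  show ?thesis
  proof (rule that[of M a])
    fix x and h :: real assume h: "0 < h" "h \<le> 1"
    have D: "((\<lambda>s. \<phi> (x + s *\<^sub>R z)) has_real_derivative frechet_derivative \<phi> (at (x + s *\<^sub>R z)) z) (at s)" for s
    proof -
      have "((\<lambda>s. x + s *\<^sub>R z) has_derivative (\<lambda>r. r *\<^sub>R z)) (at s)"
        by (auto intro!: derivative_eq_intros)
      from diff_chain_at[OF this C_k_has_derivative[OF C]] show ?thesis
        using linear_cmul[OF linear_frechet_derivative[OF C_k_differentiable[OF C]]]
        by (simp add: o_def has_field_derivative_def mult_commute_abs)
    qed
    obtain s where s: "0 < s" "s < h" "\<phi> (x + h *\<^sub>R z) - \<phi> (x + 0 *\<^sub>R z) = (h - 0) * frechet_derivative \<phi> (at (x + s *\<^sub>R z)) z"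
      using MVT2[OF h(1) D] by blast
    then have eq: "(\<phi> (x + h *\<^sub>R z) - \<phi> x) / h = frechet_derivative \<phi> (at (x + s *\<^sub>R z)) z"
      using h by simp
    show "\<bar>(\<phi> (x + h *\<^sub>R z) - \<phi> x) / h\<bar> \<le> M * indicator (cbox (-a) a) x"
    proof (cases "x \<in> cbox (-a) a")
      case False
      then show ?thesis
        using out[OF False, of s] s h unfolding eq by (simp add: frechet_derivative_zero_outside[OF K])
    qed (use M(2) eq in auto)
  qed (rule M(1))
qed

lemma difference_quotient_tendsto:
  fixes \<phi> :: "'a::euclidean_space \<Rightarrow> real"
  assumes C: "C_k (Suc 0) \<phi>"
  shows "(\<lambda>n. (\<phi> (x + inverse (real (Suc n)) *\<^sub>R z) - \<phi> x) / inverse (real (Suc n)))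
    \<longlonglongrightarrow> frechet_derivative \<phi> (at x) z"
proof -
  have "((\<lambda>s. x + s *\<^sub>R z) has_derivative (\<lambda>r. r *\<^sub>R z)) (at 0)"
    by (auto intro!: derivative_eq_intros)
  from diff_chain_at[OF this C_k_has_derivative[OF C]]
  have "((\<lambda>s. \<phi> (x + s *\<^sub>R z)) has_real_derivative frechet_derivative \<phi> (at x) z) (at 0)"
    using linear_cmul[OF linear_frechet_derivative[OF C_k_differentiable[OF C]]]
    by (simp add: o_def has_field_derivative_def mult_commute_abs)
  then have lim: "((\<lambda>h. (\<phi> (x + h *\<^sub>R z) - \<phi> x) / h) \<longlongrightarrow> frechet_derivative \<phi> (at x) z) (at 0)"
    by (simp add: DERIV_def)
  have "filterlim (\<lambda>n. inverse (real (Suc n))) (at 0) sequentially"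
    using LIMSEQ_inverse_real_of_nat by (simp add: filterlim_at)
  from filterlim_compose[OF lim this] show ?thesis .
qed

text \<open>Every difference quotient has integral zero by translation invariance, and dominated
  convergence passes this on to the derivative. No iterated integration is involved.\<close>

lemma integral_frechet_derivative_zero:
  fixes \<phi> :: "'a::euclidean_space \<Rightarrow> real"
  assumes C: "C_k (Suc 0) \<phi>" and K: "compact K" "\<And>x. x \<notin> K \<Longrightarrow> \<phi> x = 0"
  shows "(LINT x|lebesgue. frechet_derivative \<phi> (at x) z) = 0"
proof -
  have cont: "continuous_on UNIV \<phi>" by (rule C_k_continuous[OF C])
  have bm: "\<phi> \<in> borel_measurable borel" by (rule borel_measurable_continuous_onI[OF cont])
  have int: "integrable lebesgue \<phi>" by (rule compact_support_integrable[OF cont K])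
  obtain M a where Ma: "M \<ge> 0"
    "\<And>x h. 0 < h \<Longrightarrow> h \<le> 1 \<Longrightarrow> \<bar>(\<phi> (x + h *\<^sub>R z) - \<phi> x) / h\<bar> \<le> M * indicator (cbox (-a) a) x"
    using difference_quotient_bound[OF C K] by metis
  let ?h = "\<lambda>n. inverse (real (Suc n))"
  have h: "0 < ?h n" "?h n \<le> 1" for n by (auto simp: field_simps)
  have "(\<lambda>n. LINT x|lebesgue. (\<phi> (x + ?h n *\<^sub>R z) - \<phi> x) / ?h n) \<longlonglongrightarrow> (LINT x|lebesgue. frechet_derivative \<phi> (at x) z)"
  proof (rule integral_dominated_convergence[where w = "\<lambda>x. M * indicator (cbox (-a) a) x"])
    show "(\<lambda>x. frechet_derivative \<phi> (at x) z) \<in> borel_measurable lebesgue"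
      using continuous_on_frechet_derivative[OF C] by (simp add: borel_measurable_continuous_onI measurable_completion)
    show "(\<lambda>x. (\<phi> (x + ?h n *\<^sub>R z) - \<phi> x) / ?h n) \<in> borel_measurable lebesgue" for n
      using integrable_lebesgue_translation[OF bm int] int by (intro borel_measurable_integrable) auto
    show "integrable lebesgue (\<lambda>x. M * indicat_real (cbox (-a) a) x)"
      by (intro integrable_mult_right integrable_real_indicator)
        (use emeasure_lborel_cbox_finite[of "-a" a] in auto)
    show "AE x in lebesgue. norm ((\<phi> (x + ?h n *\<^sub>R z) - \<phi> x) / ?h n) \<le> M * indicator (cbox (-a) a) x" for n
      using Ma(2)[OF h] by (intro AE_I2) (simp only: real_norm_def)
  qed (intro AE_I2 difference_quotient_tendsto[OF C])
  moreover have "(LINT x|lebesgue. (\<phi> (x + ?h n *\<^sub>R z) - \<phi> x) / ?h n) = 0" for n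
    using integrable_lebesgue_translation[OF bm int] int integral_lebesgue_translation[OF bm]
    by simp
  ultimately show ?thesis by (simp add: LIMSEQ_const_iff)
qed

lemma test_function_frechet_derivative:
  assumes "test_function S \<phi>" "b \<in> Basis"
  shows "test_function S (\<lambda>x. frechet_derivative \<phi> (at x) b)"
proof -
  obtain K where K: "compact K" "K \<subseteq> S" "\<And>x. x \<notin> K \<Longrightarrow> \<phi> x = 0" by (rule test_function_support[OF assms(1)]) blast
  show ?thesis
  proof (rule test_function_supportI[OF _ K(1,2)])
    show "C_k k (\<lambda>x. frechet_derivative \<phi> (at x) b)" for k
      using test_functionD[OF assms(1), of "Suc k"] assms(2) by (simp add: C_k.simps)
  qed (rule frechet_derivative_zero_outside[OF K(1,3)])
qed

lemma test_function_L2: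
  assumes "test_function S \<phi>" "T \<in> sets lebesgue"
  shows "\<phi> \<in> L2_space T"
proof -
  obtain K where K: "compact K" "K \<subseteq> S" "\<And>x. x \<notin> K \<Longrightarrow> \<phi> x = 0" by (rule test_function_support[OF assms(1)]) blast
  show ?thesis by (rule compact_support_L2[OF C_k_continuous[OF test_functionD[OF assms(1), of 0]] K(1,3) assms(2)])
qed

lemma test_function_lin:
  assumes "test_function S \<phi>" "test_function S \<psi>"
  shows "test_function S (\<lambda>x. c * \<phi> x + d * \<psi> x)"
proof -
  obtain K where K: "compact K" "K \<subseteq> S" "\<And>x. x \<notin> K \<Longrightarrow> \<phi> x = 0" by (rule test_function_support[OF assms(1)]) blast
  obtain L where L: "compact L" "L \<subseteq> S" "\<And>x. x \<notin> L \<Longrightarrow> \<psi> x = 0" by (rule test_function_support[OF assms(2)]) blast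
  show ?thesis
  proof (rule test_function_supportI[of _ "K \<union> L"])
    show "C_k k (\<lambda>x. c * \<phi> x + d * \<psi> x)" for k
      using assms by (intro C_k_add C_k_cmult test_functionD)
  qed (use K L in auto)
qed

lemma test_function_zero: "test_function S (\<lambda>x. 0)"
  by (rule test_function_supportI[of _ "{}"]) (auto intro: C_k_const)

lemma test_function_cmult: "test_function S \<phi> \<Longrightarrow> test_function S (\<lambda>x. c * \<phi> x)"
  using test_function_lin[of S \<phi> \<phi> c 0] by simp

lemma integral_lebesgue_on_zero_outside:
  fixes f :: "'a::euclidean_space \<Rightarrow> real"
  assumes "S \<in> sets lebesgue" "\<And>x. x \<notin> S \<Longrightarrow> f x = 0"
  shows "(LINT x|lebesgue_on S. f x) = (LINT x|lebesgue. f x)"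
  using assms by (subst integral_restrict_space) (auto simp: indicator_def intro!: Bochner_Integration.integral_cong)

lemma test_function_integration_by_parts:
  assumes "open S" "test_function S \<phi>" "test_function S \<psi>" "b \<in> Basis"
  shows "(LINT x|lebesgue_on S. \<phi> x * frechet_derivative \<psi> (at x) b)
    = - (LINT x|lebesgue_on S. frechet_derivative \<phi> (at x) b * \<psi> x)"
proof -
  have S: "S \<in> sets lebesgue" using assms(1) by auto
  obtain K where K: "compact K" "K \<subseteq> S" "\<And>x. x \<notin> K \<Longrightarrow> \<phi> x = 0" by (rule test_function_support[OF assms(2)]) blast
  note D = C_k_has_derivative[OF test_functionD[OF assms(2)]] C_k_has_derivative[OF test_functionD[OF assms(3)]]
  have fd: "frechet_derivative (\<lambda>x. \<phi> x * \<psi> x) (at x) b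
      = \<phi> x * frechet_derivative \<psi> (at x) b + frechet_derivative \<phi> (at x) b * \<psi> x" for x
    using frechet_derivative_at[OF has_derivative_mult[OF D]] by metis
  have "(LINT x|lebesgue_on S. frechet_derivative (\<lambda>x. \<phi> x * \<psi> x) (at x) b) = 0"
  proof (subst integral_lebesgue_on_zero_outside[OF S])
    have "C_k (Suc 0) (\<lambda>x. \<phi> x * \<psi> x)" using assms by (intro C_k_mult test_functionD)
    then show "(LINT x|lebesgue. frechet_derivative (\<lambda>x. \<phi> x * \<psi> x) (at x) b) = 0"
      using K by (intro integral_frechet_derivative_zero[OF _ K(1)]) auto
    show "frechet_derivative (\<lambda>x. \<phi> x * \<psi> x) (at x) b = 0" if "x \<notin> S" for x
      using that K by (intro frechet_derivative_zero_outside[OF K(1)]) auto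
  qed
  moreover have "(LINT x|lebesgue_on S. frechet_derivative (\<lambda>x. \<phi> x * \<psi> x) (at x) b)
    = (LINT x|lebesgue_on S. \<phi> x * frechet_derivative \<psi> (at x) b)
      + (LINT x|lebesgue_on S. frechet_derivative \<phi> (at x) b * \<psi> x)"
    unfolding fd using assms S
    by (intro Bochner_Integration.integral_add integrable_L2_mult)
      (auto intro: test_function_L2 test_function_frechet_derivative)
  ultimately show ?thesis by linarith
qed

section \<open>Weak derivatives\<close>

locale bounded_open =
  fixes \<Omega> :: "'a::euclidean_space set"
  assumes open_Omega: "open \<Omega>" and bounded_Omega: "bounded \<Omega>"
begin

lemma lmeasurable_Omega: "\<Omega> \<in> lmeasurable"
  using open_Omega bounded_Omega by (rule lmeasurable_open[rotated])

lemma sets_Omega [measurable]: "\<Omega> \<in> sets lebesgue"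
  using open_Omega by auto

lemma has_wderivD:
  assumes "has_wderiv \<Omega> b v g"
  shows "v \<in> L2_space \<Omega>" "g \<in> L2_space \<Omega>"
    "\<And>\<phi>. test_function \<Omega> \<phi> \<Longrightarrow>
      L2_inner \<Omega> v (\<lambda>x. frechet_derivative \<phi> (at x) b) = - L2_inner \<Omega> g \<phi>"
  using assms by (auto simp: has_wderiv_def L2_inner_def)

lemma has_wderivI:
  assumes "v \<in> L2_space \<Omega>" "g \<in> L2_space \<Omega>"
    "\<And>\<phi>. test_function \<Omega> \<phi> \<Longrightarrow>
      L2_inner \<Omega> v (\<lambda>x. frechet_derivative \<phi> (at x) b) = - L2_inner \<Omega> g \<phi>"
  shows "has_wderiv \<Omega> b v g"
  using assms by (auto simp: has_wderiv_def L2_inner_def)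

lemma test_L2: "test_function \<Omega> \<phi> \<Longrightarrow> \<phi> \<in> L2_space \<Omega>"
  by (rule test_function_L2) auto

lemma test_deriv_L2:
  "test_function \<Omega> \<phi> \<Longrightarrow> b \<in> Basis \<Longrightarrow> (\<lambda>x. frechet_derivative \<phi> (at x) b) \<in> L2_space \<Omega>"
  by (intro test_L2 test_function_frechet_derivative)

lemma has_wderiv_test:
  assumes "test_function \<Omega> \<phi>" "b \<in> Basis"
  shows "has_wderiv \<Omega> b \<phi> (\<lambda>x. frechet_derivative \<phi> (at x) b)"
  using test_function_integration_by_parts[OF open_Omega assms(1) _ assms(2)] assms
  by (intro has_wderivI test_L2 test_deriv_L2) (auto simp: L2_inner_def)

lemma has_wderiv_lin:
  assumes "has_wderiv \<Omega> b v g" "has_wderiv \<Omega> b w h" "b \<in> Basis"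
  shows "has_wderiv \<Omega> b (\<lambda>x. c * v x + d * w x) (\<lambda>x. c * g x + d * h x)"
proof (rule has_wderivI)
  note L2 = has_wderivD(1,2)[OF assms(1)] has_wderivD(1,2)[OF assms(2)]
  show "(\<lambda>x. c * v x + d * w x) \<in> L2_space \<Omega>" "(\<lambda>x. c * g x + d * h x) \<in> L2_space \<Omega>"
    using L2 by auto
  fix \<phi> assume \<phi>: "test_function \<Omega> \<phi>"
  show "L2_inner \<Omega> (\<lambda>x. c * v x + d * w x) (\<lambda>x. frechet_derivative \<phi> (at x) b)
      = - L2_inner \<Omega> (\<lambda>x. c * g x + d * h x) \<phi>"
    using L2 \<phi> assms(3) has_wderivD(3)[OF assms(1) \<phi>] has_wderivD(3)[OF assms(2) \<phi>]
    by (simp add: L2_inner_add_left L2_space_cmult test_L2 test_deriv_L2 L2_inner_cmult_left)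
qed

text \<open>The fundamental lemma applied to g - h. Allowing v and w to differ on a null set makes
  it serve for changes of representative as well.\<close>

lemma has_wderiv_unique:
  assumes "has_wderiv \<Omega> b v g" "has_wderiv \<Omega> b w h" "b \<in> Basis"
    and "AE x in lebesgue_on \<Omega>. v x = w x"
  shows "AE x in lebesgue_on \<Omega>. g x = h x"
proof -
  note L2 = has_wderivD(1,2)[OF assms(1)] has_wderivD(1,2)[OF assms(2)]
  have "AE x in lebesgue_on \<Omega>. g x - h x = 0"
  proof (rule AE_zero_if_test_integrals_zero[OF open_Omega])
    show "(\<lambda>x. g x - h x) \<in> L2_space \<Omega>" using L2 by auto
    fix \<phi> assume \<phi>: "test_function \<Omega> \<phi>"
    have "L2_inner \<Omega> v (\<lambda>x. frechet_derivative \<phi> (at x) b) = L2_inner \<Omega> w (\<lambda>x. frechet_derivative \<phi> (at x) b)"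
      by (rule L2_inner_cong_AE[OF assms(4)]) (use L2 \<phi> assms(3) test_deriv_L2 in auto)
    then have "L2_inner \<Omega> (\<lambda>x. g x - h x) \<phi> = 0"
      using has_wderivD(3)[OF assms(1) \<phi>] has_wderivD(3)[OF assms(2) \<phi>] L2 \<phi>
      by (simp add: L2_inner_diff_left test_L2)
    then show "(LINT x|lebesgue_on \<Omega>. (g x - h x) * \<phi> x) = 0" by (simp add: L2_inner_def)
  qed
  then show ?thesis by simp
qed

lemma has_wderiv_wderiv: "v \<in> H1_space \<Omega> \<Longrightarrow> b \<in> Basis \<Longrightarrow> has_wderiv \<Omega> b v (wderiv \<Omega> b v)"
  unfolding wderiv_def H1_space_def using someI_ex[of "has_wderiv \<Omega> b v"] by auto

lemma H1_spaceI:
  assumes "\<And>b. b \<in> Basis \<Longrightarrow> has_wderiv \<Omega> b v (g b)"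
  shows "v \<in> H1_space \<Omega>"
proof -
  obtain b :: 'a where "b \<in> Basis" using nonempty_Basis by blast
  then show ?thesis using assms has_wderivD(1) by (auto simp: H1_space_def)
qed

lemma H1_L2: "v \<in> H1_space \<Omega> \<Longrightarrow> v \<in> L2_space \<Omega>"
  by (simp add: H1_space_def)

lemma wderiv_L2: "v \<in> H1_space \<Omega> \<Longrightarrow> b \<in> Basis \<Longrightarrow> wderiv \<Omega> b v \<in> L2_space \<Omega>"
  using has_wderivD(2)[OF has_wderiv_wderiv] .

text \<open>Connects the representative chosen by \<open>SOME\<close> with a weak derivative known
  explicitly.\<close>

lemma wderiv_AE:
  assumes "has_wderiv \<Omega> b v g" "b \<in> Basis"
  shows "AE x in lebesgue_on \<Omega>. wderiv \<Omega> b v x = g x"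
proof -
  have "has_wderiv \<Omega> b v (wderiv \<Omega> b v)"
    unfolding wderiv_def by (rule someI[of "has_wderiv \<Omega> b v", OF assms(1)])
  then show ?thesis by (rule has_wderiv_unique[OF _ assms]) simp
qed

lemma wgrad_inner_Basis: "b \<in> Basis \<Longrightarrow> wgrad \<Omega> v x \<bullet> b = wderiv \<Omega> b v x"
  by (simp add: wgrad_def)

lemma wgrad_L2: "v \<in> H1_space \<Omega> \<Longrightarrow> wgrad \<Omega> v \<in> L2_space \<Omega>"
proof -
  assume v: "v \<in> H1_space \<Omega>"
  have "(\<lambda>x. wderiv \<Omega> b v x *\<^sub>R b) \<in> L2_space \<Omega>" if "b \<in> Basis" for b
    using wderiv_L2[OF v that] by (auto simp: L2_space_def power_mult_distrib that)
  then show ?thesis unfolding wgrad_def[abs_def] by (intro L2_space_sum)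
qed

lemma wgrad_AE:
  assumes "\<And>b. b \<in> Basis \<Longrightarrow> has_wderiv \<Omega> b v (g b)"
  shows "AE x in lebesgue_on \<Omega>. wgrad \<Omega> v x = (\<Sum>b\<in>Basis. g b x *\<^sub>R b)"
proof -
  have "AE x in lebesgue_on \<Omega>. \<forall>b\<in>Basis. wderiv \<Omega> b v x = g b x"
    using wderiv_AE[OF assms] by (subst AE_ball_countable) (auto simp: countable_finite)
  then show ?thesis by eventually_elim (simp add: wgrad_def)
qed

lemma L2_inner_wgrad:
  assumes "v \<in> H1_space \<Omega>" "w \<in> H1_space \<Omega>"
  shows "L2_inner \<Omega> (wgrad \<Omega> v) (wgrad \<Omega> w) = (\<Sum>b\<in>Basis. L2_inner \<Omega> (wderiv \<Omega> b v) (wderiv \<Omega> b w))"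
proof -
  have eq: "wgrad \<Omega> v x \<bullet> wgrad \<Omega> w x = (\<Sum>b\<in>Basis. wderiv \<Omega> b v x * wderiv \<Omega> b w x)" for x
    by (subst euclidean_inner) (simp add: wgrad_inner_Basis)
  show ?thesis
    unfolding L2_inner_def eq using assms
    by (subst Bochner_Integration.integral_sum) (auto intro!: integrable_L2_mult wderiv_L2)
qed

lemma H1_space_lin:
  assumes "v \<in> H1_space \<Omega>" "w \<in> H1_space \<Omega>"
  shows "(\<lambda>x. c * v x + d * w x) \<in> H1_space \<Omega>"
  using has_wderiv_lin[OF has_wderiv_wderiv[OF assms(1)] has_wderiv_wderiv[OF assms(2)]] by (rule H1_spaceI)

lemma wgrad_lin:
  assumes "v \<in> H1_space \<Omega>" "w \<in> H1_space \<Omega>"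
  shows "AE x in lebesgue_on \<Omega>. wgrad \<Omega> (\<lambda>x. c * v x + d * w x) x = c *\<^sub>R wgrad \<Omega> v x + d *\<^sub>R wgrad \<Omega> w x"
proof -
  have "AE x in lebesgue_on \<Omega>. wgrad \<Omega> (\<lambda>x. c * v x + d * w x) x
      = (\<Sum>b\<in>Basis. (c * wderiv \<Omega> b v x + d * wderiv \<Omega> b w x) *\<^sub>R b)"
    by (intro wgrad_AE has_wderiv_lin has_wderiv_wderiv assms)
  then show ?thesis
    by eventually_elim (simp add: wgrad_def scaleR_sum_right scaleR_left_distrib sum.distrib)
qed

lemma H1_space_diff: "v \<in> H1_space \<Omega> \<Longrightarrow> w \<in> H1_space \<Omega> \<Longrightarrow> (\<lambda>x. v x - w x) \<in> H1_space \<Omega>"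
  using H1_space_lin[of v w 1 "-1"] by simp

lemma wgrad_diff:
  assumes "v \<in> H1_space \<Omega>" "w \<in> H1_space \<Omega>"
  shows "AE x in lebesgue_on \<Omega>. wgrad \<Omega> (\<lambda>x. v x - w x) x = wgrad \<Omega> v x - wgrad \<Omega> w x"
  using wgrad_lin[OF assms, of 1 "-1"] by simp

lemma L2_norm_wgrad_diff:
  assumes "v \<in> H1_space \<Omega>" "w \<in> H1_space \<Omega>"
  shows "L2_norm \<Omega> (wgrad \<Omega> (\<lambda>x. v x - w x)) = L2_norm \<Omega> (\<lambda>x. wgrad \<Omega> v x - wgrad \<Omega> w x)"
  by (rule L2_norm_cong_AE[OF wgrad_diff[OF assms]]) (use assms in \<open>auto intro: wgrad_L2 H1_space_diff\<close>)

lemma wgrad_cong_AE: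
  assumes "v \<in> H1_space \<Omega>" "w \<in> H1_space \<Omega>" "AE x in lebesgue_on \<Omega>. v x = w x"
  shows "AE x in lebesgue_on \<Omega>. wgrad \<Omega> v x = wgrad \<Omega> w x"
proof -
  have "AE x in lebesgue_on \<Omega>. \<forall>b\<in>Basis. wderiv \<Omega> b v x = wderiv \<Omega> b w x"
    using has_wderiv_unique[OF has_wderiv_wderiv[OF assms(1)] has_wderiv_wderiv[OF assms(2)] _ assms(3)]
    by (subst AE_ball_countable) (auto simp: countable_finite)
  then show ?thesis by eventually_elim (simp add: wgrad_def)
qed

lemma test_H1: "test_function \<Omega> \<phi> \<Longrightarrow> \<phi> \<in> H1_space \<Omega>"
  by (rule H1_spaceI[OF has_wderiv_test])

lemma L2_norm_le_H1_norm: "L2_norm \<Omega> v \<le> H1_norm \<Omega> v" "L2_norm \<Omega> (wgrad \<Omega> v) \<le> H1_norm \<Omega> v"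
  unfolding H1_norm_def by (auto intro!: real_le_rsqrt)

lemma H1_norm_tendsto_0_iff:
  "((\<lambda>i. H1_norm \<Omega> (v i)) \<longlongrightarrow> 0) F \<longleftrightarrow>
    ((\<lambda>i. L2_norm \<Omega> (v i)) \<longlongrightarrow> 0) F \<and> ((\<lambda>i. L2_norm \<Omega> (wgrad \<Omega> (v i))) \<longlongrightarrow> 0) F"
proof safe
  assume H: "((\<lambda>i. H1_norm \<Omega> (v i)) \<longlongrightarrow> 0) F"
  show "((\<lambda>i. L2_norm \<Omega> (v i)) \<longlongrightarrow> 0) F"
    by (rule Lim_null_comparison[OF _ H]) (simp add: L2_norm_le_H1_norm)
  show "((\<lambda>i. L2_norm \<Omega> (wgrad \<Omega> (v i))) \<longlongrightarrow> 0) F"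
    by (rule Lim_null_comparison[OF _ H]) (simp add: L2_norm_le_H1_norm)
next
  assume "((\<lambda>i. L2_norm \<Omega> (v i)) \<longlongrightarrow> 0) F" "((\<lambda>i. L2_norm \<Omega> (wgrad \<Omega> (v i))) \<longlongrightarrow> 0) F"
  then have "((\<lambda>i. sqrt ((L2_norm \<Omega> (v i))\<^sup>2 + (L2_norm \<Omega> (wgrad \<Omega> (v i)))\<^sup>2)) \<longlongrightarrow> sqrt (0\<^sup>2 + 0\<^sup>2)) F"
    by (intro tendsto_intros)
  then show "((\<lambda>i. H1_norm \<Omega> (v i)) \<longlongrightarrow> 0) F" by (simp add: H1_norm_def)
qed

section \<open>The space H^1_0 as a closure of test functions\<close>

text \<open>The definition contains the gradient of a difference, which is the difference of the
  gradients only almost everywhere. This is settled here once, and H^1 convergence is split into its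
  two L^2 parts.\<close>

lemma H10_space_iff:
  "v \<in> H10_space \<Omega> \<longleftrightarrow> v \<in> H1_space \<Omega> \<and> (\<exists>\<phi>. (\<forall>n. test_function \<Omega> (\<phi> n)) \<and>
    (\<lambda>n. L2_norm \<Omega> (\<lambda>x. \<phi> n x - v x)) \<longlonglongrightarrow> 0 \<and>
    (\<lambda>n. L2_norm \<Omega> (\<lambda>x. wgrad \<Omega> (\<phi> n) x - wgrad \<Omega> v x)) \<longlonglongrightarrow> 0)"
proof (cases "v \<in> H1_space \<Omega>")
  case True
  have "(\<lambda>n. H1_norm \<Omega> (\<lambda>x. v x - \<phi> n x)) \<longlonglongrightarrow> 0 \<longleftrightarrow>
      (\<lambda>n. L2_norm \<Omega> (\<lambda>x. \<phi> n x - v x)) \<longlonglongrightarrow> 0 \<and>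
      (\<lambda>n. L2_norm \<Omega> (\<lambda>x. wgrad \<Omega> (\<phi> n) x - wgrad \<Omega> v x)) \<longlonglongrightarrow> 0"
    if "\<forall>n. test_function \<Omega> (\<phi> n)" for \<phi>
  proof -
    have "L2_norm \<Omega> (wgrad \<Omega> (\<lambda>x. v x - \<phi> n x)) = L2_norm \<Omega> (\<lambda>x. wgrad \<Omega> (\<phi> n) x - wgrad \<Omega> v x)" for n
      using L2_norm_wgrad_diff[OF True test_H1, of "\<phi> n"] that L2_norm_minus_commute by metis
    moreover have "L2_norm \<Omega> (\<lambda>x. v x - \<phi> n x) = L2_norm \<Omega> (\<lambda>x. \<phi> n x - v x)" for n
      by (rule L2_norm_minus_commute)
    ultimately show ?thesis by (simp add: H1_norm_tendsto_0_iff)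
  qed
  then show ?thesis using True unfolding H10_space_def by blast
qed (simp add: H10_space_def)

lemma H10_H1: "v \<in> H10_space \<Omega> \<Longrightarrow> v \<in> H1_space \<Omega>"
  by (simp add: H10_space_def)

lemma H10_L2: "v \<in> H10_space \<Omega> \<Longrightarrow> v \<in> L2_space \<Omega>"
  using H1_L2[OF H10_H1] .

lemma H10_approx:
  assumes "v \<in> H10_space \<Omega>"
  obtains \<phi> where "\<And>n. test_function \<Omega> (\<phi> n)" "(\<lambda>n. L2_norm \<Omega> (\<lambda>x. \<phi> n x - v x)) \<longlonglongrightarrow> 0"
    "(\<lambda>n. L2_norm \<Omega> (\<lambda>x. wgrad \<Omega> (\<phi> n) x - wgrad \<Omega> v x)) \<longlonglongrightarrow> 0"
  using assms unfolding H10_space_iff by blast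

lemma test_H10: "test_function \<Omega> \<phi> \<Longrightarrow> \<phi> \<in> H10_space \<Omega>"
  unfolding H10_space_iff by (auto simp: test_H1 L2_norm_def intro!: exI[of _ "\<lambda>n. \<phi>"])

lemma L2_norm_lin_le:
  assumes "v \<in> L2_space S" "w \<in> L2_space S"
  shows "L2_norm S (\<lambda>x. c *\<^sub>R v x + d *\<^sub>R w x) \<le> \<bar>c\<bar> * L2_norm S v + \<bar>d\<bar> * L2_norm S w"
  using L2_norm_triangle[OF L2_space_scaleR[OF assms(1), of c] L2_space_scaleR[OF assms(2), of d]]
  by (simp add: L2_norm_scaleR)

lemma H10_space_lin:
  assumes v: "v \<in> H10_space \<Omega>" and w: "w \<in> H10_space \<Omega>"
  shows "(\<lambda>x. c * v x + d * w x) \<in> H10_space \<Omega>"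
proof -
  obtain \<phi> where \<phi>: "\<And>n. test_function \<Omega> (\<phi> n)" "(\<lambda>n. L2_norm \<Omega> (\<lambda>x. \<phi> n x - v x)) \<longlonglongrightarrow> 0"
    "(\<lambda>n. L2_norm \<Omega> (\<lambda>x. wgrad \<Omega> (\<phi> n) x - wgrad \<Omega> v x)) \<longlonglongrightarrow> 0" by (rule H10_approx[OF v]) blast
  obtain \<psi> where \<psi>: "\<And>n. test_function \<Omega> (\<psi> n)" "(\<lambda>n. L2_norm \<Omega> (\<lambda>x. \<psi> n x - w x)) \<longlonglongrightarrow> 0"
    "(\<lambda>n. L2_norm \<Omega> (\<lambda>x. wgrad \<Omega> (\<psi> n) x - wgrad \<Omega> w x)) \<longlonglongrightarrow> 0" by (rule H10_approx[OF w]) blast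
  let ?\<chi> = "\<lambda>n x. c * \<phi> n x + d * \<psi> n x"
  have \<chi>: "test_function \<Omega> (?\<chi> n)" for n using \<phi> \<psi> by (intro test_function_lin)
  have V: "(\<lambda>x. c * v x + d * w x) \<in> H1_space \<Omega>" using v w by (intro H1_space_lin H10_H1)
  have 1: "(\<lambda>n. L2_norm \<Omega> (\<lambda>x. ?\<chi> n x - (c * v x + d * w x))) \<longlonglongrightarrow> 0"
  proof (rule Lim_null_comparison)
    show "(\<lambda>n. \<bar>c\<bar> * L2_norm \<Omega> (\<lambda>x. \<phi> n x - v x) + \<bar>d\<bar> * L2_norm \<Omega> (\<lambda>x. \<psi> n x - w x)) \<longlonglongrightarrow> 0"
      using tendsto_add[OF tendsto_mult_right_zero[OF \<phi>(2)] tendsto_mult_right_zero[OF \<psi>(2)]] by simp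
    have "L2_norm \<Omega> (\<lambda>x. c *\<^sub>R (\<phi> n x - v x) + d *\<^sub>R (\<psi> n x - w x))
        \<le> \<bar>c\<bar> * L2_norm \<Omega> (\<lambda>x. \<phi> n x - v x) + \<bar>d\<bar> * L2_norm \<Omega> (\<lambda>x. \<psi> n x - w x)" for n
      by (intro L2_norm_lin_le L2_space_diff test_L2 \<phi>(1) \<psi>(1) H10_L2[OF v] H10_L2[OF w])
    then show "\<forall>\<^sub>F n in sequentially. norm (L2_norm \<Omega> (\<lambda>x. ?\<chi> n x - (c * v x + d * w x)))
        \<le> \<bar>c\<bar> * L2_norm \<Omega> (\<lambda>x. \<phi> n x - v x) + \<bar>d\<bar> * L2_norm \<Omega> (\<lambda>x. \<psi> n x - w x)"
      by (intro always_eventually allI) (simp add: algebra_simps)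
  qed
  have 2: "(\<lambda>n. L2_norm \<Omega> (\<lambda>x. wgrad \<Omega> (?\<chi> n) x - wgrad \<Omega> (\<lambda>x. c * v x + d * w x) x)) \<longlonglongrightarrow> 0"
  proof (rule Lim_null_comparison)
    let ?G = "\<lambda>n x. wgrad \<Omega> (\<phi> n) x - wgrad \<Omega> v x" and ?H = "\<lambda>n x. wgrad \<Omega> (\<psi> n) x - wgrad \<Omega> w x"
    show "(\<lambda>n. \<bar>c\<bar> * L2_norm \<Omega> (?G n) + \<bar>d\<bar> * L2_norm \<Omega> (?H n)) \<longlonglongrightarrow> 0"
      using tendsto_add[OF tendsto_mult_right_zero[OF \<phi>(3)] tendsto_mult_right_zero[OF \<psi>(3)]] by simp
    have "L2_norm \<Omega> (\<lambda>x. wgrad \<Omega> (?\<chi> n) x - wgrad \<Omega> (\<lambda>x. c * v x + d * w x) x)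
        \<le> \<bar>c\<bar> * L2_norm \<Omega> (?G n) + \<bar>d\<bar> * L2_norm \<Omega> (?H n)" for n
    proof -
      have L2: "?G n \<in> L2_space \<Omega>" "?H n \<in> L2_space \<Omega>"
        by (auto intro!: L2_space_diff wgrad_L2 test_H1[OF \<phi>(1)] test_H1[OF \<psi>(1)] H10_H1[OF v] H10_H1[OF w])
      have "AE x in lebesgue_on \<Omega>. wgrad \<Omega> (?\<chi> n) x - wgrad \<Omega> (\<lambda>x. c * v x + d * w x) x
          = c *\<^sub>R ?G n x + d *\<^sub>R ?H n x"
        using wgrad_lin[OF test_H1[OF \<phi>(1)[of n]] test_H1[OF \<psi>(1)[of n]], of c d]
          wgrad_lin[OF H10_H1[OF v] H10_H1[OF w], of c d]
        by eventually_elim (simp add: algebra_simps)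
      then have "L2_norm \<Omega> (\<lambda>x. wgrad \<Omega> (?\<chi> n) x - wgrad \<Omega> (\<lambda>x. c * v x + d * w x) x)
          = L2_norm \<Omega> (\<lambda>x. c *\<^sub>R ?G n x + d *\<^sub>R ?H n x)"
        using L2 V \<chi> by (intro L2_norm_cong_AE) (auto intro!: L2_space_diff wgrad_L2 test_H1)
      then show ?thesis using L2_norm_lin_le[OF L2] by simp
    qed
    then show "\<forall>\<^sub>F n in sequentially. norm (L2_norm \<Omega> (\<lambda>x. wgrad \<Omega> (?\<chi> n) x - wgrad \<Omega> (\<lambda>x. c * v x + d * w x) x))
        \<le> \<bar>c\<bar> * L2_norm \<Omega> (?G n) + \<bar>d\<bar> * L2_norm \<Omega> (?H n)"
      by (intro always_eventually allI) simp
  qed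
  show ?thesis unfolding H10_space_iff using V \<chi> 1 2 by (intro conjI exI[of _ ?\<chi>]) auto
qed

lemma H10_space_diff: "v \<in> H10_space \<Omega> \<Longrightarrow> w \<in> H10_space \<Omega> \<Longrightarrow> (\<lambda>x. v x - w x) \<in> H10_space \<Omega>"
  using H10_space_lin[of v w 1 "-1"] by simp

lemma H10_space_cmult: "v \<in> H10_space \<Omega> \<Longrightarrow> (\<lambda>x. c * v x) \<in> H10_space \<Omega>"
  using H10_space_lin[of v v c 0] by simp

lemma H10_space_0: "(\<lambda>x. 0) \<in> H10_space \<Omega>"
  by (rule test_H10[OF test_function_zero])

section \<open>The weak Laplacian\<close>

lemma H2_H1: "v \<in> H2_space \<Omega> \<Longrightarrow> v \<in> H1_space \<Omega>"
  by (simp add: H2_space_def)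

lemma wlaplacian_L2: "v \<in> H2_space \<Omega> \<Longrightarrow> wlaplacian \<Omega> v \<in> L2_space \<Omega>"
  unfolding wlaplacian_def[abs_def] by (intro L2_space_sum wderiv_L2) (auto simp: H2_space_def)

lemma L2_inner_wlaplacian_test:
  assumes v: "v \<in> H2_space \<Omega>" and \<phi>: "test_function \<Omega> \<phi>"
  shows "L2_inner \<Omega> (wlaplacian \<Omega> v) \<phi> = - L2_inner \<Omega> (wgrad \<Omega> v) (wgrad \<Omega> \<phi>)"
proof -
  have D: "wderiv \<Omega> b v \<in> H1_space \<Omega>" if "b \<in> Basis" for b using v that by (auto simp: H2_space_def)
  have "L2_inner \<Omega> (wlaplacian \<Omega> v) \<phi> = (\<Sum>b\<in>Basis. L2_inner \<Omega> (wderiv \<Omega> b (wderiv \<Omega> b v)) \<phi>)"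
    unfolding L2_inner_def wlaplacian_def inner_sum_left
    using D by (intro Bochner_Integration.integral_sum integrable_L2_inner wderiv_L2 test_L2 \<phi>)
  also have "\<dots> = (\<Sum>b\<in>Basis. - L2_inner \<Omega> (wderiv \<Omega> b v) (wderiv \<Omega> b \<phi>))"
  proof (rule sum.cong)
    fix b :: 'a assume b: "b \<in> Basis"
    have "L2_inner \<Omega> (wderiv \<Omega> b v) (\<lambda>x. frechet_derivative \<phi> (at x) b)
        = L2_inner \<Omega> (wderiv \<Omega> b v) (wderiv \<Omega> b \<phi>)"
      using wderiv_AE[OF has_wderiv_test[OF \<phi> b] b] b D \<phi>
      by (intro L2_inner_cong_AE) (auto intro: H1_L2 test_deriv_L2 wderiv_L2 test_H1)
    then show "L2_inner \<Omega> (wderiv \<Omega> b (wderiv \<Omega> b v)) \<phi> = - L2_inner \<Omega> (wderiv \<Omega> b v) (wderiv \<Omega> b \<phi>)"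
      using has_wderivD(3)[OF has_wderiv_wderiv[OF D[OF b] b] \<phi>] by simp
  qed simp
  also have "\<dots> = - L2_inner \<Omega> (wgrad \<Omega> v) (wgrad \<Omega> \<phi>)"
    by (simp add: sum_negf L2_inner_wgrad[OF H2_H1[OF v] test_H1[OF \<phi>]])
  finally show ?thesis .
qed

text \<open>Green's formula. Both sides are continuous in w for the H^1 norm, and w is an H^1 limit
  of test functions, for which the formula is the definition of weak derivatives; hence no boundary
  term.\<close>

lemma L2_inner_wlaplacian:
  assumes v: "v \<in> H2_space \<Omega>" and w: "w \<in> H10_space \<Omega>"
  shows "L2_inner \<Omega> (wlaplacian \<Omega> v) w = - L2_inner \<Omega> (wgrad \<Omega> v) (wgrad \<Omega> w)"
proof -
  obtain \<phi> where \<phi>: "\<And>n. test_function \<Omega> (\<phi> n)" "(\<lambda>n. L2_norm \<Omega> (\<lambda>x. \<phi> n x - w x)) \<longlonglongrightarrow> 0"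
    "(\<lambda>n. L2_norm \<Omega> (\<lambda>x. wgrad \<Omega> (\<phi> n) x - wgrad \<Omega> w x)) \<longlonglongrightarrow> 0" by (rule H10_approx[OF w]) blast
  have "(\<lambda>n. L2_inner \<Omega> (\<phi> n) (wlaplacian \<Omega> v)) \<longlonglongrightarrow> L2_inner \<Omega> w (wlaplacian \<Omega> v)"
    using v w \<phi>(1) by (intro L2_inner_tendsto[OF \<phi>(2)]) (auto intro: test_L2 H10_L2 wlaplacian_L2 always_eventually)
  moreover have "(\<lambda>n. - L2_inner \<Omega> (wgrad \<Omega> (\<phi> n)) (wgrad \<Omega> v)) \<longlonglongrightarrow> - L2_inner \<Omega> (wgrad \<Omega> w) (wgrad \<Omega> v)"
    using v w \<phi>(1)
    by (intro tendsto_minus L2_inner_tendsto[OF \<phi>(3)]) (auto intro: wgrad_L2 test_H1 H10_H1 H2_H1 always_eventually)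
  moreover have "L2_inner \<Omega> (\<phi> n) (wlaplacian \<Omega> v) = - L2_inner \<Omega> (wgrad \<Omega> (\<phi> n)) (wgrad \<Omega> v)" for n
    using L2_inner_wlaplacian_test[OF v \<phi>(1)[of n]] by (simp add: L2_inner_commute)
  ultimately have "L2_inner \<Omega> w (wlaplacian \<Omega> v) = - L2_inner \<Omega> (wgrad \<Omega> w) (wgrad \<Omega> v)"
    using LIMSEQ_unique by auto
  then show ?thesis by (simp add: L2_inner_commute)
qed

end

section \<open>Rellich compactness\<close>

lemma test_function_continuous: "test_function S \<phi> \<Longrightarrow> continuous_on T \<phi>"
  using C_k_continuous[OF test_functionD[of S \<phi> 0]] .

lemma translate_L2:
  assumes "test_function T \<phi>" "S \<in> sets lebesgue"
  shows "(\<lambda>x. \<phi> (x + z)) \<in> L2_space S"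
proof -
  obtain K where K: "compact K" "\<And>x. x \<notin> K \<Longrightarrow> \<phi> x = 0" by (rule test_function_support[OF assms(1)]) blast
  show ?thesis
  proof (rule compact_support_L2[OF _ _ _ assms(2)])
    have "continuous_on UNIV (\<phi> \<circ> (\<lambda>x. x + z))"
      by (intro continuous_on_compose continuous_intros test_function_continuous[OF assms(1)])
    then show "continuous_on UNIV (\<lambda>x. \<phi> (x + z))" by (simp add: o_def)
    show "compact ((\<lambda>x. (-z) + x) ` K)" by (rule compact_translation[OF K(1)])
    show "\<phi> (x + z) = 0" if "x \<notin> (\<lambda>x. (-z) + x) ` K" for x
    proof (rule K(2), rule notI)
      assume "x + z \<in> K"
      then have "(-z) + (x + z) \<in> (\<lambda>x. (-z) + x) ` K" by (rule imageI)
      then show False using that by simp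
    qed
  qed
qed

lemma L2_norm_translate:
  fixes f :: "'a::euclidean_space \<Rightarrow> real"
  assumes "continuous_on UNIV f"
  shows "L2_norm UNIV (\<lambda>x. f (x + z)) = L2_norm UNIV f"
proof -
  have [measurable]: "f \<in> borel_measurable borel" using assms by (rule borel_measurable_continuous_onI)
  show ?thesis
    unfolding L2_norm_def lebesgue_on_UNIV_eq
    by (subst integral_lebesgue_translation[of "\<lambda>x. (norm (f x))\<^sup>2"]) auto
qed

text \<open>The classical gradient, available on the whole space, where translations preserve the
  L^2 norm; \<open>wgrad\<close> is meaningful on \<Omega> only, up to null sets.\<close>

definition grad :: "('a::euclidean_space \<Rightarrow> real) \<Rightarrow> 'a \<Rightarrow> 'a" where
  "grad \<phi> x = (\<Sum>b\<in>Basis. frechet_derivative \<phi> (at x) b *\<^sub>R b)"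

lemma grad_L2:
  assumes "test_function T \<phi>" "S \<in> sets lebesgue"
  shows "grad \<phi> \<in> L2_space S"
proof -
  have "(\<lambda>x. frechet_derivative \<phi> (at x) b *\<^sub>R b) \<in> L2_space S" if "b \<in> Basis" for b
    using test_function_L2[OF test_function_frechet_derivative[OF assms(1) that] assms(2)]
    by (auto simp: L2_space_def power_mult_distrib that)
  then show ?thesis unfolding grad_def[abs_def] by (intro L2_space_sum)
qed

lemma frechet_derivative_le_grad:
  assumes "test_function T \<phi>"
  shows "\<bar>frechet_derivative \<phi> (at x) z\<bar> \<le> norm z * norm (grad \<phi> x)"
proof -
  have "frechet_derivative \<phi> (at x) z = z \<bullet> grad \<phi> x"
    unfolding grad_def inner_sum_right
    by (subst frechet_derivative_Basis_sum[OF C_k_differentiable[OF test_functionD[OF assms]]])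
      (simp add: mult.commute)
  then show ?thesis by (simp add: Cauchy_Schwarz_ineq2)
qed

lemma L2_norm_mono:
  assumes "w \<in> L2_space S" "v \<in> borel_measurable (lebesgue_on S)" "\<And>x. norm (v x) \<le> norm (w x)"
  shows "v \<in> L2_space S" "L2_norm S v \<le> L2_norm S w"
proof -
  have sq: "(norm (v x))\<^sup>2 \<le> (norm (w x))\<^sup>2" for x using assms(3) by (intro power_mono) auto
  show v: "v \<in> L2_space S"
    using sq by (intro L2_space_bounded[OF assms(2) L2_spaceD(2)[OF assms(1)]]) auto
  show "L2_norm S v \<le> L2_norm S w"
    unfolding L2_norm_def using sq
    by (intro real_sqrt_le_mono integral_mono L2_spaceD(2) v assms(1))
qed

lemma L2_norm_frechet_le:
  assumes "test_function T \<phi>"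
  shows "L2_norm UNIV (\<lambda>x. frechet_derivative \<phi> (at x) z) \<le> norm z * L2_norm UNIV (grad \<phi>)"
proof -
  have "L2_norm UNIV (\<lambda>x. frechet_derivative \<phi> (at x) z) \<le> L2_norm UNIV (\<lambda>x. norm z *\<^sub>R grad \<phi> x)"
    using frechet_derivative_le_grad[OF assms]
    by (intro L2_norm_mono(2) L2_space_scaleR grad_L2[OF assms] borel_measurable_lebesgue_on_continuous
        continuous_on_frechet_derivative test_functionD[OF assms]) auto
  then show ?thesis by (simp add: L2_norm_scaleR)
qed

text \<open>
  The increment along \<open>z\<close> is a telescoping sum of \<open>n\<close> increments along \<open>z / n\<close>, which all have the
  same norm; this bounds its norm by that of the difference quotient of step \<open>1 / n\<close>.
\<close>

lemma L2_norm_translation_diff: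
  assumes \<phi>: "test_function T \<phi>"
  shows "L2_norm UNIV (\<lambda>x. \<phi> (x + z) - \<phi> x) \<le> norm z * L2_norm UNIV (grad \<phi>)"
proof -
  let ?h = "\<lambda>n. inverse (real (Suc n))"
  have h: "0 < ?h n" "?h n \<le> 1" for n by (auto simp: field_simps)
  have L2: "(\<lambda>x. \<phi> (x + z)) \<in> L2_space UNIV" for z by (rule translate_L2[OF \<phi>]) simp
  have L2': "\<phi> \<in> L2_space UNIV" by (rule test_function_L2[OF \<phi>]) simp
  have C: "C_k (Suc 0) \<phi>" by (rule test_functionD[OF \<phi>])
  have cont: "continuous_on UNIV (\<lambda>x. \<phi> (x + y) - \<phi> x)" for y
  proof -
    have "continuous_on UNIV (\<phi> \<circ> (\<lambda>x. x + y))"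
      by (intro continuous_on_compose continuous_intros test_function_continuous[OF \<phi>])
    then show ?thesis by (intro continuous_on_diff test_function_continuous[OF \<phi>]) (simp add: o_def)
  qed
  have tel: "L2_norm UNIV (\<lambda>x. \<phi> (x + real k *\<^sub>R y) - \<phi> x) \<le> real k * L2_norm UNIV (\<lambda>x. \<phi> (x + y) - \<phi> x)" for k y
  proof (induction k)
    case 0
    then show ?case by (simp add: L2_norm_def)
  next
    case (Suc k)
    have "L2_norm UNIV (\<lambda>x. \<phi> (x + real (Suc k) *\<^sub>R y) - \<phi> x)
      \<le> L2_norm UNIV (\<lambda>x. \<phi> (x + real (Suc k) *\<^sub>R y) - \<phi> (x + real k *\<^sub>R y)) + L2_norm UNIV (\<lambda>x. \<phi> (x + real k *\<^sub>R y) - \<phi> x)"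
      by (rule L2_norm_diff_triangle[OF L2 L2 L2'])
    moreover have "L2_norm UNIV (\<lambda>x. \<phi> (x + real (Suc k) *\<^sub>R y) - \<phi> (x + real k *\<^sub>R y)) = L2_norm UNIV (\<lambda>x. \<phi> (x + y) - \<phi> x)"
      using L2_norm_translate[OF cont[of y], of "real k *\<^sub>R y"] by (simp add: algebra_simps)
    ultimately show ?case using Suc.IH by (simp add: algebra_simps)
  qed
  let ?\<delta> = "\<lambda>n x. (\<phi> (x + ?h n *\<^sub>R z) - \<phi> x) / ?h n"
  have le: "L2_norm UNIV (\<lambda>x. \<phi> (x + z) - \<phi> x) \<le> L2_norm UNIV (?\<delta> n)" for n
  proof -
    have "real (Suc n) *\<^sub>R (?h n *\<^sub>R z) = z" by simp
    then have "L2_norm UNIV (\<lambda>x. \<phi> (x + z) - \<phi> x) \<le> real (Suc n) * L2_norm UNIV (\<lambda>x. \<phi> (x + ?h n *\<^sub>R z) - \<phi> x)"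
      using tel[of "Suc n" "?h n *\<^sub>R z"] by metis
    also have "\<dots> = L2_norm UNIV (\<lambda>x. real (Suc n) *\<^sub>R (\<phi> (x + ?h n *\<^sub>R z) - \<phi> x))"
      unfolding L2_norm_scaleR by simp
    also have "(\<lambda>x. real (Suc n) *\<^sub>R (\<phi> (x + ?h n *\<^sub>R z) - \<phi> x)) = ?\<delta> n"
      by (auto simp: fun_eq_iff field_simps)
    finally show ?thesis .
  qed
  obtain K where K: "compact K" "\<And>x. x \<notin> K \<Longrightarrow> \<phi> x = 0" by (rule test_function_support[OF \<phi>]) blast
  obtain M a where Ma: "M \<ge> 0" "\<And>x h. 0 < h \<Longrightarrow> h \<le> 1 \<Longrightarrow> \<bar>(\<phi> (x + h *\<^sub>R z) - \<phi> x) / h\<bar> \<le> M * indicator (cbox (-a) a) x"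
    using difference_quotient_bound[OF C K] by metis
  \<comment> \<open>Dominated convergence replaces the difference quotients by the directional
    derivative.\<close>
  have "(\<lambda>n. LINT x|lebesgue. (norm (?\<delta> n x))\<^sup>2) \<longlonglongrightarrow> (LINT x|lebesgue. (norm (frechet_derivative \<phi> (at x) z))\<^sup>2)"
  proof (rule integral_dominated_convergence[where w = "\<lambda>x. M\<^sup>2 * indicator (cbox (-a) a) x"])
    show "(\<lambda>x. (norm (frechet_derivative \<phi> (at x) z))\<^sup>2) \<in> borel_measurable lebesgue"
      using borel_measurable_lebesgue_on_continuous[OF continuous_on_frechet_derivative[OF C, of z], where S = UNIV]
      unfolding lebesgue_on_UNIV_eq by measurable
    show "(\<lambda>x. (norm (?\<delta> n x))\<^sup>2) \<in> borel_measurable lebesgue" for n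
      using borel_measurable_lebesgue_on_continuous[OF cont[of "?h n *\<^sub>R z"], where S = UNIV]
      unfolding lebesgue_on_UNIV_eq by measurable
    show "integrable lebesgue (\<lambda>x. M\<^sup>2 * indicat_real (cbox (-a) a) x)"
      by (intro integrable_mult_right integrable_real_indicator)
        (use emeasure_lborel_cbox_finite[of "-a" a] in auto)
    show "AE x in lebesgue. norm ((norm (?\<delta> n x))\<^sup>2) \<le> M\<^sup>2 * indicator (cbox (-a) a) x" for n
    proof (rule AE_I2)
      fix x
      have "(norm (?\<delta> n x))\<^sup>2 \<le> (M * indicator (cbox (-a) a) x)\<^sup>2"
        using Ma(2)[OF h] unfolding real_norm_def by (intro power_mono) auto
      also have "(M * indicator (cbox (-a) a) x)\<^sup>2 = M\<^sup>2 * indicator (cbox (-a) a) x"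
        by (cases "x \<in> cbox (-a) a") auto
      finally show "norm ((norm (?\<delta> n x))\<^sup>2) \<le> M\<^sup>2 * indicator (cbox (-a) a) x"
        unfolding real_norm_def power_abs abs_idempotent .
    qed
    show "AE x in lebesgue. (\<lambda>n. (norm (?\<delta> n x))\<^sup>2) \<longlonglongrightarrow> (norm (frechet_derivative \<phi> (at x) z))\<^sup>2"
      by (intro AE_I2 tendsto_intros difference_quotient_tendsto[OF C])
  qed
  then have "(\<lambda>n. L2_norm UNIV (?\<delta> n)) \<longlonglongrightarrow> L2_norm UNIV (\<lambda>x. frechet_derivative \<phi> (at x) z)"
    unfolding L2_norm_def lebesgue_on_UNIV_eq by (rule tendsto_real_sqrt)
  then have "L2_norm UNIV (\<lambda>x. \<phi> (x + z) - \<phi> x) \<le> L2_norm UNIV (\<lambda>x. frechet_derivative \<phi> (at x) z)"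
    by (rule LIMSEQ_le_const) (use le in blast)
  also have "\<dots> \<le> norm z * L2_norm UNIV (grad \<phi>)" by (rule L2_norm_frechet_le[OF \<phi>])
  finally show ?thesis .
qed

section \<open>Averages over balls\<close>

text \<open>Mollification by a normalised indicator. Integrating over the ball about 0 keeps the
  domain fixed when x varies, so averages at two points are compared by subtracting
  integrands.\<close>

definition ball_avg :: "real \<Rightarrow> ('a::euclidean_space \<Rightarrow> real) \<Rightarrow> 'a \<Rightarrow> real" where
  "ball_avg r \<phi> x = (LINT y|lebesgue_on (ball 0 r). \<phi> (x + y)) / measure lebesgue (ball 0 r :: 'a set)"

lemma measure_ball_pos: "r > 0 \<Longrightarrow> 0 < measure lebesgue (ball (0::'a::euclidean_space) r)"
  by (simp add: content_ball_pos)

lemma one_L2_ball: "(\<lambda>x. c :: real) \<in> L2_space (ball 0 r)"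
proof -
  interpret finite_measure "lebesgue_on (ball (0::'a) r)"
    by (rule finite_measure_lebesgue_on) auto
  show ?thesis by (auto simp: L2_space_def)
qed

lemma ball_avg_inner:
  fixes \<phi> :: "'a::euclidean_space \<Rightarrow> real"
  shows "ball_avg r \<phi> x = L2_inner (ball 0 r) (\<lambda>y. 1) (\<lambda>y. \<phi> (x + y)) / measure lebesgue (ball (0::'a) r)"
  by (simp add: ball_avg_def L2_inner_def)

lemma L2_norm_one_ball: "L2_norm (ball (0::'a) r) (\<lambda>y. 1::real) = sqrt (measure lebesgue (ball (0::'a::euclidean_space) r))"
  by (simp add: L2_norm_def measure_restrict_space)

lemma L2_norm_subset:
  fixes v :: "'a::euclidean_space \<Rightarrow> real"
  assumes "v \<in> L2_space UNIV" "S \<in> sets lebesgue"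
  shows "v \<in> L2_space S" "L2_norm S v \<le> L2_norm UNIV v"
proof -
  have v: "v \<in> borel_measurable lebesgue" "integrable lebesgue (\<lambda>x. (norm (v x))\<^sup>2)"
    using L2_spaceD[OF assms(1)] by (auto simp: lebesgue_on_UNIV_eq)
  have int: "integrable lebesgue (\<lambda>x. indicator S x *\<^sub>R (norm (v x))\<^sup>2)"
    using integrable_mult_indicator[OF assms(2) v(2)] .
  then show "v \<in> L2_space S"
    using v assms(2) by (auto simp: L2_space_def integrable_restrict_space intro: measurable_restrict_space1)
  show "L2_norm S v \<le> L2_norm UNIV v"
    unfolding L2_norm_def lebesgue_on_UNIV_eq
  proof (rule real_sqrt_le_mono)
    show "(LINT x|lebesgue_on S. (norm (v x))\<^sup>2) \<le> (LINT x|lebesgue. (norm (v x))\<^sup>2)"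
      using int v assms(2) by (subst integral_restrict_space) (auto intro!: integral_mono simp: indicator_def)
  qed
qed

lemma ball_avg_bound:
  fixes f :: "'a::euclidean_space \<Rightarrow> real"
  assumes r: "r > 0" and f: "(\<lambda>y. f (x + y)) \<in> L2_space (ball 0 r)"
  shows "\<bar>ball_avg r f x\<bar> \<le> L2_norm (ball 0 r) (\<lambda>y. f (x + y)) / sqrt (measure lebesgue (ball (0::'a) r))"
proof -
  let ?m = "measure lebesgue (ball (0::'a) r)"
  have m: "?m > 0" by (rule measure_ball_pos[OF r])
  have "\<bar>ball_avg r f x\<bar> \<le> (sqrt ?m * L2_norm (ball 0 r) (\<lambda>y. f (x + y))) / ?m"
    unfolding ball_avg_inner using L2_Cauchy_Schwarz[OF one_L2_ball f, of 1] m
    by (simp add: L2_norm_one_ball divide_right_mono)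
  also have "\<dots> = L2_norm (ball 0 r) (\<lambda>y. f (x + y)) / sqrt ?m"
    using m by (simp add: field_simps flip: power2_eq_square)
  finally show ?thesis .
qed

text \<open>The difference of two averages is the average of \<phi> minus a translate. The
  translation estimate thus gives a Lipschitz constant depending only on r and the norm of the
  gradient: the equicontinuity behind Rellich's theorem.\<close>

lemma ball_avg_diff_bound:
  fixes \<phi> :: "'a::euclidean_space \<Rightarrow> real"
  assumes r: "r > 0" and \<phi>: "test_function T \<phi>"
  shows "\<bar>ball_avg r \<phi> x - ball_avg r \<phi> y\<bar>
    \<le> norm (x - y) * (L2_norm UNIV (grad \<phi>) / sqrt (measure lebesgue (ball (0::'a) r)))"
proof -
  let ?m = "measure lebesgue (ball (0::'a) r)"
  have m: "?m > 0" by (rule measure_ball_pos[OF r])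
  have L2: "(\<lambda>y. \<phi> (x + y)) \<in> L2_space S" if "S \<in> sets lebesgue" for x S
    using translate_L2[OF \<phi> that, of x] by (simp add: add.commute)
  have L2i: "integrable (lebesgue_on (ball 0 r)) (\<lambda>y. \<phi> (x + y))" for x
    using integrable_L2_inner[OF one_L2_ball[of 1 r] L2[of "ball 0 r" x]] by simp
  let ?f = "\<lambda>w. \<phi> w - \<phi> (w + (y - x))"
  have "ball_avg r \<phi> x - ball_avg r \<phi> y = ball_avg r ?f x"
    unfolding ball_avg_def
    by (subst Bochner_Integration.integral_diff)
      (use L2i[of x] L2i[of y] in \<open>auto simp: diff_divide_distrib algebra_simps\<close>)
  moreover have f: "(\<lambda>w. ?f (x + w)) \<in> L2_space S" if "S \<in> sets lebesgue" for S
    using L2_space_diff[OF L2[OF that, of x] L2[OF that, of y]] by (simp add: algebra_simps)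
  ultimately have le: "\<bar>ball_avg r \<phi> x - ball_avg r \<phi> y\<bar> \<le> L2_norm (ball 0 r) (\<lambda>w. ?f (x + w)) / sqrt ?m"
    using ball_avg_bound[OF r, of ?f x] by auto
  have "L2_norm (ball 0 r) (\<lambda>w. ?f (x + w)) \<le> L2_norm UNIV (\<lambda>w. ?f (x + w))"
    by (rule L2_norm_subset(2)[OF f]) auto
  also have "L2_norm UNIV (\<lambda>w. ?f (x + w)) = L2_norm UNIV (\<lambda>w. ?f (w + x))"
    by (simp only: add.commute[of x])
  also have "\<dots> = L2_norm UNIV ?f"
  proof (rule L2_norm_translate)
    have "continuous_on UNIV (\<phi> \<circ> (\<lambda>w. w + (y - x)))"
      by (intro continuous_on_compose continuous_intros test_function_continuous[OF \<phi>])
    then show "continuous_on UNIV ?f"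
      by (intro continuous_on_diff test_function_continuous[OF \<phi>]) (simp add: o_def)
  qed
  also have "\<dots> = L2_norm UNIV (\<lambda>w. \<phi> (w + (y - x)) - \<phi> w)" by (rule L2_norm_minus_commute)
  also have "\<dots> \<le> norm (y - x) * L2_norm UNIV (grad \<phi>)" by (rule L2_norm_translation_diff[OF \<phi>])
  finally have "L2_norm (ball 0 r) (\<lambda>w. ?f (x + w)) / sqrt ?m \<le> norm (y - x) * L2_norm UNIV (grad \<phi>) / sqrt ?m"
    using m by (intro divide_right_mono) auto
  with le show ?thesis by (simp add: norm_minus_commute)
qed

lemma ball_avg_continuous:
  assumes "r > 0" "test_function T \<phi>"
  shows "continuous_on UNIV (ball_avg r \<phi>)"
proof -
  define L where "L = L2_norm UNIV (grad \<phi>) / sqrt (measure lebesgue (ball (0::'a) r))"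
  have "L \<ge> 0" by (simp add: L_def)
  have "L-lipschitz_on UNIV (ball_avg r \<phi>)"
    using ball_avg_diff_bound[OF assms] \<open>L \<ge> 0\<close>
    by (intro lipschitz_onI) (auto simp: dist_norm L_def mult.commute)
  then show ?thesis by (rule lipschitz_on_continuous_on)
qed

text \<open>By Cauchy-Schwarz the squared error at x is at most the mean of the squared increments
  over the ball. After Tonelli the integral over x is the translation estimate with |y| < r.\<close>

lemma ball_avg_L2_error:
  fixes \<phi> :: "'a::euclidean_space \<Rightarrow> real"
  assumes r: "r > 0" and \<phi>: "test_function T \<phi>"
  shows "(\<lambda>x. ball_avg r \<phi> x - \<phi> x) \<in> L2_space UNIV"
    "L2_norm UNIV (\<lambda>x. ball_avg r \<phi> x - \<phi> x) \<le> r * L2_norm UNIV (grad \<phi>)"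
proof -
  let ?B = "ball (0::'a) r"
  let ?m = "measure lebesgue ?B"
  let ?G = "L2_norm UNIV (grad \<phi>)"
  have m: "?m > 0" by (rule measure_ball_pos[OF r])
  have [measurable]: "\<phi> \<in> borel_measurable borel"
    by (rule borel_measurable_continuous_onI[OF test_function_continuous[OF \<phi>]])
  have L2: "(\<lambda>y. \<phi> (x + y)) \<in> L2_space S" if "S \<in> sets lebesgue" for x S
    using translate_L2[OF \<phi> that, of x] by (simp add: add.commute)
  have L2i: "integrable (lebesgue_on ?B) (\<lambda>y. \<phi> (x + y))" for x
    using integrable_L2_inner[OF one_L2_ball[of 1 r] L2[of "ball 0 r" x]] by simp
  let ?f = "\<lambda>x y. \<phi> (x + y) - \<phi> x"
  have fL2: "?f x \<in> L2_space ?B" for x by (intro L2_space_diff L2 one_L2_ball) auto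
  interpret finite_measure "lebesgue_on ?B" by (rule finite_measure_lebesgue_on) auto
  have pt: "ennreal ((norm (ball_avg r \<phi> x - \<phi> x))\<^sup>2)
      \<le> ennreal (1 / ?m) * (\<integral>\<^sup>+y. ennreal (indicator ?B y * (?f x y)\<^sup>2) \<partial>lborel)" for x
  proof -
    have "ball_avg r \<phi> x - \<phi> x = ball_avg r (\<lambda>w. \<phi> w - \<phi> x) x"
      unfolding ball_avg_def
      by (subst Bochner_Integration.integral_diff)
        (use L2i[of x] m in \<open>auto simp: diff_divide_distrib measure_restrict_space\<close>)
    then have "\<bar>ball_avg r \<phi> x - \<phi> x\<bar> \<le> L2_norm ?B (?f x) / sqrt ?m"
      using ball_avg_bound[OF r, of "\<lambda>w. \<phi> w - \<phi> x" x] fL2[of x] by simp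
    then have "(norm (ball_avg r \<phi> x - \<phi> x))\<^sup>2 \<le> (L2_norm ?B (?f x) / sqrt ?m)\<^sup>2"
      by (intro power_mono) auto
    also have "\<dots> = 1 / ?m * (L2_norm ?B (?f x))\<^sup>2"
      using m by (simp add: power_divide)
    finally have "ennreal ((norm (ball_avg r \<phi> x - \<phi> x))\<^sup>2) \<le> ennreal (1 / ?m) * ennreal ((L2_norm ?B (?f x))\<^sup>2)"
      using m by (simp add: ennreal_leI flip: ennreal_mult)
    also have "ennreal ((L2_norm ?B (?f x))\<^sup>2) = (\<integral>\<^sup>+y. ennreal ((norm (?f x y))\<^sup>2) \<partial>lebesgue_on ?B)"
      unfolding L2_norm_def
      by (subst nn_integral_eq_integral[OF L2_spaceD(2)[OF fL2]]) auto
    also have "\<dots> = (\<integral>\<^sup>+y. ennreal (indicator ?B y * (?f x y)\<^sup>2) \<partial>lborel)"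
      by (subst nn_integral_restrict_space)
        (auto simp: nn_integral_completion indicator_def intro!: nn_integral_cong)
    finally show ?thesis .
  qed
  \<comment> \<open>Joint measurability follows from continuity in the Borel sense; hence the
    passage from \<open>lebesgue\<close> to \<open>lborel\<close>.\<close>
  have F: "(\<lambda>p. ennreal (indicator ?B (snd p) * (?f (fst p) (snd p))\<^sup>2)) \<in> borel_measurable (lborel \<Otimes>\<^sub>M lborel)"
  proof -
    have "continuous_on UNIV (\<phi> \<circ> (\<lambda>p::'a \<times> 'a. fst p + snd p))" "continuous_on UNIV (\<phi> \<circ> (fst :: 'a \<times> 'a \<Rightarrow> 'a))"
      by (intro continuous_on_compose continuous_intros test_function_continuous[OF \<phi>])+
    then have "(\<lambda>p. ?f (fst p) (snd p)) \<in> borel_measurable (borel \<Otimes>\<^sub>M borel)"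
      unfolding borel_prod by (intro borel_measurable_continuous_onI continuous_on_diff) (simp_all add: o_def)
    moreover have "(\<lambda>p::'a \<times> 'a. indicator ?B (snd p) :: real) \<in> borel_measurable (borel \<Otimes>\<^sub>M borel)"
      by (rule measurable_compose[OF measurable_snd borel_measurable_indicator]) simp
    ultimately have "(\<lambda>p. indicator ?B (snd p) * (?f (fst p) (snd p))\<^sup>2) \<in> borel_measurable (borel \<Otimes>\<^sub>M borel)"
      by (intro borel_measurable_times borel_measurable_power)
    moreover have "sets (lborel \<Otimes>\<^sub>M lborel) = sets (borel \<Otimes>\<^sub>M borel :: ('a \<times> 'a) measure)"
      by (intro sets_pair_measure_cong sets_lborel)
    ultimately show ?thesis by (intro measurable_compose[OF _ measurable_ennreal]) (simp cong: measurable_cong_sets)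
  qed
  have "(\<integral>\<^sup>+x. ennreal ((norm (ball_avg r \<phi> x - \<phi> x))\<^sup>2) \<partial>lborel)
      \<le> (\<integral>\<^sup>+x. ennreal (1 / ?m) * (\<integral>\<^sup>+y. ennreal (indicator ?B y * (?f x y)\<^sup>2) \<partial>lborel) \<partial>lborel)"
    by (intro nn_integral_mono pt)
  also have "\<dots> = ennreal (1 / ?m) * (\<integral>\<^sup>+x. (\<integral>\<^sup>+y. ennreal (indicator ?B y * (?f x y)\<^sup>2) \<partial>lborel) \<partial>lborel)"
    using lborel.borel_measurable_nn_integral_fst[OF F] by (intro nn_integral_cmult) simp
  also have "(\<integral>\<^sup>+x. (\<integral>\<^sup>+y. ennreal (indicator ?B y * (?f x y)\<^sup>2) \<partial>lborel) \<partial>lborel)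
      = (\<integral>\<^sup>+y. (\<integral>\<^sup>+x. ennreal (indicator ?B y * (?f x y)\<^sup>2) \<partial>lborel) \<partial>lborel)"
    using F by (intro lborel_pair.Fubini'[symmetric]) (simp add: split_beta')
  also have "\<dots> \<le> (\<integral>\<^sup>+y. ennreal ((r * ?G)\<^sup>2) * indicator ?B y \<partial>lborel)"
  proof (rule nn_integral_mono)
    fix y :: 'a
    show "(\<integral>\<^sup>+x. ennreal (indicator ?B y * (?f x y)\<^sup>2) \<partial>lborel) \<le> ennreal ((r * ?G)\<^sup>2) * indicator ?B y"
    proof (cases "y \<in> ?B")
      case True
      let ?g = "\<lambda>x. \<phi> (x + y) - \<phi> x"
      have gL2: "?g \<in> L2_space UNIV"
        by (intro L2_space_diff translate_L2[OF \<phi>] test_function_L2[OF \<phi>]) auto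
      have "(\<integral>\<^sup>+x. ennreal (indicator ?B y * (?f x y)\<^sup>2) \<partial>lborel) = (\<integral>\<^sup>+x. ennreal ((norm (?g x))\<^sup>2) \<partial>lebesgue)"
        using True by (simp add: nn_integral_completion)
      also have "\<dots> = ennreal ((L2_norm UNIV ?g)\<^sup>2)"
        using nn_integral_eq_integral[OF L2_spaceD(2)[OF gL2]]
        by (simp add: L2_norm_def lebesgue_on_UNIV_eq)
      also have "\<dots> \<le> ennreal ((r * ?G)\<^sup>2)"
      proof (intro ennreal_leI power_mono)
        have "L2_norm UNIV ?g \<le> norm y * ?G" by (rule L2_norm_translation_diff[OF \<phi>])
        also have "\<dots> \<le> r * ?G" using True by (intro mult_right_mono) auto
        finally show "L2_norm UNIV ?g \<le> r * ?G" .
      qed simp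
      finally show ?thesis using True by simp
    qed simp
  qed
  also have "\<dots> = ennreal ((r * ?G)\<^sup>2) * emeasure lborel ?B"
    by (subst nn_integral_cmult_indicator) auto
  also have "emeasure lborel ?B = ennreal ?m"
    using emeasure_eq_ennreal_measure[of lborel ?B] emeasure_lborel_ball_finite[of "0::'a" r] by auto
  finally have "(\<integral>\<^sup>+x. ennreal ((norm (ball_avg r \<phi> x - \<phi> x))\<^sup>2) \<partial>lborel)
      \<le> ennreal (1 / ?m) * (ennreal ((r * ?G)\<^sup>2) * ennreal ?m)"
    by (simp add: mult_left_mono)
  also have "\<dots> = ennreal ((r * ?G)\<^sup>2)"
    using m by (simp flip: ennreal_mult)
  finally have fin: "(\<integral>\<^sup>+x. ennreal ((norm (ball_avg r \<phi> x - \<phi> x))\<^sup>2) \<partial>lebesgue_on UNIV) \<le> ennreal ((r * ?G)\<^sup>2)"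
    by (simp add: lebesgue_on_UNIV_eq nn_integral_completion)
  have cont: "continuous_on UNIV (\<lambda>x. ball_avg r \<phi> x - \<phi> x)"
    by (intro continuous_on_diff ball_avg_continuous[OF r \<phi>] test_function_continuous[OF \<phi>])
  have meas: "(\<lambda>x. ball_avg r \<phi> x - \<phi> x) \<in> borel_measurable (lebesgue_on UNIV)"
    by (rule borel_measurable_lebesgue_on_continuous[OF cont])
  have i: "integrable (lebesgue_on UNIV) (\<lambda>x. (norm (ball_avg r \<phi> x - \<phi> x))\<^sup>2)"
    using fin meas by (intro integrableI_bounded) (auto simp: less_top[symmetric] top_unique)
  then show "(\<lambda>x. ball_avg r \<phi> x - \<phi> x) \<in> L2_space UNIV"
    using meas by (auto simp: L2_space_def)
  have "ennreal ((L2_norm UNIV (\<lambda>x. ball_avg r \<phi> x - \<phi> x))\<^sup>2) \<le> ennreal ((r * ?G)\<^sup>2)"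
    using fin nn_integral_eq_integral[OF i] by (simp add: L2_norm_def)
  then have "(L2_norm UNIV (\<lambda>x. ball_avg r \<phi> x - \<phi> x))\<^sup>2 \<le> (r * ?G)\<^sup>2" by simp
  then show "L2_norm UNIV (\<lambda>x. ball_avg r \<phi> x - \<phi> x) \<le> r * ?G"
    by (rule power2_le_imp_le) (use r in simp)
qed

section \<open>Compactness of bounded sequences of test functions\<close>

context bounded_open
begin

lemma wgrad_test: "test_function \<Omega> \<phi> \<Longrightarrow> AE x in lebesgue_on \<Omega>. wgrad \<Omega> \<phi> x = grad \<phi> x"
  unfolding grad_def by (rule wgrad_AE[OF has_wderiv_test])

lemma L2_norm_zero_outside:
  assumes "\<And>x. x \<notin> \<Omega> \<Longrightarrow> v x = 0"
  shows "L2_norm UNIV v = L2_norm \<Omega> v"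
  unfolding L2_norm_def lebesgue_on_UNIV_eq
  using assms by (subst integral_lebesgue_on_zero_outside) auto

lemma test_zero_outside: "test_function \<Omega> \<phi> \<Longrightarrow> x \<notin> \<Omega> \<Longrightarrow> \<phi> x = 0"
  by (rule test_function_support) auto

lemma L2_norm_grad_test:
  assumes "test_function \<Omega> \<phi>"
  shows "L2_norm UNIV (grad \<phi>) = L2_norm \<Omega> (wgrad \<Omega> \<phi>)"
proof -
  have "L2_norm UNIV (grad \<phi>) = L2_norm \<Omega> (grad \<phi>)"
  proof (rule L2_norm_zero_outside)
    obtain K where K: "compact K" "K \<subseteq> \<Omega>" "\<And>x. x \<notin> K \<Longrightarrow> \<phi> x = 0" by (rule test_function_support[OF assms]) blast
    show "grad \<phi> x = 0" if "x \<notin> \<Omega>" for x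
    proof -
      have "x \<notin> K" using K(2) that by blast
      then show ?thesis by (simp add: grad_def frechet_derivative_zero_outside[OF K(1,3)])
    qed
  qed
  also have "\<dots> = L2_norm \<Omega> (wgrad \<Omega> \<phi>)"
    using wgrad_test[OF assms] by (intro L2_norm_cong_AE[symmetric] grad_L2[OF assms] wgrad_L2 test_H1[OF assms]) auto
  finally show ?thesis .
qed

text \<open>A diagonal argument over all pairs of a radius and a point of a countable dense set. The
  Lipschitz bounds, uniform in n at a fixed radius, extend convergence to every point.\<close>

lemma ball_avg_Cauchy_subseq:
  assumes \<phi>: "\<And>n. test_function \<Omega> (\<phi> n)" "\<And>n. L2_norm \<Omega> (\<phi> n) \<le> A" "\<And>n. L2_norm \<Omega> (wgrad \<Omega> (\<phi> n)) \<le> G"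
    and r: "\<And>k::nat. r k > 0"
  obtains s where "strict_mono (s :: nat \<Rightarrow> nat)" "\<And>k x. Cauchy (\<lambda>n. ball_avg (r k) (\<phi> (s n)) x)"
proof -
  define m where "m k = sqrt (measure lebesgue (ball (0::'a) (r k)))" for k
  have m: "m k > 0" for k using measure_ball_pos[OF r] by (simp add: m_def)
  have bound: "\<bar>ball_avg (r k) (\<phi> n) x\<bar> \<le> A / m k" for k n x
  proof -
    have t: "(\<lambda>y. \<phi> n (x + y)) \<in> L2_space S" if "S \<in> sets lebesgue" for S
      using translate_L2[OF \<phi>(1)[of n] that, of x] by (simp add: add.commute)
    have "L2_norm (ball 0 (r k)) (\<lambda>y. \<phi> n (x + y)) \<le> L2_norm UNIV (\<lambda>y. \<phi> n (x + y))"
      by (rule L2_norm_subset(2)[OF t]) auto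
    also have "\<dots> = L2_norm UNIV (\<lambda>y. \<phi> n (y + x))" by (simp only: add.commute[of x])
    also have "\<dots> = L2_norm UNIV (\<phi> n)" by (rule L2_norm_translate[OF test_function_continuous[OF \<phi>(1)]])
    also have "\<dots> = L2_norm \<Omega> (\<phi> n)" by (rule L2_norm_zero_outside[OF test_zero_outside[OF \<phi>(1)]])
    also have "\<dots> \<le> A" by (rule \<phi>(2))
    finally have "L2_norm (ball 0 (r k)) (\<lambda>y. \<phi> n (x + y)) / m k \<le> A / m k"
      using m[of k] by (intro divide_right_mono) auto
    then show ?thesis using ball_avg_bound[OF r t[of "ball 0 (r k)"]] by (simp add: m_def)
  qed
  have lip: "\<bar>ball_avg (r k) (\<phi> n) x - ball_avg (r k) (\<phi> n) y\<bar> \<le> norm (x - y) * (G / m k)" for k n x y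
  proof -
    have "\<bar>ball_avg (r k) (\<phi> n) x - ball_avg (r k) (\<phi> n) y\<bar> \<le> norm (x - y) * (L2_norm UNIV (grad (\<phi> n)) / m k)"
      using ball_avg_diff_bound[OF r \<phi>(1)] by (simp add: m_def)
    also have "\<dots> \<le> norm (x - y) * (G / m k)"
      using m[of k] \<phi>(3)[of n] by (intro mult_left_mono divide_right_mono) (auto simp: L2_norm_grad_test[OF \<phi>(1)])
    finally show ?thesis .
  qed
  obtain D :: "'a set" where D: "countable D" "\<And>U. open U \<Longrightarrow> U \<noteq> {} \<Longrightarrow> \<exists>d\<in>D. d \<in> U"
    using countable_dense_setE by metis
  \<comment> \<open>The factor \<open>m k\<close> compensates for the bound \<open>A / m k\<close>,
    so that A bounds all pairs at once, as the diagonal argument requires.\<close>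
  define f where "f n p = m (fst p) * ball_avg (r (fst p)) (\<phi> n) (snd p)" for n p
  have cD: "countable ((UNIV :: nat set) \<times> D)" using D(1) by auto
  have fA: "norm (f n p) \<le> A" for n p
  proof -
    obtain k x where p: "p = (k, x)" by (cases p)
    have "m k * \<bar>ball_avg (r k) (\<phi> n) x\<bar> \<le> m k * (A / m k)"
      using bound m[of k] by (intro mult_left_mono) auto
    then show ?thesis using m[of k] by (simp add: p f_def abs_mult)
  qed
  obtain s where s: "strict_mono (s :: nat \<Rightarrow> nat)"
    and conv: "\<And>p. p \<in> UNIV \<times> D \<Longrightarrow> \<exists>l. (\<lambda>n. f (s n) p) \<longlonglongrightarrow> l"
    by (rule function_convergent_subsequence[where f = f, OF cD fA]) (rule that)
  have CauchyD: "Cauchy (\<lambda>n. ball_avg (r k) (\<phi> (s n)) d)" if d: "d \<in> D" for k d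
  proof -
    obtain l where "(\<lambda>n. m k * ball_avg (r k) (\<phi> (s n)) d) \<longlonglongrightarrow> l"
      using conv[of "(k, d)"] d by (auto simp: f_def)
    then have "(\<lambda>n. inverse (m k) * (m k * ball_avg (r k) (\<phi> (s n)) d)) \<longlonglongrightarrow> inverse (m k) * l"
      by (intro tendsto_intros)
    then have "(\<lambda>n. ball_avg (r k) (\<phi> (s n)) d) \<longlonglongrightarrow> inverse (m k) * l"
      using m[of k] by (simp add: mult.assoc[symmetric])
    then show ?thesis by (rule LIMSEQ_imp_Cauchy)
  qed
  have G: "G \<ge> 0" using \<phi>(3)[of 0] L2_norm_nonneg order_trans by blast
  have "Cauchy (\<lambda>n. ball_avg (r k) (\<phi> (s n)) x)" for k x
  proof (rule metric_CauchyI)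
    fix e :: real assume e: "e > 0"
    define L where "L = G / m k"
    have L: "L \<ge> 0" using G m[of k] by (simp add: L_def)
    \<comment> \<open>Moving to a point of the dense set costs less than e/3 at each of the two
      indices; the summand 1 covers L = 0.\<close>
    have "e / (3 * (L + 1)) > 0" using e L by (intro divide_pos_pos) auto
    then obtain d where d: "d \<in> D" "d \<in> ball x (e / (3 * (L + 1)))"
      using D(2)[of "ball x (e / (3 * (L + 1)))"] by (auto simp del: mem_ball)
    have "norm (x - d) * L \<le> e / (3 * (L + 1)) * L"
      using d(2) L by (intro mult_right_mono) (auto simp: dist_norm)
    also have "\<dots> < e / 3" using e L by (simp add: field_simps)
    finally have near: "norm (x - d) * L < e / 3" .
    obtain N where N: "\<And>i j. i \<ge> N \<Longrightarrow> j \<ge> N \<Longrightarrow>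
        dist (ball_avg (r k) (\<phi> (s i)) d) (ball_avg (r k) (\<phi> (s j)) d) < e / 3"
      using metric_CauchyD[OF CauchyD[OF d(1)], of "e / 3" k] e by auto
    show "\<exists>N. \<forall>i\<ge>N. \<forall>j\<ge>N. dist (ball_avg (r k) (\<phi> (s i)) x) (ball_avg (r k) (\<phi> (s j)) x) < e"
    proof (intro exI allI impI)
      fix i j assume ij: "N \<le> i" "N \<le> j"
      show "dist (ball_avg (r k) (\<phi> (s i)) x) (ball_avg (r k) (\<phi> (s j)) x) < e"
        using N[OF ij] near lip[of k "s i" x d] lip[of k "s j" x d]
        unfolding dist_real_def L_def by linarith
    qed
  qed
  with s show ?thesis by (rule that)
qed

text \<open>For a small radius the averages are close to the functions in L^2, uniformly in n. At a
  fixed radius they converge pointwise and are uniformly bounded, hence converge in L^2 of the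
  bounded set \<Omega>.\<close>

theorem Rellich_test_functions:
  assumes \<phi>: "\<And>n. test_function \<Omega> (\<phi> n)" "\<And>n. L2_norm \<Omega> (\<phi> n) \<le> A" "\<And>n. L2_norm \<Omega> (wgrad \<Omega> (\<phi> n)) \<le> G"
  obtains s where "strict_mono (s :: nat \<Rightarrow> nat)"
    "\<And>e. e > 0 \<Longrightarrow> \<exists>N. \<forall>i\<ge>N. \<forall>j\<ge>N. L2_norm \<Omega> (\<lambda>x. \<phi> (s i) x - \<phi> (s j) x) < e"
proof -
  define r where "r k = inverse (real (Suc k))" for k
  have r: "r k > 0" for k by (simp add: r_def)
  \<comment> \<open>One subsequence for all radii, so that it does not depend on the accuracy
    e.\<close>
  obtain s where s: "strict_mono (s :: nat \<Rightarrow> nat)" "\<And>k x. Cauchy (\<lambda>n. ball_avg (r k) (\<phi> (s n)) x)"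
    by (rule ball_avg_Cauchy_subseq[OF \<phi> r]) (rule that)
  have G: "G \<ge> 0" using \<phi>(3)[of 0] L2_norm_nonneg order_trans by blast
  have A: "A \<ge> 0" using \<phi>(2)[of 0] L2_norm_nonneg order_trans by blast
  interpret finite_measure "lebesgue_on \<Omega>" by (rule finite_measure_lebesgue_on[OF lmeasurable_Omega])
  have avgL2: "ball_avg (r k) (\<phi> n) \<in> L2_space \<Omega>" for k n
    using L2_space_add[OF L2_norm_subset(1)[OF ball_avg_L2_error(1)[OF r \<phi>(1)] sets_Omega] test_L2[OF \<phi>(1)], of k n n] by simp
  have err: "L2_norm \<Omega> (\<lambda>x. ball_avg (r k) (\<phi> n) x - \<phi> n x) \<le> r k * G" for k n
  proof -
    have "L2_norm \<Omega> (\<lambda>x. ball_avg (r k) (\<phi> n) x - \<phi> n x) \<le> L2_norm UNIV (\<lambda>x. ball_avg (r k) (\<phi> n) x - \<phi> n x)"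
      by (rule L2_norm_subset(2)[OF ball_avg_L2_error(1)[OF r \<phi>(1)] sets_Omega])
    also have "\<dots> \<le> r k * L2_norm UNIV (grad (\<phi> n))" by (rule ball_avg_L2_error(2)[OF r \<phi>(1)])
    also have "\<dots> \<le> r k * G" using r[of k] \<phi>(3)[of n] by (simp add: L2_norm_grad_test[OF \<phi>(1)])
    finally show ?thesis .
  qed
  have "\<exists>N. \<forall>i\<ge>N. \<forall>j\<ge>N. L2_norm \<Omega> (\<lambda>x. \<phi> (s i) x - \<phi> (s j) x) < e" if e: "e > 0" for e
  proof -
    obtain k where k: "r k < e / (4 * (G + 1))"
      using reals_Archimedean[OF divide_pos_pos[OF e, of "4 * (G + 1)"]] G by (auto simp: r_def)
    have "r k * G \<le> e / (4 * (G + 1)) * G" using k G by (intro mult_right_mono) auto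
    also have "\<dots> < e / 4" using e G by (simp add: field_simps)
    finally have rG: "r k * G < e / 4" .
    let ?a = "\<lambda>n. ball_avg (r k) (\<phi> (s n))"
    define l where "l x = lim (\<lambda>n. ?a n x)" for x
    have lim: "(\<lambda>n. ?a n x) \<longlonglongrightarrow> l x" for x
      using s(2)[of k x] unfolding l_def by (simp add: Cauchy_convergent_iff convergent_LIMSEQ_iff)
    define C where "C = A / sqrt (measure lebesgue (ball (0::'a) (r k)))"
    have C: "\<bar>?a n x\<bar> \<le> C" for n x
    proof -
      have t: "(\<lambda>y. \<phi> (s n) (x + y)) \<in> L2_space S" if "S \<in> sets lebesgue" for S
        using translate_L2[OF \<phi>(1)[of "s n"] that, of x] by (simp add: add.commute)
      have "L2_norm (ball 0 (r k)) (\<lambda>y. \<phi> (s n) (x + y)) \<le> L2_norm UNIV (\<lambda>y. \<phi> (s n) (x + y))"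
        by (rule L2_norm_subset(2)[OF t]) auto
      also have "\<dots> = L2_norm UNIV (\<lambda>y. \<phi> (s n) (y + x))" by (simp only: add.commute[of x])
      also have "\<dots> = L2_norm UNIV (\<phi> (s n))" by (rule L2_norm_translate[OF test_function_continuous[OF \<phi>(1)]])
      also have "\<dots> = L2_norm \<Omega> (\<phi> (s n))" by (rule L2_norm_zero_outside[OF test_zero_outside[OF \<phi>(1)]])
      also have "\<dots> \<le> A" by (rule \<phi>(2))
      finally have "L2_norm (ball 0 (r k)) (\<lambda>y. \<phi> (s n) (x + y)) / sqrt (measure lebesgue (ball (0::'a) (r k))) \<le> C"
        unfolding C_def by (intro divide_right_mono) auto
      then show ?thesis using ball_avg_bound[OF r t[of "ball 0 (r k)"]] by simp
    qed
    have lC: "\<bar>l x\<bar> \<le> C" for x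
      using tendsto_rabs[OF lim[of x]] C by (intro LIMSEQ_le_const2) auto
    have [measurable]: "?a n \<in> borel_measurable (lebesgue_on \<Omega>)" for n by (rule L2_spaceD(1)[OF avgL2])
    have [measurable]: "l \<in> borel_measurable (lebesgue_on \<Omega>)"
      unfolding l_def[abs_def] by measurable
    have lL2: "l \<in> L2_space \<Omega>"
    proof (rule L2_space_bounded)
      show "integrable (lebesgue_on \<Omega>) (\<lambda>x. C\<^sup>2)" by simp
      show "AE x in lebesgue_on \<Omega>. (norm (l x))\<^sup>2 \<le> C\<^sup>2"
        using lC by (intro AE_I2) (simp add: power2_le_iff_abs_le order_trans[OF abs_ge_zero lC])
    qed measurable
    \<comment> \<open>A constant is an integrable majorant, as \<Omega> has finite measure.\<close>
    have "(\<lambda>n. LINT x|lebesgue_on \<Omega>. (norm (?a n x - l x))\<^sup>2) \<longlonglongrightarrow> (LINT x|lebesgue_on \<Omega>. 0)"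
    proof (rule integral_dominated_convergence[where w = "\<lambda>x. (2 * C)\<^sup>2"])
      show "AE x in lebesgue_on \<Omega>. (\<lambda>n. (norm (?a n x - l x))\<^sup>2) \<longlonglongrightarrow> 0"
      proof (rule AE_I2)
        fix x
        have "(\<lambda>n. (norm (?a n x - l x))\<^sup>2) \<longlonglongrightarrow> (norm (l x - l x))\<^sup>2" by (intro tendsto_intros lim)
        then show "(\<lambda>n. (norm (?a n x - l x))\<^sup>2) \<longlonglongrightarrow> 0" by simp
      qed
      show "AE x in lebesgue_on \<Omega>. norm ((norm (?a n x - l x))\<^sup>2) \<le> (2 * C)\<^sup>2" for n
      proof (rule AE_I2)
        fix x
        have "\<bar>?a n x - l x\<bar> \<le> 2 * C" using C[of n x] lC[of x] by linarith
        then have "\<bar>?a n x - l x\<bar>\<^sup>2 \<le> (2 * C)\<^sup>2" by (intro power_mono) auto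
        then show "norm ((norm (?a n x - l x))\<^sup>2) \<le> (2 * C)\<^sup>2"
          unfolding real_norm_def power_abs abs_idempotent .
      qed
    qed simp_all
    then have "(\<lambda>n. L2_norm \<Omega> (\<lambda>x. ?a n x - l x)) \<longlonglongrightarrow> sqrt 0"
      unfolding L2_norm_def by (intro tendsto_real_sqrt) simp
    then have "\<forall>\<^sub>F n in sequentially. L2_norm \<Omega> (\<lambda>x. ?a n x - l x) < e / 4"
      using e by (intro order_tendstoD(2)) auto
    then obtain N where N: "\<And>n. n \<ge> N \<Longrightarrow> L2_norm \<Omega> (\<lambda>x. ?a n x - l x) < e / 4"
      by (auto simp: eventually_sequentially)
    have near: "L2_norm \<Omega> (\<lambda>x. \<phi> (s n) x - l x) < e / 2" if "n \<ge> N" for n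
      using L2_norm_diff_triangle[OF test_L2[OF \<phi>(1)[of "s n"]] avgL2[of k "s n"] lL2]
        N[OF that] err[of k "s n"] rG L2_norm_minus_commute[of \<Omega> "\<phi> (s n)" "?a n"] by linarith
    have "L2_norm \<Omega> (\<lambda>x. \<phi> (s i) x - \<phi> (s j) x) < e" if "i \<ge> N" "j \<ge> N" for i j
      using L2_norm_diff_triangle[OF test_L2[OF \<phi>(1)[of "s i"]] lL2 test_L2[OF \<phi>(1)[of "s j"]]]
        near[OF that(1)] near[OF that(2)] L2_norm_minus_commute[of \<Omega> "\<phi> (s j)" l] by linarith
    then show ?thesis by blast
  qed
  with s(1) show ?thesis by (rule that)
qed

lemma L2_norm_tendsto_imp_wderiv:
  assumes "\<And>n. has_wderiv \<Omega> b (v n) (g n)" "b \<in> Basis" "w \<in> L2_space \<Omega>" "h \<in> L2_space \<Omega>"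
    and "(\<lambda>n. L2_norm \<Omega> (\<lambda>x. v n x - w x)) \<longlonglongrightarrow> 0" "(\<lambda>n. L2_norm \<Omega> (\<lambda>x. g n x - h x)) \<longlonglongrightarrow> 0"
  shows "has_wderiv \<Omega> b w h"
proof (rule has_wderivI[OF assms(3,4)])
  fix \<phi> assume \<phi>: "test_function \<Omega> \<phi>"
  have "(\<lambda>n. L2_inner \<Omega> (v n) (\<lambda>x. frechet_derivative \<phi> (at x) b)) \<longlonglongrightarrow> L2_inner \<Omega> w (\<lambda>x. frechet_derivative \<phi> (at x) b)"
    using has_wderivD(1)[OF assms(1)] by (intro L2_inner_tendsto[OF assms(5)] test_deriv_L2 assms \<phi> always_eventually allI)
  moreover have "(\<lambda>n. - L2_inner \<Omega> (g n) \<phi>) \<longlonglongrightarrow> - L2_inner \<Omega> h \<phi>"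
    using has_wderivD(2)[OF assms(1)] by (intro tendsto_minus L2_inner_tendsto[OF assms(6)] assms(4) test_L2[OF \<phi>] always_eventually allI)
  ultimately show "L2_inner \<Omega> w (\<lambda>x. frechet_derivative \<phi> (at x) b) = - L2_inner \<Omega> h \<phi>"
    using has_wderivD(3)[OF assms(1) \<phi>] LIMSEQ_unique by auto
qed

text \<open>The components of the gradients converge by completeness of L^2, and the identity
  defining weak derivatives survives L^2 convergence of function and derivative.\<close>

lemma H1_closed:
  assumes v: "\<And>n. v n \<in> H1_space \<Omega>" and w: "w \<in> L2_space \<Omega>"
    and lim: "(\<lambda>n. L2_norm \<Omega> (\<lambda>x. v n x - w x)) \<longlonglongrightarrow> 0"
    and Cauchy: "\<And>e. e > 0 \<Longrightarrow> \<exists>N. \<forall>i\<ge>N. \<forall>j\<ge>N. L2_norm \<Omega> (\<lambda>x. wgrad \<Omega> (v i) x - wgrad \<Omega> (v j) x) < e"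
  shows "w \<in> H1_space \<Omega>" "(\<lambda>n. L2_norm \<Omega> (\<lambda>x. wgrad \<Omega> (v n) x - wgrad \<Omega> w x)) \<longlonglongrightarrow> 0"
proof -
  have "\<exists>h. h \<in> L2_space \<Omega> \<and> (\<lambda>n. L2_norm \<Omega> (\<lambda>x. wderiv \<Omega> b (v n) x - h x)) \<longlonglongrightarrow> 0" if b: "b \<in> Basis" for b
  proof (rule L2_space_complete[OF lmeasurable_Omega, of "\<lambda>n. wderiv \<Omega> b (v n)"])
    show "wderiv \<Omega> b (v n) \<in> L2_space \<Omega>" for n by (rule wderiv_L2[OF v b])
    fix e :: real assume "e > 0"
    then obtain N where N: "\<And>i j. i \<ge> N \<Longrightarrow> j \<ge> N \<Longrightarrow> L2_norm \<Omega> (\<lambda>x. wgrad \<Omega> (v i) x - wgrad \<Omega> (v j) x) < e"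
      using Cauchy by meson
    have "L2_norm \<Omega> (\<lambda>x. wderiv \<Omega> b (v i) x - wderiv \<Omega> b (v j) x)
        \<le> L2_norm \<Omega> (\<lambda>x. wgrad \<Omega> (v i) x - wgrad \<Omega> (v j) x)" for i j
    proof (rule L2_norm_mono(2))
      show "norm (wderiv \<Omega> b (v i) x - wderiv \<Omega> b (v j) x) \<le> norm (wgrad \<Omega> (v i) x - wgrad \<Omega> (v j) x)" for x
        using Basis_le_norm[OF b, of "wgrad \<Omega> (v i) x - wgrad \<Omega> (v j) x"]
        by (simp add: inner_diff_left wgrad_inner_Basis[OF b])
    qed (auto intro!: L2_spaceD(1) L2_space_diff wgrad_L2 wderiv_L2 v b)
    then show "\<exists>N. \<forall>i\<ge>N. \<forall>j\<ge>N. L2_norm \<Omega> (\<lambda>x. wderiv \<Omega> b (v i) x - wderiv \<Omega> b (v j) x) < e"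
      using N order_le_less_trans by blast
  qed blast
  then obtain h where h: "\<And>b. b \<in> Basis \<Longrightarrow> h b \<in> L2_space \<Omega>"
    "\<And>b. b \<in> Basis \<Longrightarrow> (\<lambda>n. L2_norm \<Omega> (\<lambda>x. wderiv \<Omega> b (v n) x - h b x)) \<longlonglongrightarrow> 0"
    by metis
  have D: "has_wderiv \<Omega> b w (h b)" if "b \<in> Basis" for b
    by (rule L2_norm_tendsto_imp_wderiv[OF has_wderiv_wderiv[OF v that] that w h(1)[OF that] lim h(2)[OF that]])
  show w1: "w \<in> H1_space \<Omega>" by (rule H1_spaceI[OF D])
  have "(\<lambda>n. \<Sum>b\<in>Basis. (L2_norm \<Omega> (\<lambda>x. wderiv \<Omega> b (v n) x - h b x))\<^sup>2) \<longlonglongrightarrow> (\<Sum>b\<in>(Basis::'a set). 0\<^sup>2)"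
    by (intro tendsto_sum tendsto_power h(2))
  moreover have "(\<Sum>b\<in>Basis. (L2_norm \<Omega> (\<lambda>x. wderiv \<Omega> b (v n) x - h b x))\<^sup>2)
      = (L2_norm \<Omega> (\<lambda>x. wgrad \<Omega> (v n) x - wgrad \<Omega> w x))\<^sup>2" for n
  proof -
    have d1: "(\<lambda>x. v n x - w x) \<in> H1_space \<Omega>" by (rule H1_space_diff[OF v w1])
    have "L2_norm \<Omega> (\<lambda>x. wderiv \<Omega> b (v n) x - h b x) = L2_norm \<Omega> (wderiv \<Omega> b (\<lambda>x. v n x - w x))" if b: "b \<in> Basis" for b
    proof (rule L2_norm_cong_AE[symmetric])
      have "has_wderiv \<Omega> b (\<lambda>x. 1 * v n x + (-1) * w x) (\<lambda>x. 1 * wderiv \<Omega> b (v n) x + (-1) * h b x)"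
        by (rule has_wderiv_lin[OF has_wderiv_wderiv[OF v b] D[OF b] b])
      then have "has_wderiv \<Omega> b (\<lambda>x. v n x - w x) (\<lambda>x. wderiv \<Omega> b (v n) x - h b x)" by simp
      then show "AE x in lebesgue_on \<Omega>. wderiv \<Omega> b (\<lambda>x. v n x - w x) x = wderiv \<Omega> b (v n) x - h b x"
        by (rule wderiv_AE[OF _ b])
    qed (auto intro!: wderiv_L2 d1 v b L2_space_diff h(1))
    then have "(\<Sum>b\<in>Basis. (L2_norm \<Omega> (\<lambda>x. wderiv \<Omega> b (v n) x - h b x))\<^sup>2)
        = (L2_norm \<Omega> (wgrad \<Omega> (\<lambda>x. v n x - w x)))\<^sup>2"
      by (simp add: L2_norm_power2 L2_inner_wgrad[OF d1 d1])
    then show ?thesis by (simp add: L2_norm_wgrad_diff[OF v w1])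
  qed
  ultimately have "(\<lambda>n. (L2_norm \<Omega> (\<lambda>x. wgrad \<Omega> (v n) x - wgrad \<Omega> w x))\<^sup>2) \<longlonglongrightarrow> 0"
    by (simp only: power2_eq_square mult_zero_left sum.neutral_const)
  from tendsto_real_sqrt[OF this]
  show "(\<lambda>n. L2_norm \<Omega> (\<lambda>x. wgrad \<Omega> (v n) x - wgrad \<Omega> w x)) \<longlonglongrightarrow> 0" by simp
qed

end

section \<open>The first Dirichlet eigenvalue\<close>

context bounded_open
begin

text \<open>After scaling, an admissible competitor: the infimum of the Rayleigh quotient is over a
  nonempty set.\<close>

lemma exists_normalized_test_function:
  assumes "\<Omega> \<noteq> {}"
  obtains \<phi> where "test_function \<Omega> \<phi>" "L2_norm \<Omega> \<phi> > 0"
proof -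
  obtain x where x: "x \<in> \<Omega>" using assms by blast
  obtain a b where ab: "x \<in> box a b" "cbox a b \<subseteq> \<Omega>"
    using open_contains_cbox[OF open_Omega x] by metis
  let ?\<phi> = "\<lambda>x. 1 - (1 - box_bump a b x) ^ 1"
  have \<phi>: "test_function \<Omega> ?\<phi>" by (rule test_function_box[OF ab(2)])
  have "L2_norm \<Omega> ?\<phi> \<noteq> 0"
  proof
    assume "L2_norm \<Omega> ?\<phi> = 0"
    then have "AE x in lebesgue_on \<Omega>. ?\<phi> x = 0"
      using L2_norm_eq_0_iff[OF test_L2[OF \<phi>]] by simp
    then have "AE x in lebesgue. x \<in> \<Omega> \<longrightarrow> ?\<phi> x = 0"
      by (subst (asm) AE_restrict_space_iff) auto
    then have "AE x in lebesgue. x \<notin> box a b"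
    proof eventually_elim
      case (elim x)
      show ?case
      proof
        assume "x \<in> box a b"
        then have "0 < box_bump a b x" "x \<in> \<Omega>"
          using box_bump_pos ab(2) box_subset_cbox[of a b] by auto
        then show False using elim by simp
      qed
    qed
    then have "negligible (box a b)"
      by (simp add: negligible_iff_null_sets AE_iff_null_sets)
    then have "box a b = {}" by (metis negligible_imp_measure0 open_box open_not_negligible)
    then show False using ab(1) by simp
  qed
  then show ?thesis using \<phi> by (intro that[of ?\<phi>]) (auto simp: order_less_le)
qed

lemma L2_norm_wgrad_cmult:
  assumes "v \<in> H1_space \<Omega>"
  shows "L2_norm \<Omega> (wgrad \<Omega> (\<lambda>x. c * v x)) = \<bar>c\<bar> * L2_norm \<Omega> (wgrad \<Omega> v)"
proof -
  have "L2_norm \<Omega> (wgrad \<Omega> (\<lambda>x. c * v x)) = L2_norm \<Omega> (\<lambda>x. c *\<^sub>R wgrad \<Omega> v x)"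
    using wgrad_lin[OF assms assms, of c 0] H1_space_lin[OF assms assms, of c 0]
    by (intro L2_norm_cong_AE L2_space_scaleR wgrad_L2 assms) auto
  then show ?thesis by (simp add: L2_norm_scaleR)
qed

lemma L2_parallelogram:
  assumes "v \<in> L2_space S" "w \<in> L2_space S"
  shows "(L2_norm S (\<lambda>x. v x + w x))\<^sup>2 + (L2_norm S (\<lambda>x. v x - w x))\<^sup>2
    = 2 * (L2_norm S v)\<^sup>2 + 2 * (L2_norm S w)\<^sup>2"
  using L2_inner_expand[OF assms, of 1] L2_inner_expand[OF assms, of "-1"]
  by (simp add: L2_norm_power2)

text \<open>The infimum is over test functions, to which the compactness theorem applies; density
  carries the lower bound over to H^1_0.\<close>

definition rayleigh_inf :: real where
  "rayleigh_inf = (INF \<phi>\<in>{\<phi>. test_function \<Omega> \<phi> \<and> L2_norm \<Omega> \<phi> = 1}. (L2_norm \<Omega> (wgrad \<Omega> \<phi>))\<^sup>2)"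

lemma rayleigh_inf_le_test:
  assumes \<phi>: "test_function \<Omega> \<phi>"
  shows "rayleigh_inf * (L2_norm \<Omega> \<phi>)\<^sup>2 \<le> (L2_norm \<Omega> (wgrad \<Omega> \<phi>))\<^sup>2"
proof (cases "L2_norm \<Omega> \<phi> = 0")
  case False
  let ?n = "L2_norm \<Omega> \<phi>"
  let ?\<psi> = "\<lambda>x. inverse ?n * \<phi> x"
  have \<psi>: "test_function \<Omega> ?\<psi>" by (rule test_function_cmult[OF \<phi>])
  have "L2_norm \<Omega> ?\<psi> = 1"
    using L2_norm_scaleR[of \<Omega> "inverse ?n" \<phi>] False by simp
  then have "rayleigh_inf \<le> (L2_norm \<Omega> (wgrad \<Omega> ?\<psi>))\<^sup>2"
    unfolding rayleigh_inf_def using \<psi> by (intro cINF_lower bdd_belowI[of _ 0]) auto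
  also have "\<dots> = (L2_norm \<Omega> (wgrad \<Omega> \<phi>))\<^sup>2 / ?n\<^sup>2"
    unfolding L2_norm_wgrad_cmult[OF test_H1[OF \<phi>]] by (simp add: power_mult_distrib field_simps)
  finally show ?thesis using False by (simp add: field_simps)
qed simp

lemma rayleigh_inf_le:
  assumes v: "v \<in> H10_space \<Omega>"
  shows "rayleigh_inf * (L2_norm \<Omega> v)\<^sup>2 \<le> (L2_norm \<Omega> (wgrad \<Omega> v))\<^sup>2"
proof -
  obtain \<phi> where \<phi>: "\<And>n. test_function \<Omega> (\<phi> n)" "(\<lambda>n. L2_norm \<Omega> (\<lambda>x. \<phi> n x - v x)) \<longlonglongrightarrow> 0"
    "(\<lambda>n. L2_norm \<Omega> (\<lambda>x. wgrad \<Omega> (\<phi> n) x - wgrad \<Omega> v x)) \<longlonglongrightarrow> 0" by (rule H10_approx[OF v]) blast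
  have "(\<lambda>n. rayleigh_inf * (L2_norm \<Omega> (\<phi> n))\<^sup>2) \<longlonglongrightarrow> rayleigh_inf * (L2_norm \<Omega> v)\<^sup>2"
    by (intro tendsto_intros L2_norm_tendsto[OF \<phi>(2)] always_eventually allI test_L2[OF \<phi>(1)] H10_L2[OF v])
  moreover have "(\<lambda>n. (L2_norm \<Omega> (wgrad \<Omega> (\<phi> n)))\<^sup>2) \<longlonglongrightarrow> (L2_norm \<Omega> (wgrad \<Omega> v))\<^sup>2"
    by (intro tendsto_intros L2_norm_tendsto[OF \<phi>(3)] always_eventually allI wgrad_L2 test_H1[OF \<phi>(1)] H10_H1[OF v])
  ultimately show ?thesis
    by (rule LIMSEQ_le) (use rayleigh_inf_le_test[OF \<phi>(1)] in blast)
qed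

text \<open>The direct method with strong convergence throughout: Rellich's theorem makes a
  minimising sequence of test functions converge in L^2, minimality upgrades this to H^1, and the
  limit lies in H^1_0 by construction.\<close>

lemma rayleigh_inf_attained:
  assumes "\<Omega> \<noteq> {}"
  obtains v where "v \<in> H10_space \<Omega>" "L2_norm \<Omega> v = 1" "(L2_norm \<Omega> (wgrad \<Omega> v))\<^sup>2 = rayleigh_inf"
proof -
  let ?T = "{\<phi>. test_function \<Omega> \<phi> \<and> L2_norm \<Omega> \<phi> = 1}"
  let ?D = "\<lambda>\<phi>. (L2_norm \<Omega> (wgrad \<Omega> \<phi>))\<^sup>2"
  obtain \<phi>0 where \<phi>0: "test_function \<Omega> \<phi>0" "L2_norm \<Omega> \<phi>0 > 0" by (rule exists_normalized_test_function[OF assms])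
  have "(\<lambda>x. inverse (L2_norm \<Omega> \<phi>0) * \<phi>0 x) \<in> ?T"
    using test_function_cmult[OF \<phi>0(1)] L2_norm_scaleR[of \<Omega> "inverse (L2_norm \<Omega> \<phi>0)" \<phi>0] \<phi>0(2) by simp
  then have ne: "?T \<noteq> {}" by blast
  have bdd: "bdd_below (?D ` ?T)" by (intro bdd_belowI[of _ 0]) auto
  have nonneg: "0 \<le> rayleigh_inf" unfolding rayleigh_inf_def by (rule cINF_greatest[OF ne]) simp
  let ?h = "\<lambda>n. inverse (real (Suc n))"
  have "\<exists>\<phi>. test_function \<Omega> \<phi> \<and> L2_norm \<Omega> \<phi> = 1 \<and> ?D \<phi> < rayleigh_inf + ?h n" for n
    using cINF_less_iff[OF ne bdd, of "rayleigh_inf + ?h n"] unfolding rayleigh_inf_def[symmetric] by auto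
  then obtain \<phi> where \<phi>: "\<And>n. test_function \<Omega> (\<phi> n)" "\<And>n. L2_norm \<Omega> (\<phi> n) = 1" "\<And>n. ?D (\<phi> n) < rayleigh_inf + ?h n"
    by metis
  have G: "L2_norm \<Omega> (wgrad \<Omega> (\<phi> n)) \<le> sqrt (rayleigh_inf + 1)" for n
  proof (rule real_le_rsqrt)
    have "?h n \<le> 1" by (simp add: field_simps)
    then show "?D (\<phi> n) \<le> rayleigh_inf + 1" using \<phi>(3)[of n] by linarith
  qed
  obtain s where s: "strict_mono (s :: nat \<Rightarrow> nat)"
    "\<And>e. e > 0 \<Longrightarrow> \<exists>N. \<forall>i\<ge>N. \<forall>j\<ge>N. L2_norm \<Omega> (\<lambda>x. \<phi> (s i) x - \<phi> (s j) x) < e"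
    using eq_refl[OF \<phi>(2)] by (rule Rellich_test_functions[OF \<phi>(1) _ G]) (rule that)
  define \<psi> where "\<psi> n = \<phi> (s n)" for n
  have \<psi>: "test_function \<Omega> (\<psi> n)" "L2_norm \<Omega> (\<psi> n) = 1" "?D (\<psi> n) < rayleigh_inf + ?h n" for n
  proof -
    \<comment> \<open>\<open>n \<le> s n\<close> preserves the rate 1/(n + 1) along the
      subsequence.\<close>
    have "?h (s n) \<le> ?h n" using seq_suble[OF s(1), of n] by (simp add: field_simps)
    then show "?D (\<psi> n) < rayleigh_inf + ?h n" using \<phi>(3)[of "s n"] unfolding \<psi>_def by linarith
  qed (simp_all add: \<psi>_def \<phi>)
  have \<psi>_Cauchy: "\<And>e. e > 0 \<Longrightarrow> \<exists>N. \<forall>i\<ge>N. \<forall>j\<ge>N. L2_norm \<Omega> (\<lambda>x. \<psi> i x - \<psi> j x) < e"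
    using s(2) by (simp add: \<psi>_def)
  obtain v where v: "v \<in> L2_space \<Omega>" "(\<lambda>n. L2_norm \<Omega> (\<lambda>x. \<psi> n x - v x)) \<longlonglongrightarrow> 0"
    by (rule L2_space_complete[OF lmeasurable_Omega test_L2[OF \<psi>(1)] \<psi>_Cauchy])
  \<comment> \<open>A minimising sequence that is Cauchy in \<open>L\<^sup>2\<close> is Cauchy in the energy norm, by the parallelogram law.\<close>
  have par: "(L2_norm \<Omega> (\<lambda>x. wgrad \<Omega> (\<psi> i) x - wgrad \<Omega> (\<psi> j) x))\<^sup>2
      \<le> 2 * ?h i + 2 * ?h j + rayleigh_inf * (L2_norm \<Omega> (\<lambda>x. \<psi> i x - \<psi> j x))\<^sup>2" for i j
  proof -
    have t: "test_function \<Omega> (\<lambda>x. 1 * \<psi> i x + 1 * \<psi> j x)" by (intro test_function_lin \<psi>(1))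
    have "L2_norm \<Omega> (wgrad \<Omega> (\<lambda>x. 1 * \<psi> i x + 1 * \<psi> j x)) = L2_norm \<Omega> (\<lambda>x. wgrad \<Omega> (\<psi> i) x + wgrad \<Omega> (\<psi> j) x)"
      using wgrad_lin[OF test_H1[OF \<psi>(1)[of i]] test_H1[OF \<psi>(1)[of j]], of 1 1]
      by (intro L2_norm_cong_AE wgrad_L2 test_H1[OF t] L2_space_add test_H1[OF \<psi>(1)]) simp
    then have "rayleigh_inf * (L2_norm \<Omega> (\<lambda>x. \<psi> i x + \<psi> j x))\<^sup>2 \<le> (L2_norm \<Omega> (\<lambda>x. wgrad \<Omega> (\<psi> i) x + wgrad \<Omega> (\<psi> j) x))\<^sup>2"
      using rayleigh_inf_le_test[OF t] by simp
    moreover have "(L2_norm \<Omega> (\<lambda>x. \<psi> i x + \<psi> j x))\<^sup>2 = 4 - (L2_norm \<Omega> (\<lambda>x. \<psi> i x - \<psi> j x))\<^sup>2"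
      using L2_parallelogram[OF test_L2[OF \<psi>(1)[of i]] test_L2[OF \<psi>(1)[of j]]] by (simp add: \<psi>(2))
    moreover have "(L2_norm \<Omega> (\<lambda>x. wgrad \<Omega> (\<psi> i) x + wgrad \<Omega> (\<psi> j) x))\<^sup>2 + (L2_norm \<Omega> (\<lambda>x. wgrad \<Omega> (\<psi> i) x - wgrad \<Omega> (\<psi> j) x))\<^sup>2
        = 2 * ?D (\<psi> i) + 2 * ?D (\<psi> j)"
      by (rule L2_parallelogram) (intro wgrad_L2 test_H1 \<psi>(1))+
    ultimately show ?thesis
      using \<psi>(3)[of i] \<psi>(3)[of j] by (simp add: algebra_simps)
  qed
  have grad_Cauchy: "\<exists>N. \<forall>i\<ge>N. \<forall>j\<ge>N. L2_norm \<Omega> (\<lambda>x. wgrad \<Omega> (\<psi> i) x - wgrad \<Omega> (\<psi> j) x) < e" if e: "e > 0" for e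
  proof -
    \<comment> \<open>The two rates contribute less than e^2/2 and the Rayleigh term at most e^2/4.
      The summand 1 in the second threshold covers \<open>rayleigh_inf = 0\<close>.\<close>
    have e2: "e\<^sup>2 / 8 > 0" using e by simp
    obtain N1 where N1: "?h N1 < e\<^sup>2 / 8" using reals_Archimedean[OF e2] by blast
    have "sqrt (e\<^sup>2 / (4 * (rayleigh_inf + 1))) > 0" using e nonneg by simp
    then obtain N2 where N2: "\<And>i j. i \<ge> N2 \<Longrightarrow> j \<ge> N2 \<Longrightarrow> L2_norm \<Omega> (\<lambda>x. \<psi> i x - \<psi> j x) < sqrt (e\<^sup>2 / (4 * (rayleigh_inf + 1)))"
      using \<psi>_Cauchy by meson
    have "L2_norm \<Omega> (\<lambda>x. wgrad \<Omega> (\<psi> i) x - wgrad \<Omega> (\<psi> j) x) < e" if ij: "i \<ge> max N1 N2" "j \<ge> max N1 N2" for i j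
    proof (rule power2_less_imp_less)
      have hh: "?h i \<le> ?h N1" "?h j \<le> ?h N1" using ij by (auto simp: field_simps)
      have "(L2_norm \<Omega> (\<lambda>x. \<psi> i x - \<psi> j x))\<^sup>2 \<le> (sqrt (e\<^sup>2 / (4 * (rayleigh_inf + 1))))\<^sup>2"
        using N2[of i j] ij by (intro power_mono) auto
      also have "\<dots> = e\<^sup>2 / (4 * (rayleigh_inf + 1))" using nonneg by simp
      finally have "rayleigh_inf * (L2_norm \<Omega> (\<lambda>x. \<psi> i x - \<psi> j x))\<^sup>2 \<le> rayleigh_inf * (e\<^sup>2 / (4 * (rayleigh_inf + 1)))"
        using nonneg by (rule mult_left_mono)
      also have "\<dots> \<le> e\<^sup>2 / 4" using nonneg by (simp add: field_simps)
      finally show "(L2_norm \<Omega> (\<lambda>x. wgrad \<Omega> (\<psi> i) x - wgrad \<Omega> (\<psi> j) x))\<^sup>2 < e\<^sup>2"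
        using par[of i j] hh N1 e2 by linarith
    qed (use e in simp)
    then show ?thesis by blast
  qed
  have v1: "v \<in> H1_space \<Omega>" and vg: "(\<lambda>n. L2_norm \<Omega> (\<lambda>x. wgrad \<Omega> (\<psi> n) x - wgrad \<Omega> v x)) \<longlonglongrightarrow> 0"
    using H1_closed[OF test_H1[OF \<psi>(1)] v grad_Cauchy] by auto
  have v10: "v \<in> H10_space \<Omega>" unfolding H10_space_iff using v1 vg v(2) \<psi>(1) by blast
  have vn: "L2_norm \<Omega> v = 1"
  proof -
    have "(\<lambda>n. L2_norm \<Omega> (\<psi> n)) \<longlonglongrightarrow> L2_norm \<Omega> v"
      by (intro L2_norm_tendsto[OF v(2)] always_eventually allI test_L2 \<psi>(1) v(1))
    then show ?thesis by (simp add: \<psi>(2) LIMSEQ_const_iff)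
  qed
  have "?D v = rayleigh_inf"
  proof (rule antisym)
    have "(\<lambda>n. ?D (\<psi> n)) \<longlonglongrightarrow> ?D v"
      by (intro tendsto_intros L2_norm_tendsto[OF vg] always_eventually allI wgrad_L2 test_H1 \<psi>(1) v1)
    moreover have "(\<lambda>n. rayleigh_inf + ?h n) \<longlonglongrightarrow> rayleigh_inf + 0"
      by (intro tendsto_intros LIMSEQ_inverse_real_of_nat)
    ultimately show "?D v \<le> rayleigh_inf"
      using \<psi>(3) by (intro LIMSEQ_le[of "\<lambda>n. ?D (\<psi> n)" _ "\<lambda>n. rayleigh_inf + ?h n"]) (auto intro: less_imp_le)
    show "rayleigh_inf \<le> ?D v"
      using rayleigh_inf_le[OF v10] vn by simp
  qed
  with v10 vn show ?thesis by (rule that)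
qed

text \<open>The form (\<nabla>v, \<nabla>w) - \<open>rayleigh_inf\<close> (v, w) is nonnegative on
  H^1_0 and so obeys a Cauchy-Schwarz inequality. Its quadratic form vanishes at the minimiser v,
  hence the form itself vanishes for v and every w.\<close>

lemma dirichlet_eigenvalue_rayleigh_inf:
  assumes "\<Omega> \<noteq> {}"
  shows "dirichlet_eigenvalue \<Omega> rayleigh_inf"
proof -
  obtain v where v: "v \<in> H10_space \<Omega>" "L2_norm \<Omega> v = 1" "(L2_norm \<Omega> (wgrad \<Omega> v))\<^sup>2 = rayleigh_inf"
    by (rule rayleigh_inf_attained[OF assms])
  have "\<not> (AE x in lebesgue_on \<Omega>. v x = 0)"
    using L2_norm_eq_0_iff[OF H10_L2[OF v(1)]] v(2) by simp
  moreover have "L2_inner \<Omega> (wgrad \<Omega> v) (wgrad \<Omega> w) = rayleigh_inf * L2_inner \<Omega> v w" if w: "w \<in> H10_space \<Omega>" for w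
  proof -
    let ?A = "(L2_norm \<Omega> (wgrad \<Omega> v))\<^sup>2 - rayleigh_inf * (L2_norm \<Omega> v)\<^sup>2"
    let ?B = "L2_inner \<Omega> (wgrad \<Omega> v) (wgrad \<Omega> w) - rayleigh_inf * L2_inner \<Omega> v w"
    let ?C = "(L2_norm \<Omega> (wgrad \<Omega> w))\<^sup>2 - rayleigh_inf * (L2_norm \<Omega> w)\<^sup>2"
    have "?B\<^sup>2 \<le> ?A * ?C"
    proof (rule nonneg_quadratic_imp)
      fix t :: real
      let ?u = "\<lambda>x. 1 * v x + t * w x"
      have u: "?u \<in> H10_space \<Omega>" by (rule H10_space_lin[OF v(1) w])
      have "L2_norm \<Omega> (wgrad \<Omega> ?u) = L2_norm \<Omega> (\<lambda>x. wgrad \<Omega> v x + t *\<^sub>R wgrad \<Omega> w x)"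
        using wgrad_lin[OF H10_H1[OF v(1)] H10_H1[OF w], of 1 t]
        by (intro L2_norm_cong_AE wgrad_L2 H10_H1[OF u] L2_space_add L2_space_scaleR H10_H1[OF v(1)] H10_H1[OF w]) simp
      then have "(L2_norm \<Omega> (wgrad \<Omega> ?u))\<^sup>2 = (L2_norm \<Omega> (wgrad \<Omega> v))\<^sup>2
          + 2 * t * L2_inner \<Omega> (wgrad \<Omega> v) (wgrad \<Omega> w) + t\<^sup>2 * (L2_norm \<Omega> (wgrad \<Omega> w))\<^sup>2"
        using L2_inner_expand[OF wgrad_L2[OF H10_H1[OF v(1)]] wgrad_L2[OF H10_H1[OF w]], of t]
        by (simp add: L2_norm_power2)
      moreover have "(L2_norm \<Omega> ?u)\<^sup>2 = (L2_norm \<Omega> v)\<^sup>2 + 2 * t * L2_inner \<Omega> v w + t\<^sup>2 * (L2_norm \<Omega> w)\<^sup>2"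
        using L2_inner_expand[OF H10_L2[OF v(1)] H10_L2[OF w], of t] by (simp add: L2_norm_power2)
      ultimately show "0 \<le> ?A + 2 * t * ?B + t\<^sup>2 * ?C"
        using rayleigh_inf_le[OF u] by (simp add: algebra_simps)
    qed (use rayleigh_inf_le[OF w] in simp)
    also have "?A * ?C = 0" using v by simp
    finally show ?thesis by simp
  qed
  ultimately show ?thesis unfolding dirichlet_eigenvalue_def using v(1) by blast
qed

text \<open>\<open>LEAST\<close> is determined because the infimum is itself an eigenvalue. Testing
  the equation of any eigenvalue with its eigenfunction exhibits it as a Rayleigh quotient, so none
  lies below the infimum.\<close>

lemma dirichlet_eigenvalue1_eq:
  assumes "\<Omega> \<noteq> {}"
  shows "dirichlet_eigenvalue1 \<Omega> = rayleigh_inf"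
  unfolding dirichlet_eigenvalue1_def
proof (rule Least_equality[where P = "dirichlet_eigenvalue \<Omega>", OF dirichlet_eigenvalue_rayleigh_inf[OF assms]])
  fix \<mu> assume "dirichlet_eigenvalue \<Omega> \<mu>"
  then obtain v where v: "v \<in> H10_space \<Omega>" "\<not> (AE x in lebesgue_on \<Omega>. v x = 0)"
    "L2_inner \<Omega> (wgrad \<Omega> v) (wgrad \<Omega> v) = \<mu> * L2_inner \<Omega> v v"
    unfolding dirichlet_eigenvalue_def by blast
  have pos: "(L2_norm \<Omega> v)\<^sup>2 > 0" using L2_norm_eq_0_iff[OF H10_L2[OF v(1)]] v(2) by simp
  have "rayleigh_inf * (L2_norm \<Omega> v)\<^sup>2 \<le> \<mu> * (L2_norm \<Omega> v)\<^sup>2"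
    using rayleigh_inf_le[OF v(1)] v(3) by (simp add: L2_norm_power2)
  then show "rayleigh_inf \<le> \<mu>" using pos by simp
qed

theorem Poincare_inequality:
  assumes "\<Omega> \<noteq> {}" "v \<in> H10_space \<Omega>"
  shows "dirichlet_eigenvalue1 \<Omega> * (L2_norm \<Omega> v)\<^sup>2 \<le> (L2_norm \<Omega> (wgrad \<Omega> v))\<^sup>2"
  unfolding dirichlet_eigenvalue1_eq[OF assms(1)] by (rule rayleigh_inf_le[OF assms(2)])

end

section \<open>Difference quotients in time\<close>

lemma absolutely_integrable_on_iff_integrable:
  fixes f :: "'a::euclidean_space \<Rightarrow> real"
  assumes "S \<in> sets lebesgue"
  shows "f absolutely_integrable_on S \<longleftrightarrow> integrable (lebesgue_on S) f"
  using assms by (simp add: set_integrable_def integrable_restrict_space)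

lemma absolutely_integrable_abs_diff:
  fixes f g :: "'a::euclidean_space \<Rightarrow> real"
  assumes "f absolutely_integrable_on S" "g absolutely_integrable_on S" "S \<in> sets lebesgue"
  shows "(\<lambda>x. \<bar>f x - g x\<bar>) absolutely_integrable_on S"
  using assms by (simp add: absolutely_integrable_on_iff_integrable)

lemma integral_abs_le:
  fixes f g :: "real \<Rightarrow> real"
  assumes "f integrable_on S" "g integrable_on S" "\<And>x. x \<in> S \<Longrightarrow> \<bar>f x\<bar> \<le> g x"
  shows "\<bar>integral S f\<bar> \<le> integral S g"
  using integral_norm_bound_integral[OF assms(1,2)] assms(3) by simp

text \<open>\<gamma> is clipped at a height K, then approximated almost everywhere by continuous
  functions clipped at the same height. Both steps are dominated convergence, the second with a
  constant majorant.\<close>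

lemma L1_continuous_approx:
  fixes \<gamma> :: "real \<Rightarrow> real"
  assumes \<gamma>: "\<gamma> absolutely_integrable_on {a..b}" and e: "\<epsilon> > 0"
  obtains c where "continuous_on UNIV c" "integral {a..b} (\<lambda>x. \<bar>\<gamma> x - c x\<bar>) < \<epsilon>"
proof -
  let ?M = "lebesgue_on {a..b}"
  interpret finite_measure ?M by (rule finite_measure_lebesgue_on) auto
  define cl where "cl K x = max (- K) (min K x)" for K x :: real
  have cl_bound: "\<bar>cl K x\<bar> \<le> \<bar>K\<bar>" for K x by (auto simp: cl_def)
  have cl_cont: "continuous_on S (cl K)" for K S unfolding cl_def by (intro continuous_intros)
  have int: "integrable ?M \<gamma>" using \<gamma> by (simp add: absolutely_integrable_on_iff_integrable)
  have gm: "\<gamma> \<in> borel_measurable ?M" using int by auto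
  have clm: "(\<lambda>x. cl K (f x)) \<in> borel_measurable ?M" if "f \<in> borel_measurable ?M" for K f
    by (rule measurable_compose[OF that borel_measurable_continuous_onI[OF cl_cont]])
  have clint: "integrable ?M (\<lambda>x. cl K (f x))" if "f \<in> borel_measurable ?M" for K f
    by (rule integrable_const_bound[where B = "\<bar>K\<bar>", OF _ clm[OF that]]) (simp add: cl_bound)
  have "(\<lambda>n. LINT x|?M. \<bar>\<gamma> x - cl (real n) (\<gamma> x)\<bar>) \<longlonglongrightarrow> (LINT x|?M. 0)"
  proof (rule integral_dominated_convergence[where w = "\<lambda>x. \<bar>\<gamma> x\<bar>"])
    show "AE x in ?M. (\<lambda>n. \<bar>\<gamma> x - cl (real n) (\<gamma> x)\<bar>) \<longlonglongrightarrow> 0"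
    proof (rule AE_I2, rule tendsto_eventually)
      fix x
      obtain n :: nat where n: "\<bar>\<gamma> x\<bar> < real n" using reals_Archimedean2 by blast
      show "\<forall>\<^sub>F n in sequentially. \<bar>\<gamma> x - cl (real n) (\<gamma> x)\<bar> = 0"
      proof (rule eventually_sequentiallyI[of n])
        fix k assume "k \<ge> n"
        then have "\<bar>\<gamma> x\<bar> < real k" using n by linarith
        then show "\<bar>\<gamma> x - cl (real k) (\<gamma> x)\<bar> = 0" by (simp add: cl_def)
      qed
    qed
    show "AE x in ?M. norm \<bar>\<gamma> x - cl (real n) (\<gamma> x)\<bar> \<le> \<bar>\<gamma> x\<bar>" for n
      by (rule AE_I2) (auto simp: cl_def)
    show "(\<lambda>x. \<bar>\<gamma> x - cl (real n) (\<gamma> x)\<bar>) \<in> borel_measurable ?M" for n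
      using gm clm[OF gm] by measurable
  qed (use int in auto)
  then have "\<forall>\<^sub>F n in sequentially. (LINT x|?M. \<bar>\<gamma> x - cl (real n) (\<gamma> x)\<bar>) < \<epsilon> / 2"
    using e by (intro order_tendstoD(2)) auto
  then obtain K :: nat where K: "(LINT x|?M. \<bar>\<gamma> x - cl (real K) (\<gamma> x)\<bar>) < \<epsilon> / 2"
    by (auto simp: eventually_sequentially)
  have "(\<lambda>x. if x \<in> {a..b} then \<gamma> x else 0) \<in> borel_measurable lebesgue"
    by (rule borel_measurable_if_I[OF gm]) auto
  then have "(\<lambda>x. if x \<in> {a..b} then \<gamma> x else 0) measurable_on UNIV"
    by (rule lebesgue_measurable_imp_measurable_on_real) auto
  then obtain N g where N: "negligible N" and g: "\<And>n. continuous_on UNIV (g n)"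
    and lim: "\<And>x. x \<notin> N \<Longrightarrow> (\<lambda>n::nat. g n x) \<longlonglongrightarrow> (if x \<in> {a..b} then \<gamma> x else 0)"
    unfolding measurable_on_def by auto
  have gnm: "g n \<in> borel_measurable ?M" for n by (rule borel_measurable_lebesgue_on_continuous[OF g])
  have "(\<lambda>n. LINT x|?M. \<bar>cl (real K) (\<gamma> x) - cl (real K) (g n x)\<bar>) \<longlonglongrightarrow> (LINT x|?M. 0)"
  proof (rule integral_dominated_convergence[where w = "\<lambda>x. 2 * real K"])
    have "AE x in lebesgue. x \<notin> N" using N by (intro AE_not_in) (simp add: negligible_iff_null_sets)
    then have "AE x in ?M. x \<notin> N" by (subst AE_restrict_space_iff) auto
    then show "AE x in ?M. (\<lambda>n. \<bar>cl (real K) (\<gamma> x) - cl (real K) (g n x)\<bar>) \<longlonglongrightarrow> 0"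
    proof (rule AE_mp, intro AE_I2 impI)
      fix x assume x: "x \<in> space ?M" "x \<notin> N"
      have "(\<lambda>n. g n x) \<longlonglongrightarrow> \<gamma> x" using lim[OF x(2)] x(1) by simp
      then have "(\<lambda>n. cl (real K) (g n x)) \<longlonglongrightarrow> cl (real K) (\<gamma> x)"
        by (rule continuous_on_tendsto_compose[OF cl_cont[of UNIV]]) auto
      then have "(\<lambda>n. \<bar>cl (real K) (\<gamma> x) - cl (real K) (g n x)\<bar>) \<longlonglongrightarrow> \<bar>cl (real K) (\<gamma> x) - cl (real K) (\<gamma> x)\<bar>"
        by (intro tendsto_intros)
      then show "(\<lambda>n. \<bar>cl (real K) (\<gamma> x) - cl (real K) (g n x)\<bar>) \<longlonglongrightarrow> 0" by simp
    qed
    show "AE x in ?M. norm \<bar>cl (real K) (\<gamma> x) - cl (real K) (g n x)\<bar> \<le> 2 * real K" for n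
    proof (rule AE_I2)
      fix x
      show "norm \<bar>cl (real K) (\<gamma> x) - cl (real K) (g n x)\<bar> \<le> 2 * real K"
        using cl_bound[of "real K" "\<gamma> x"] cl_bound[of "real K" "g n x"] by simp
    qed
    show "(\<lambda>x. \<bar>cl (real K) (\<gamma> x) - cl (real K) (g n x)\<bar>) \<in> borel_measurable ?M" for n
      using clm[OF gm, of "real K"] clm[OF gnm, of "real K" n] by measurable
  qed auto
  then have "\<forall>\<^sub>F n in sequentially. (LINT x|?M. \<bar>cl (real K) (\<gamma> x) - cl (real K) (g n x)\<bar>) < \<epsilon> / 2"
    using e by (intro order_tendstoD(2)) auto
  then obtain n where n: "(LINT x|?M. \<bar>cl (real K) (\<gamma> x) - cl (real K) (g n x)\<bar>) < \<epsilon> / 2"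
    by (auto simp: eventually_sequentially)
  let ?c = "\<lambda>x. cl (real K) (g n x)"
  note ints = int clint[OF gm, of "real K"] clint[OF gnm, of "real K" n]
  have "(LINT x|?M. \<bar>\<gamma> x - ?c x\<bar>) \<le> (LINT x|?M. \<bar>\<gamma> x - cl (real K) (\<gamma> x)\<bar> + \<bar>cl (real K) (\<gamma> x) - ?c x\<bar>)"
    using ints by (intro integral_mono integrable_abs Bochner_Integration.integrable_add Bochner_Integration.integrable_diff) auto
  also have "\<dots> = (LINT x|?M. \<bar>\<gamma> x - cl (real K) (\<gamma> x)\<bar>) + (LINT x|?M. \<bar>cl (real K) (\<gamma> x) - ?c x\<bar>)"
    using ints by (intro Bochner_Integration.integral_add integrable_abs Bochner_Integration.integrable_diff)
  also have "\<dots> < \<epsilon>" using K n by linarith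
  also have "(LINT x|?M. \<bar>\<gamma> x - ?c x\<bar>) = integral {a..b} (\<lambda>x. \<bar>\<gamma> x - ?c x\<bar>)"
    using ints by (intro lebesgue_integral_eq_integral integrable_abs Bochner_Integration.integrable_diff) auto
  finally have "integral {a..b} (\<lambda>x. \<bar>\<gamma> x - ?c x\<bar>) < \<epsilon>" .
  moreover have "continuous_on UNIV ?c"
    using continuous_on_compose[OF g[of n] cl_cont[of _ "real K"]] by (simp add: o_def)
  ultimately show ?thesis by (intro that)
qed

section \<open>Moving integrals and difference quotients\<close>

lemma continuous_on_moving_integral:
  fixes F :: "real \<Rightarrow> real"
  assumes F: "F integrable_on {0..T}" and h: "0 \<le> h" "h \<le> a" "b \<le> T"
  shows "continuous_on {a..b} (\<lambda>t. integral {t - h..t} F)"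
proof -
  have R: "continuous_on {0..T} (\<lambda>t. integral {0..t} F)" by (rule indefinite_integral_continuous_1[OF F])
  have "continuous_on {a..b} (\<lambda>t. integral {0..t} F - integral {0..t - h} F)"
  proof (rule continuous_on_diff)
    show "continuous_on {a..b} (\<lambda>t. integral {0..t} F)"
      using h by (intro continuous_on_subset[OF R]) auto
    have "continuous_on {a..b} ((\<lambda>t. integral {0..t} F) \<circ> (\<lambda>t. t - h))"
      using h by (intro continuous_on_compose continuous_intros continuous_on_subset[OF R]) auto
    then show "continuous_on {a..b} (\<lambda>t. integral {0..t - h} F)" by (simp add: o_def)
  qed
  then show ?thesis
  proof (rule continuous_on_eq)
    show "integral {0..t} F - integral {0..t - h} F = integral {t - h..t} F" if "t \<in> {a..b}" for t
      using Henstock_Kurzweil_Integration.integral_combine[of 0 "t - h" t F] that h integrable_subinterval_real[OF F, of 0 t] by auto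
  qed
qed

text \<open>After a change of variable the integrals over [a, b] and [a - h, b - h] cancel except
  for two end pieces.\<close>

lemma integral_shift_diff:
  fixes R :: "real \<Rightarrow> real"
  assumes R: "continuous_on {0..T} R" and h: "0 \<le> h" "h \<le> a" "a \<le> b" "b \<le> T"
  shows "integral {a..b} (\<lambda>t. R t - R (t - h)) = integral {b - h..b} R - integral {a - h..a} R"
proof -
  have int: "R integrable_on {x..y}" if "0 \<le> x" "y \<le> T" for x y
    using that by (intro integrable_continuous_interval continuous_on_subset[OF R]) auto
  have shift: "integral {a..b} (\<lambda>t. R (t - h)) = integral {a - h..b - h} R"
    using integral_shift_Icc_real[of a b R "- h"] by (simp add: o_def)
  have ints: "(\<lambda>t. R (t - h)) integrable_on {a..b}"
    using integrable_on_shift_Icc_real[of R "- h" a b] int[of "a - h" "b - h"] h by (simp add: o_def)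
  have "integral {a..b} (\<lambda>t. R t - R (t - h)) = integral {a..b} R - integral {a - h..b - h} R"
    using int[of a b] h ints by (subst Henstock_Kurzweil_Integration.integral_diff) (auto simp: shift)
  moreover have "integral {a - h..a} R + integral {a..b} R = integral {a - h..b} R"
    using h int[of "a - h" b] by (intro Henstock_Kurzweil_Integration.integral_combine) auto
  moreover have "integral {a - h..b - h} R + integral {b - h..b} R = integral {a - h..b} R"
    using h int[of "a - h" b] by (intro Henstock_Kurzweil_Integration.integral_combine) auto
  ultimately show ?thesis by linarith
qed

text \<open>An interchange of integrations in elementary form: with the antiderivative R of F the
  inner integral is R t - R (t - h), only two end pieces of length h remain, and 0 \<le> R t \<le> R
  T because F is nonnegative.\<close>

lemma integral_moving_integral_le:
  fixes F :: "real \<Rightarrow> real"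
  assumes F: "F integrable_on {0..T}" "\<And>t. F t \<ge> 0" and h: "0 \<le> h" "h \<le> a" "a \<le> b" "b \<le> T"
  shows "integral {a..b} (\<lambda>t. integral {t - h..t} F) \<le> h * integral {0..T} F"
proof -
  define R where "R t = integral {0..t} F" for t
  have R: "continuous_on {0..T} R" unfolding R_def by (rule indefinite_integral_continuous_1[OF F(1)])
  have intF: "F integrable_on {x..y}" if "0 \<le> x" "y \<le> T" for x y
    using that by (intro integrable_subinterval_real[OF F(1)]) auto
  have R0: "0 \<le> R t" if "0 \<le> t" "t \<le> T" for t
    unfolding R_def using that intF F(2) by (intro Henstock_Kurzweil_Integration.integral_nonneg) auto
  have RT: "R t \<le> R T" if "0 \<le> t" "t \<le> T" for t
    unfolding R_def using that intF F(2) by (intro integral_subset_le) auto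
  have "integral {t - h..t} F = R t - R (t - h)" if "t \<in> {a..b}" for t
    unfolding R_def
    using Henstock_Kurzweil_Integration.integral_combine[of 0 "t - h" t F] that h intF[of 0 t] by auto
  then have "integral {a..b} (\<lambda>t. integral {t - h..t} F) = integral {a..b} (\<lambda>t. R t - R (t - h))"
    by (intro Henstock_Kurzweil_Integration.integral_cong) auto
  also have "\<dots> = integral {b - h..b} R - integral {a - h..a} R" by (rule integral_shift_diff[OF R h])
  also have "\<dots> \<le> integral {b - h..b} (\<lambda>t. R T) - 0"
  proof (rule diff_mono)
    have int: "R integrable_on {x..y}" if "0 \<le> x" "y \<le> T" for x y
      using that by (intro integrable_continuous_interval continuous_on_subset[OF R]) auto
    show "integral {b - h..b} R \<le> integral {b - h..b} (\<lambda>t. R T)"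
      using h RT int by (intro integral_le) auto
    show "0 \<le> integral {a - h..a} R"
      using h R0 int by (intro Henstock_Kurzweil_Integration.integral_nonneg) auto
  qed
  also have "\<dots> = h * integral {0..T} F" using h by (simp add: R_def)
  finally show ?thesis .
qed

lemma integral_backward_quotient_tendsto:
  fixes z :: "real \<Rightarrow> real"
  assumes z: "continuous_on {0..T} z" and c: "0 < c" "c \<le> T"
    and h: "\<And>n. 0 < h n" "\<And>n. h n < c" "h \<longlonglongrightarrow> 0"
  shows "(\<lambda>n. integral {c - h n..c} z / h n) \<longlonglongrightarrow> z c"
proof -
  have "((\<lambda>x. integral {0..x} z) has_real_derivative z c) (at c within {0..T})"
    using c by (intro integral_has_real_derivative[OF z]) auto
  then have lim: "((\<lambda>y. (integral {0..y} z - integral {0..c} z) / (y - c)) \<longlongrightarrow> z c) (at c within {0..T})"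
    by (simp add: has_field_derivative_iff)
  have "filterlim (\<lambda>n. c - h n) (at c within {0..T}) sequentially"
    unfolding filterlim_at
  proof
    have "c - h n \<in> {0..T} \<and> c - h n \<noteq> c" for n using h(1)[of n] h(2)[of n] c by auto
    then show "\<forall>\<^sub>F n in sequentially. c - h n \<in> {0..T} \<and> c - h n \<noteq> c" by (intro always_eventually allI)
    have "(\<lambda>n. c - h n) \<longlonglongrightarrow> c - 0" by (intro tendsto_intros h(3))
    then show "(\<lambda>n. c - h n) \<longlonglongrightarrow> c" by simp
  qed
  from filterlim_compose[OF lim this]
  have "(\<lambda>n. (integral {0..c - h n} z - integral {0..c} z) / (c - h n - c)) \<longlonglongrightarrow> z c" .
  moreover have "(integral {0..c - h n} z - integral {0..c} z) / (c - h n - c) = integral {c - h n..c} z / h n" for n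
  proof -
    have "integral {0..c - h n} z + integral {c - h n..c} z = integral {0..c} z"
      using h(1)[of n] h(2)[of n] c
      by (intro Henstock_Kurzweil_Integration.integral_combine integrable_continuous_interval continuous_on_subset[OF z]) auto
    then have "integral {0..c - h n} z - integral {0..c} z = - integral {c - h n..c} z" by linarith
    then show ?thesis by simp
  qed
  ultimately show ?thesis by simp
qed

lemma integral_difference_quotient_tendsto:
  fixes z :: "real \<Rightarrow> real"
  assumes z: "continuous_on {0..T} z" and ab: "0 < a" "a \<le> b" "b \<le> T"
    and h: "\<And>n. 0 < h n" "\<And>n. h n < a" "h \<longlonglongrightarrow> 0"
  shows "(\<lambda>n. integral {a..b} (\<lambda>t. (z t - z (t - h n)) / h n)) \<longlonglongrightarrow> z b - z a"
proof -
  have "(\<lambda>n. integral {b - h n..b} z / h n - integral {a - h n..a} z / h n) \<longlonglongrightarrow> z b - z a"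
    using ab h order_less_le_trans[OF h(2) ab(2)]
    by (intro tendsto_diff integral_backward_quotient_tendsto[OF z]) auto
  moreover have "integral {a..b} (\<lambda>t. (z t - z (t - h n)) / h n) = integral {b - h n..b} z / h n - integral {a - h n..a} z / h n" for n
    using integral_shift_diff[OF z, of "h n" a b] h(1)[of n] h(2)[of n] ab
    by (simp add: diff_divide_distrib[symmetric] less_imp_le)
  ultimately show ?thesis by simp
qed

text \<open>For continuous \<gamma> the convergence is uniform. In general \<gamma> is approximated
  in L^1 by a continuous c; averaging over a window does not increase the L^1 norm, so the error is
  paid at most twice. The identity for V is assumed at positive times, where the weak time
  derivative provides it.\<close>

lemma difference_quotient_tendsto_L1:
  fixes \<gamma> V :: "real \<Rightarrow> real"
  assumes \<gamma>: "\<gamma> absolutely_integrable_on {0..T}" and V: "continuous_on {0..T} V"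
    and FTC: "\<And>s t. 0 < s \<Longrightarrow> s \<le> t \<Longrightarrow> t \<le> T \<Longrightarrow> V t - V s = integral {s..t} \<gamma>"
    and ab: "0 < a" "a \<le> b" "b \<le> T"
    and h: "\<And>n. 0 < h n" "\<And>n. h n < a" "h \<longlonglongrightarrow> 0"
  shows "(\<lambda>n. integral {a..b} (\<lambda>t. \<bar>(V t - V (t - h n)) / h n - \<gamma> t\<bar>)) \<longlonglongrightarrow> 0"
proof (rule LIMSEQ_I)
  fix e :: real assume e: "e > 0"
  obtain c where c: "continuous_on UNIV c" and ce: "integral {0..T} (\<lambda>x. \<bar>\<gamma> x - c x\<bar>) < e / 4"
    by (rule L1_continuous_approx[OF \<gamma>, of "e / 4"]) (use e in auto)
  have cai: "c absolutely_integrable_on {x..y}" for x y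
    by (intro absolutely_integrable_continuous_real continuous_on_subset[OF c]) auto
  have gai: "\<gamma> absolutely_integrable_on {x..y}" if "0 \<le> x" "y \<le> T" for x y
    using that by (intro absolutely_integrable_on_subinterval[OF \<gamma>]) auto
  let ?F = "\<lambda>x. \<bar>\<gamma> x - c x\<bar>"
  have Fai: "?F absolutely_integrable_on {x..y}" if "0 \<le> x" "y \<le> T" for x y
    by (intro absolutely_integrable_abs_diff gai cai that) auto
  have Fint: "?F integrable_on {x..y}" if "0 \<le> x" "y \<le> T" for x y
    using Fai[OF that] by (rule set_lebesgue_integral_eq_integral(1))
  have "uniformly_continuous_on {0..T} c"
    by (intro compact_uniformly_continuous continuous_on_subset[OF c]) auto
  \<comment> \<open>Two errors e/4 come from \<gamma> - c, and at most e/4 from uniform continuity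
    integrated over [a, b]; the summand 1 covers a = b.\<close>
  moreover have "e / (4 * (b - a + 1)) > 0" using e ab by (intro divide_pos_pos) auto
  ultimately obtain d where d: "d > 0" and uc: "\<And>x y. x \<in> {0..T} \<Longrightarrow> y \<in> {0..T} \<Longrightarrow> \<bar>x - y\<bar> < d \<Longrightarrow> \<bar>c x - c y\<bar> < e / (4 * (b - a + 1))"
    unfolding uniformly_continuous_on_def dist_real_def by meson
  obtain N where N: "\<And>n. n \<ge> N \<Longrightarrow> h n < d"
    using order_tendstoD(2)[OF h(3) d] by (auto simp: eventually_sequentially)
  have "norm (integral {a..b} (\<lambda>t. \<bar>(V t - V (t - h n)) / h n - \<gamma> t\<bar>) - 0) < e" if n: "n \<ge> N" for n
  proof -
    let ?h = "h n"
    have hn: "0 < ?h" "?h < a" "?h < d" using h N[OF n] by auto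
    let ?D = "\<lambda>t. (V t - V (t - ?h)) / ?h"
    have pt: "\<bar>?D t - \<gamma> t\<bar> \<le> integral {t - ?h..t} ?F / ?h + e / (4 * (b - a + 1)) + ?F t" if t: "t \<in> {a..b}" for t
    proof -
      have in1: "\<gamma> integrable_on {t - ?h..t}" and in2: "c integrable_on {t - ?h..t}"
        using gai[of "t - ?h" t] cai[of "t - ?h" t] t hn ab by (auto intro: set_lebesgue_integral_eq_integral(1))
      have "V t - V (t - ?h) = integral {t - ?h..t} \<gamma>" using t hn ab by (intro FTC) auto
      also have "\<dots> = integral {t - ?h..t} (\<lambda>x. \<gamma> x - c x) + integral {t - ?h..t} c"
        using in1 in2 by (simp add: Henstock_Kurzweil_Integration.integral_diff)
      finally have V1: "V t - V (t - ?h) = integral {t - ?h..t} (\<lambda>x. \<gamma> x - c x) + integral {t - ?h..t} c" .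
      have i1: "\<bar>integral {t - ?h..t} (\<lambda>x. \<gamma> x - c x)\<bar> \<le> integral {t - ?h..t} ?F"
        using Fint[of "t - ?h" t] t hn ab in1 in2
        by (intro integral_abs_le integrable_diff) auto
      have "\<bar>integral {t - ?h..t} (\<lambda>x. c x - c t)\<bar> \<le> integral {t - ?h..t} (\<lambda>x. e / (4 * (b - a + 1)))"
      proof (intro integral_abs_le integrable_diff in2)
        show "\<bar>c x - c t\<bar> \<le> e / (4 * (b - a + 1))" if "x \<in> {t - ?h..t}" for x
          using uc[of x t] that t hn ab by auto
      qed auto
      also have "\<dots> = ?h * (e / (4 * (b - a + 1)))" using hn by simp
      finally have i2: "\<bar>integral {t - ?h..t} c - ?h * c t\<bar> \<le> ?h * (e / (4 * (b - a + 1)))"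
        by (subst (asm) Henstock_Kurzweil_Integration.integral_diff[OF in2]) (use hn in auto)
      have "\<bar>?D t - c t\<bar> = \<bar>(V t - V (t - ?h) - ?h * c t) / ?h\<bar>"
        using hn by (simp add: diff_divide_distrib)
      also have "\<dots> \<le> (integral {t - ?h..t} ?F + ?h * (e / (4 * (b - a + 1)))) / ?h"
        unfolding abs_divide using V1 i1 i2 hn by (simp add: divide_right_mono)
      also have "\<dots> = integral {t - ?h..t} ?F / ?h + e / (4 * (b - a + 1))"
        using hn by (simp add: add_divide_distrib)
      finally show ?thesis by linarith
    qed
    have "continuous_on {a..b} (\<lambda>t. integral {t - ?h..t} ?F)"
      using hn ab by (intro continuous_on_moving_integral[OF Fint[of 0 T]]) auto
    then have mint: "(\<lambda>t. integral {t - ?h..t} ?F / ?h) integrable_on {a..b}"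
      using hn by (intro integrable_continuous_interval continuous_on_divide continuous_on_const) auto
    have Dcont: "continuous_on {a..b} ?D"
    proof (intro continuous_on_divide continuous_on_diff continuous_on_const)
      show "continuous_on {a..b} V" using ab by (intro continuous_on_subset[OF V]) auto
      have "continuous_on {a..b} (V \<circ> (\<lambda>t. t - ?h))"
        using hn ab by (intro continuous_on_compose continuous_intros continuous_on_subset[OF V]) auto
      then show "continuous_on {a..b} (\<lambda>t. V (t - ?h))" by (simp add: o_def)
    qed (use hn in auto)
    have Dint: "(\<lambda>t. \<bar>?D t - \<gamma> t\<bar>) absolutely_integrable_on {a..b}"
      using ab by (intro absolutely_integrable_abs_diff absolutely_integrable_continuous_real[OF Dcont] gai) auto
    have "integral {a..b} (\<lambda>t. \<bar>?D t - \<gamma> t\<bar>) \<le> integral {a..b} (\<lambda>t. integral {t - ?h..t} ?F / ?h + e / (4 * (b - a + 1)) + ?F t)"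
      using pt Fint[of a b] ab
      by (intro integral_le set_lebesgue_integral_eq_integral(1)[OF Dint] integrable_add mint) auto
    also have "\<dots> = integral {a..b} (\<lambda>t. integral {t - ?h..t} ?F / ?h) + integral {a..b} (\<lambda>t. e / (4 * (b - a + 1))) + integral {a..b} ?F"
    proof -
      have ci: "(\<lambda>t. e / (4 * (b - a + 1))) integrable_on {a..b}" by auto
      show ?thesis
        using Fint[of a b] ab
        by (simp only: Henstock_Kurzweil_Integration.integral_add[OF integrable_add[OF mint ci]]
            Henstock_Kurzweil_Integration.integral_add[OF mint ci] less_imp_le)
    qed
    also have "\<dots> < e"
    proof -
      have "integral {a..b} (\<lambda>t. integral {t - ?h..t} ?F) \<le> ?h * integral {0..T} ?F"
        using hn ab by (intro integral_moving_integral_le Fint) auto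
      then have 1: "integral {a..b} (\<lambda>t. integral {t - ?h..t} ?F / ?h) \<le> integral {0..T} ?F"
        using hn by (simp add: field_simps)
      have 2: "integral {a..b} ?F \<le> integral {0..T} ?F"
        using ab Fint by (intro integral_subset_le) auto
      have "integral {a..b} (\<lambda>t. e / (4 * (b - a + 1))) = (b - a) * (e / (4 * (b - a + 1)))" using ab by simp
      also have "\<dots> \<le> e / 4" using ab e by (simp add: field_simps)
      finally show ?thesis using 1 2 ce e by linarith
    qed
    finally have "integral {a..b} (\<lambda>t. \<bar>?D t - \<gamma> t\<bar>) < e" .
    moreover have "0 \<le> integral {a..b} (\<lambda>t. \<bar>?D t - \<gamma> t\<bar>)"
      by (intro Henstock_Kurzweil_Integration.integral_nonneg set_lebesgue_integral_eq_integral(1)[OF Dint]) auto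
    ultimately show ?thesis by simp
  qed
  then show "\<exists>N. \<forall>n\<ge>N. norm (integral {a..b} (\<lambda>t. \<bar>(V t - V (t - h n)) / h n - \<gamma> t\<bar>) - 0) < e" by blast
qed

section \<open>Bochner measurable functions\<close>

lemma borel_measurable_lebesgue_on_AE:
  fixes f g :: "'a::euclidean_space \<Rightarrow> real"
  assumes f: "f \<in> borel_measurable (lebesgue_on S)" and S: "S \<in> sets lebesgue"
    and ae: "AE x in lebesgue_on S. f x = g x"
  shows "g \<in> borel_measurable (lebesgue_on S)"
proof -
  have "AE x in lebesgue. x \<in> S \<longrightarrow> f x = g x"
    using ae S by (subst (asm) AE_restrict_space_iff) auto
  then have "AE x in lebesgue. (if x \<in> S then f x else 0) = (if x \<in> S then g x else 0)"
    by eventually_elim auto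
  from borel_measurable_AE[OF borel_measurable_if_I[OF f S] this] show ?thesis
    by (rule borel_measurable_if_D)
qed

lemma borel_measurable_lebesgue_on_AE_lim:
  fixes f :: "nat \<Rightarrow> 'a::euclidean_space \<Rightarrow> real"
  assumes f: "\<And>n. f n \<in> borel_measurable (lebesgue_on S)" and S: "S \<in> sets lebesgue"
    and lim: "AE x in lebesgue_on S. (\<lambda>n. f n x) \<longlonglongrightarrow> g x"
  shows "g \<in> borel_measurable (lebesgue_on S)"
proof (rule borel_measurable_lebesgue_on_AE[OF _ S])
  show "(\<lambda>x. lim (\<lambda>n. f n x)) \<in> borel_measurable (lebesgue_on S)"
    by (rule borel_measurable_lim_metric[OF f])
  show "AE x in lebesgue_on S. lim (\<lambda>n. f n x) = g x"
    using lim by eventually_elim (rule limI)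
qed

lemma AE_lebesgue_on_subset:
  assumes "AE x in lebesgue_on S. P x" "T \<subseteq> S" "S \<in> sets lebesgue" "T \<in> sets lebesgue"
  shows "AE x in lebesgue_on T. P x"
proof -
  have "AE x in lebesgue. x \<in> S \<longrightarrow> P x" using assms by (subst (asm) AE_restrict_space_iff) auto
  then have "AE x in lebesgue. x \<in> T \<longrightarrow> P x" by eventually_elim (use assms in auto)
  then show ?thesis using assms by (subst AE_restrict_space_iff) auto
qed

text \<open>The time spaces live on open intervals, the integrals of the estimates on closed ones;
  the two end points are negligible.\<close>

lemma AE_lebesgue_on_Icc:
  assumes "AE t in lebesgue_on {a<..<b::real}. P t"
  shows "AE t in lebesgue_on {a..b}. P t"
proof -
  have "AE t in lebesgue. t \<in> {a<..<b} \<longrightarrow> P t" using assms by (subst (asm) AE_restrict_space_iff) auto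
  moreover have "AE t in lebesgue. t \<notin> {a, b}"
    by (intro AE_not_in) (simp flip: negligible_iff_null_sets)
  ultimately have "AE t in lebesgue. t \<in> {a..b} \<longrightarrow> P t" by eventually_elim auto
  then show ?thesis by (subst AE_restrict_space_iff) auto
qed

lemma borel_measurable_lebesgue_on_Icc:
  fixes f :: "real \<Rightarrow> real"
  assumes "f \<in> borel_measurable (lebesgue_on {a<..<b})"
  shows "f \<in> borel_measurable (lebesgue_on {a..b})"
proof (rule borel_measurable_if_D, rule borel_measurable_AE[OF borel_measurable_if_I[OF assms]])
  have "AE t in lebesgue. t \<notin> {a, b}"
    by (intro AE_not_in) (simp flip: negligible_iff_null_sets)
  then show "AE x in lebesgue. (if x \<in> {a<..<b} then f x else 0) = (if x \<in> {a..b} then f x else 0)"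
    by eventually_elim auto
qed auto

lemma integrable_lebesgue_on_Icc:
  fixes f :: "real \<Rightarrow> real"
  assumes "integrable (lebesgue_on {a<..<b}) f"
  shows "integrable (lebesgue_on {a..b}) f"
proof -
  have "integrable lebesgue (\<lambda>x. indicator {a<..<b} x *\<^sub>R f x)"
    using assms by (subst (asm) integrable_restrict_space) auto
  moreover have "(\<lambda>x. indicator {a..b} x *\<^sub>R f x) \<in> borel_measurable lebesgue"
  proof -
    have "(\<lambda>x. if x \<in> {a..b} then f x else 0) \<in> borel_measurable lebesgue"
      by (rule borel_measurable_if_I[OF borel_measurable_lebesgue_on_Icc[OF borel_measurable_integrable[OF assms]]]) auto
    moreover have "(\<lambda>x. indicator {a..b} x *\<^sub>R f x) = (\<lambda>x. if x \<in> {a..b} then f x else 0)"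
      by (auto simp: fun_eq_iff)
    ultimately show ?thesis by simp
  qed
  moreover have "AE x in lebesgue. indicator {a<..<b} x *\<^sub>R f x = indicator {a..b} x *\<^sub>R f x"
  proof -
    have "AE t in lebesgue. t \<notin> {a, b}"
      by (intro AE_not_in) (simp flip: negligible_iff_null_sets)
    then show ?thesis by eventually_elim (auto simp: indicator_def)
  qed
  ultimately have "integrable lebesgue (\<lambda>x. indicator {a..b} x *\<^sub>R f x)"
    by (rule integrable_cong_AE_imp)
  then show ?thesis by (subst integrable_restrict_space) auto
qed

lemma integrable_lebesgue_on_subset:
  fixes f :: "'a::euclidean_space \<Rightarrow> real"
  assumes "integrable (lebesgue_on S) f" "T \<subseteq> S" "S \<in> sets lebesgue" "T \<in> sets lebesgue"
  shows "integrable (lebesgue_on T) f"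
  using assms set_integrable_subset[of lebesgue S f T]
  by (simp add: set_integrable_def integrable_restrict_space)

section \<open>Strong measurability\<close>

text \<open>A simple function has finitely many values, and on each level set the composition is one
  of the measurable functions \<open>F v\<close>; joint measurability of F never arises.\<close>

lemma simple_function_compose_measurable:
  fixes F :: "'b \<Rightarrow> real \<Rightarrow> real"
  assumes s: "simple_function (lebesgue_on I) s" "s ` I \<subseteq> X"
    and F: "\<And>v. v \<in> X \<Longrightarrow> F v \<in> borel_measurable (lebesgue_on I)"
  shows "(\<lambda>t. F (s t) t) \<in> borel_measurable (lebesgue_on I)"
proof (rule measurable_compose_countable'[of "s ` I" F])
  have fin: "finite (s ` I)" using simple_functionD(1)[OF s(1)] by simp
  then show "countable (s ` I)" by (rule countable_finite)
  show "s \<in> measurable (lebesgue_on I) (count_space (s ` I))"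
    using fin simple_functionD(2)[OF s(1)] by (subst measurable_count_space_eq2) auto
qed (use F s(2) in auto)

text \<open>Simple approximations pass through F by a Lipschitz bound whose constant may depend on
  t. This dependence admits inner products with a second function of time.\<close>

lemma strongly_measurable_compose:
  fixes F :: "('a \<Rightarrow> real) \<Rightarrow> real \<Rightarrow> real"
  assumes w: "strongly_measurable I X N w" and I: "I \<in> sets lebesgue"
    and F: "\<And>v. v \<in> X \<Longrightarrow> F v \<in> borel_measurable (lebesgue_on I)"
    and Lip: "AE t in lebesgue_on I. \<forall>v\<in>X. \<forall>v'\<in>X. \<bar>F v t - F v' t\<bar> \<le> C t * N (\<lambda>x. v x - v' x)"
  shows "(\<lambda>t. F (w t) t) \<in> borel_measurable (lebesgue_on I)"
proof -
  obtain s where s: "\<And>n. simple_function (lebesgue_on I) (s n)" "\<And>n. s n ` I \<subseteq> X"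
    and lim: "AE t in lebesgue_on I. (\<lambda>n. N (\<lambda>x. w t x - s n t x)) \<longlonglongrightarrow> 0"
    and wX: "AE t in lebesgue_on I. w t \<in> X"
    using w unfolding strongly_measurable_def by auto
  show ?thesis
  proof (rule borel_measurable_lebesgue_on_AE_lim[OF _ I])
    show "(\<lambda>t. F (s n t) t) \<in> borel_measurable (lebesgue_on I)" for n
      by (rule simple_function_compose_measurable[OF s F])
    have "AE t in lebesgue_on I. t \<in> I" by (rule AE_I2) simp
    with lim wX Lip show "AE t in lebesgue_on I. (\<lambda>n. F (s n t) t) \<longlonglongrightarrow> F (w t) t"
    proof eventually_elim
      case (elim t)
      show ?case
      proof (rule LIM_zero_cancel, rule Lim_null_comparison)
        show "\<forall>\<^sub>F n in sequentially. norm (F (s n t) t - F (w t) t) \<le> C t * N (\<lambda>x. w t x - s n t x)"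
        proof (intro always_eventually allI)
          fix n
          have "s n t \<in> X" using s(2) elim(4) by blast
          then have "\<bar>F (w t) t - F (s n t) t\<bar> \<le> C t * N (\<lambda>x. w t x - s n t x)"
            using elim(2,3) by blast
          then show "norm (F (s n t) t - F (w t) t) \<le> C t * N (\<lambda>x. w t x - s n t x)"
            by (simp add: abs_minus_commute)
        qed
        show "(\<lambda>n. C t * N (\<lambda>x. w t x - s n t x)) \<longlonglongrightarrow> 0"
          using tendsto_mult_right_zero[OF elim(1)] .
      qed
    qed
  qed
qed

lemma strongly_measurable_L2_norm:
  assumes "strongly_measurable I (L2_space S) (L2_norm S) w" "I \<in> sets lebesgue"
  shows "(\<lambda>t. L2_norm S (w t)) \<in> borel_measurable (lebesgue_on I)"
  by (rule strongly_measurable_compose[OF assms, where F = "\<lambda>v t. L2_norm S v" and C = "\<lambda>t. 1"])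
    (use L2_norm_triangle_rev in auto)

text \<open>Strong measurability gives convergence almost everywhere only. Setting the
  approximations to zero where their norm exceeds twice that of w bounds the squared error by nine
  times the squared norm of w.\<close>

lemma Bochner_L2_simple_approx:
  fixes S :: "'a::euclidean_space set" and w :: "real \<Rightarrow> 'a \<Rightarrow> real"
  assumes w: "w \<in> Bochner_L2 I (L2_space S) (L2_norm S)" and I: "I \<in> sets lebesgue" and e: "\<epsilon> > 0"
  obtains s where "simple_function (lebesgue_on I) s" "s ` I \<subseteq> L2_space S"
    "integrable (lebesgue_on I) (\<lambda>t. (L2_norm S (\<lambda>x. w t x - s t x))\<^sup>2)"
    "(LINT t|lebesgue_on I. (L2_norm S (\<lambda>x. w t x - s t x))\<^sup>2) < \<epsilon>"
proof -
  let ?N = "L2_norm S" and ?X = "L2_space S" and ?M = "lebesgue_on I"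
  have sm: "strongly_measurable I ?X ?N w" and wint: "integrable ?M (\<lambda>t. (?N (w t))\<^sup>2)"
    using w by (auto simp: Bochner_L2_def)
  obtain s where s: "\<And>n. simple_function ?M (s n)" "\<And>n. s n ` I \<subseteq> ?X"
    and lim: "AE t in ?M. (\<lambda>n. ?N (\<lambda>x. w t x - s n t x)) \<longlonglongrightarrow> 0"
    and wX: "AE t in ?M. w t \<in> ?X"
    using sm unfolding strongly_measurable_def by auto
  \<comment> \<open>The factor 2 leaves room: where the norm of \<open>w t\<close> is positive, the
    norms converge to it and the cut becomes inactive; where it is zero, the cut function has norm
    zero too.\<close>
  define q where "q n t = (if ?N (s n t) \<le> 2 * ?N (w t) then s n t else (\<lambda>x. 0))" for n t
  have sN: "(\<lambda>t. ?N (s n t)) \<in> borel_measurable ?M" for n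
    by (rule simple_function_compose_measurable[OF s, where F = "\<lambda>v t. ?N v"]) auto
  have wN: "(\<lambda>t. ?N (w t)) \<in> borel_measurable ?M" by (rule strongly_measurable_L2_norm[OF sm I])
  have q: "simple_function ?M (q n)" for n
    unfolding q_def
    by (rule simple_function_If[OF s(1) simple_function_const]) (use sN[of n] wN in measurable)
  have qX: "q n ` I \<subseteq> ?X" for n using s(2)[of n] by (auto simp: q_def)
  have meas: "(\<lambda>t. ?N (\<lambda>x. w t x - q n t x)) \<in> borel_measurable ?M" for n
  proof (rule strongly_measurable_compose[OF sm I, where F = "\<lambda>v t. ?N (\<lambda>x. v x - q n t x)" and C = "\<lambda>t. 1"])
    show "(\<lambda>t. ?N (\<lambda>x. v x - q n t x)) \<in> borel_measurable ?M" if "v \<in> ?X" for v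
      by (rule simple_function_compose_measurable[OF q qX, where F = "\<lambda>p t. ?N (\<lambda>x. v x - p x)"]) auto
    show "AE t in ?M. \<forall>v\<in>?X. \<forall>v'\<in>?X.
        \<bar>?N (\<lambda>x. v x - q n t x) - ?N (\<lambda>x. v' x - q n t x)\<bar> \<le> 1 * ?N (\<lambda>x. v x - v' x)"
    proof (rule AE_I2, intro ballI)
      fix t and v v' :: "'a \<Rightarrow> real" assume *: "t \<in> space ?M" "v \<in> ?X" "v' \<in> ?X"
      have "q n t \<in> ?X" using qX[of n] *(1) by auto
      from L2_norm_triangle_rev[OF L2_space_diff[OF *(2) this] L2_space_diff[OF *(3) this]]
      show "\<bar>?N (\<lambda>x. v x - q n t x) - ?N (\<lambda>x. v' x - q n t x)\<bar> \<le> 1 * ?N (\<lambda>x. v x - v' x)"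
        by simp
    qed
  qed
  have inI: "AE t in ?M. t \<in> I" by (rule AE_I2) simp
  have bound: "AE t in ?M. norm ((?N (\<lambda>x. w t x - q n t x))\<^sup>2) \<le> 9 * (?N (w t))\<^sup>2" for n
    using wX inI
  proof eventually_elim
    case (elim t)
    have qt: "q n t \<in> ?X" using qX[of n] elim(2) by blast
    have "?N (q n t) \<le> 2 * ?N (w t)"
      by (auto simp: q_def L2_norm_def[of S "\<lambda>x. 0"])
    moreover have "?N (\<lambda>x. w t x - q n t x) \<le> ?N (w t) + ?N (q n t)"
      using L2_norm_triangle[OF elim(1) L2_space_uminus[OF qt]] L2_norm_uminus[of S "q n t"] by simp
    ultimately have "?N (\<lambda>x. w t x - q n t x) \<le> 3 * ?N (w t)" by linarith
    then have "(?N (\<lambda>x. w t x - q n t x))\<^sup>2 \<le> (3 * ?N (w t))\<^sup>2" by (intro power_mono) auto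
    then show ?case by (simp add: power_mult_distrib)
  qed
  have conv: "AE t in ?M. (\<lambda>n. (?N (\<lambda>x. w t x - q n t x))\<^sup>2) \<longlonglongrightarrow> 0"
    using lim wX inI
  proof eventually_elim
    case (elim t)
    have sX: "s n t \<in> ?X" for n using s(2) elim(3) by blast
    have "(\<lambda>n. ?N (\<lambda>x. w t x - q n t x)) \<longlonglongrightarrow> 0"
    proof (cases "?N (w t) = 0")
      case True
      have "?N (\<lambda>x. w t x - q n t x) = 0" for n
      proof -
        have qt: "q n t \<in> ?X" using qX[of n] elim(3) by blast
        have "?N (q n t) \<le> 2 * ?N (w t)"
          by (auto simp: q_def L2_norm_def[of S "\<lambda>x. 0"])
        moreover have "?N (\<lambda>x. w t x - q n t x) \<le> ?N (w t) + ?N (q n t)"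
          using L2_norm_triangle[OF elim(2) L2_space_uminus[OF qt]] L2_norm_uminus[of S "q n t"] by simp
        ultimately show ?thesis using True L2_norm_nonneg[of S "\<lambda>x. w t x - q n t x"] by linarith
      qed
      then show ?thesis by simp
    next
      case False
      then have pos: "?N (w t) > 0" using L2_norm_nonneg[of S "w t"] by linarith
      have "(\<lambda>n. ?N (s n t)) \<longlonglongrightarrow> ?N (w t)"
      proof (rule L2_norm_tendsto)
        show "(\<lambda>n. ?N (\<lambda>x. s n t x - w t x)) \<longlonglongrightarrow> 0"
          using elim(1) by (simp add: L2_norm_minus_commute[of S "w t"])
      qed (use sX elim(2) in auto)
      then have "\<forall>\<^sub>F n in sequentially. ?N (s n t) < 2 * ?N (w t)"
        using pos by (intro order_tendstoD(2)) auto
      then have "\<forall>\<^sub>F n in sequentially. ?N (\<lambda>x. w t x - s n t x) = ?N (\<lambda>x. w t x - q n t x)"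
        by eventually_elim (simp add: q_def)
      with elim(1) show ?thesis by (rule Lim_transform_eventually)
    qed
    from tendsto_power[OF this, of 2] show ?case by simp
  qed
  have meas2: "(\<lambda>t. (?N (\<lambda>x. w t x - q n t x))\<^sup>2) \<in> borel_measurable ?M" for n
    using meas[of n] by measurable
  have wint9: "integrable ?M (\<lambda>t. 9 * (?N (w t))\<^sup>2)" using wint by simp
  have "(\<lambda>n. LINT t|?M. (?N (\<lambda>x. w t x - q n t x))\<^sup>2) \<longlonglongrightarrow> (LINT t|?M. 0)"
    by (rule integral_dominated_convergence[OF _ meas2 wint9 conv bound]) simp
  then have "\<forall>\<^sub>F n in sequentially. (LINT t|?M. (?N (\<lambda>x. w t x - q n t x))\<^sup>2) < \<epsilon>"
    using e by (intro order_tendstoD(2)) auto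
  then obtain n where n: "(LINT t|?M. (?N (\<lambda>x. w t x - q n t x))\<^sup>2) < \<epsilon>"
    by (auto simp: eventually_sequentially)
  moreover have "integrable ?M (\<lambda>t. (?N (\<lambda>x. w t x - q n t x))\<^sup>2)"
    by (rule Bochner_Integration.integrable_bound[OF wint9 meas2]) (use bound[of n] in auto)
  ultimately show ?thesis using q[of n] qX[of n] by (intro that)
qed

lemma strongly_measurable_subset:
  assumes "strongly_measurable I X N w" "J \<subseteq> I" "I \<in> sets lebesgue" "J \<in> sets lebesgue"
  shows "strongly_measurable J X N w"
proof -
  obtain s where s: "\<And>n. simple_function (lebesgue_on I) (s n)" "\<And>n. s n ` I \<subseteq> X"
    and lim: "AE t in lebesgue_on I. (\<lambda>n. N (\<lambda>x. w t x - s n t x)) \<longlonglongrightarrow> 0"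
    and wX: "AE t in lebesgue_on I. w t \<in> X"
    using assms(1) unfolding strongly_measurable_def by auto
  have "simple_function (lebesgue_on J) (s n)" for n
    unfolding simple_function_def
  proof (intro conjI ballI)
    have "finite (s n ` I)" using simple_functionD(1)[OF s(1)] by simp
    then show "finite (s n ` space (lebesgue_on J))"
      by (rule finite_subset[rotated]) (use assms(2) in auto)
    fix v
    have "s n -` {v} \<inter> I \<in> sets lebesgue"
      using simple_functionD(2)[OF s(1), of n "{v}"] assms(3) by (simp add: sets_restrict_space_iff)
    then have "(s n -` {v} \<inter> I) \<inter> J \<in> sets lebesgue" using assms(4) by blast
    moreover have "(s n -` {v} \<inter> I) \<inter> J = s n -` {v} \<inter> J" using assms(2) by blast
    ultimately show "s n -` {v} \<inter> space (lebesgue_on J) \<in> sets (lebesgue_on J)"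
      using assms(4) by (simp add: sets_restrict_space_iff)
  qed
  moreover have "s n ` J \<subseteq> X" for n using s(2)[of n] assms(2) by blast
  ultimately show ?thesis
    unfolding strongly_measurable_def
    using AE_lebesgue_on_subset[OF lim assms(2-4)] AE_lebesgue_on_subset[OF wX assms(2-4)] by blast
qed

lemma Bochner_L2_subset:
  assumes "w \<in> Bochner_L2 I X N" "J \<subseteq> I" "I \<in> sets lebesgue" "J \<in> sets lebesgue"
  shows "w \<in> Bochner_L2 J X N"
  using assms strongly_measurable_subset[OF _ assms(2-4)] integrable_lebesgue_on_subset[OF _ assms(2-4)]
  by (auto simp: Bochner_L2_def)

section \<open>A smooth step function\<close>

text \<open>H is the normalised primitive of a bump on [0, 1]. Scaled copies H (n (r - a)) serve as
  cut-offs in time, and their derivatives form an approximate identity.\<close>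

lemma smooth_step:
  obtains H :: "real \<Rightarrow> real" and \<rho> :: "real \<Rightarrow> real"
  where "\<And>k. C_k k H" "\<And>x. (H has_real_derivative \<rho> x) (at x)"
    "\<And>x. x \<le> 0 \<Longrightarrow> H x = 0" "\<And>x. x \<ge> 1 \<Longrightarrow> H x = 1" "\<And>x. 0 \<le> H x" "\<And>x. H x \<le> 1"
    "continuous_on UNIV \<rho>" "\<And>x. x \<notin> {0..1} \<Longrightarrow> \<rho> x = 0" "(LINT x|lborel. \<rho> x) = 1"
proof -
  define \<beta> where "\<beta> = box_bump (0::real) 1"
  have \<beta>C: "C_k k \<beta>" for k unfolding \<beta>_def by (rule C_k_box_bump)
  have \<beta>cont: "continuous_on S \<beta>" for S by (rule C_k_continuous[OF \<beta>C[of 0]])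
  have \<beta>0: "\<beta> x = 0" if "x \<le> 0 \<or> x \<ge> 1" for x
    unfolding \<beta>_def using that by (intro box_bump_eq_0) auto
  have \<beta>nn: "0 \<le> \<beta> x" for x unfolding \<beta>_def by (rule box_bump_bounds)
  have int: "\<beta> integrable_on {x..y}" for x y by (rule integrable_continuous_interval[OF \<beta>cont])
  define c where "c = integral {0..1} \<beta>"
  have c: "c > 0"
  proof -
    have "c \<noteq> 0"
    proof
      assume "c = 0"
      then have "\<beta> (1/2) = 0"
        using integral_eq_0_iff[OF \<beta>cont[of "{0..1}"]] \<beta>nn by (auto simp: c_def)
      moreover have "\<beta> (1/2) > 0" unfolding \<beta>_def by (rule box_bump_pos) auto
      ultimately show False by simp
    qed
    moreover have "c \<ge> 0" unfolding c_def using int \<beta>nn by (intro Henstock_Kurzweil_Integration.integral_nonneg) auto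
    ultimately show ?thesis by simp
  qed
  \<comment> \<open>Integration starts at -1 to make every x \<ge> 0 an interior point, where the
    derivative is two-sided.\<close>
  define H where "H x = integral {-1..x} \<beta> / c" for x
  have H0: "H x = 0" if "x \<le> 0" for x
  proof -
    have "integral {-1..x} \<beta> = integral {-1..x} (\<lambda>x. 0)"
      using that \<beta>0 by (intro Henstock_Kurzweil_Integration.integral_cong) auto
    then show ?thesis by (simp add: H_def)
  qed
  have i10: "integral {-1..0} \<beta> = 0" using H0[of 0] c by (simp add: H_def)
  have H1: "H x = 1" if "x \<ge> 1" for x
  proof -
    have "integral {1..x} \<beta> = integral {1..x} (\<lambda>x. 0)"
      using that \<beta>0 by (intro Henstock_Kurzweil_Integration.integral_cong) auto
    then have "integral {1..x} \<beta> = 0" by simp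
    moreover have "integral {-1..0} \<beta> + integral {0..x} \<beta> = integral {-1..x} \<beta>"
      using that int by (intro Henstock_Kurzweil_Integration.integral_combine) auto
    moreover have "integral {0..1} \<beta> + integral {1..x} \<beta> = integral {0..x} \<beta>"
      using that int by (intro Henstock_Kurzweil_Integration.integral_combine) auto
    ultimately show ?thesis using c i10 by (simp add: H_def c_def)
  qed
  have Hmono: "H x \<le> H y" if "x \<le> y" for x y
    unfolding H_def using c that int \<beta>nn by (intro divide_right_mono integral_subset_le) auto
  have Hnn: "0 \<le> H x" for x using Hmono[of "min x 0" x] H0[of "min x 0"] by simp
  have Hle: "H x \<le> 1" for x using Hmono[of x "max x 1"] H1[of "max x 1"] by simp
  have Hder: "(H has_real_derivative \<beta> x / c) (at x)" for x
  proof (cases "x < 0")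
    case True
    have "((\<lambda>x. 0) has_real_derivative 0) (at x)" by simp
    then have "(H has_real_derivative 0) (at x)"
      by (rule has_field_derivative_transform_within_open[of _ _ _ "{..<0}"]) (use True H0 in auto)
    then show ?thesis using True \<beta>0 by simp
  next
    case False
    have "((\<lambda>x. integral {-1..x} \<beta>) has_real_derivative \<beta> x) (at x within {-1..x+1})"
      using False by (intro integral_has_real_derivative[OF \<beta>cont]) auto
    moreover have "at x within {-1..x+1} = at x" using False by (intro at_within_Icc_at) auto
    ultimately have "((\<lambda>x. integral {-1..x} \<beta>) has_real_derivative \<beta> x) (at x)" by simp
    then show ?thesis unfolding H_def by (rule DERIV_cdivide)
  qed
  have HC: "C_k k H" for k
  proof (cases k)
    case 0
    then show ?thesis using Hder by (auto simp: C_k.simps intro!: continuous_at_imp_continuous_on DERIV_isCont)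
  next
    case (Suc j)
    show ?thesis unfolding Suc
    proof (rule C_k_SucI)
      show "(H has_derivative (\<lambda>b. \<beta> x / c * b)) (at x)" for x
        using Hder unfolding has_field_derivative_def .
      show "C_k j (\<lambda>x. \<beta> x / c * b)" if "b \<in> Basis" for b
        using C_k_cmult[OF \<beta>C, of j "inverse c * b"] by (simp add: divide_inverse mult.commute mult.left_commute)
    qed
  qed
  have "(LINT x|lborel. \<beta> x / c) = 1"
  proof -
    have "(LINT x|lborel. \<beta> x / c) = (LINT x|lebesgue. \<beta> x / c)"
      using borel_measurable_continuous_onI[OF \<beta>cont]
      by (intro integral_completion[symmetric]) (auto intro: borel_measurable_divide)
    also have "\<dots> = (LINT x|lebesgue_on {0..1}. \<beta> x / c)"
      using \<beta>0 by (intro integral_lebesgue_on_zero_outside[symmetric]) auto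
    also have "\<dots> = integral {0..1} (\<lambda>x. \<beta> x / c)"
    proof (rule lebesgue_integral_eq_integral)
      show "integrable (lebesgue_on {0..1}) (\<lambda>x. \<beta> x / c)"
        using absolutely_integrable_continuous_real[OF \<beta>cont, of 0 1]
        by (simp add: absolutely_integrable_on_iff_integrable)
    qed auto
    also have "\<dots> = 1" using c by (simp add: c_def)
    finally show ?thesis .
  qed
  then show ?thesis
    using HC Hder H0 H1 Hnn Hle \<beta>cont \<beta>0
    by (intro that[of H "\<lambda>x. \<beta> x / c"]) (auto intro!: continuous_on_divide simp: c less_imp_neq[OF c, symmetric])
qed

section \<open>Integrating increments of an evolution\<close>

text \<open>Isolates what the limit in difference quotients uses: continuity in L^2 and the weak
  time derivative. Gradients and the equation enter later, through the inequality that is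
  integrated.\<close>

locale evolution = bounded_open \<Omega> for \<Omega> :: "'a::euclidean_space set" +
  fixes u g :: "real \<Rightarrow> 'a \<Rightarrow> real"
  assumes u_L2: "t \<ge> 0 \<Longrightarrow> u t \<in> L2_space \<Omega>"
    and u_cont: "t \<ge> 0 \<Longrightarrow> ((\<lambda>s. L2_norm \<Omega> (\<lambda>x. u s x - u t x)) \<longlongrightarrow> 0) (at t within {0..})"
    and u_deriv: "has_time_deriv \<Omega> u g"
begin

lemma continuous_on_inner_u:
  assumes "v \<in> L2_space \<Omega>"
  shows "continuous_on {0..} (\<lambda>t. L2_inner \<Omega> (u t) v)"
  unfolding continuous_on_def
proof
  fix t :: real assume "t \<in> {0..}"
  then show "((\<lambda>t. L2_inner \<Omega> (u t) v) \<longlongrightarrow> L2_inner \<Omega> (u t) v) (at t within {0..})"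
    by (intro L2_inner_tendsto u_cont u_L2 assms) (auto simp: eventually_at_filter u_L2)
qed

lemma continuous_on_norm_u: "continuous_on {0..} (\<lambda>t. L2_norm \<Omega> (u t))"
  unfolding continuous_on_def
proof
  fix t :: real assume "t \<in> {0..}"
  then show "((\<lambda>t. L2_norm \<Omega> (u t)) \<longlongrightarrow> L2_norm \<Omega> (u t)) (at t within {0..})"
    by (intro L2_norm_tendsto u_cont u_L2) (auto simp: eventually_at_filter u_L2)
qed

lemma g_Bochner: "T > 0 \<Longrightarrow> g \<in> Bochner_L2 {0<..<T} (L2_space \<Omega>) (L2_norm \<Omega>)"
  using u_deriv by (auto simp: has_time_deriv_def)

lemma AE_g_L2: "AE t in lebesgue_on {0..T}. g t \<in> L2_space \<Omega>"
proof -
  have "AE t in lebesgue_on {0<..<max T 1}. g t \<in> L2_space \<Omega>"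
    using g_Bochner[of "max T 1"] by (auto simp: Bochner_L2_def strongly_measurable_def)
  from AE_lebesgue_on_subset[OF AE_lebesgue_on_Icc[OF this], of "{0..T}"] show ?thesis by auto
qed

lemma integrable_norm_g: "integrable (lebesgue_on {0..T}) (\<lambda>t. (L2_norm \<Omega> (g t))\<^sup>2)"
proof -
  have "integrable (lebesgue_on {0<..<max T 1}) (\<lambda>t. (L2_norm \<Omega> (g t))\<^sup>2)"
    using g_Bochner[of "max T 1"] by (auto simp: Bochner_L2_def)
  from integrable_lebesgue_on_subset[OF integrable_lebesgue_on_Icc[OF this], of "{0..T}"] show ?thesis by auto
qed

lemma measurable_norm_g: "(\<lambda>t. L2_norm \<Omega> (g t)) \<in> borel_measurable (lebesgue_on {0..T})"
proof -
  have "(\<lambda>t. L2_norm \<Omega> (g t)) \<in> borel_measurable (lebesgue_on {0<..<max T 1})"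
    using g_Bochner[of "max T 1"] by (intro strongly_measurable_L2_norm) (auto simp: Bochner_L2_def)
  from measurable_restrict_mono[OF borel_measurable_lebesgue_on_Icc[OF this], of "{0..T}"]
  show ?thesis by auto
qed

lemma norm_g_L2: "(\<lambda>t. L2_norm \<Omega> (g t)) \<in> L2_space {0..T}"
  using integrable_norm_g measurable_norm_g by (auto simp: L2_space_def)

lemma measurable_inner_g:
  assumes v: "v \<in> L2_space \<Omega>"
  shows "(\<lambda>t. L2_inner \<Omega> v (g t)) \<in> borel_measurable (lebesgue_on {0..T})"
proof -
  have "(\<lambda>t. L2_inner \<Omega> v (g t)) \<in> borel_measurable (lebesgue_on {0<..<max T 1})"
  proof (rule strongly_measurable_compose[where F = "\<lambda>q t. L2_inner \<Omega> v q" and C = "\<lambda>t. L2_norm \<Omega> v"])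
    show "strongly_measurable {0<..<max T 1} (L2_space \<Omega>) (L2_norm \<Omega>) g"
      using g_Bochner[of "max T 1"] by (auto simp: Bochner_L2_def)
    show "AE t in lebesgue_on {0<..<max T 1}. \<forall>q\<in>L2_space \<Omega>. \<forall>q'\<in>L2_space \<Omega>.
        \<bar>L2_inner \<Omega> v q - L2_inner \<Omega> v q'\<bar> \<le> L2_norm \<Omega> v * L2_norm \<Omega> (\<lambda>x. q x - q' x)"
      using L2_Cauchy_Schwarz[OF v L2_space_diff] v by (intro AE_I2 ballI) (simp flip: L2_inner_diff_right)
  qed auto
  from measurable_restrict_mono[OF borel_measurable_lebesgue_on_Icc[OF this], of "{0..T}"]
  show ?thesis by auto
qed

lemma integrable_inner_g:
  assumes v: "v \<in> L2_space \<Omega>"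
  shows "integrable (lebesgue_on {0..T}) (\<lambda>t. L2_inner \<Omega> v (g t))"
proof (rule Bochner_Integration.integrable_bound[OF _ measurable_inner_g[OF v]])
  interpret finite_measure "lebesgue_on {0..T}" by (rule finite_measure_lebesgue_on) auto
  have one: "(\<lambda>t. 1::real) \<in> L2_space {0..T}" by (auto simp: L2_space_def)
  have "integrable (lebesgue_on {0..T}) (\<lambda>t. 1 * L2_norm \<Omega> (g t))"
    by (rule integrable_L2_mult[OF one norm_g_L2])
  then show "integrable (lebesgue_on {0..T}) (\<lambda>t. L2_norm \<Omega> v * L2_norm \<Omega> (g t))" by simp
  show "AE t in lebesgue_on {0..T}. norm (L2_inner \<Omega> v (g t)) \<le> norm (L2_norm \<Omega> v * L2_norm \<Omega> (g t))"
    using AE_g_L2 by eventually_elim (simp add: L2_Cauchy_Schwarz[OF v])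
qed

lemma absolutely_integrable_inner_g:
  assumes "v \<in> L2_space \<Omega>" "0 \<le> a"
  shows "(\<lambda>t. L2_inner \<Omega> v (g t)) absolutely_integrable_on {a..b}"
  using integrable_lebesgue_on_subset[OF integrable_inner_g[OF assms(1), of b], of "{a..b}"] assms(2)
  by (simp add: absolutely_integrable_on_iff_integrable)

text \<open>
  The weak formulation is tested with smooth approximations of the indicator of \<open>(a, b]\<close>, whose
  derivatives are approximate identities at \<open>a\<close> and \<open>b\<close>.
\<close>

lemma inner_u_increment:
  assumes v: "v \<in> L2_space \<Omega>" and ab: "0 < a" "a \<le> b"
  shows "L2_inner \<Omega> v (u b) - L2_inner \<Omega> v (u a) = integral {a..b} (\<lambda>t. L2_inner \<Omega> v (g t))"
proof -
  obtain H \<rho> :: "real \<Rightarrow> real" where H: "\<And>k. C_k k H" "\<And>x. (H has_real_derivative \<rho> x) (at x)"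
    "\<And>x. x \<le> 0 \<Longrightarrow> H x = 0" "\<And>x. x \<ge> 1 \<Longrightarrow> H x = 1" "\<And>x. 0 \<le> H x" "\<And>x. H x \<le> 1"
    "continuous_on UNIV \<rho>" "\<And>x. x \<notin> {0..1} \<Longrightarrow> \<rho> x = 0" "(LINT x|lborel. \<rho> x) = 1"
    by (rule smooth_step) (rule that)
  \<comment> \<open>Constant continuation to negative times makes V continuous on the whole
    line.\<close>
  define V where "V r = L2_inner \<Omega> (u (max 0 r)) v" for r
  have V: "continuous_on UNIV V"
  proof -
    have "continuous_on UNIV ((\<lambda>t. L2_inner \<Omega> (u t) v) \<circ> (\<lambda>r. max 0 r))"
      by (intro continuous_on_compose continuous_intros continuous_on_subset[OF continuous_on_inner_u[OF v]]) auto
    then show ?thesis by (simp add: o_def V_def[abs_def])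
  qed
  \<comment> \<open>Both transitions lie within 1/n to the right of a and b, so the support stays in
    [a, b + 1] and hence in the open half-line.\<close>
  define \<phi> where "\<phi> n r = H (real n * (r - a)) - H (real n * (r - b))" for n r
  define \<phi>' where "\<phi>' n r = real n * \<rho> (real n * (r - a)) - real n * \<rho> (real n * (r - b))" for n r
  have \<phi>D: "(\<phi> n has_real_derivative \<phi>' n r) (at r)" for n r
    unfolding \<phi>_def[abs_def] \<phi>'_def
    by (auto intro!: derivative_eq_intros DERIV_chain2[OF H(2)])
  have test: "test_function {0<..} (\<phi> n)" if n: "n \<ge> 1" for n
  proof (rule test_function_supportI[of _ "{a..b+1}"])
    show "C_k k (\<phi> n)" for k
    proof -
      have "C_k k (\<lambda>r. H (r \<bullet> real n + (- real n * a)) - H (r \<bullet> real n + (- real n * b)))"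
        by (intro C_k_diff C_k_compose_affine H(1))
      then show ?thesis by (simp add: \<phi>_def[abs_def] algebra_simps)
    qed
    show "\<phi> n r = 0" if "r \<notin> {a..b+1}" for r
    proof (cases "r < a")
      case True
      then show ?thesis using ab n by (simp add: \<phi>_def H(3) mult_nonneg_nonpos)
    next
      case False
      then have "r - a \<ge> 1" "r - b \<ge> 1" using that ab by auto
      then have "real n * (r - a) \<ge> 1 * 1" "real n * (r - b) \<ge> 1 * 1"
        using n by (intro mult_mono; simp)+
      then show ?thesis by (simp add: \<phi>_def H(4))
    qed
  qed (use ab in auto)
  \<comment> \<open>A change of variable turns the concentrating kernel into a fixed one, with V
    evaluated ever closer to c.\<close>
  have \<rho>V: "(\<lambda>n. LINT r|lborel. real (Suc n) * \<rho> (real (Suc n) * (r - c)) * V r) \<longlonglongrightarrow> V c" for c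
  proof -
    have [measurable]: "\<rho> \<in> borel_measurable borel" "V \<in> borel_measurable borel"
      using H(7) V by (auto intro: borel_measurable_continuous_onI)
    have eq: "(LINT r|lborel. real (Suc n) * \<rho> (real (Suc n) * (r - c)) * V r)
        = (LINT x|lborel. \<rho> x * V (c + inverse (real (Suc n)) * x))" for n
    proof -
      have "(LINT r|lborel. real (Suc n) * \<rho> (real (Suc n) * (r - c)) * V r)
        = \<bar>inverse (real (Suc n))\<bar> *\<^sub>R (LINT x|lborel. real (Suc n) * \<rho> (real (Suc n) * ((c + inverse (real (Suc n)) * x) - c)) * V (c + inverse (real (Suc n)) * x))"
        by (rule lborel_integral_real_affine) simp
      also have "\<dots> = (LINT x|lborel. inverse (real (Suc n)) * (real (Suc n) * \<rho> (real (Suc n) * ((c + inverse (real (Suc n)) * x) - c)) * V (c + inverse (real (Suc n)) * x)))"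
        by simp
      also have "\<dots> = (LINT x|lborel. \<rho> x * V (c + inverse (real (Suc n)) * x))"
      proof (rule Bochner_Integration.integral_cong[OF refl])
        fix x
        have a: "real (Suc n) * ((c + inverse (real (Suc n)) * x) - c) = x" by (simp add: mult.assoc[symmetric] del: of_nat_Suc)
        show "inverse (real (Suc n)) * (real (Suc n) * \<rho> (real (Suc n) * ((c + inverse (real (Suc n)) * x) - c)) * V (c + inverse (real (Suc n)) * x))
            = \<rho> x * V (c + inverse (real (Suc n)) * x)"
          unfolding a by (simp add: mult.assoc[symmetric] del: of_nat_Suc)
      qed
      finally show ?thesis .
    qed
    have "continuous_on {c..c+1} V" by (rule continuous_on_subset[OF V]) auto
    then have "bounded (V ` {c..c+1})" by (intro compact_imp_bounded compact_continuous_image) auto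
    then obtain M where "\<forall>y\<in>V ` {c..c+1}. norm y \<le> M" unfolding bounded_iff by blast
    then have M: "\<bar>V x\<bar> \<le> M" if "x \<in> {c..c+1}" for x using that by auto
    \<comment> \<open>The integral of a non-integrable function is 0, so the value 1 settles
      integrability.\<close>
    have \<rho>int: "integrable lborel \<rho>" using H(9) not_integrable_integral_eq by fastforce
    have "(\<lambda>n. LINT x|lborel. \<rho> x * V (c + inverse (real (Suc n)) * x)) \<longlonglongrightarrow> (LINT x|lborel. \<rho> x * V c)"
    proof (rule integral_dominated_convergence[where w = "\<lambda>x. \<bar>\<rho> x\<bar> * M"])
      show "AE x in lborel. (\<lambda>n. \<rho> x * V (c + inverse (real (Suc n)) * x)) \<longlonglongrightarrow> \<rho> x * V c"
      proof (rule AE_I2, rule tendsto_mult[OF tendsto_const])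
        fix x :: real
        have "(\<lambda>n. c + inverse (real (Suc n)) * x) \<longlonglongrightarrow> c + 0 * x"
          by (intro tendsto_intros LIMSEQ_inverse_real_of_nat)
        then show "(\<lambda>n. V (c + inverse (real (Suc n)) * x)) \<longlonglongrightarrow> V c"
          by (intro continuous_on_tendsto_compose[OF V]) auto
      qed
      show "AE x in lborel. norm (\<rho> x * V (c + inverse (real (Suc n)) * x)) \<le> \<bar>\<rho> x\<bar> * M" for n
      proof (rule AE_I2)
        fix x
        show "norm (\<rho> x * V (c + inverse (real (Suc n)) * x)) \<le> \<bar>\<rho> x\<bar> * M"
        proof (cases "x \<in> {0..1}")
          case True
          have "inverse (real (Suc n)) * x \<le> 1 * 1" using True by (intro mult_mono) (auto simp: field_simps)
          then have "c + inverse (real (Suc n)) * x \<in> {c..c+1}" using True by auto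
          from M[OF this] show ?thesis by (simp add: abs_mult mult_left_mono)
        qed (simp add: H(8))
      qed
    qed (use \<rho>int in auto)
    then show ?thesis unfolding eq by (simp add: H(9))
  qed
  have lim1: "(\<lambda>n. LINT t|lebesgue_on {0<..}. deriv (\<phi> (Suc n)) t * L2_inner \<Omega> (u t) v) \<longlonglongrightarrow> V a - V b"
  proof -
    have "(LINT t|lebesgue_on {0<..}. deriv (\<phi> (Suc n)) t * L2_inner \<Omega> (u t) v)
      = (LINT r|lborel. real (Suc n) * \<rho> (real (Suc n) * (r - a)) * V r) - (LINT r|lborel. real (Suc n) * \<rho> (real (Suc n) * (r - b)) * V r)" for n
    proof -
      have int: "integrable lborel (\<lambda>r. real (Suc n) * \<rho> (real (Suc n) * (r - c)) * V r)" for c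
      proof -
        have "continuous_on UNIV (\<rho> \<circ> (\<lambda>r. real (Suc n) * (r - c)))"
          by (intro continuous_on_compose continuous_intros continuous_on_subset[OF H(7)]) auto
        then have cont: "continuous_on UNIV (\<lambda>r. real (Suc n) * \<rho> (real (Suc n) * (r - c)) * V r)"
          by (intro continuous_on_mult continuous_on_const V) (simp add: o_def)
        have "integrable lebesgue (\<lambda>r. real (Suc n) * \<rho> (real (Suc n) * (r - c)) * V r)"
        proof (rule compact_support_integrable[OF cont, of "{c..c+1}"])
          fix r assume r: "r \<notin> {c..c+1}"
          have "real (Suc n) * (r - c) \<notin> {0..1}"
          proof (cases "r < c")
            case True
            then have "real (Suc n) * (r - c) < 0" by (intro mult_pos_neg) auto
            then show ?thesis by auto
          next
            case False
            then have "1 * 1 < real (Suc n) * (r - c)" using r by (intro mult_le_less_imp_less) auto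
            then show ?thesis by auto
          qed
          then show "real (Suc n) * \<rho> (real (Suc n) * (r - c)) * V r = 0" by (simp add: H(8))
        qed auto
        then show ?thesis using cont by (subst (asm) integrable_completion) (auto intro: borel_measurable_continuous_onI)
      qed
      have zero: "\<phi>' (Suc n) r = 0" if "r \<notin> {0<..}" for r
      proof -
        have "real (Suc n) * (r - a) < 0" "real (Suc n) * (r - b) < 0"
          using that ab by (intro mult_pos_neg; simp)+
        then show ?thesis by (simp add: \<phi>'_def H(8))
      qed
      have "deriv (\<phi> (Suc n)) = \<phi>' (Suc n)" using DERIV_imp_deriv[OF \<phi>D] by (intro ext)
      then have "(LINT t|lebesgue_on {0<..}. deriv (\<phi> (Suc n)) t * L2_inner \<Omega> (u t) v)
          = (LINT t|lebesgue_on {0<..}. \<phi>' (Suc n) t * V t)"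
        by (intro Bochner_Integration.integral_cong) (auto simp: V_def)
      also have "\<dots> = (LINT t|lebesgue. \<phi>' (Suc n) t * V t)"
        by (rule integral_lebesgue_on_zero_outside) (use zero in auto)
      also have "\<dots> = (LINT t|lborel. \<phi>' (Suc n) t * V t)"
      proof (rule integral_completion)
        have "(\<lambda>t. real (Suc n) * \<rho> (real (Suc n) * (t - a)) * V t - real (Suc n) * \<rho> (real (Suc n) * (t - b)) * V t) \<in> borel_measurable lborel"
          using int[of a] int[of b] by (intro borel_measurable_diff borel_measurable_integrable)
        then show "(\<lambda>t. \<phi>' (Suc n) t * V t) \<in> borel_measurable lborel"
          by (simp add: \<phi>'_def algebra_simps)
      qed
      also have "\<dots> = (LINT t|lborel. real (Suc n) * \<rho> (real (Suc n) * (t - a)) * V t - real (Suc n) * \<rho> (real (Suc n) * (t - b)) * V t)"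
        by (simp add: \<phi>'_def algebra_simps)
      also have "\<dots> = (LINT r|lborel. real (Suc n) * \<rho> (real (Suc n) * (r - a)) * V r) - (LINT r|lborel. real (Suc n) * \<rho> (real (Suc n) * (r - b)) * V r)"
        by (rule Bochner_Integration.integral_diff[OF int int])
      finally show ?thesis .
    qed
    then show ?thesis using tendsto_diff[OF \<rho>V[of a] \<rho>V[of b]] by simp
  qed
  let ?\<gamma> = "\<lambda>t. L2_inner \<Omega> v (g t)"
  have lim2: "(\<lambda>n. LINT t|lebesgue_on {0<..}. \<phi> (Suc n) t * L2_inner \<Omega> (g t) v) \<longlonglongrightarrow> integral {a..b} ?\<gamma>"
  proof -
    let ?G = "\<lambda>t. indicator {0..b+1} t * ?\<gamma> t"
    have G: "integrable lebesgue ?G"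
      using integrable_inner_g[OF v, of "b+1"] by (subst (asm) integrable_restrict_space) auto
    have eq: "(LINT t|lebesgue_on {0<..}. \<phi> (Suc n) t * L2_inner \<Omega> (g t) v) = (LINT t|lebesgue. \<phi> (Suc n) t * ?G t)" for n
    proof -
      obtain K where K: "compact K" "K \<subseteq> {0<..}" "\<And>x. x \<notin> K \<Longrightarrow> \<phi> (Suc n) x = 0"
        by (rule test_function_support[OF test[of "Suc n"]]) auto
      have out: "\<phi> (Suc n) t = 0" if "t \<notin> {0<..}" for t using K that by blast
      have out2: "\<phi> (Suc n) t = 0" if "t > b + 1" for t
      proof -
        have "t - a \<ge> 1" "t - b \<ge> 1" using that ab by auto
        then have "real (Suc n) * (t - a) \<ge> 1 * 1" "real (Suc n) * (t - b) \<ge> 1 * 1"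
          by (intro mult_mono; simp)+
        then show ?thesis by (simp add: \<phi>_def H(4))
      qed
      have "(LINT t|lebesgue_on {0<..}. \<phi> (Suc n) t * L2_inner \<Omega> (g t) v) = (LINT t|lebesgue. \<phi> (Suc n) t * L2_inner \<Omega> (g t) v)"
        by (rule integral_lebesgue_on_zero_outside) (use out in auto)
      also have "\<dots> = (LINT t|lebesgue. \<phi> (Suc n) t * ?G t)"
      proof (rule Bochner_Integration.integral_cong[OF refl])
        fix t
        show "\<phi> (Suc n) t * L2_inner \<Omega> (g t) v = \<phi> (Suc n) t * ?G t"
          using out[of t] out2[of t] by (cases "t \<in> {0..b+1}") (auto simp: L2_inner_commute not_le)
      qed
      finally show ?thesis .
    qed
    have "(\<lambda>n. LINT t|lebesgue. \<phi> (Suc n) t * ?G t) \<longlonglongrightarrow> (LINT t|lebesgue. indicator {a<..b} t * ?G t)"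
    proof (rule integral_dominated_convergence[where w = "\<lambda>t. \<bar>?G t\<bar>"])
      have \<phi>c: "continuous_on UNIV (\<phi> n)" for n
        using DERIV_isCont[OF \<phi>D] by (simp add: continuous_at_imp_continuous_on)
      show "(\<lambda>t. \<phi> (Suc n) t * ?G t) \<in> borel_measurable lebesgue" for n
        using borel_measurable_lebesgue_on_continuous[OF \<phi>c, where S = UNIV]
        by (intro borel_measurable_times[OF _ borel_measurable_integrable[OF G]]) (simp add: lebesgue_on_UNIV_eq)
      show "(\<lambda>t. indicator {a<..b} t * ?G t) \<in> borel_measurable lebesgue"
        by (intro borel_measurable_times[OF _ borel_measurable_integrable[OF G]] borel_measurable_indicator) auto
      show "integrable lebesgue (\<lambda>t. \<bar>?G t\<bar>)" using G by (rule integrable_abs)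
      show "AE t in lebesgue. norm (\<phi> (Suc n) t * ?G t) \<le> \<bar>?G t\<bar>" for n
      proof (rule AE_I2)
        fix t
        have "\<bar>\<phi> (Suc n) t\<bar> \<le> 1"
          using H(5,6)[of "real (Suc n) * (t - a)"] H(5,6)[of "real (Suc n) * (t - b)"]
          unfolding \<phi>_def by linarith
        then have "\<bar>\<phi> (Suc n) t\<bar> * \<bar>?G t\<bar> \<le> 1 * \<bar>?G t\<bar>" by (intro mult_right_mono) auto
        then show "norm (\<phi> (Suc n) t * ?G t) \<le> \<bar>?G t\<bar>" by (simp only: real_norm_def abs_mult mult_1)
      qed
      have Hlim: "(\<lambda>n. H (real (Suc n) * (t - c))) \<longlonglongrightarrow> (if c < t then 1 else 0)" for t c
      proof (cases "c < t")
        case True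
        obtain N :: nat where N: "inverse (t - c) \<le> real N" using real_arch_simple by blast
        have "H (real (Suc n) * (t - c)) = 1" if "n \<ge> N" for n
        proof (rule H(4))
          have "inverse (t - c) \<le> real (Suc n)" using N that by simp
          then show "1 \<le> real (Suc n) * (t - c)" using True by (simp add: field_simps)
        qed
        then have "\<forall>\<^sub>F n in sequentially. H (real (Suc n) * (t - c)) = (if c < t then 1 else 0)"
          using True by (auto simp: eventually_sequentially)
        then show ?thesis by (rule tendsto_eventually)
      next
        case False
        then have "H (real (Suc n) * (t - c)) = 0" for n by (intro H(3) mult_nonneg_nonpos) auto
        then show ?thesis using False by simp
      qed
      show "AE t in lebesgue. (\<lambda>n. \<phi> (Suc n) t * ?G t) \<longlonglongrightarrow> indicator {a<..b} t * ?G t"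
      proof (rule AE_I2, rule tendsto_mult[OF _ tendsto_const])
        fix t
        have "(\<lambda>n. \<phi> (Suc n) t) \<longlonglongrightarrow> (if a < t then 1 else 0) - (if b < t then 1 else 0)"
          unfolding \<phi>_def by (intro tendsto_diff Hlim)
        then show "(\<lambda>n. \<phi> (Suc n) t) \<longlonglongrightarrow> indicator {a<..b} t"
          using ab by (auto simp: indicator_def split: if_splits)
      qed
    qed
    moreover have "(LINT t|lebesgue. indicator {a<..b} t * ?G t) = integral {a..b} ?\<gamma>"
    proof -
      \<comment> \<open>The cut-offs tend to the indicator of the half-open interval; its missing
        point is negligible.\<close>
      have "AE t in lebesgue. t \<notin> {a}"
        by (intro AE_not_in) (simp flip: negligible_iff_null_sets)
      then have "AE t in lebesgue. indicator {a<..b} t * ?G t = indicator {a..b} t * ?G t"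
        by eventually_elim (auto simp: indicator_def)
      then have "(LINT t|lebesgue. indicator {a<..b} t * ?G t) = (LINT t|lebesgue. indicator {a..b} t * ?G t)"
        by (intro integral_cong_AE borel_measurable_times[OF _ borel_measurable_integrable[OF G]] borel_measurable_indicator) auto
      also have "\<dots> = (LINT t|lebesgue_on {a..b}. ?\<gamma> t)"
        using ab by (subst integral_restrict_space) (auto simp: indicator_def intro!: Bochner_Integration.integral_cong)
      also have "\<dots> = integral {a..b} ?\<gamma>"
        using absolutely_integrable_inner_g[OF v, of a b] ab
        by (intro lebesgue_integral_eq_integral) (auto simp: absolutely_integrable_on_iff_integrable)
      finally show ?thesis .
    qed
    ultimately show ?thesis unfolding eq by simp
  qed
  have "(LINT t|lebesgue_on {0<..}. deriv (\<phi> (Suc n)) t * L2_inner \<Omega> (u t) v)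
      = - (LINT t|lebesgue_on {0<..}. \<phi> (Suc n) t * L2_inner \<Omega> (g t) v)" for n
    using u_deriv v test[of "Suc n"] unfolding has_time_deriv_def by auto
  then have "V a - V b = - integral {a..b} ?\<gamma>"
    using LIMSEQ_unique[OF lim1, of "- integral {a..b} ?\<gamma>"] tendsto_minus[OF lim2] by simp
  then show ?thesis using ab by (simp add: V_def L2_inner_commute)
qed

text \<open>The increment is tested with itself, which bounds its square by its norm times the
  integral of the norm of g. After division, Cauchy-Schwarz in time gives the factor b - a; no
  vector-valued integral is formed.\<close>

lemma norm_u_increment:
  assumes ab: "0 < a" "a \<le> b"
  shows "(L2_norm \<Omega> (\<lambda>x. u b x - u a x))\<^sup>2 \<le> (b - a) * integral {a..b} (\<lambda>t. (L2_norm \<Omega> (g t))\<^sup>2)"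
proof -
  let ?v = "\<lambda>x. u b x - u a x"
  let ?n = "L2_norm \<Omega> ?v"
  have v: "?v \<in> L2_space \<Omega>" using ab by (intro L2_space_diff u_L2) auto
  have one: "(\<lambda>t. 1::real) \<in> L2_space {a..b}"
  proof -
    interpret finite_measure "lebesgue_on {a..b}" by (rule finite_measure_lebesgue_on) auto
    show ?thesis by (auto simp: L2_space_def)
  qed
  have int2: "integrable (lebesgue_on {a..b}) (\<lambda>t. (L2_norm \<Omega> (g t))\<^sup>2)"
    using integrable_lebesgue_on_subset[OF integrable_norm_g[of b], of "{a..b}"] ab by auto
  have gL2: "(\<lambda>t. L2_norm \<Omega> (g t)) \<in> L2_space {a..b}"
    using int2 measurable_restrict_mono[OF measurable_norm_g[of b], of "{a..b}"] ab by (auto simp: L2_space_def)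
  have gint: "integrable (lebesgue_on {a..b}) (\<lambda>t. L2_norm \<Omega> (g t))"
    using integrable_L2_mult[OF one gL2] by simp
  have aeg: "AE t in lebesgue_on {a..b}. g t \<in> L2_space \<Omega>"
    using AE_lebesgue_on_subset[OF AE_g_L2[of b], of "{a..b}"] ab by auto
  have iint: "integrable (lebesgue_on {a..b}) (\<lambda>t. L2_inner \<Omega> ?v (g t))"
    using absolutely_integrable_inner_g[OF v, of a b] ab by (simp add: absolutely_integrable_on_iff_integrable)
  have "?n\<^sup>2 = L2_inner \<Omega> ?v (u b) - L2_inner \<Omega> ?v (u a)"
    unfolding L2_norm_power2 using ab by (intro L2_inner_diff_right u_L2 v) auto
  also have "\<dots> = integral {a..b} (\<lambda>t. L2_inner \<Omega> ?v (g t))" by (rule inner_u_increment[OF v ab])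
  also have "\<dots> = (LINT t|lebesgue_on {a..b}. L2_inner \<Omega> ?v (g t))"
    by (rule lebesgue_integral_eq_integral[symmetric, OF iint]) simp
  also have "\<dots> \<le> (LINT t|lebesgue_on {a..b}. ?n * L2_norm \<Omega> (g t))"
  proof (rule integral_mono_AE)
    show "AE t in lebesgue_on {a..b}. L2_inner \<Omega> ?v (g t) \<le> ?n * L2_norm \<Omega> (g t)"
      using aeg
    proof eventually_elim
      case (elim t)
      then show ?case using L2_Cauchy_Schwarz[OF v elim] by linarith
    qed
  qed (use iint gint in auto)
  also have "\<dots> = ?n * L2_inner {a..b} (\<lambda>t. 1) (\<lambda>t. L2_norm \<Omega> (g t))" by (simp add: L2_inner_def)
  finally have le: "?n * ?n \<le> ?n * L2_inner {a..b} (\<lambda>t. 1) (\<lambda>t. L2_norm \<Omega> (g t))" by (simp add: power2_eq_square)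
  have "?n \<le> L2_norm {a..b} (\<lambda>t. 1::real) * L2_norm {a..b} (\<lambda>t. L2_norm \<Omega> (g t))"
  proof (cases "?n = 0")
    case False
    then have "?n > 0" using L2_norm_nonneg[of \<Omega> ?v] by linarith
    with le have "?n \<le> L2_inner {a..b} (\<lambda>t. 1) (\<lambda>t. L2_norm \<Omega> (g t))" by simp
    then show ?thesis using L2_Cauchy_Schwarz[OF one gL2] by linarith
  qed simp
  then have "?n\<^sup>2 \<le> (L2_norm {a..b} (\<lambda>t. 1::real) * L2_norm {a..b} (\<lambda>t. L2_norm \<Omega> (g t)))\<^sup>2"
    by (intro power_mono) auto
  also have "\<dots> = (L2_norm {a..b} (\<lambda>t. 1::real))\<^sup>2 * (L2_norm {a..b} (\<lambda>t. L2_norm \<Omega> (g t)))\<^sup>2"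
    by (rule power_mult_distrib)
  also have "(L2_norm {a..b} (\<lambda>t. 1::real))\<^sup>2 = b - a"
    using ab by (simp add: L2_norm_def measure_restrict_space)
  also have "(L2_norm {a..b} (\<lambda>t. L2_norm \<Omega> (g t)))\<^sup>2 = integral {a..b} (\<lambda>t. (L2_norm \<Omega> (g t))\<^sup>2)"
    using lebesgue_integral_eq_integral[OF int2]
    unfolding L2_norm_power2[of "{a..b}"] L2_inner_def[of "{a..b}"] by (simp add: power2_eq_square)
  finally show ?thesis .
qed

end

lemma sqrt_power2_measurable:
  fixes f :: "'b \<Rightarrow> real"
  assumes "(\<lambda>t. (f t)\<^sup>2) \<in> borel_measurable M" "\<And>t. f t \<ge> 0"
  shows "f \<in> borel_measurable M"
proof -
  have "(\<lambda>t. sqrt ((f t)\<^sup>2)) \<in> borel_measurable M" using assms(1) by measurable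
  then show ?thesis using assms(2) by simp
qed

lemma integrable_bounded_mult:
  fixes f m :: "'b \<Rightarrow> real"
  assumes "integrable M f" "m \<in> borel_measurable M" "\<And>t. t \<in> space M \<Longrightarrow> \<bar>m t\<bar> \<le> C"
  shows "integrable M (\<lambda>t. m t * f t)"
proof (rule Bochner_Integration.integrable_bound)
  show "integrable M (\<lambda>t. C * f t)" using assms(1) by simp
  show "(\<lambda>t. m t * f t) \<in> borel_measurable M" using assms(1,2) by measurable
  show "AE t in M. norm (m t * f t) \<le> norm (C * f t)"
  proof (rule AE_I2)
    fix t assume "t \<in> space M"
    then have "\<bar>m t\<bar> \<le> \<bar>C\<bar>" using assms(3)[of t] by linarith
    then show "norm (m t * f t) \<le> norm (C * f t)" by (simp add: abs_mult mult_right_mono)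
  qed
qed

lemma continuous_bounded_on_Icc:
  fixes f :: "real \<Rightarrow> real"
  assumes "continuous_on {a..b} f"
  obtains C where "C \<ge> 0" "\<And>t. t \<in> {a..b} \<Longrightarrow> \<bar>f t\<bar> \<le> C"
proof -
  have "bounded (f ` {a..b})" by (intro compact_imp_bounded compact_continuous_image assms) auto
  then obtain C where "\<forall>y\<in>f ` {a..b}. norm y \<le> C" unfolding bounded_iff by blast
  then have "\<bar>f t\<bar> \<le> max C 0" if "t \<in> {a..b}" for t
    using that by (auto intro: max.coboundedI1)
  then show ?thesis by (intro that[of "max C 0"]) auto
qed

lemma borel_measurable_lebesgue_on_Icc_continuous:
  fixes f :: "real \<Rightarrow> real"
  assumes "continuous_on {a..b} f"
  shows "f \<in> borel_measurable (lebesgue_on {a..b})"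
  using assms by (intro continuous_imp_measurable_on_sets_lebesgue) auto

lemma integrable_continuous_Icc:
  fixes f :: "real \<Rightarrow> real"
  assumes "continuous_on {a..b} f"
  shows "integrable (lebesgue_on {a..b}) f"
  using absolutely_integrable_continuous_real[OF assms] by (simp add: absolutely_integrable_on_iff_integrable)

lemma L2_space_continuous_Icc:
  fixes f :: "real \<Rightarrow> real"
  assumes "continuous_on {a..b} f"
  shows "f \<in> L2_space {a..b}"
  using borel_measurable_lebesgue_on_Icc_continuous[OF assms]
    integrable_continuous_Icc[OF continuous_on_power[OF assms], of 2]
  by (auto simp: L2_space_def)

section \<open>Limits of difference quotients of the evolution\<close>

context evolution
begin

definition incr :: "real \<Rightarrow> real \<Rightarrow> 'a \<Rightarrow> real" where
  "incr h t x = u t x - u (t - h) x"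

lemma incr_L2: "0 \<le> h \<Longrightarrow> h \<le> t \<Longrightarrow> incr h t \<in> L2_space \<Omega>"
  unfolding incr_def[abs_def] by (intro L2_space_diff u_L2) auto

lemma incr_continuous:
  assumes h: "0 \<le> h" "h \<le> a" and t: "t \<in> {a..b}"
  shows "((\<lambda>s. L2_norm \<Omega> (\<lambda>x. incr h s x - incr h t x)) \<longlongrightarrow> 0) (at t within {a..b})"
proof -
  have 1: "((\<lambda>s. L2_norm \<Omega> (\<lambda>x. u s x - u t x)) \<longlongrightarrow> 0) (at t within {a..b})"
    using h t by (intro tendsto_within_subset[OF u_cont]) auto
  have "filterlim (\<lambda>s. s - h) (at (t - h) within {0..}) (at t within {a..b})"
    unfolding filterlim_at
  proof
    show "\<forall>\<^sub>F s in at t within {a..b}. s - h \<in> {0..} \<and> s - h \<noteq> t - h"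
      using h by (auto simp: eventually_at_filter)
    show "((\<lambda>s. s - h) \<longlongrightarrow> t - h) (at t within {a..b})" by (intro tendsto_intros)
  qed
  from filterlim_compose[OF u_cont this]
  have 2: "((\<lambda>s. L2_norm \<Omega> (\<lambda>x. u (s - h) x - u (t - h) x)) \<longlongrightarrow> 0) (at t within {a..b})"
    using h t by simp
  show ?thesis
  proof (rule Lim_null_comparison)
    show "((\<lambda>s. L2_norm \<Omega> (\<lambda>x. u s x - u t x) + L2_norm \<Omega> (\<lambda>x. u (s - h) x - u (t - h) x)) \<longlongrightarrow> 0) (at t within {a..b})"
      using tendsto_add[OF 1 2] by simp
    have "L2_norm \<Omega> (\<lambda>x. incr h s x - incr h t x)
        \<le> L2_norm \<Omega> (\<lambda>x. u s x - u t x) + L2_norm \<Omega> (\<lambda>x. u (s - h) x - u (t - h) x)" if "s \<in> {a..b}" for s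
    proof -
      have L2: "(\<lambda>x. u s x - u t x) \<in> L2_space \<Omega>" "(\<lambda>x. u (t - h) x - u (s - h) x) \<in> L2_space \<Omega>"
        using h t that by (auto intro!: L2_space_diff u_L2)
      have "(\<lambda>x. incr h s x - incr h t x) = (\<lambda>x. (u s x - u t x) + (u (t - h) x - u (s - h) x))"
        by (simp add: incr_def fun_eq_iff)
      then show ?thesis
        using L2_norm_triangle[OF L2] L2_norm_minus_commute[of \<Omega> "u (t - h)" "u (s - h)"] by simp
    qed
    then show "\<forall>\<^sub>F s in at t within {a..b}. norm (L2_norm \<Omega> (\<lambda>x. incr h s x - incr h t x))
        \<le> L2_norm \<Omega> (\<lambda>x. u s x - u t x) + L2_norm \<Omega> (\<lambda>x. u (s - h) x - u (t - h) x)"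
      by (auto simp: eventually_at_filter)
  qed
qed

lemma continuous_on_norm_incr:
  assumes h: "0 \<le> h" "h \<le> a"
  shows "continuous_on {a..b} (\<lambda>t. L2_norm \<Omega> (incr h t))"
  unfolding continuous_on_def
proof
  fix t assume "t \<in> {a..b}"
  then show "((\<lambda>t. L2_norm \<Omega> (incr h t)) \<longlongrightarrow> L2_norm \<Omega> (incr h t)) (at t within {a..b})"
    using h by (intro L2_norm_tendsto incr_continuous incr_L2) (auto simp: eventually_at_filter incr_L2)
qed

lemma continuous_on_inner_incr:
  assumes h: "0 \<le> h" "h \<le> a" and v: "v \<in> L2_space \<Omega>"
  shows "continuous_on {a..b} (\<lambda>t. L2_inner \<Omega> v (incr h t))"
  unfolding continuous_on_def
proof
  fix t assume "t \<in> {a..b}"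
  then have "((\<lambda>t. L2_inner \<Omega> (incr h t) v) \<longlongrightarrow> L2_inner \<Omega> (incr h t) v) (at t within {a..b})"
    using h v by (intro L2_inner_tendsto incr_continuous incr_L2) (auto simp: eventually_at_filter incr_L2)
  then show "((\<lambda>t. L2_inner \<Omega> v (incr h t)) \<longlongrightarrow> L2_inner \<Omega> v (incr h t)) (at t within {a..b})"
    by (simp add: L2_inner_commute)
qed

text \<open>Each squared quotient is at most the mean of the squared norm of g over the preceding
  window. The resulting bound does not depend on h, which is what allows replacing w by simple
  functions.\<close>

lemma integral_norm_incr_le:
  assumes h: "0 < h" "h < a" and ab: "a \<le> b"
  shows "(L2_norm {a..b} (\<lambda>t. L2_norm \<Omega> (incr h t) / h))\<^sup>2 \<le> integral {0..b} (\<lambda>t. (L2_norm \<Omega> (g t))\<^sup>2)"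
proof -
  let ?G = "\<lambda>t. (L2_norm \<Omega> (g t))\<^sup>2"
  have G: "?G integrable_on {0..b}" by (rule integrable_on_lebesgue_on[OF integrable_norm_g]) simp
  have cont: "continuous_on {a..b} (\<lambda>t. (L2_norm \<Omega> (incr h t) / h)\<^sup>2)"
    using h by (intro continuous_intros continuous_on_norm_incr) auto
  have "(L2_norm {a..b} (\<lambda>t. L2_norm \<Omega> (incr h t) / h))\<^sup>2 = (LINT t|lebesgue_on {a..b}. (L2_norm \<Omega> (incr h t) / h)\<^sup>2)"
    unfolding L2_norm_power2[of "{a..b}"] L2_inner_def[of "{a..b}"] by (simp add: power2_eq_square)
  also have "\<dots> = integral {a..b} (\<lambda>t. (L2_norm \<Omega> (incr h t) / h)\<^sup>2)"
    by (rule lebesgue_integral_eq_integral[OF integrable_continuous_Icc[OF cont]]) simp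
  also have "\<dots> \<le> integral {a..b} (\<lambda>t. integral {t - h..t} ?G / h)"
  proof (rule integral_le)
    show "(\<lambda>t. (L2_norm \<Omega> (incr h t) / h)\<^sup>2) integrable_on {a..b}"
      by (rule integrable_continuous_interval[OF cont])
    show "(\<lambda>t. integral {t - h..t} ?G / h) integrable_on {a..b}"
      using h by (intro integrable_continuous_interval continuous_on_divide continuous_on_const
          continuous_on_moving_integral[OF G]) auto
    fix t assume t: "t \<in> {a..b}"
    have "(L2_norm \<Omega> (incr h t))\<^sup>2 \<le> h * integral {t - h..t} ?G"
      using norm_u_increment[of "t - h" t] h t by (simp add: incr_def[abs_def])
    then show "(L2_norm \<Omega> (incr h t) / h)\<^sup>2 \<le> integral {t - h..t} ?G / h"
      using h by (simp add: power_divide power2_eq_square field_simps)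
  qed
  also have "\<dots> = integral {a..b} (\<lambda>t. integral {t - h..t} ?G) / h" by simp
  also have "\<dots> \<le> (h * integral {0..b} ?G) / h"
    using h ab by (intro divide_right_mono integral_moving_integral_le[OF G]) auto
  finally show ?thesis using h by simp
qed

text \<open>For fixed v the claim is scalar, and the quotients converge even in L^1. The weight m is
  merely bounded and measurable, in order to contain indicators of level sets.\<close>

lemma inner_incr_quotient_tendsto:
  assumes v: "v \<in> L2_space \<Omega>" and ab: "0 < a" "a \<le> b"
    and h: "\<And>n. 0 < h n" "\<And>n. h n < a" "h \<longlonglongrightarrow> 0"
    and m: "m \<in> borel_measurable (lebesgue_on {a..b})" "\<And>t. t \<in> {a..b} \<Longrightarrow> \<bar>m t\<bar> \<le> C"
  shows "(\<lambda>n. LINT t|lebesgue_on {a..b}. m t * (L2_inner \<Omega> v (incr (h n) t) / h n))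
    \<longlonglongrightarrow> (LINT t|lebesgue_on {a..b}. m t * L2_inner \<Omega> v (g t))"
proof -
  let ?V = "\<lambda>t. L2_inner \<Omega> v (u t)" and ?\<gamma> = "\<lambda>t. L2_inner \<Omega> v (g t)"
  let ?D = "\<lambda>n t. L2_inner \<Omega> v (incr (h n) t) / h n"
  have Vc: "continuous_on {0..b} ?V"
    using continuous_on_subset[OF continuous_on_inner_u[OF v], of "{0..b}"] by (auto simp: L2_inner_commute)
  have D: "?D n t = (?V t - ?V (t - h n)) / h n" if "t \<in> {a..b}" for n t
    unfolding incr_def[abs_def] using h(1)[of n] h(2)[of n] that ab
    by (subst L2_inner_diff_right) (auto intro!: u_L2 v)
  have gi: "integrable (lebesgue_on {a..b}) ?\<gamma>"
    using absolutely_integrable_inner_g[OF v, of a b] ab by (simp add: absolutely_integrable_on_iff_integrable)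
  have Di: "integrable (lebesgue_on {a..b}) (?D n)" for n
    using h(1)[of n] h(2)[of n]
    by (intro integrable_continuous_Icc continuous_on_divide continuous_on_inner_incr v continuous_on_const) (auto simp: less_imp_le)
  have C: "C \<ge> 0" using m(2)[of a] ab by auto
  have "(\<lambda>n. integral {a..b} (\<lambda>t. \<bar>(?V t - ?V (t - h n)) / h n - ?\<gamma> t\<bar>)) \<longlonglongrightarrow> 0"
    using inner_u_increment[OF v] ab
    by (intro difference_quotient_tendsto_L1[OF absolutely_integrable_inner_g[OF v] Vc _ _ _ _ h]) auto
  moreover have "integral {a..b} (\<lambda>t. \<bar>(?V t - ?V (t - h n)) / h n - ?\<gamma> t\<bar>) = (LINT t|lebesgue_on {a..b}. \<bar>?D n t - ?\<gamma> t\<bar>)" for n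
  proof -
    have "integral {a..b} (\<lambda>t. \<bar>(?V t - ?V (t - h n)) / h n - ?\<gamma> t\<bar>) = integral {a..b} (\<lambda>t. \<bar>?D n t - ?\<gamma> t\<bar>)"
      by (intro Henstock_Kurzweil_Integration.integral_cong) (simp only: D)
    also have "\<dots> = (LINT t|lebesgue_on {a..b}. \<bar>?D n t - ?\<gamma> t\<bar>)"
      using Di gi by (intro lebesgue_integral_eq_integral[symmetric] integrable_abs Bochner_Integration.integrable_diff) auto
    finally show ?thesis .
  qed
  ultimately have lim: "(\<lambda>n. LINT t|lebesgue_on {a..b}. \<bar>?D n t - ?\<gamma> t\<bar>) \<longlonglongrightarrow> 0" by simp
  show ?thesis
  proof (rule LIM_zero_cancel, rule Lim_null_comparison[OF _ tendsto_mult_right_zero[OF lim, of C]])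
    have "\<bar>(LINT t|lebesgue_on {a..b}. m t * ?D n t) - (LINT t|lebesgue_on {a..b}. m t * ?\<gamma> t)\<bar>
        \<le> C * (LINT t|lebesgue_on {a..b}. \<bar>?D n t - ?\<gamma> t\<bar>)" for n
    proof -
      have i1: "integrable (lebesgue_on {a..b}) (\<lambda>t. m t * ?D n t)"
        using m by (intro integrable_bounded_mult[OF Di]) auto
      have i2: "integrable (lebesgue_on {a..b}) (\<lambda>t. m t * ?\<gamma> t)"
        using m by (intro integrable_bounded_mult[OF gi]) auto
      have "\<bar>LINT t|lebesgue_on {a..b}. m t * ?D n t - m t * ?\<gamma> t\<bar> \<le> (LINT t|lebesgue_on {a..b}. \<bar>m t * ?D n t - m t * ?\<gamma> t\<bar>)"
        by (rule integral_abs_bound)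
      also have "\<dots> \<le> (LINT t|lebesgue_on {a..b}. C * \<bar>?D n t - ?\<gamma> t\<bar>)"
      proof (rule integral_mono)
        show "integrable (lebesgue_on {a..b}) (\<lambda>t. \<bar>m t * ?D n t - m t * ?\<gamma> t\<bar>)"
          by (intro integrable_abs Bochner_Integration.integrable_diff i1 i2)
        show "integrable (lebesgue_on {a..b}) (\<lambda>t. C * \<bar>?D n t - ?\<gamma> t\<bar>)"
          by (intro integrable_mult_right integrable_abs Bochner_Integration.integrable_diff Di gi)
        fix t assume "t \<in> space (lebesgue_on {a..b})"
        then have "\<bar>m t\<bar> \<le> C" using m(2) by simp
        from mult_right_mono[OF this abs_ge_zero[of "?D n t - ?\<gamma> t"]]
        show "\<bar>m t * ?D n t - m t * ?\<gamma> t\<bar> \<le> C * \<bar>?D n t - ?\<gamma> t\<bar>"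
          by (simp only: abs_mult[symmetric] right_diff_distrib)
      qed
      finally show ?thesis using i1 i2 by simp
    qed
    then show "\<forall>\<^sub>F n in sequentially. norm ((LINT t|lebesgue_on {a..b}. m t * ?D n t) - (LINT t|lebesgue_on {a..b}. m t * ?\<gamma> t))
        \<le> C * (LINT t|lebesgue_on {a..b}. \<bar>?D n t - ?\<gamma> t\<bar>)"
      by (intro always_eventually allI) simp
  qed
qed

lemma simple_incr_quotient_tendsto:
  assumes s: "simple_function (lebesgue_on {a..b}) s" "s ` {a..b} \<subseteq> L2_space \<Omega>" and ab: "0 < a" "a \<le> b"
    and h: "\<And>n. 0 < h n" "\<And>n. h n < a" "h \<longlonglongrightarrow> 0"
    and \<theta>: "continuous_on {a..b} \<theta>"
  shows "(\<lambda>n. LINT t|lebesgue_on {a..b}. \<theta> t * (L2_inner \<Omega> (s t) (incr (h n) t) / h n))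
    \<longlonglongrightarrow> (LINT t|lebesgue_on {a..b}. \<theta> t * L2_inner \<Omega> (s t) (g t))"
proof -
  let ?M = "lebesgue_on {a..b}"
  obtain C where C: "C \<ge> 0" "\<And>t. t \<in> {a..b} \<Longrightarrow> \<bar>\<theta> t\<bar> \<le> C" by (rule continuous_bounded_on_Icc[OF \<theta>]) (rule that)
  \<comment> \<open>\<theta> restricted to the level set of the value v; this reduces the claim to a
    finite sum of cases with fixed v.\<close>
  define m where "m v t = \<theta> t * indicator (s -` {v} \<inter> {a..b}) t" for v t
  have fin: "finite (s ` {a..b})" using simple_functionD(1)[OF s(1)] by simp
  have mm: "m v \<in> borel_measurable ?M" for v
    unfolding m_def
    using simple_functionD(2)[OF s(1), of "{v}"]
    by (intro borel_measurable_times borel_measurable_lebesgue_on_Icc_continuous[OF \<theta>] borel_measurable_indicator) simp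
  have mC: "\<bar>m v t\<bar> \<le> C" if "t \<in> {a..b}" for v t
    using C that by (auto simp: m_def indicator_def)
  have sum: "\<theta> t * f (s t) = (\<Sum>v\<in>s ` {a..b}. m v t * f v)" if "t \<in> {a..b}" for f :: "('a \<Rightarrow> real) \<Rightarrow> real" and t
  proof -
    have "(\<Sum>v\<in>s ` {a..b}. m v t * f v) = (\<Sum>v\<in>s ` {a..b}. if v = s t then \<theta> t * f v else 0)"
      using that by (intro sum.cong) (auto simp: m_def indicator_def)
    then show ?thesis using that fin by (simp add: sum.delta)
  qed
  have vL2: "v \<in> L2_space \<Omega>" if "v \<in> s ` {a..b}" for v using s(2) that by blast
  have eq1: "(LINT t|?M. \<theta> t * (L2_inner \<Omega> (s t) (incr (h n) t) / h n))
      = (\<Sum>v\<in>s ` {a..b}. LINT t|?M. m v t * (L2_inner \<Omega> v (incr (h n) t) / h n))" for n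
  proof -
    have "(LINT t|?M. \<theta> t * (L2_inner \<Omega> (s t) (incr (h n) t) / h n))
      = (LINT t|?M. (\<Sum>v\<in>s ` {a..b}. m v t * (L2_inner \<Omega> v (incr (h n) t) / h n)))"
    proof (rule Bochner_Integration.integral_cong[OF refl])
      fix t assume "t \<in> space ?M"
      then show "\<theta> t * (L2_inner \<Omega> (s t) (incr (h n) t) / h n)
          = (\<Sum>v\<in>s ` {a..b}. m v t * (L2_inner \<Omega> v (incr (h n) t) / h n))"
        by (intro sum[where f = "\<lambda>v. L2_inner \<Omega> v (incr (h n) t) / h n"]) simp
    qed
    also have "\<dots> = (\<Sum>v\<in>s ` {a..b}. LINT t|?M. m v t * (L2_inner \<Omega> v (incr (h n) t) / h n))"
      using h(1)[of n] h(2)[of n] mC vL2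
      by (intro Bochner_Integration.integral_sum integrable_bounded_mult[OF _ mm, where C = C] integrable_continuous_Icc
          continuous_on_divide continuous_on_inner_incr continuous_on_const) (auto simp: less_imp_le)
    finally show ?thesis .
  qed
  have eq2: "(LINT t|?M. \<theta> t * L2_inner \<Omega> (s t) (g t)) = (\<Sum>v\<in>s ` {a..b}. LINT t|?M. m v t * L2_inner \<Omega> v (g t))"
  proof -
    have "(LINT t|?M. \<theta> t * L2_inner \<Omega> (s t) (g t)) = (LINT t|?M. (\<Sum>v\<in>s ` {a..b}. m v t * L2_inner \<Omega> v (g t)))"
    proof (rule Bochner_Integration.integral_cong[OF refl])
      fix t assume "t \<in> space ?M"
      then show "\<theta> t * L2_inner \<Omega> (s t) (g t) = (\<Sum>v\<in>s ` {a..b}. m v t * L2_inner \<Omega> v (g t))"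
        by (intro sum[where f = "\<lambda>v. L2_inner \<Omega> v (g t)"]) simp
    qed
    also have "\<dots> = (\<Sum>v\<in>s ` {a..b}. LINT t|?M. m v t * L2_inner \<Omega> v (g t))"
    proof (rule Bochner_Integration.integral_sum)
      fix v assume "v \<in> s ` {a..b}"
      then have "integrable ?M (\<lambda>t. L2_inner \<Omega> v (g t))"
        using absolutely_integrable_inner_g[OF vL2, of v a b] ab by (simp add: absolutely_integrable_on_iff_integrable)
      then show "integrable ?M (\<lambda>t. m v t * L2_inner \<Omega> v (g t))"
        using mC by (intro integrable_bounded_mult[OF _ mm, where C = C]) auto
    qed
    finally show ?thesis .
  qed
  show ?thesis
    unfolding eq1 eq2
    by (intro tendsto_sum inner_incr_quotient_tendsto[OF vL2 ab h mm mC])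
qed

text \<open>The majorant is a product of two norms square-integrable in time. It is applied with y =
  g and with increments of \<open>u\<close>.\<close>

lemma Bochner_inner_integrable:
  assumes w: "w \<in> Bochner_L2 I (L2_space \<Omega>) (L2_norm \<Omega>)" and I: "I \<in> sets lebesgue"
    and \<theta>: "\<theta> \<in> borel_measurable (lebesgue_on I)" "\<And>t. t \<in> I \<Longrightarrow> \<bar>\<theta> t\<bar> \<le> C"
    and y: "AE t in lebesgue_on I. y t \<in> L2_space \<Omega>" "(\<lambda>t. L2_norm \<Omega> (y t)) \<in> L2_space I"
    and meas: "\<And>v. v \<in> L2_space \<Omega> \<Longrightarrow> (\<lambda>t. L2_inner \<Omega> v (y t)) \<in> borel_measurable (lebesgue_on I)"
  shows "integrable (lebesgue_on I) (\<lambda>t. \<theta> t * L2_inner \<Omega> (w t) (y t))"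
proof -
  let ?M = "lebesgue_on I"
  have sm: "strongly_measurable I (L2_space \<Omega>) (L2_norm \<Omega>) w" and wi: "integrable ?M (\<lambda>t. (L2_norm \<Omega> (w t))\<^sup>2)"
    using w by (auto simp: Bochner_L2_def)
  have wX: "AE t in ?M. w t \<in> L2_space \<Omega>" using sm by (simp add: strongly_measurable_def)
  have wL2: "(\<lambda>t. L2_norm \<Omega> (w t)) \<in> L2_space I"
    using strongly_measurable_L2_norm[OF sm I] wi by (auto simp: L2_space_def)
  have "integrable ?M (\<lambda>t. L2_inner \<Omega> (w t) (y t))"
  proof (rule Bochner_Integration.integrable_bound[OF integrable_L2_mult[OF wL2 y(2)]])
    show "(\<lambda>t. L2_inner \<Omega> (w t) (y t)) \<in> borel_measurable ?M"
    proof (rule strongly_measurable_compose[OF sm I, where F = "\<lambda>v t. L2_inner \<Omega> v (y t)" and C = "\<lambda>t. L2_norm \<Omega> (y t)"])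
      show "AE t in ?M. \<forall>v\<in>L2_space \<Omega>. \<forall>v'\<in>L2_space \<Omega>.
          \<bar>L2_inner \<Omega> v (y t) - L2_inner \<Omega> v' (y t)\<bar> \<le> L2_norm \<Omega> (y t) * L2_norm \<Omega> (\<lambda>x. v x - v' x)"
        using y(1)
      proof eventually_elim
        case (elim t)
        show ?case
        proof (intro ballI)
          fix v v' :: "'a \<Rightarrow> real" assume v: "v \<in> L2_space \<Omega>" "v' \<in> L2_space \<Omega>"
          show "\<bar>L2_inner \<Omega> v (y t) - L2_inner \<Omega> v' (y t)\<bar> \<le> L2_norm \<Omega> (y t) * L2_norm \<Omega> (\<lambda>x. v x - v' x)"
            using L2_Cauchy_Schwarz[OF L2_space_diff[OF v] elim] L2_inner_diff_left[OF v elim] by (simp add: mult.commute)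
        qed
      qed
    qed (use meas in auto)
    show "AE t in ?M. norm (L2_inner \<Omega> (w t) (y t)) \<le> norm (L2_norm \<Omega> (w t) * L2_norm \<Omega> (y t))"
      using wX y(1) by eventually_elim (simp add: L2_Cauchy_Schwarz)
  qed
  then show ?thesis
    by (rule integrable_bounded_mult[OF _ \<theta>(1)]) (use \<theta>(2) in simp)
qed

text \<open>
  The difference quotients of \<open>u\<close> are bounded in \<open>L\<^sup>2(a, b; L\<^sup>2(\<Omega>))\<close>, so that it suffices to pass to
  the limit for simple functions \<open>w\<close>, which form a dense set.
\<close>

lemma Bochner_incr_quotient_tendsto:
  assumes w: "w \<in> Bochner_L2 {a..b} (L2_space \<Omega>) (L2_norm \<Omega>)" and ab: "0 < a" "a \<le> b"
    and h: "\<And>n. 0 < h n" "\<And>n. h n < a" "h \<longlonglongrightarrow> 0"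
    and \<theta>: "continuous_on {a..b} \<theta>"
  shows "(\<lambda>n. LINT t|lebesgue_on {a..b}. \<theta> t * (L2_inner \<Omega> (w t) (incr (h n) t) / h n))
    \<longlonglongrightarrow> (LINT t|lebesgue_on {a..b}. \<theta> t * L2_inner \<Omega> (w t) (g t))"
    "\<And>n. integrable (lebesgue_on {a..b}) (\<lambda>t. \<theta> t * (L2_inner \<Omega> (w t) (incr (h n) t) / h n))"
    "integrable (lebesgue_on {a..b}) (\<lambda>t. \<theta> t * L2_inner \<Omega> (w t) (g t))"
proof -
  let ?M = "lebesgue_on {a..b}"
  obtain C where C: "C \<ge> 0" "\<And>t. t \<in> {a..b} \<Longrightarrow> \<bar>\<theta> t\<bar> \<le> C" by (rule continuous_bounded_on_Icc[OF \<theta>]) (rule that)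
  have \<theta>m: "\<theta> \<in> borel_measurable ?M" by (rule borel_measurable_lebesgue_on_Icc_continuous[OF \<theta>])
  \<comment> \<open>One bound for the norm of g and for all difference quotients.\<close>
  define J where "J = sqrt (integral {0..b} (\<lambda>t. (L2_norm \<Omega> (g t))\<^sup>2))"
  have J: "J \<ge> 0"
    unfolding J_def using integrable_on_lebesgue_on[OF integrable_norm_g, of b]
    by (simp add: Henstock_Kurzweil_Integration.integral_nonneg)
  define y where "y n = incr (h n)" for n
  have yX: "y n t \<in> L2_space \<Omega>" if "t \<in> {a..b}" for n t
    using that h(1)[of n] h(2)[of n] by (auto simp: y_def intro!: incr_L2)
  have aeI: "AE t in ?M. t \<in> {a..b}" by (rule AE_I2) simp
  have aey: "AE t in ?M. y n t \<in> L2_space \<Omega>" for n by (rule AE_I2) (simp add: yX)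
  have yc: "continuous_on {a..b} (\<lambda>t. L2_norm \<Omega> (y n t))" for n
    using h(1)[of n] h(2)[of n] by (auto simp: y_def intro!: continuous_on_norm_incr)
  have yL2: "(\<lambda>t. L2_norm \<Omega> (y n t)) \<in> L2_space {a..b}" for n by (rule L2_space_continuous_Icc[OF yc])
  have yhL2: "(\<lambda>t. L2_norm \<Omega> (y n t) / h n) \<in> L2_space {a..b}" for n
    using L2_space_cmult[OF yL2, of "inverse (h n)" n] by (simp add: divide_inverse mult.commute)
  have yJ: "L2_norm {a..b} (\<lambda>t. L2_norm \<Omega> (y n t) / h n) \<le> J" for n
    unfolding J_def y_def using integral_norm_incr_le[OF h(1,2) ab(2)] by (intro real_le_rsqrt)
  have gX: "AE t in ?M. g t \<in> L2_space \<Omega>"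
    using AE_lebesgue_on_subset[OF AE_g_L2[of b], of "{a..b}"] ab by auto
  have g2: "integrable ?M (\<lambda>t. (L2_norm \<Omega> (g t))\<^sup>2)"
    using integrable_lebesgue_on_subset[OF integrable_norm_g[of b], of "{a..b}"] ab by auto
  have gL2: "(\<lambda>t. L2_norm \<Omega> (g t)) \<in> L2_space {a..b}"
    using g2 measurable_restrict_mono[OF measurable_norm_g[of b], of "{a..b}"] ab by (auto simp: L2_space_def)
  have gJ: "L2_norm {a..b} (\<lambda>t. L2_norm \<Omega> (g t)) \<le> J"
    unfolding J_def
  proof (rule real_le_rsqrt)
    have "(L2_norm {a..b} (\<lambda>t. L2_norm \<Omega> (g t)))\<^sup>2 = integral {a..b} (\<lambda>t. (L2_norm \<Omega> (g t))\<^sup>2)"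
      using lebesgue_integral_eq_integral[OF g2]
      unfolding L2_norm_power2[of "{a..b}"] L2_inner_def[of "{a..b}"] by (simp add: power2_eq_square)
    also have "\<dots> \<le> integral {0..b} (\<lambda>t. (L2_norm \<Omega> (g t))\<^sup>2)"
      using ab integrable_on_lebesgue_on[OF integrable_norm_g, of b] integrable_on_lebesgue_on[OF g2]
      by (intro integral_subset_le) auto
    finally show "(L2_norm {a..b} (\<lambda>t. L2_norm \<Omega> (g t)))\<^sup>2 \<le> integral {0..b} (\<lambda>t. (L2_norm \<Omega> (g t))\<^sup>2)" .
  qed
  have ymeas: "(\<lambda>t. L2_inner \<Omega> v (y n t)) \<in> borel_measurable ?M" if "v \<in> L2_space \<Omega>" for v n
    using h(1)[of n] h(2)[of n] that
    by (auto simp: y_def intro!: borel_measurable_lebesgue_on_Icc_continuous continuous_on_inner_incr)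
  have gmeas: "(\<lambda>t. L2_inner \<Omega> v (g t)) \<in> borel_measurable ?M" if "v \<in> L2_space \<Omega>" for v
    using measurable_restrict_mono[OF measurable_inner_g[OF that, of b], of "{a..b}"] ab by auto
  have inty: "integrable ?M (\<lambda>t. \<theta> t * (L2_inner \<Omega> (p t) (y n t) / h n))"
    if "p \<in> Bochner_L2 {a..b} (L2_space \<Omega>) (L2_norm \<Omega>)" for p n
    using integrable_mult_right[of "inverse (h n)", OF Bochner_inner_integrable[OF that _ \<theta>m C(2) aey yL2 ymeas]]
    by (simp add: divide_inverse mult_ac)
  have intg: "integrable ?M (\<lambda>t. \<theta> t * L2_inner \<Omega> (p t) (g t))"
    if "p \<in> Bochner_L2 {a..b} (L2_space \<Omega>) (L2_norm \<Omega>)" for p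
    by (rule Bochner_inner_integrable[OF that _ \<theta>m C(2) gX gL2 gmeas]) auto
  show "\<And>n. integrable ?M (\<lambda>t. \<theta> t * (L2_inner \<Omega> (w t) (incr (h n) t) / h n))"
    using inty[OF w] by (simp add: y_def)
  show "integrable ?M (\<lambda>t. \<theta> t * L2_inner \<Omega> (w t) (g t))" by (rule intg[OF w])
  have wX: "AE t in ?M. w t \<in> L2_space \<Omega>" using w by (simp add: Bochner_L2_def strongly_measurable_def)
  \<comment> \<open>Replacing w by s costs the same for g and for the quotients, hence the general
    z.\<close>
  have close: "\<bar>(LINT t|?M. \<theta> t * L2_inner \<Omega> (w t) (z t)) - (LINT t|?M. \<theta> t * L2_inner \<Omega> (s t) (z t))\<bar>
      \<le> C * (d * J)"
    if s: "s ` {a..b} \<subseteq> L2_space \<Omega>"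
      and d: "(\<lambda>t. L2_norm \<Omega> (\<lambda>x. w t x - s t x)) \<in> L2_space {a..b}"
        "L2_norm {a..b} (\<lambda>t. L2_norm \<Omega> (\<lambda>x. w t x - s t x)) \<le> d"
      and z: "AE t in ?M. z t \<in> L2_space \<Omega>" "(\<lambda>t. L2_norm \<Omega> (z t)) \<in> L2_space {a..b}" "L2_norm {a..b} (\<lambda>t. L2_norm \<Omega> (z t)) \<le> J"
      and i: "integrable ?M (\<lambda>t. \<theta> t * L2_inner \<Omega> (w t) (z t))" "integrable ?M (\<lambda>t. \<theta> t * L2_inner \<Omega> (s t) (z t))"
    for s z d
  proof -
    have "\<bar>(LINT t|?M. \<theta> t * L2_inner \<Omega> (w t) (z t)) - (LINT t|?M. \<theta> t * L2_inner \<Omega> (s t) (z t))\<bar>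
        = \<bar>LINT t|?M. \<theta> t * L2_inner \<Omega> (w t) (z t) - \<theta> t * L2_inner \<Omega> (s t) (z t)\<bar>"
      using i by simp
    also have "\<dots> \<le> (LINT t|?M. \<bar>\<theta> t * L2_inner \<Omega> (w t) (z t) - \<theta> t * L2_inner \<Omega> (s t) (z t)\<bar>)"
      by (rule integral_abs_bound)
    also have "\<dots> \<le> (LINT t|?M. C * (L2_norm \<Omega> (\<lambda>x. w t x - s t x) * L2_norm \<Omega> (z t)))"
    proof (rule integral_mono_AE)
      show "integrable ?M (\<lambda>t. \<bar>\<theta> t * L2_inner \<Omega> (w t) (z t) - \<theta> t * L2_inner \<Omega> (s t) (z t)\<bar>)" using i by simp
      show "integrable ?M (\<lambda>t. C * (L2_norm \<Omega> (\<lambda>x. w t x - s t x) * L2_norm \<Omega> (z t)))"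
        using integrable_L2_mult[OF d(1) z(2)] by simp
      show "AE t in ?M. \<bar>\<theta> t * L2_inner \<Omega> (w t) (z t) - \<theta> t * L2_inner \<Omega> (s t) (z t)\<bar>
          \<le> C * (L2_norm \<Omega> (\<lambda>x. w t x - s t x) * L2_norm \<Omega> (z t))"
        using aeI wX z(1)
      proof eventually_elim
        case (elim t)
        have st: "s t \<in> L2_space \<Omega>" using s elim(1) by blast
        have "\<bar>L2_inner \<Omega> (w t) (z t) - L2_inner \<Omega> (s t) (z t)\<bar> \<le> L2_norm \<Omega> (\<lambda>x. w t x - s t x) * L2_norm \<Omega> (z t)"
          using L2_Cauchy_Schwarz[OF L2_space_diff[OF elim(2) st] elim(3)] L2_inner_diff_left[OF elim(2) st elim(3)] by simp
        then have "\<bar>\<theta> t\<bar> * \<bar>L2_inner \<Omega> (w t) (z t) - L2_inner \<Omega> (s t) (z t)\<bar> \<le> C * (L2_norm \<Omega> (\<lambda>x. w t x - s t x) * L2_norm \<Omega> (z t))"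
          using C elim(1) by (intro mult_mono) auto
        then show ?case by (simp only: abs_mult[symmetric] right_diff_distrib)
      qed
    qed
    also have "\<dots> = C * L2_inner {a..b} (\<lambda>t. L2_norm \<Omega> (\<lambda>x. w t x - s t x)) (\<lambda>t. L2_norm \<Omega> (z t))"
      by (simp add: L2_inner_def[of "{a..b}"])
    also have "\<dots> \<le> C * (d * J)"
    proof (rule mult_left_mono[OF _ C(1)])
      have "L2_inner {a..b} (\<lambda>t. L2_norm \<Omega> (\<lambda>x. w t x - s t x)) (\<lambda>t. L2_norm \<Omega> (z t))
          \<le> L2_norm {a..b} (\<lambda>t. L2_norm \<Omega> (\<lambda>x. w t x - s t x)) * L2_norm {a..b} (\<lambda>t. L2_norm \<Omega> (z t))"
        using L2_Cauchy_Schwarz[OF d(1) z(2)] by linarith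
      also have "\<dots> \<le> d * J"
        using d(2) z(3) order_trans[OF L2_norm_nonneg d(2)] by (intro mult_mono) auto
      finally show "L2_inner {a..b} (\<lambda>t. L2_norm \<Omega> (\<lambda>x. w t x - s t x)) (\<lambda>t. L2_norm \<Omega> (z t)) \<le> d * J" .
    qed
    finally show ?thesis .
  qed
  show "(\<lambda>n. LINT t|?M. \<theta> t * (L2_inner \<Omega> (w t) (incr (h n) t) / h n)) \<longlonglongrightarrow> (LINT t|?M. \<theta> t * L2_inner \<Omega> (w t) (g t))"
  proof (rule LIMSEQ_I)
    fix e :: real assume e: "e > 0"
    \<comment> \<open>Chosen to give C d J \<le> e/4; the summands 1 cover C = 0 and J = 0.\<close>
    define d where "d = e / (4 * (C + 1) * (J + 1))"
    have d: "d > 0" unfolding d_def using e C(1) J by (intro divide_pos_pos mult_pos_pos) auto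
    have CdJ: "C * (d * J) \<le> e / 4"
    proof -
      have "C * (d * J) \<le> (C + 1) * (d * (J + 1))" using C(1) J d by (intro mult_mono) auto
      also have "\<dots> = e / 4"
      proof -
        have "4 * (C + 1) * (J + 1) \<noteq> 0" using C(1) J by simp
        then have "d * (4 * (C + 1) * (J + 1)) = e" by (simp add: d_def del: distrib_right_numeral)
        then show ?thesis by (simp add: algebra_simps)
      qed
      finally show ?thesis .
    qed
    obtain s where s: "simple_function ?M s" "s ` {a..b} \<subseteq> L2_space \<Omega>"
      and si: "integrable ?M (\<lambda>t. (L2_norm \<Omega> (\<lambda>x. w t x - s t x))\<^sup>2)"
      and sd: "(LINT t|?M. (L2_norm \<Omega> (\<lambda>x. w t x - s t x))\<^sup>2) < d\<^sup>2"
      by (rule Bochner_L2_simple_approx[OF w _ zero_less_power[OF d, of 2]]) (simp, rule that)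
    have sB: "s \<in> Bochner_L2 {a..b} (L2_space \<Omega>) (L2_norm \<Omega>)"
    proof -
      have "AE t in ?M. s t \<in> L2_space \<Omega>" using s(2) by (intro AE_I2) auto
      moreover have "L2_norm \<Omega> (\<lambda>x. s t x - s t x) = 0" for t by (simp add: L2_norm_def)
      ultimately have sm: "strongly_measurable {a..b} (L2_space \<Omega>) (L2_norm \<Omega>) s"
        unfolding strongly_measurable_def using s by (intro conjI exI[of _ "\<lambda>n. s"]) auto
      have "integrable ?M (\<lambda>t. (L2_norm \<Omega> (s t))\<^sup>2)"
      proof -
        interpret finite_measure ?M by (rule finite_measure_lebesgue_on) auto
        have fin: "finite (s ` {a..b})" using simple_functionD(1)[OF s(1)] by simp
        have "AE t in ?M. norm ((L2_norm \<Omega> (s t))\<^sup>2) \<le> Max ((\<lambda>v. (L2_norm \<Omega> v)\<^sup>2) ` s ` {a..b})"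
        proof (rule AE_I2)
          fix t assume "t \<in> space ?M"
          then show "norm ((L2_norm \<Omega> (s t))\<^sup>2) \<le> Max ((\<lambda>v. (L2_norm \<Omega> v)\<^sup>2) ` s ` {a..b})"
            using fin by (simp add: Max_ge)
        qed
        moreover have "(\<lambda>t. (L2_norm \<Omega> (s t))\<^sup>2) \<in> borel_measurable ?M"
          by (rule simple_function_compose_measurable[OF s, where F = "\<lambda>v t. (L2_norm \<Omega> v)\<^sup>2"]) simp
        ultimately show ?thesis by (intro integrable_const_bound)
      qed
      then show ?thesis using sm by (simp add: Bochner_L2_def)
    qed
    have dL2: "(\<lambda>t. L2_norm \<Omega> (\<lambda>x. w t x - s t x)) \<in> L2_space {a..b}"
      using si sqrt_power2_measurable[OF borel_measurable_integrable[OF si]] by (auto simp: L2_space_def)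
    have dle: "L2_norm {a..b} (\<lambda>t. L2_norm \<Omega> (\<lambda>x. w t x - s t x)) \<le> d"
    proof (rule power2_le_imp_le)
      show "(L2_norm {a..b} (\<lambda>t. L2_norm \<Omega> (\<lambda>x. w t x - s t x)))\<^sup>2 \<le> d\<^sup>2"
        using sd unfolding L2_norm_power2[of "{a..b}"] L2_inner_def[of "{a..b}"] by (simp add: power2_eq_square)
    qed (use d in simp)
    have c1: "\<bar>(LINT t|?M. \<theta> t * L2_inner \<Omega> (w t) (g t)) - (LINT t|?M. \<theta> t * L2_inner \<Omega> (s t) (g t))\<bar> \<le> e / 4"
      using close[OF s(2) dL2 dle gX gL2 gJ intg[OF w] intg[OF sB]] CdJ by linarith
    have c2: "\<bar>(LINT t|?M. \<theta> t * (L2_inner \<Omega> (w t) (y n t) / h n)) - (LINT t|?M. \<theta> t * (L2_inner \<Omega> (s t) (y n t) / h n))\<bar> \<le> e / 4" for n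
    proof -
      \<comment> \<open>The quotient becomes a pairing with a scaled increment, to which
        \<open>close\<close> applies.\<close>
      let ?z = "\<lambda>t x. inverse (h n) * y n t x"
      have z: "L2_inner \<Omega> p (?z t) = L2_inner \<Omega> p (y n t) / h n" for p t
        using L2_inner_scaleR_right[of \<Omega> p "inverse (h n)" "y n t"] by (simp add: divide_inverse mult.commute)
      have zn: "L2_norm \<Omega> (?z t) = L2_norm \<Omega> (y n t) / h n" for t
        using L2_norm_scaleR[of \<Omega> "inverse (h n)" "y n t"] h(1)[of n] by (simp add: divide_inverse mult.commute)
      have "\<bar>(LINT t|?M. \<theta> t * L2_inner \<Omega> (w t) (?z t)) - (LINT t|?M. \<theta> t * L2_inner \<Omega> (s t) (?z t))\<bar> \<le> C * (d * J)"
      proof (rule close[OF s(2) dL2 dle])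
        show "AE t in ?M. ?z t \<in> L2_space \<Omega>" using aey[of n] by eventually_elim auto
        show "(\<lambda>t. L2_norm \<Omega> (?z t)) \<in> L2_space {a..b}" unfolding zn by (rule yhL2)
        show "L2_norm {a..b} (\<lambda>t. L2_norm \<Omega> (?z t)) \<le> J" unfolding zn by (rule yJ)
      qed (use inty[OF w, of n] inty[OF sB, of n] in \<open>simp_all add: z\<close>)
      then show ?thesis unfolding z using CdJ by linarith
    qed
    have "(\<lambda>n. LINT t|?M. \<theta> t * (L2_inner \<Omega> (s t) (incr (h n) t) / h n)) \<longlonglongrightarrow> (LINT t|?M. \<theta> t * L2_inner \<Omega> (s t) (g t))"
      by (rule simple_incr_quotient_tendsto[OF s ab h \<theta>])
    from LIMSEQ_D[OF this, of "e / 4"] e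
    obtain N where N: "\<forall>n\<ge>N. norm ((LINT t|?M. \<theta> t * (L2_inner \<Omega> (s t) (incr (h n) t) / h n)) - (LINT t|?M. \<theta> t * L2_inner \<Omega> (s t) (g t))) < e / 4"
      by auto
    have "norm ((LINT t|?M. \<theta> t * (L2_inner \<Omega> (w t) (incr (h n) t) / h n)) - (LINT t|?M. \<theta> t * L2_inner \<Omega> (w t) (g t))) < e" if "n \<ge> N" for n
      using N[rule_format, OF that] c1 c2[of n] e unfolding y_def real_norm_def by linarith
    then show "\<exists>N. \<forall>n\<ge>N. norm ((LINT t|?M. \<theta> t * (L2_inner \<Omega> (w t) (incr (h n) t) / h n)) - (LINT t|?M. \<theta> t * L2_inner \<Omega> (w t) (g t))) < e" by blast
  qed
qed

section \<open>Integral inequalities from increments\<close>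

text \<open>The hypothesis at s = t - h is divided by h and integrated over [a, b]. The left-hand
  side tends to \<Phi> b - \<Phi> a by continuity of \<Phi> alone, so no derivative of \<Phi> is
  ever formed.\<close>

lemma evolution_inequality_positive:
  assumes w: "w \<in> Bochner_L2 {0<..<T} (L2_space \<Omega>) (L2_norm \<Omega>)" and ab: "0 < a" "a \<le> b" "b < T"
    and cont: "continuous_on {0..T} \<Phi>" "continuous_on {0..T} \<theta>" "continuous_on {0..T} C" "continuous_on {0..T} P"
    and ineq: "AE t in lebesgue_on {0<..<T}. \<forall>s\<in>{0..<t}. \<Phi> t - \<Phi> s
      \<le> \<theta> t * L2_inner \<Omega> (w t) (\<lambda>x. u t x - u s x) + (t - s) * (C t * P s)"
  shows "\<Phi> b - \<Phi> a \<le> (LINT t|lebesgue_on {a..b}. \<theta> t * L2_inner \<Omega> (w t) (g t) + C t * P t)"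
proof -
  let ?M = "lebesgue_on {a..b}"
  \<comment> \<open>The summand 2 ensures h < a already for n = 0, so that t - h stays positive on
    [a, b].\<close>
  define h where "h n = a / (real n + 2)" for n :: nat
  have h: "0 < h n" "h n < a" for n
  proof -
    show "0 < h n" using ab by (simp add: h_def)
    have "a * 1 < a * (real n + 2)" using ab by (intro mult_strict_left_mono) auto
    then show "h n < a" by (simp add: h_def divide_less_eq)
  qed
  have hlim: "h \<longlonglongrightarrow> 0"
    unfolding h_def[abs_def] by real_asymp
  have sub: "{a..b} \<subseteq> {0..T}" "{a..b} \<subseteq> {0<..<T}" using ab by auto
  have wab: "w \<in> Bochner_L2 {a..b} (L2_space \<Omega>) (L2_norm \<Omega>)"
    by (rule Bochner_L2_subset[OF w sub(2)]) auto
  note lim = Bochner_incr_quotient_tendsto[OF wab ab(1,2) h hlim continuous_on_subset[OF cont(2) sub(1)]]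
  have shift: "continuous_on {a..b} (\<lambda>t. f (t - h n))" if "continuous_on {0..T} f" for f n
  proof -
    have "continuous_on {a..b} (f \<circ> (\<lambda>t. t - h n))"
      using h(1)[of n] h(2)[of n] ab
      by (intro continuous_on_compose continuous_intros continuous_on_subset[OF that]) auto
    then show ?thesis by (simp add: o_def)
  qed
  have dc: "continuous_on {a..b} (\<lambda>t. (\<Phi> t - \<Phi> (t - h n)) / h n)" for n
    using h(1)[of n] by (intro continuous_on_divide continuous_on_diff continuous_on_const shift[OF cont(1)]
        continuous_on_subset[OF cont(1) sub(1)]) auto
  have CPc: "continuous_on {a..b} (\<lambda>t. C t * P (t - h n))" for n
    by (intro continuous_on_mult shift[OF cont(4)] continuous_on_subset[OF cont(3) sub(1)])
  have CPc': "continuous_on {a..b} (\<lambda>t. C t * P t)"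
    by (intro continuous_on_mult continuous_on_subset[OF cont(4) sub(1)] continuous_on_subset[OF cont(3) sub(1)])
  have 1: "(\<lambda>n. LINT t|?M. (\<Phi> t - \<Phi> (t - h n)) / h n) \<longlonglongrightarrow> \<Phi> b - \<Phi> a"
  proof -
    have "(\<lambda>n. integral {a..b} (\<lambda>t. (\<Phi> t - \<Phi> (t - h n)) / h n)) \<longlonglongrightarrow> \<Phi> b - \<Phi> a"
      using ab by (intro integral_difference_quotient_tendsto[OF cont(1) _ _ _ h hlim]) auto
    moreover have "(LINT t|?M. (\<Phi> t - \<Phi> (t - h n)) / h n) = integral {a..b} (\<lambda>t. (\<Phi> t - \<Phi> (t - h n)) / h n)" for n
      by (rule lebesgue_integral_eq_integral[OF integrable_continuous_Icc[OF dc]]) simp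
    ultimately show ?thesis by (simp only:)
  qed
  obtain K1 where K1: "K1 \<ge> 0" "\<And>t. t \<in> {0..T} \<Longrightarrow> \<bar>C t\<bar> \<le> K1" by (rule continuous_bounded_on_Icc[OF cont(3)]) (rule that)
  obtain K2 where K2: "K2 \<ge> 0" "\<And>t. t \<in> {0..T} \<Longrightarrow> \<bar>P t\<bar> \<le> K2" by (rule continuous_bounded_on_Icc[OF cont(4)]) (rule that)
  interpret finite_measure ?M by (rule finite_measure_lebesgue_on) auto
  have 2: "(\<lambda>n. LINT t|?M. C t * P (t - h n)) \<longlonglongrightarrow> (LINT t|?M. C t * P t)"
  proof (rule integral_dominated_convergence[where w = "\<lambda>t. K1 * K2"])
    show "AE t in ?M. (\<lambda>n. C t * P (t - h n)) \<longlonglongrightarrow> C t * P t"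
    proof (rule AE_I2, rule tendsto_mult[OF tendsto_const])
      fix t assume t: "t \<in> space ?M"
      have "(\<lambda>n. t - h n) \<longlonglongrightarrow> t - 0" by (intro tendsto_intros hlim)
      then show "(\<lambda>n. P (t - h n)) \<longlonglongrightarrow> P t"
      proof (intro continuous_on_tendsto_compose[OF cont(4)] always_eventually allI)
        show "t - h n \<in> {0..T}" for n using t ab h(1)[of n] h(2)[of n] by simp
      qed (use t ab in auto)
    qed
    show "AE t in ?M. norm (C t * P (t - h n)) \<le> K1 * K2" for n
    proof (rule AE_I2)
      fix t assume "t \<in> space ?M"
      then have "t \<in> {0..T}" "t - h n \<in> {0..T}" using ab h(1)[of n] h(2)[of n] by auto
      then show "norm (C t * P (t - h n)) \<le> K1 * K2"
        using K1 K2 by (simp only: real_norm_def abs_mult) (intro mult_mono; simp)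
    qed
  qed (use borel_measurable_lebesgue_on_Icc_continuous[OF CPc] borel_measurable_lebesgue_on_Icc_continuous[OF CPc'] in auto)
  have "\<Phi> b - \<Phi> a \<le> (LINT t|?M. \<theta> t * L2_inner \<Omega> (w t) (g t)) + (LINT t|?M. C t * P t)"
  proof (rule LIMSEQ_le[OF 1 tendsto_add[OF lim(1) 2]], intro exI allI impI)
    fix n :: nat
    have "(LINT t|?M. (\<Phi> t - \<Phi> (t - h n)) / h n)
        \<le> (LINT t|?M. \<theta> t * (L2_inner \<Omega> (w t) (incr (h n) t) / h n) + C t * P (t - h n))"
    proof (rule integral_mono_AE)
      show "integrable ?M (\<lambda>t. (\<Phi> t - \<Phi> (t - h n)) / h n)" by (rule integrable_continuous_Icc[OF dc])
      show "integrable ?M (\<lambda>t. \<theta> t * (L2_inner \<Omega> (w t) (incr (h n) t) / h n) + C t * P (t - h n))"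
        by (intro Bochner_Integration.integrable_add lim(2) integrable_continuous_Icc[OF CPc])
      have "AE t in ?M. \<forall>s\<in>{0..<t}. \<Phi> t - \<Phi> s
          \<le> \<theta> t * L2_inner \<Omega> (w t) (\<lambda>x. u t x - u s x) + (t - s) * (C t * P s)"
        by (rule AE_lebesgue_on_subset[OF ineq sub(2)]) auto
      moreover have "AE t in ?M. t \<in> {a..b}" by (rule AE_I2) simp
      ultimately show "AE t in ?M. (\<Phi> t - \<Phi> (t - h n)) / h n
          \<le> \<theta> t * (L2_inner \<Omega> (w t) (incr (h n) t) / h n) + C t * P (t - h n)"
      proof eventually_elim
        case (elim t)
        have "t - h n \<in> {0..<t}" using elim(2) h(1)[of n] h(2)[of n] by auto
        from bspec[OF elim(1) this] have "\<Phi> t - \<Phi> (t - h n)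
            \<le> \<theta> t * L2_inner \<Omega> (w t) (incr (h n) t) + h n * (C t * P (t - h n))"
          by (simp add: incr_def[abs_def])
        then have "(\<Phi> t - \<Phi> (t - h n)) / h n
            \<le> (\<theta> t * L2_inner \<Omega> (w t) (incr (h n) t) + h n * (C t * P (t - h n))) / h n"
          using h(1)[of n] by (intro divide_right_mono) auto
        then show ?case using h(1)[of n] by (simp add: add_divide_distrib)
      qed
    qed
    then show "(LINT t|?M. (\<Phi> t - \<Phi> (t - h n)) / h n)
        \<le> (LINT t|?M. \<theta> t * (L2_inner \<Omega> (w t) (incr (h n) t) / h n)) + (LINT t|?M. C t * P (t - h n))"
      by (simp only: Bochner_Integration.integral_add[OF lim(2) integrable_continuous_Icc[OF CPc]])
  qed
  then show ?thesis
    by (simp only: Bochner_Integration.integral_add[OF lim(3) integrable_continuous_Icc[OF CPc']])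
qed

text \<open>The weak derivative is tested on (0, \<infinity>), which yields positive lower limits
  only; continuity of \<Phi> and of the indefinite integral lets them tend to 0. The bound b < T
  keeps [a, b] inside the open interval.\<close>

lemma evolution_inequality:
  assumes w: "w \<in> Bochner_L2 {0<..<T} (L2_space \<Omega>) (L2_norm \<Omega>)" and b: "0 < b" "b < T"
    and cont: "continuous_on {0..T} \<Phi>" "continuous_on {0..T} \<theta>" "continuous_on {0..T} C" "continuous_on {0..T} P"
    and ineq: "AE t in lebesgue_on {0<..<T}. \<forall>s\<in>{0..<t}. \<Phi> t - \<Phi> s
      \<le> \<theta> t * L2_inner \<Omega> (w t) (\<lambda>x. u t x - u s x) + (t - s) * (C t * P s)"
  shows "integrable (lebesgue_on {0..b}) (\<lambda>t. \<theta> t * L2_inner \<Omega> (w t) (g t) + C t * P t)"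
    and "\<Phi> b - \<Phi> 0 \<le> (LINT t|lebesgue_on {0..b}. \<theta> t * L2_inner \<Omega> (w t) (g t) + C t * P t)"
proof -
  let ?F = "\<lambda>t. \<theta> t * L2_inner \<Omega> (w t) (g t) + C t * P t"
  obtain K where K: "K \<ge> 0" "\<And>t. t \<in> {0..T} \<Longrightarrow> \<bar>\<theta> t\<bar> \<le> K" by (rule continuous_bounded_on_Icc[OF cont(2)]) (rule that)
  have sub: "{0<..<T} \<subseteq> {0..T}" by auto
  have "integrable (lebesgue_on {0<..<T}) (\<lambda>t. \<theta> t * L2_inner \<Omega> (w t) (g t))"
  proof (rule Bochner_inner_integrable[OF w])
    show "\<theta> \<in> borel_measurable (lebesgue_on {0<..<T})"
      by (rule measurable_restrict_mono[OF borel_measurable_lebesgue_on_Icc_continuous[OF cont(2)] sub])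
    show "\<bar>\<theta> t\<bar> \<le> K" if "t \<in> {0<..<T}" for t using K(2)[of t] that by auto
    show "AE t in lebesgue_on {0<..<T}. g t \<in> L2_space \<Omega>"
      by (rule AE_lebesgue_on_subset[OF AE_g_L2 sub]) auto
    show "(\<lambda>t. L2_norm \<Omega> (g t)) \<in> L2_space {0<..<T}"
      using measurable_restrict_mono[OF measurable_norm_g sub] integrable_lebesgue_on_subset[OF integrable_norm_g sub]
      by (auto simp: L2_space_def)
    show "(\<lambda>t. L2_inner \<Omega> v (g t)) \<in> borel_measurable (lebesgue_on {0<..<T})" if "v \<in> L2_space \<Omega>" for v
      by (rule measurable_restrict_mono[OF measurable_inner_g[OF that] sub])
  qed auto
  then have "integrable (lebesgue_on {0..T}) (\<lambda>t. \<theta> t * L2_inner \<Omega> (w t) (g t))"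
    by (rule integrable_lebesgue_on_Icc)
  moreover have "integrable (lebesgue_on {0..T}) (\<lambda>t. C t * P t)"
    by (intro integrable_continuous_Icc continuous_on_mult cont)
  ultimately have "integrable (lebesgue_on {0..T}) ?F" by (rule Bochner_Integration.integrable_add)
  from integrable_lebesgue_on_subset[OF this, of "{0..b}"] b
  show F: "integrable (lebesgue_on {0..b}) ?F" by auto
  have FHK: "?F integrable_on {0..b}" by (rule integrable_on_lebesgue_on[OF F]) simp
  define a where "a n = b / (real n + 2)" for n :: nat
  have a: "0 < a n" "a n < b" for n
  proof -
    show "0 < a n" using b by (simp add: a_def)
    have "b * 1 < b * (real n + 2)" using b by (intro mult_strict_left_mono) auto
    then show "a n < b" by (simp add: a_def divide_less_eq)
  qed
  have aT: "a n \<in> {0..T}" "a n \<in> {0..b}" for n using a[of n] b by auto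
  have alim: "a \<longlonglongrightarrow> 0"
    unfolding a_def[abs_def] by real_asymp
  have "\<Phi> b - \<Phi> (a n) \<le> integral {0..b} ?F - integral {0..a n} ?F" for n
  proof -
    have Fa: "integrable (lebesgue_on {a n..b}) ?F"
      using integrable_lebesgue_on_subset[OF F, of "{a n..b}"] a(1)[of n] by auto
    have "\<Phi> b - \<Phi> (a n) \<le> (LINT t|lebesgue_on {a n..b}. ?F t)"
      using a[of n] b by (intro evolution_inequality_positive[OF w _ _ _ cont ineq]) auto
    also have "\<dots> = integral {a n..b} ?F" by (rule lebesgue_integral_eq_integral[OF Fa]) simp
    also have "\<dots> = integral {0..b} ?F - integral {0..a n} ?F"
      using Henstock_Kurzweil_Integration.integral_combine[OF _ _ FHK, of "a n"] a[of n] by simp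
    finally show ?thesis .
  qed
  moreover have "(\<lambda>n. \<Phi> b - \<Phi> (a n)) \<longlonglongrightarrow> \<Phi> b - \<Phi> 0"
    using aT b by (intro tendsto_intros continuous_on_tendsto_compose[OF cont(1) alim] always_eventually allI) auto
  moreover have "(\<lambda>n. integral {0..b} ?F - integral {0..a n} ?F) \<longlonglongrightarrow> integral {0..b} ?F - integral {0..0} ?F"
    using aT b
    by (intro tendsto_intros continuous_on_tendsto_compose[OF indefinite_integral_continuous_1[OF FHK] alim] always_eventually allI) auto
  ultimately have "\<Phi> b - \<Phi> 0 \<le> integral {0..b} ?F - integral {0..0} ?F"
    by (intro LIMSEQ_le) auto
  then show "\<Phi> b - \<Phi> 0 \<le> (LINT t|lebesgue_on {0..b}. ?F t)"
    using lebesgue_integral_eq_integral[OF F] by simp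
qed

end

section \<open>Energy estimates\<close>

text \<open>\<open>real_of_ereal\<close> would turn an infinite essential supremum into 0;
  measurability and the bound C exclude this.\<close>

lemma Linf_norm_AE:
  assumes m: "(\<lambda>t. N (f t)) \<in> borel_measurable (lebesgue_on I)"
    and b: "AE t in lebesgue_on I. N (f t) \<le> C"
  shows "AE t in lebesgue_on I. N (f t) \<le> Linf_norm I N f"
proof -
  let ?M = "lebesgue_on I"
  define e where "e = esssup ?M (\<lambda>t. ereal (N (f t)))"
  have m': "(\<lambda>t. ereal (N (f t))) \<in> borel_measurable ?M" using m by measurable
  have le: "AE t in ?M. ereal (N (f t)) \<le> e" unfolding e_def by (rule esssup_AE)
  have "e \<le> ereal C" unfolding e_def by (rule esssup_I[OF m']) (use b in simp)
  \<comment> \<open>The value -\<infinity> occurs only for a null set of times, where the claim is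
    vacuous.\<close>
  then consider "e = -\<infinity>" | r where "e = ereal r" by (cases e) auto
  then have "AE t in ?M. N (f t) \<le> real_of_ereal e"
  proof cases
    case 1
    show ?thesis using le unfolding 1 by eventually_elim simp
  next
    case 2
    show ?thesis using le unfolding 2 by eventually_elim simp
  qed
  then show ?thesis by (simp add: Linf_norm_def e_def)
qed

context bounded_open
begin

section \<open>The dual norm\<close>

context
  assumes nonempty: "\<Omega> \<noteq> {}" and eigenvalue1_pos: "0 < dirichlet_eigenvalue1 \<Omega>"
begin

lemma L2_norm_le_wgrad:
  assumes "q \<in> H10_space \<Omega>"
  shows "L2_norm \<Omega> q \<le> L2_norm \<Omega> (wgrad \<Omega> q) / sqrt (dirichlet_eigenvalue1 \<Omega>)"
proof (rule power2_le_imp_le)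
  show "(L2_norm \<Omega> q)\<^sup>2 \<le> (L2_norm \<Omega> (wgrad \<Omega> q) / sqrt (dirichlet_eigenvalue1 \<Omega>))\<^sup>2"
    using Poincare_inequality[OF nonempty assms] eigenvalue1_pos by (simp add: power_divide field_simps)
qed (use eigenvalue1_pos in simp)

abbreviation (input) dual_ball :: "('a \<Rightarrow> real) set" where
  "dual_ball \<equiv> {q \<in> H10_space \<Omega>. L2_norm \<Omega> (wgrad \<Omega> q) \<le> 1}"

text \<open>By the Poincare inequality the set whose supremum defines \<open>Hm1_norm\<close> is
  bounded; otherwise that real supremum would carry no information.\<close>

lemma L2_inner_dual_ball_le:
  assumes v: "v \<in> L2_space \<Omega>" and q: "q \<in> dual_ball"
  shows "\<bar>L2_inner \<Omega> v q\<bar> \<le> 1 / sqrt (dirichlet_eigenvalue1 \<Omega>) * L2_norm \<Omega> v"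
proof -
  have "L2_norm \<Omega> q \<le> 1 / sqrt (dirichlet_eigenvalue1 \<Omega>)"
  proof -
    have "L2_norm \<Omega> (wgrad \<Omega> q) / sqrt (dirichlet_eigenvalue1 \<Omega>) \<le> 1 / sqrt (dirichlet_eigenvalue1 \<Omega>)"
      using q eigenvalue1_pos by (intro divide_right_mono) auto
    then show ?thesis using L2_norm_le_wgrad[of q] q by auto
  qed
  then have "L2_norm \<Omega> v * L2_norm \<Omega> q \<le> L2_norm \<Omega> v * (1 / sqrt (dirichlet_eigenvalue1 \<Omega>))"
    by (rule mult_left_mono) simp
  then show ?thesis using L2_Cauchy_Schwarz[OF v H10_L2, of q] q by (simp add: mult.commute)
qed

lemma bdd_above_dual: "v \<in> L2_space \<Omega> \<Longrightarrow> bdd_above ((\<lambda>q. \<bar>L2_inner \<Omega> v q\<bar>) ` dual_ball)"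
  using L2_inner_dual_ball_le by (intro bdd_aboveI2) blast

lemma zero_dual_ball: "(\<lambda>x. 0) \<in> dual_ball"
  using L2_norm_wgrad_cmult[OF H10_H1[OF H10_space_0], of 0] by (simp add: H10_space_0)

lemma Hm1_norm_upper: "v \<in> L2_space \<Omega> \<Longrightarrow> q \<in> dual_ball \<Longrightarrow> \<bar>L2_inner \<Omega> v q\<bar> \<le> Hm1_norm \<Omega> v"
  unfolding Hm1_norm_def by (rule cSUP_upper[OF _ bdd_above_dual])

lemma Hm1_norm_least: "(\<And>q. q \<in> dual_ball \<Longrightarrow> \<bar>L2_inner \<Omega> v q\<bar> \<le> C) \<Longrightarrow> Hm1_norm \<Omega> v \<le> C"
  unfolding Hm1_norm_def using zero_dual_ball by (intro cSUP_least) blast+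

lemma Hm1_norm_le_L2_norm:
  "v \<in> L2_space \<Omega> \<Longrightarrow> Hm1_norm \<Omega> v \<le> 1 / sqrt (dirichlet_eigenvalue1 \<Omega>) * L2_norm \<Omega> v"
  by (rule Hm1_norm_least) (rule L2_inner_dual_ball_le)

text \<open>Makes the dual norm of f a measurable function of time.\<close>

lemma Hm1_norm_Lipschitz:
  assumes v: "v \<in> L2_space \<Omega>" and w: "w \<in> L2_space \<Omega>"
  shows "\<bar>Hm1_norm \<Omega> v - Hm1_norm \<Omega> w\<bar> \<le> 1 / sqrt (dirichlet_eigenvalue1 \<Omega>) * L2_norm \<Omega> (\<lambda>x. v x - w x)"
proof -
  have "Hm1_norm \<Omega> v \<le> Hm1_norm \<Omega> w + 1 / sqrt (dirichlet_eigenvalue1 \<Omega>) * L2_norm \<Omega> (\<lambda>x. v x - w x)"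
    if v: "v \<in> L2_space \<Omega>" and w: "w \<in> L2_space \<Omega>" for v w
  proof (rule Hm1_norm_least)
    fix q assume q: "q \<in> dual_ball"
    have "L2_inner \<Omega> v q = L2_inner \<Omega> w q + L2_inner \<Omega> (\<lambda>x. v x - w x) q"
      using L2_inner_diff_left[OF v w H10_L2, of q] q by simp
    then show "\<bar>L2_inner \<Omega> v q\<bar> \<le> Hm1_norm \<Omega> w + 1 / sqrt (dirichlet_eigenvalue1 \<Omega>) * L2_norm \<Omega> (\<lambda>x. v x - w x)"
      using Hm1_norm_upper[OF w q] L2_inner_dual_ball_le[OF L2_space_diff[OF v w] q] by linarith
  qed
  from this[OF v w] this[OF w v] show ?thesis
    using L2_norm_minus_commute[of \<Omega> v w] by simp
qed

lemma L2_inner_le_Hm1_norm: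
  assumes v: "v \<in> L2_space \<Omega>" and q: "q \<in> H10_space \<Omega>"
  shows "\<bar>L2_inner \<Omega> v q\<bar> \<le> Hm1_norm \<Omega> v * L2_norm \<Omega> (wgrad \<Omega> q)"
proof (cases "L2_norm \<Omega> (wgrad \<Omega> q) = 0")
  case True
  \<comment> \<open>With zero gradient q cannot be normalised, but the Poincare inequality shows
    that it is null.\<close>
  then have "L2_norm \<Omega> q = 0" using L2_norm_le_wgrad[OF q] L2_norm_nonneg[of \<Omega> q] by simp
  then show ?thesis using L2_Cauchy_Schwarz[OF v H10_L2[OF q]] True by simp
next
  case False
  let ?n = "L2_norm \<Omega> (wgrad \<Omega> q)"
  have n: "?n > 0" using False L2_norm_nonneg[of \<Omega> "wgrad \<Omega> q"] by linarith
  let ?p = "\<lambda>x. inverse ?n * q x"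
  have "?p \<in> dual_ball"
    using H10_space_cmult[OF q] L2_norm_wgrad_cmult[OF H10_H1[OF q], of "inverse ?n"] n by simp
  from Hm1_norm_upper[OF v this] have "\<bar>L2_inner \<Omega> v ?p\<bar> \<le> Hm1_norm \<Omega> v" .
  moreover have "L2_inner \<Omega> v ?p = inverse ?n * L2_inner \<Omega> v q"
    using L2_inner_scaleR_right[of \<Omega> v "inverse ?n" q] by simp
  ultimately have "inverse ?n * \<bar>L2_inner \<Omega> v q\<bar> \<le> Hm1_norm \<Omega> v"
    using n by (simp only: abs_mult abs_inverse abs_of_pos)
  then have "\<bar>L2_inner \<Omega> v q\<bar> / ?n \<le> Hm1_norm \<Omega> v" by (simp only: divide_inverse mult.commute)
  then show ?thesis using n by (simp add: pos_divide_le_eq)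
qed

end

lemma L2_norm_le_H2_norm: "L2_norm \<Omega> v \<le> H2_norm \<Omega> v"
proof -
  have "L2_norm \<Omega> v \<le> H1_norm \<Omega> v" by (rule L2_norm_le_H1_norm)
  also have "\<dots> \<le> H2_norm \<Omega> v"
    unfolding H2_norm_def by (intro real_le_rsqrt) (simp add: sum_nonneg)
  finally show ?thesis .
qed

end

text \<open>Continuity is given on each [0, T]; at t < T this is continuity relative to [0,
  \<infinity>).\<close>

lemma at_within_atLeastAtMost_eq:
  fixes t :: real
  assumes "0 \<le> t" "t < T"
  shows "at t within {0..T} = at t within {0..}"
  by (rule at_within_nhd[of t "{..<T}"]) (use assms in auto)

section \<open>Solutions of the Kirchhoff problem\<close>

text \<open>Positivity of the first eigenvalue is a locale hypothesis because the bounds on \<alpha>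
  supply it.\<close>

locale kirchhoff = bounded_open \<Omega> for \<Omega> :: "'a::euclidean_space set" +
  fixes u0 :: "'a \<Rightarrow> real" and f u :: "real \<Rightarrow> 'a \<Rightarrow> real"
  assumes nonempty: "\<Omega> \<noteq> {}" and eigenvalue1_pos: "0 < dirichlet_eigenvalue1 \<Omega>"
    and u0: "u0 \<in> H10_space \<Omega>"
    and f: "f \<in> Bochner_Linf {0<..} (L2_space \<Omega>) (L2_norm \<Omega>)"
    and sol: "strong_solution \<Omega> u0 f u"
begin

abbreviation (input) g :: "real \<Rightarrow> 'a \<Rightarrow> real" where "g \<equiv> time_deriv \<Omega> u"

definition z :: "real \<Rightarrow> real" where "z t = (L2_norm \<Omega> (wgrad \<Omega> (u t)))\<^sup>2"

definition y :: "real \<Rightarrow> real" where "y t = (L2_norm \<Omega> (u t))\<^sup>2"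

abbreviation (input) F :: real where "F \<equiv> Linf_norm {0<..} (L2_norm \<Omega>) f"

abbreviation (input) F' :: real where "F' \<equiv> Linf_norm {0<..} (Hm1_norm \<Omega>) f"

lemma u_H10: "0 \<le> t \<Longrightarrow> u t \<in> H10_space \<Omega>"
  using sol unfolding strong_solution_def continuous_into_def by (auto dest!: spec[of _ "t + 1"])

lemma H1_norm_u_tendsto:
  assumes t: "0 \<le> t"
  shows "((\<lambda>s. H1_norm \<Omega> (\<lambda>x. u s x - u t x)) \<longlongrightarrow> 0) (at t within {0..})"
proof -
  have "continuous_into {0..t + 1} (H10_space \<Omega>) (H1_norm \<Omega>) u"
    using sol t unfolding strong_solution_def by auto
  then have "((\<lambda>s. H1_norm \<Omega> (\<lambda>x. u s x - u t x)) \<longlongrightarrow> 0) (at t within {0..t + 1})"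
    using t unfolding continuous_into_def by auto
  then show ?thesis using at_within_atLeastAtMost_eq[of t "t + 1"] t by simp
qed

sublocale evolution \<Omega> u g
proof
  show "u t \<in> L2_space \<Omega>" if "0 \<le> t" for t using H10_L2[OF u_H10[OF that]] .
  show "((\<lambda>s. L2_norm \<Omega> (\<lambda>x. u s x - u t x)) \<longlongrightarrow> 0) (at t within {0..})" if "0 \<le> t" for t
    using H1_norm_u_tendsto[OF that] by (simp add: H1_norm_tendsto_0_iff)
  have "\<exists>g. has_time_deriv \<Omega> u g" using sol unfolding strong_solution_def by blast
  then show "has_time_deriv \<Omega> u g" unfolding time_deriv_def by (rule someI_ex)
qed

lemma continuous_on_z: "continuous_on {0..} z"
proof -
  have "continuous_on {0..} (\<lambda>t. L2_norm \<Omega> (wgrad \<Omega> (u t)))"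
    unfolding continuous_on_def
  proof
    fix t :: real assume t: "t \<in> {0..}"
    have "((\<lambda>s. L2_norm \<Omega> (wgrad \<Omega> (\<lambda>x. u s x - u t x))) \<longlongrightarrow> 0) (at t within {0..})"
      using H1_norm_u_tendsto[of t] t by (simp add: H1_norm_tendsto_0_iff)
    then have "((\<lambda>s. L2_norm \<Omega> (\<lambda>x. wgrad \<Omega> (u s) x - wgrad \<Omega> (u t) x)) \<longlongrightarrow> 0) (at t within {0..})"
    proof (rule Lim_transform_eventually)
      show "\<forall>\<^sub>F s in at t within {0..}. L2_norm \<Omega> (wgrad \<Omega> (\<lambda>x. u s x - u t x))
          = L2_norm \<Omega> (\<lambda>x. wgrad \<Omega> (u s) x - wgrad \<Omega> (u t) x)"
        using t by (auto simp: eventually_at_filter intro!: always_eventually L2_norm_wgrad_diff H10_H1 u_H10)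
    qed
    then show "((\<lambda>t. L2_norm \<Omega> (wgrad \<Omega> (u t))) \<longlongrightarrow> L2_norm \<Omega> (wgrad \<Omega> (u t))) (at t within {0..})"
      using t by (intro L2_norm_tendsto) (auto simp: eventually_at_filter intro!: always_eventually wgrad_L2 H10_H1 u_H10)
  qed
  then show ?thesis unfolding z_def[abs_def] by (intro continuous_intros)
qed

lemma continuous_on_y: "continuous_on {0..} y"
  unfolding y_def[abs_def] by (intro continuous_intros continuous_on_norm_u)

lemma z_0: "z 0 = (L2_norm \<Omega> (wgrad \<Omega> u0))\<^sup>2" and y_0: "y 0 = (L2_norm \<Omega> u0)\<^sup>2"
proof -
  have ae: "AE x in lebesgue_on \<Omega>. u 0 x = u0 x" using sol unfolding strong_solution_def by blast
  show "y 0 = (L2_norm \<Omega> u0)\<^sup>2"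
    unfolding y_def using ae by (simp add: L2_norm_cong_AE[OF ae] u_L2 H10_L2[OF u0])
  have "L2_norm \<Omega> (wgrad \<Omega> (u 0)) = L2_norm \<Omega> (wgrad \<Omega> u0)"
    using u_H10[of 0] u0 by (intro L2_norm_cong_AE wgrad_cong_AE ae wgrad_L2) (auto intro: H10_H1)
  then show "z 0 = (L2_norm \<Omega> (wgrad \<Omega> u0))\<^sup>2" by (simp add: z_def)
qed

lemma y_le_z: "0 \<le> t \<Longrightarrow> y t \<le> z t / dirichlet_eigenvalue1 \<Omega>"
  using Poincare_inequality[OF nonempty u_H10] eigenvalue1_pos by (simp add: y_def z_def field_simps)

lemma f_Bochner:
  shows "f \<in> Bochner_L2 {0<..<T} (L2_space \<Omega>) (L2_norm \<Omega>)"
proof -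
  have sm: "strongly_measurable {0<..} (L2_space \<Omega>) (L2_norm \<Omega>) f"
    and "\<exists>C. AE t in lebesgue_on {0<..}. L2_norm \<Omega> (f t) \<le> C"
    using f by (auto simp: Bochner_Linf_def)
  then obtain C where C: "AE t in lebesgue_on {0<..}. L2_norm \<Omega> (f t) \<le> C" by blast
  have sub: "{0<..<T} \<subseteq> {0<..}" by auto
  have smT: "strongly_measurable {0<..<T} (L2_space \<Omega>) (L2_norm \<Omega>) f"
    by (rule strongly_measurable_subset[OF sm sub]) auto
  interpret finite_measure "lebesgue_on {0<..<T}" by (rule finite_measure_lebesgue_on) auto
  have "integrable (lebesgue_on {0<..<T}) (\<lambda>t. (L2_norm \<Omega> (f t))\<^sup>2)"
  proof (rule integrable_const_bound)
    have "AE t in lebesgue_on {0<..<T}. L2_norm \<Omega> (f t) \<le> C"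
      by (rule AE_lebesgue_on_subset[OF C sub]) auto
    then show "AE t in lebesgue_on {0<..<T}. norm ((L2_norm \<Omega> (f t))\<^sup>2) \<le> C\<^sup>2"
      by eventually_elim (simp add: power_mono)
    show "(\<lambda>t. (L2_norm \<Omega> (f t))\<^sup>2) \<in> borel_measurable (lebesgue_on {0<..<T})"
      by (intro borel_measurable_power strongly_measurable_L2_norm[OF smT]) auto
  qed
  with smT show ?thesis by (simp add: Bochner_L2_def)
qed

lemma AE_f: "AE t in lebesgue_on {0<..}. f t \<in> L2_space \<Omega> \<and> L2_norm \<Omega> (f t) \<le> F \<and> Hm1_norm \<Omega> (f t) \<le> F'"
proof -
  have sm: "strongly_measurable {0<..} (L2_space \<Omega>) (L2_norm \<Omega>) f"
    and "\<exists>C. AE t in lebesgue_on {0<..}. L2_norm \<Omega> (f t) \<le> C"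
    using f by (auto simp: Bochner_Linf_def)
  then obtain C where C: "AE t in lebesgue_on {0<..}. L2_norm \<Omega> (f t) \<le> C" by blast
  have fX: "AE t in lebesgue_on {0<..}. f t \<in> L2_space \<Omega>" using sm by (simp add: strongly_measurable_def)
  let ?K = "1 / sqrt (dirichlet_eigenvalue1 \<Omega>)"
  have K: "?K \<ge> 0" using eigenvalue1_pos by simp
  have "AE t in lebesgue_on {0<..}. L2_norm \<Omega> (f t) \<le> F"
    using strongly_measurable_L2_norm[OF sm] C by (intro Linf_norm_AE[where C = C]) auto
  moreover have "AE t in lebesgue_on {0<..}. Hm1_norm \<Omega> (f t) \<le> F'"
  proof (rule Linf_norm_AE)
    show "(\<lambda>t. Hm1_norm \<Omega> (f t)) \<in> borel_measurable (lebesgue_on {0<..})"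
      by (rule strongly_measurable_compose[OF sm, where F = "\<lambda>v t. Hm1_norm \<Omega> v" and C = "\<lambda>t. ?K"])
        (use Hm1_norm_Lipschitz[OF nonempty eigenvalue1_pos] in auto)
    show "AE t in lebesgue_on {0<..}. Hm1_norm \<Omega> (f t) \<le> ?K * C"
      using C fX
    proof eventually_elim
      case (elim t)
      have "Hm1_norm \<Omega> (f t) \<le> ?K * L2_norm \<Omega> (f t)"
        by (rule Hm1_norm_le_L2_norm[OF nonempty eigenvalue1_pos elim(2)])
      also have "\<dots> \<le> ?K * C" using K elim(1) by (intro mult_left_mono)
      finally show ?case .
    qed
  qed
  ultimately show ?thesis using fX by eventually_elim simp
qed

text \<open>At almost every time the equation, H^2 regularity and square-integrability hold
  together, and Green's formula applies. The quantifier over q stands inside, so the exceptional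
  times do not depend on q and u(t) - u(s) may be inserted for all s at once.\<close>

lemma AE_weak_form:
  "AE t in lebesgue_on {0<..<T}. g t \<in> L2_space \<Omega> \<and> (\<forall>q\<in>H10_space \<Omega>.
     L2_inner \<Omega> (\<lambda>x. f t x - g t x) q = (1 + z t) * L2_inner \<Omega> (wgrad \<Omega> (u t)) (wgrad \<Omega> q))"
proof -
  have sub: "{0<..<T} \<subseteq> {0<..<max T 1}" "{0<..<T} \<subseteq> {0<..}" "{0<..<T} \<subseteq> {0..T}" by auto
  have "AE t in lebesgue_on {0<..<max T 1}. u t \<in> H2_space \<Omega>"
  proof -
    have "u \<in> Bochner_L2 {0<..<max T 1} (H2_space \<Omega>) (H2_norm \<Omega>)"
      using sol unfolding strong_solution_def by auto
    then show ?thesis by (simp add: Bochner_L2_def strongly_measurable_def)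
  qed
  then have H2: "AE t in lebesgue_on {0<..<T}. u t \<in> H2_space \<Omega>"
    by (rule AE_lebesgue_on_subset[OF _ sub(1)]) auto
  have "AE t in lebesgue_on {0<..}. AE x in lebesgue_on \<Omega>. g t x - (1 + z t) * wlaplacian \<Omega> (u t) x = f t x"
    using sol unfolding strong_solution_def z_def by blast
  then have pde: "AE t in lebesgue_on {0<..<T}. AE x in lebesgue_on \<Omega>. g t x - (1 + z t) * wlaplacian \<Omega> (u t) x = f t x"
    by (rule AE_lebesgue_on_subset[OF _ sub(2)]) auto
  have fT: "AE t in lebesgue_on {0<..<T}. f t \<in> L2_space \<Omega> \<and> L2_norm \<Omega> (f t) \<le> F \<and> Hm1_norm \<Omega> (f t) \<le> F'"
    by (rule AE_lebesgue_on_subset[OF AE_f sub(2)]) auto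
  have gT: "AE t in lebesgue_on {0<..<T}. g t \<in> L2_space \<Omega>"
    by (rule AE_lebesgue_on_subset[OF AE_g_L2 sub(3)]) auto
  show ?thesis
    using H2 pde fT gT
  proof eventually_elim
    case (elim t)
    have lap: "wlaplacian \<Omega> (u t) \<in> L2_space \<Omega>" by (rule wlaplacian_L2[OF elim(1)])
    have "L2_inner \<Omega> (\<lambda>x. f t x - g t x) q = (1 + z t) * L2_inner \<Omega> (wgrad \<Omega> (u t)) (wgrad \<Omega> q)"
      if q: "q \<in> H10_space \<Omega>" for q
    proof -
      have "AE x in lebesgue_on \<Omega>. f t x - g t x = (- (1 + z t)) * wlaplacian \<Omega> (u t) x"
        using elim(2) by eventually_elim (simp add: algebra_simps)
      then have "L2_inner \<Omega> (\<lambda>x. f t x - g t x) q = L2_inner \<Omega> (\<lambda>x. (- (1 + z t)) * wlaplacian \<Omega> (u t) x) q"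
        using elim(3,4) lap by (intro L2_inner_cong_AE L2_space_diff L2_space_cmult H10_L2[OF q]) auto
      also have "\<dots> = (- (1 + z t)) * L2_inner \<Omega> (wlaplacian \<Omega> (u t)) q" by (rule L2_inner_cmult_left)
      also have "\<dots> = (1 + z t) * L2_inner \<Omega> (wgrad \<Omega> (u t)) (wgrad \<Omega> q)"
        by (simp add: L2_inner_wlaplacian[OF elim(1) q] algebra_simps)
      finally show ?thesis .
    qed
    then show ?case using elim(4) by blast
  qed
qed

lemma AE_estimates:
  "AE t in lebesgue_on {0..T}. t \<in> {0..T} \<and> g t \<in> L2_space \<Omega> \<and> f t \<in> L2_space \<Omega> \<and>
     L2_norm \<Omega> (f t) \<le> F \<and> Hm1_norm \<Omega> (f t) \<le> F' \<and>
     L2_inner \<Omega> (\<lambda>x. f t x - g t x) (u t) = (1 + z t) * z t"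
proof -
  have sub: "{0<..<T} \<subseteq> {0<..}" by auto
  have "AE t in lebesgue_on {0<..<T}. f t \<in> L2_space \<Omega> \<and> L2_norm \<Omega> (f t) \<le> F \<and> Hm1_norm \<Omega> (f t) \<le> F'"
    by (rule AE_lebesgue_on_subset[OF AE_f sub]) auto
  moreover have "AE t in lebesgue_on {0<..<T}. t \<in> {0<..<T}" by (rule AE_I2) simp
  ultimately have "AE t in lebesgue_on {0<..<T}. t \<in> {0..T} \<and> g t \<in> L2_space \<Omega> \<and> f t \<in> L2_space \<Omega> \<and>
     L2_norm \<Omega> (f t) \<le> F \<and> Hm1_norm \<Omega> (f t) \<le> F' \<and>
     L2_inner \<Omega> (\<lambda>x. f t x - g t x) (u t) = (1 + z t) * z t"
    using AE_weak_form[of T]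
  proof eventually_elim
    case (elim t)
    have "u t \<in> H10_space \<Omega>" using elim(2) by (intro u_H10) auto
    with elim(3) have "L2_inner \<Omega> (\<lambda>x. f t x - g t x) (u t) = (1 + z t) * z t"
      by (simp add: z_def L2_norm_power2)
    then show ?case using elim by auto
  qed
  then show ?thesis by (rule AE_lebesgue_on_Icc)
qed

lemma u_Bochner:
  assumes "T > 0"
  shows "u \<in> Bochner_L2 {0<..<T} (L2_space \<Omega>) (L2_norm \<Omega>)"
proof -
  have "strongly_measurable {0<..<T} (H2_space \<Omega>) (H2_norm \<Omega>) u"
    using sol assms unfolding strong_solution_def Bochner_L2_def by auto
  then obtain s where s: "\<And>n. simple_function (lebesgue_on {0<..<T}) (s n)" "\<And>n. s n ` {0<..<T} \<subseteq> H2_space \<Omega>"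
    and lim: "AE t in lebesgue_on {0<..<T}. (\<lambda>n. H2_norm \<Omega> (\<lambda>x. u t x - s n t x)) \<longlonglongrightarrow> 0"
    unfolding strongly_measurable_def by auto
  have "AE t in lebesgue_on {0<..<T}. (\<lambda>n. L2_norm \<Omega> (\<lambda>x. u t x - s n t x)) \<longlonglongrightarrow> 0"
    using lim
  proof eventually_elim
    case (elim t)
    show ?case by (rule Lim_null_comparison[OF _ elim]) (simp add: L2_norm_le_H2_norm)
  qed
  moreover have "s n ` {0<..<T} \<subseteq> L2_space \<Omega>" for n using s(2)[of n] H1_L2[OF H2_H1] by blast
  moreover have "AE t in lebesgue_on {0<..<T}. u t \<in> L2_space \<Omega>" by (rule AE_I2) (simp add: u_L2)
  ultimately have sm: "strongly_measurable {0<..<T} (L2_space \<Omega>) (L2_norm \<Omega>) u"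
    unfolding strongly_measurable_def using s(1) by blast
  have "integrable (lebesgue_on {0..T}) y"
    by (intro integrable_continuous_Icc continuous_on_subset[OF continuous_on_y]) auto
  then have "integrable (lebesgue_on {0<..<T}) y"
    by (rule integrable_lebesgue_on_subset) auto
  then show ?thesis using sm by (simp add: Bochner_L2_def y_def[abs_def])
qed

lemma f_minus_g_Bochner:
  assumes "T > 0"
  shows "(\<lambda>t x. f t x - g t x) \<in> Bochner_L2 {0<..<T} (L2_space \<Omega>) (L2_norm \<Omega>)"
proof -
  let ?M = "lebesgue_on {0<..<T}"
  have fB: "strongly_measurable {0<..<T} (L2_space \<Omega>) (L2_norm \<Omega>) f" "integrable ?M (\<lambda>t. (L2_norm \<Omega> (f t))\<^sup>2)"
    using f_Bochner[of T] by (auto simp: Bochner_L2_def)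
  have gB: "strongly_measurable {0<..<T} (L2_space \<Omega>) (L2_norm \<Omega>) g" "integrable ?M (\<lambda>t. (L2_norm \<Omega> (g t))\<^sup>2)"
    using g_Bochner[OF assms] by (auto simp: Bochner_L2_def)
  obtain r where r: "\<And>n. simple_function ?M (r n)" "\<And>n. r n ` {0<..<T} \<subseteq> L2_space \<Omega>"
    and rlim: "AE t in ?M. (\<lambda>n. L2_norm \<Omega> (\<lambda>x. f t x - r n t x)) \<longlonglongrightarrow> 0" and fX: "AE t in ?M. f t \<in> L2_space \<Omega>"
    using fB(1) unfolding strongly_measurable_def by auto
  obtain s where s: "\<And>n. simple_function ?M (s n)" "\<And>n. s n ` {0<..<T} \<subseteq> L2_space \<Omega>"
    and slim: "AE t in ?M. (\<lambda>n. L2_norm \<Omega> (\<lambda>x. g t x - s n t x)) \<longlonglongrightarrow> 0" and gX: "AE t in ?M. g t \<in> L2_space \<Omega>"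
    using gB(1) unfolding strongly_measurable_def by auto
  have inI: "AE t in ?M. t \<in> {0<..<T}" by (rule AE_I2) simp
  have "simple_function ?M (\<lambda>t x. r n t x - s n t x)" for n
    using simple_function_compose2[OF r(1) s(1), of "\<lambda>v w x. v x - w x"] .
  moreover have "(\<lambda>t x. r n t x - s n t x) ` {0<..<T} \<subseteq> L2_space \<Omega>" for n
    using r(2)[of n] s(2)[of n] by (auto intro!: L2_space_diff)
  moreover have "AE t in ?M. (\<lambda>n. L2_norm \<Omega> (\<lambda>x. (f t x - g t x) - (r n t x - s n t x))) \<longlonglongrightarrow> 0"
    using rlim slim fX gX inI
  proof eventually_elim
    case (elim t)
    show ?case
    proof (rule Lim_null_comparison)
      show "(\<lambda>n. L2_norm \<Omega> (\<lambda>x. f t x - r n t x) + L2_norm \<Omega> (\<lambda>x. g t x - s n t x)) \<longlonglongrightarrow> 0"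
        using tendsto_add[OF elim(1,2)] by simp
      have "L2_norm \<Omega> (\<lambda>x. (f t x - g t x) - (r n t x - s n t x))
          \<le> L2_norm \<Omega> (\<lambda>x. f t x - r n t x) + L2_norm \<Omega> (\<lambda>x. g t x - s n t x)" for n
      proof -
        have rs: "r n t \<in> L2_space \<Omega>" "s n t \<in> L2_space \<Omega>" using r(2)[of n] s(2)[of n] elim(5) by auto
        have "(\<lambda>x. (f t x - g t x) - (r n t x - s n t x)) = (\<lambda>x. (f t x - r n t x) + (s n t x - g t x))" by auto
        then show ?thesis
          using L2_norm_triangle[OF L2_space_diff[OF elim(3) rs(1)] L2_space_diff[OF rs(2) elim(4)]]
            L2_norm_minus_commute[of \<Omega> "s n t" "g t"] by simp
      qed
      then show "\<forall>\<^sub>F n in sequentially. norm (L2_norm \<Omega> (\<lambda>x. (f t x - g t x) - (r n t x - s n t x)))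
          \<le> L2_norm \<Omega> (\<lambda>x. f t x - r n t x) + L2_norm \<Omega> (\<lambda>x. g t x - s n t x)"
        by (intro always_eventually allI) simp
    qed
  qed
  moreover have "AE t in ?M. (\<lambda>x. f t x - g t x) \<in> L2_space \<Omega>"
    using fX gX by eventually_elim (rule L2_space_diff)
  ultimately have sm: "strongly_measurable {0<..<T} (L2_space \<Omega>) (L2_norm \<Omega>) (\<lambda>t x. f t x - g t x)"
    unfolding strongly_measurable_def by (intro conjI exI[of _ "\<lambda>n t x. r n t x - s n t x"]) auto
  have "integrable ?M (\<lambda>t. (L2_norm \<Omega> (\<lambda>x. f t x - g t x))\<^sup>2)"
  proof (rule Bochner_Integration.integrable_bound)
    show "integrable ?M (\<lambda>t. 2 * (L2_norm \<Omega> (f t))\<^sup>2 + 2 * (L2_norm \<Omega> (g t))\<^sup>2)" using fB(2) gB(2) by simp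
    show "(\<lambda>t. (L2_norm \<Omega> (\<lambda>x. f t x - g t x))\<^sup>2) \<in> borel_measurable ?M"
      by (intro borel_measurable_power strongly_measurable_L2_norm[OF sm]) auto
    show "AE t in ?M. norm ((L2_norm \<Omega> (\<lambda>x. f t x - g t x))\<^sup>2) \<le> norm (2 * (L2_norm \<Omega> (f t))\<^sup>2 + 2 * (L2_norm \<Omega> (g t))\<^sup>2)"
      using fX gX
    proof eventually_elim
      case (elim t)
      have "(L2_norm \<Omega> (\<lambda>x. f t x - g t x))\<^sup>2 \<le> 2 * (L2_norm \<Omega> (f t))\<^sup>2 + 2 * (L2_norm \<Omega> (g t))\<^sup>2"
        using L2_parallelogram[OF elim] zero_le_power2[of "L2_norm \<Omega> (\<lambda>x. f t x + g t x)"] by linarith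
      then show ?case by simp
    qed
  qed
  with sm show ?thesis by (simp add: Bochner_L2_def)
qed

section \<open>Energy inequalities\<close>

text \<open>The exponential lies above its tangent at t: the same backward use of convexity as for
  the norms.\<close>

lemma exp_increment_le:
  fixes \<alpha> s t :: real
  shows "exp (2 * \<alpha> * t) - exp (2 * \<alpha> * s) \<le> (t - s) * (2 * \<alpha> * exp (2 * \<alpha> * t))"
proof -
  have "exp (2 * \<alpha> * s) = exp (2 * \<alpha> * t) * exp (2 * \<alpha> * (s - t))"
    by (simp add: algebra_simps flip: exp_add)
  also have "\<dots> \<ge> exp (2 * \<alpha> * t) * (1 + 2 * \<alpha> * (s - t))"
    by (intro mult_left_mono exp_ge_add_one_self) simp
  finally show ?thesis by (simp add: algebra_simps)
qed

lemma integral_exp: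
  fixes \<alpha> t :: real
  assumes "\<alpha> > 0" "t > 0"
  shows "(LINT s|lebesgue_on {0..t}. exp (2 * \<alpha> * s)) = (exp (2 * \<alpha> * t) - 1) / (2 * \<alpha>)"
proof -
  have "((\<lambda>s. exp (2 * \<alpha> * s)) has_integral exp (2 * \<alpha> * t) / (2 * \<alpha>) - exp (2 * \<alpha> * 0) / (2 * \<alpha>)) {0..t}"
    using assms
    by (intro fundamental_theorem_of_calculus)
      (auto intro!: derivative_eq_intros simp flip: has_real_derivative_iff_has_vector_derivative)
  moreover have "(LINT s|lebesgue_on {0..t}. exp (2 * \<alpha> * s)) = integral {0..t} (\<lambda>s. exp (2 * \<alpha> * s))"
    by (intro lebesgue_integral_eq_integral integrable_continuous_Icc continuous_intros) auto
  ultimately show ?thesis by (simp add: integral_unique diff_divide_distrib)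
qed

text \<open>Testing the equation with \<open>u\<close>.\<close>

lemma dissipation_bound:
  assumes \<alpha>: "0 < \<alpha>" and t: "0 < t"
  defines "\<beta> \<equiv> 1 - 2 * \<alpha> / dirichlet_eigenvalue1 \<Omega>"
  shows "(LINT s|lebesgue_on {0..t}. exp (2 * \<alpha> * s) * (\<beta> * z s + 2 * (z s)\<^sup>2))
    \<le> y 0 + F'\<^sup>2 * ((exp (2 * \<alpha> * t) - 1) / (2 * \<alpha>))"
proof -
  let ?e = "\<lambda>s. exp (2 * \<alpha> * s)"
  let ?M = "lebesgue_on {0..t}"
  have yc: "continuous_on {0..T} y" and zc: "continuous_on {0..T} z" for T
    by (auto intro: continuous_on_subset[OF continuous_on_y] continuous_on_subset[OF continuous_on_z])
  \<comment> \<open>The increment splits into \<open>?e r * (y r - y s)\<close> and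
    \<open>(?e r - ?e s) * y s\<close>. The slope in \<open>u\<close> thus sits at the later time,
    while the weight multiplies a value at s, the \<open>P s\<close> of
    \<open>evolution_inequality\<close>.\<close>
  have ineq: "?e r * y r - ?e s * y s
      \<le> 2 * ?e r * L2_inner \<Omega> (u r) (\<lambda>x. u r x - u s x) + (r - s) * (2 * \<alpha> * ?e r * y s)"
    if rs: "0 \<le> s" "s < r" for r s
  proof -
    have L2: "u r \<in> L2_space \<Omega>" "u s \<in> L2_space \<Omega>" using rs by (auto intro: u_L2)
    \<comment> \<open>The gap is the squared norm of u(r) - u(s).\<close>
    have "y r - y s \<le> 2 * L2_inner \<Omega> (u r) (\<lambda>x. u r x - u s x)"
      using L2_inner_expand[OF L2, of "-1"] L2_inner_self_nonneg[of \<Omega> "\<lambda>x. u r x + (-1) *\<^sub>R u s x"]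
        L2_inner_diff_right[OF L2 L2(1)] by (simp add: y_def L2_norm_power2)
    then have "?e r * (y r - y s) \<le> ?e r * (2 * L2_inner \<Omega> (u r) (\<lambda>x. u r x - u s x))"
      by (intro mult_left_mono) auto
    moreover have "(?e r - ?e s) * y s \<le> ((r - s) * (2 * \<alpha> * ?e r)) * y s"
      by (intro mult_right_mono exp_increment_le) (simp add: y_def)
    ultimately show ?thesis by (simp add: algebra_simps)
  qed
  note evo = evolution_inequality[OF u_Bochner[of "t + 1"], where b = t and \<Phi> = "\<lambda>s. ?e s * y s" and \<theta> = "\<lambda>s. 2 * ?e s"
      and C = "\<lambda>s. 2 * \<alpha> * ?e s" and P = y]
  have int: "integrable ?M (\<lambda>s. 2 * ?e s * L2_inner \<Omega> (u s) (g s) + 2 * \<alpha> * ?e s * y s)"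
    using t ineq by (intro evo) (auto intro!: continuous_intros yc AE_I2)
  have "?e t * y t - ?e 0 * y 0 \<le> (LINT s|?M. 2 * ?e s * L2_inner \<Omega> (u s) (g s) + 2 * \<alpha> * ?e s * y s)"
    using t ineq by (intro evo) (auto intro!: continuous_intros yc AE_I2)
  also have "\<dots> \<le> (LINT s|?M. F'\<^sup>2 * ?e s - ?e s * (\<beta> * z s + 2 * (z s)\<^sup>2))"
  proof (rule integral_mono_AE[OF int])
    show "integrable ?M (\<lambda>s. F'\<^sup>2 * ?e s - ?e s * (\<beta> * z s + 2 * (z s)\<^sup>2))"
      by (intro integrable_continuous_Icc continuous_intros zc)
    show "AE s in ?M. 2 * ?e s * L2_inner \<Omega> (u s) (g s) + 2 * \<alpha> * ?e s * y s
        \<le> F'\<^sup>2 * ?e s - ?e s * (\<beta> * z s + 2 * (z s)\<^sup>2)"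
      using AE_estimates[of t]
    proof eventually_elim
      case (elim s)
      let ?n = "L2_norm \<Omega> (wgrad \<Omega> (u s))"
      have s: "0 \<le> s" and gs: "g s \<in> L2_space \<Omega>" and fs: "f s \<in> L2_space \<Omega>" and Fs: "Hm1_norm \<Omega> (f s) \<le> F'"
        and weak: "L2_inner \<Omega> (\<lambda>x. f s x - g s x) (u s) = (1 + z s) * z s"
        using elim by auto
      have us: "u s \<in> H10_space \<Omega>" by (rule u_H10[OF s])
      have "L2_inner \<Omega> (f s) (u s) \<le> Hm1_norm \<Omega> (f s) * ?n"
        using L2_inner_le_Hm1_norm[OF nonempty eigenvalue1_pos fs us] by linarith
      also have "\<dots> \<le> F' * ?n" using Fs by (intro mult_right_mono) auto
      \<comment> \<open>Young's inequality spends one of the two copies of z in 2 (1 + z) z. The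
        Poincare inequality below spends (1 - \<beta>) z of the other, and \<beta> z
        remains.\<close>
      finally have fu: "2 * L2_inner \<Omega> (f s) (u s) \<le> F'\<^sup>2 + z s"
        using sum_squares_bound[of F' ?n] unfolding z_def by linarith
      have "L2_inner \<Omega> (u s) (g s) = L2_inner \<Omega> (f s) (u s) - (1 + z s) * z s"
        using weak L2_inner_diff_left[OF fs gs H10_L2[OF us]] by (simp add: L2_inner_commute)
      moreover have "2 * \<alpha> * y s \<le> 2 * \<alpha> * (z s / dirichlet_eigenvalue1 \<Omega>)"
        using y_le_z[OF s] \<alpha> by (intro mult_left_mono) auto
      ultimately have "2 * L2_inner \<Omega> (u s) (g s) + 2 * \<alpha> * y s \<le> F'\<^sup>2 - (\<beta> * z s + 2 * (z s)\<^sup>2)"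
        using fu by (simp add: \<beta>_def algebra_simps power2_eq_square)
      then have "?e s * (2 * L2_inner \<Omega> (u s) (g s) + 2 * \<alpha> * y s) \<le> ?e s * (F'\<^sup>2 - (\<beta> * z s + 2 * (z s)\<^sup>2))"
        by (intro mult_left_mono) auto
      then show ?case by (simp add: algebra_simps)
    qed
  qed
  also have "\<dots> = F'\<^sup>2 * (LINT s|?M. ?e s) - (LINT s|?M. ?e s * (\<beta> * z s + 2 * (z s)\<^sup>2))"
    by (subst Bochner_Integration.integral_diff) (auto intro!: integrable_continuous_Icc continuous_intros zc)
  finally have "?e t * y t - y 0 \<le> F'\<^sup>2 * ((?e t - 1) / (2 * \<alpha>)) - (LINT s|?M. ?e s * (\<beta> * z s + 2 * (z s)\<^sup>2))"
    using integral_exp[OF \<alpha> t] by simp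
  \<comment> \<open>The norm at the final time is discarded; the dissipation is what the energy
    bound uses.\<close>
  moreover have "0 \<le> ?e t * y t" by (simp add: y_def)
  ultimately show ?thesis by linarith
qed

text \<open>
  Testing the equation with \<open>u\<^sub>t\<close>: the energy \<open>(2 + z) z\<close> is convex in \<open>\<nabla>u\<close>, so that its
  backward increments are bounded by the pairing of \<open>f - u\<^sub>t\<close> with those of \<open>u\<close>.
\<close>

lemma energy_bound:
  assumes \<alpha>: "0 < \<alpha>" "\<alpha> < dirichlet_eigenvalue1 \<Omega> / 2" and t: "0 < t"
  defines "\<beta> \<equiv> 1 - 2 * \<alpha> / dirichlet_eigenvalue1 \<Omega>"
  shows "2 * (LINT s|lebesgue_on {0..t}. exp (2 * \<alpha> * s) * (L2_norm \<Omega> (g s))\<^sup>2)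
      + exp (2 * \<alpha> * t) * ((2 + z t) * z t)
    \<le> (2 + z 0) * z 0 + 2 * F\<^sup>2 * ((exp (2 * \<alpha> * t) - 1) / (2 * \<alpha>))
      + \<alpha> * (1 + 4 / \<beta>) * (y 0 + F'\<^sup>2 * ((exp (2 * \<alpha> * t) - 1) / (2 * \<alpha>)))"
proof -
  let ?e = "\<lambda>s. exp (2 * \<alpha> * s)"
  let ?M = "lebesgue_on {0..t}"
  let ?E = "\<lambda>s. (2 + z s) * z s"
  have \<beta>: "\<beta> > 0" using \<alpha> eigenvalue1_pos by (simp add: \<beta>_def field_simps)
  have zc: "continuous_on {0..T} z" for T
    by (auto intro: continuous_on_subset[OF continuous_on_z])
  have ec: "continuous_on S ?e" for S by (intro continuous_intros)
  have z0: "0 \<le> z s" for s by (simp add: z_def)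
  have ineq: "?e r * ?E r - ?e s * ?E s
      \<le> 4 * ?e r * L2_inner \<Omega> (\<lambda>x. f r x - g r x) (\<lambda>x. u r x - u s x) + (r - s) * (2 * \<alpha> * ?e r * ?E s)"
    if rs: "0 \<le> s" "s < r" and weak: "\<forall>q\<in>H10_space \<Omega>.
     L2_inner \<Omega> (\<lambda>x. f r x - g r x) q = (1 + z r) * L2_inner \<Omega> (wgrad \<Omega> (u r)) (wgrad \<Omega> q)" for r s
  proof -
    have us: "u r \<in> H10_space \<Omega>" "u s \<in> H10_space \<Omega>" using rs by (auto intro: u_H10)
    have L2: "wgrad \<Omega> (u r) \<in> L2_space \<Omega>" "wgrad \<Omega> (u s) \<in> L2_space \<Omega>"
      using us by (auto intro: wgrad_L2 H10_H1)
    have "z r - z s \<le> 2 * L2_inner \<Omega> (wgrad \<Omega> (u r)) (\<lambda>x. wgrad \<Omega> (u r) x - wgrad \<Omega> (u s) x)"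
      using L2_inner_expand[OF L2, of "-1"] L2_inner_self_nonneg[of \<Omega> "\<lambda>x. wgrad \<Omega> (u r) x + (-1) *\<^sub>R wgrad \<Omega> (u s) x"]
        L2_inner_diff_right[OF L2 L2(1)] by (simp add: z_def L2_norm_power2)
    also have "L2_inner \<Omega> (wgrad \<Omega> (u r)) (\<lambda>x. wgrad \<Omega> (u r) x - wgrad \<Omega> (u s) x)
        = L2_inner \<Omega> (wgrad \<Omega> (u r)) (wgrad \<Omega> (\<lambda>x. u r x - u s x))"
      using wgrad_diff[OF H10_H1[OF us(1)] H10_H1[OF us(2)]]
      by (intro L2_inner_cong_AE L2_space_diff L2 wgrad_L2[OF H10_H1[OF H10_space_diff[OF us]]]) auto
    finally have zz: "z r - z s \<le> 2 * L2_inner \<Omega> (wgrad \<Omega> (u r)) (wgrad \<Omega> (\<lambda>x. u r x - u s x))" .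
    \<comment> \<open>The gap is (z r - z s)^2. The factor 1 + z r is the coefficient of the
      equation at time r, which brings in the pairing with f - u_t.\<close>
    have "?E r - ?E s \<le> 2 * (1 + z r) * (z r - z s)"
      using zero_le_power2[of "z r - z s"] by (simp add: algebra_simps power2_eq_square)
    also have "\<dots> \<le> 2 * (1 + z r) * (2 * L2_inner \<Omega> (wgrad \<Omega> (u r)) (wgrad \<Omega> (\<lambda>x. u r x - u s x)))"
      using z0[of r] by (intro mult_left_mono zz) auto
    also have "\<dots> = 4 * L2_inner \<Omega> (\<lambda>x. f r x - g r x) (\<lambda>x. u r x - u s x)"
      using weak H10_space_diff[OF us] by simp
    finally have "?e r * (?E r - ?E s) \<le> ?e r * (4 * L2_inner \<Omega> (\<lambda>x. f r x - g r x) (\<lambda>x. u r x - u s x))"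
      by (intro mult_left_mono) auto
    moreover have "(?e r - ?e s) * ?E s \<le> ((r - s) * (2 * \<alpha> * ?e r)) * ?E s"
      using z0[of s] by (intro mult_right_mono exp_increment_le) simp
    ultimately show ?thesis by (simp add: algebra_simps)
  qed
  have ineqAE: "AE r in lebesgue_on {0<..<t + 1}. \<forall>s\<in>{0..<r}. ?e r * ?E r - ?e s * ?E s
      \<le> 4 * ?e r * L2_inner \<Omega> (\<lambda>x. f r x - g r x) (\<lambda>x. u r x - u s x) + (r - s) * (2 * \<alpha> * ?e r * ?E s)"
    using AE_weak_form[of "t + 1"]
  proof eventually_elim
    case (elim r)
    show ?case
    proof
      fix s assume "s \<in> {0..<r}"
      then show "?e r * ?E r - ?e s * ?E s
          \<le> 4 * ?e r * L2_inner \<Omega> (\<lambda>x. f r x - g r x) (\<lambda>x. u r x - u s x) + (r - s) * (2 * \<alpha> * ?e r * ?E s)"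
        using elim by (intro ineq) auto
    qed
  qed
  have T1: "0 < t + 1" "t < t + 1" using t by auto
  have cont: "continuous_on {0..t + 1} (\<lambda>s. ?e s * ?E s)" "continuous_on {0..t + 1} (\<lambda>s. 4 * ?e s)"
    "continuous_on {0..t + 1} (\<lambda>s. 2 * \<alpha> * ?e s)" "continuous_on {0..t + 1} ?E"
    by (intro continuous_intros zc)+
  note evo = evolution_inequality[OF f_minus_g_Bochner[OF T1(1)] t T1(2) cont ineqAE]
  have gint: "integrable ?M (\<lambda>s. ?e s * (L2_norm \<Omega> (g s))\<^sup>2)"
  proof -
    obtain K where "\<And>s. s \<in> {0..t} \<Longrightarrow> \<bar>?e s\<bar> \<le> K" by (rule continuous_bounded_on_Icc[OF ec]) (rule that)
    then show ?thesis
      by (intro integrable_bounded_mult[OF integrable_norm_g borel_measurable_lebesgue_on_Icc_continuous[OF ec]]) auto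
  qed
  have zint: "integrable ?M (\<lambda>s. ?e s * (\<beta> * z s + 2 * (z s)\<^sup>2))"
    by (intro integrable_continuous_Icc continuous_intros zc)
  have eint: "integrable ?M ?e" by (rule integrable_continuous_Icc[OF ec])
  \<comment> \<open>The weight is distributed over free variables here, keeping the concrete terms
    out of the rearrangement.\<close>
  have gen: "4 * e * I + 2 * \<alpha> * e * E' \<le> 2 * F2 * e - 2 * (e * n2) + \<alpha> * c * (e * W)"
    if "e * (4 * I + \<alpha> * (2 * E')) \<le> e * (2 * F2 - 2 * n2 + \<alpha> * (c * W))" for e I E' F2 n2 c W :: real
    using that by (simp add: algebra_simps)
  have "?e t * ?E t - ?e 0 * ?E 0
      \<le> (LINT s|?M. 4 * ?e s * L2_inner \<Omega> (\<lambda>x. f s x - g s x) (g s) + 2 * \<alpha> * ?e s * ?E s)"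
    by (rule evo(2))
  also have "\<dots> \<le> (LINT s|?M. 2 * F\<^sup>2 * ?e s - 2 * (?e s * (L2_norm \<Omega> (g s))\<^sup>2)
      + \<alpha> * (1 + 4 / \<beta>) * (?e s * (\<beta> * z s + 2 * (z s)\<^sup>2)))"
  proof (rule integral_mono_AE[OF evo(1)])
    show "integrable ?M (\<lambda>s. 2 * F\<^sup>2 * ?e s - 2 * (?e s * (L2_norm \<Omega> (g s))\<^sup>2)
      + \<alpha> * (1 + 4 / \<beta>) * (?e s * (\<beta> * z s + 2 * (z s)\<^sup>2)))"
      by (intro Bochner_Integration.integrable_add Bochner_Integration.integrable_diff integrable_mult_right eint gint zint)
    show "AE s in ?M. 4 * ?e s * L2_inner \<Omega> (\<lambda>x. f s x - g s x) (g s) + 2 * \<alpha> * ?e s * ?E s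
        \<le> 2 * F\<^sup>2 * ?e s - 2 * (?e s * (L2_norm \<Omega> (g s))\<^sup>2)
          + \<alpha> * (1 + 4 / \<beta>) * (?e s * (\<beta> * z s + 2 * (z s)\<^sup>2))"
      using AE_estimates[of t]
    proof eventually_elim
      case (elim s)
      let ?n = "L2_norm \<Omega> (g s)" and ?m = "L2_norm \<Omega> (f s)"
      have gs: "g s \<in> L2_space \<Omega>" and fs: "f s \<in> L2_space \<Omega>" and Fs: "?m \<le> F" using elim by auto
      have "L2_inner \<Omega> (f s) (g s) \<le> ?m * ?n" using L2_Cauchy_Schwarz[OF fs gs] by linarith
      moreover have "?m\<^sup>2 \<le> F\<^sup>2" using Fs by (intro power_mono) auto
      moreover have "L2_inner \<Omega> (\<lambda>x. f s x - g s x) (g s) = L2_inner \<Omega> (f s) (g s) - ?n\<^sup>2"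
        using L2_inner_diff_left[OF fs gs gs] by (simp add: L2_norm_power2)
      \<comment> \<open>4 m n \<le> 2 m^2 + 2 n^2 leaves -2 n^2 of the term -4 n^2, whence the
        factor 2 in front of the integral of the squared norm of u_t.\<close>
      ultimately have 1: "4 * L2_inner \<Omega> (\<lambda>x. f s x - g s x) (g s) \<le> 2 * F\<^sup>2 - 2 * ?n\<^sup>2"
        using sum_squares_bound[of ?m ?n] by linarith
      \<comment> \<open>In the product, 4/\<beta> times \<beta> z gives 4 z and 1 times 2 z^2 gives
        2 z^2, together 2 (2 + z) z; the other terms are nonnegative.\<close>
      have "2 * ?E s \<le> (1 + 4 / \<beta>) * (\<beta> * z s + 2 * (z s)\<^sup>2)"
      proof -
        have "(1 + 4 / \<beta>) * (\<beta> * z s + 2 * (z s)\<^sup>2) = 2 * ?E s + (\<beta> * z s + 8 * (z s)\<^sup>2 / \<beta>)"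
          using \<beta> by (simp add: field_simps power2_eq_square)
        moreover have "0 \<le> \<beta> * z s + 8 * (z s)\<^sup>2 / \<beta>" using \<beta> z0[of s] by simp
        ultimately show ?thesis by linarith
      qed
      then have "\<alpha> * (2 * ?E s) \<le> \<alpha> * ((1 + 4 / \<beta>) * (\<beta> * z s + 2 * (z s)\<^sup>2))"
        using \<alpha> by (intro mult_left_mono) auto
      with 1 have "4 * L2_inner \<Omega> (\<lambda>x. f s x - g s x) (g s) + \<alpha> * (2 * ?E s)
          \<le> 2 * F\<^sup>2 - 2 * ?n\<^sup>2 + \<alpha> * ((1 + 4 / \<beta>) * (\<beta> * z s + 2 * (z s)\<^sup>2))" by linarith
      then have "?e s * (4 * L2_inner \<Omega> (\<lambda>x. f s x - g s x) (g s) + \<alpha> * (2 * ?E s))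
          \<le> ?e s * (2 * F\<^sup>2 - 2 * ?n\<^sup>2 + \<alpha> * ((1 + 4 / \<beta>) * (\<beta> * z s + 2 * (z s)\<^sup>2)))"
        by (intro mult_left_mono) auto
      then show ?case by (rule gen)
    qed
  qed
  also have "\<dots> = 2 * F\<^sup>2 * (LINT s|?M. ?e s) - 2 * (LINT s|?M. ?e s * (L2_norm \<Omega> (g s))\<^sup>2)
      + \<alpha> * (1 + 4 / \<beta>) * (LINT s|?M. ?e s * (\<beta> * z s + 2 * (z s)\<^sup>2))"
    using eint gint zint
    by (simp only: Bochner_Integration.integral_add Bochner_Integration.integral_diff integral_mult_right_zero
        integrable_mult_right Bochner_Integration.integrable_add Bochner_Integration.integrable_diff)
  also have "(LINT s|?M. ?e s) = (?e t - 1) / (2 * \<alpha>)" by (rule integral_exp[OF \<alpha>(1) t])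
  finally have "?e t * ?E t - ?E 0 \<le> 2 * F\<^sup>2 * ((?e t - 1) / (2 * \<alpha>)) - 2 * (LINT s|?M. ?e s * (L2_norm \<Omega> (g s))\<^sup>2)
      + \<alpha> * (1 + 4 / \<beta>) * (LINT s|?M. ?e s * (\<beta> * z s + 2 * (z s)\<^sup>2))"
    by simp
  moreover have "\<alpha> * (1 + 4 / \<beta>) * (LINT s|?M. ?e s * (\<beta> * z s + 2 * (z s)\<^sup>2))
      \<le> \<alpha> * (1 + 4 / \<beta>) * (y 0 + F'\<^sup>2 * ((?e t - 1) / (2 * \<alpha>)))"
    using dissipation_bound[OF \<alpha>(1) t] \<alpha> \<beta> by (intro mult_left_mono) (auto simp: \<beta>_def)
  ultimately show ?thesis by linarith
qed

end

theorem lemma2p3: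
  fixes \<Omega> :: "(real ^ 'd) set"
    and u0 :: "real ^ 'd \<Rightarrow> real"
    and f u :: "real \<Rightarrow> real ^ 'd \<Rightarrow> real"
    and \<alpha> t :: real
  assumes "CARD('d) = 2 \<or> CARD('d) = 3"
    and "convex_polytopal_domain \<Omega>"
    and "u0 \<in> H10_space \<Omega>"
    and "f \<in> Bochner_Linf {0<..} (L2_space \<Omega>) (L2_norm \<Omega>)"
    and "strong_solution \<Omega> u0 f u"
    and "0 < \<alpha>" and "\<alpha> < dirichlet_eigenvalue1 \<Omega> / 2"
    and "0 < t"
  shows
    "let \<beta> = 1 - 2 * \<alpha> / dirichlet_eigenvalue1 \<Omega>;
         E = (\<lambda>v. (2 + (L2_norm \<Omega> (wgrad \<Omega> v))\<^sup>2) * (L2_norm \<Omega> (wgrad \<Omega> v))\<^sup>2);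
         F = Linf_norm {0<..} (L2_norm \<Omega>) f;
         F' = Linf_norm {0<..} (Hm1_norm \<Omega>) f;
         K0_hat = exp (- 2 * \<alpha> * t) * (L2_norm \<Omega> u0)\<^sup>2
                    + 1 / (2 * \<alpha>) * F'\<^sup>2 * (1 - exp (- 2 * \<alpha> * t));
         K0 = (L2_norm \<Omega> u0)\<^sup>2 + 1 / (2 * \<alpha>) * F'\<^sup>2;
         A = 2 * exp (- 2 * \<alpha> * t) *
               (LINT s|lebesgue_on {0..t}. exp (2 * \<alpha> * s) * (L2_norm \<Omega> (time_deriv \<Omega> u s))\<^sup>2)
               + E (u t);
         B = E u0 * exp (- 2 * \<alpha> * t) + 1 / \<alpha> * F\<^sup>2 * (1 - exp (- 2 * \<alpha> * t))
               + \<alpha> * (1 + 4 / \<beta>) * K0_hat;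
         C = E u0 + 1 / \<alpha> * F\<^sup>2 + \<alpha> * (1 + 4 / \<beta>) * K0
     in A \<le> B \<and> B \<le> C"
proof -
  have \<Omega>: "open \<Omega>" "bounded \<Omega>" "\<Omega> \<noteq> {}" using assms(2) by (auto simp: convex_polytopal_domain_def)
  interpret kirchhoff \<Omega> u0 f u
    by unfold_locales (use \<Omega> assms in auto)
  define \<beta> where "\<beta> = 1 - 2 * \<alpha> / dirichlet_eigenvalue1 \<Omega>"
  define F where "F = Linf_norm {0<..} (L2_norm \<Omega>) f"
  define F' where "F' = Linf_norm {0<..} (Hm1_norm \<Omega>) f"
  define e where "e = exp (2 * \<alpha> * t)"
  define d where "d = exp (- 2 * \<alpha> * t)"
  define G where "G = (LINT s|lebesgue_on {0..t}. exp (2 * \<alpha> * s) * (L2_norm \<Omega> (time_deriv \<Omega> u s))\<^sup>2)"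
  define E0 where "E0 = (2 + z 0) * z 0"
  define k where "k = \<alpha> * (1 + 4 / \<beta>)"
  have de: "d * e = 1" by (simp add: d_def e_def flip: exp_add)
  have d: "0 < d" "d \<le> 1" using assms(6,8) by (auto simp: d_def)
  have \<beta>: "\<beta> > 0" using assms(6,7) eigenvalue1_pos by (simp add: \<beta>_def field_simps)
  then have k: "k \<ge> 0" using assms(6) by (simp add: k_def)
  have E0: "E0 \<ge> 0" by (simp add: E0_def z_def)
  have bound: "2 * G + e * ((2 + z t) * z t)
      \<le> E0 + 2 * F\<^sup>2 * ((e - 1) / (2 * \<alpha>)) + k * (y 0 + F'\<^sup>2 * ((e - 1) / (2 * \<alpha>)))"
    using energy_bound[OF assms(6-8)] by (simp only: G_def e_def E0_def F_def F'_def k_def \<beta>_def)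
  \<comment> \<open>Since d e = 1, multiplication by d turns e - 1 into 1 - d and removes the weight
    from the final energy; the quotient 2/(2\<alpha>) becomes 1/\<alpha>.\<close>
  have "d * (2 * G + e * ((2 + z t) * z t))
      \<le> d * (E0 + 2 * F\<^sup>2 * ((e - 1) / (2 * \<alpha>)) + k * (y 0 + F'\<^sup>2 * ((e - 1) / (2 * \<alpha>))))"
    using d by (intro mult_left_mono bound) auto
  also have "d * (2 * G + e * ((2 + z t) * z t)) = 2 * d * G + (d * e) * ((2 + z t) * z t)"
    by (simp add: algebra_simps)
  also have "d * (E0 + 2 * F\<^sup>2 * ((e - 1) / (2 * \<alpha>)) + k * (y 0 + F'\<^sup>2 * ((e - 1) / (2 * \<alpha>))))
      = E0 * d + 1 / \<alpha> * F\<^sup>2 * (d * e - d) + k * (d * y 0 + 1 / (2 * \<alpha>) * F'\<^sup>2 * (d * e - d))"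
    using assms(6) by (simp add: field_simps)
  finally have AB: "2 * d * G + (2 + z t) * z t
      \<le> E0 * d + 1 / \<alpha> * F\<^sup>2 * (1 - d) + k * (d * y 0 + 1 / (2 * \<alpha>) * F'\<^sup>2 * (1 - d))"
    by (simp add: de)
  \<comment> \<open>The second inequality is termwise: d and 1 - d are at most 1 and all
    coefficients are nonnegative.\<close>
  have "E0 * d \<le> E0 * 1" using d E0 by (intro mult_left_mono) auto
  moreover have "1 / \<alpha> * F\<^sup>2 * (1 - d) \<le> 1 / \<alpha> * F\<^sup>2 * 1" using d assms(6) by (intro mult_left_mono) auto
  moreover have "k * (d * y 0 + 1 / (2 * \<alpha>) * F'\<^sup>2 * (1 - d)) \<le> k * (y 0 + 1 / (2 * \<alpha>) * F'\<^sup>2)"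
  proof (intro mult_left_mono add_mono k)
    show "d * y 0 \<le> y 0" using d by (intro mult_left_le_one_le) (auto simp: y_def)
    have "1 / (2 * \<alpha>) * F'\<^sup>2 * (1 - d) \<le> 1 / (2 * \<alpha>) * F'\<^sup>2 * 1" using d assms(6) by (intro mult_left_mono) auto
    then show "1 / (2 * \<alpha>) * F'\<^sup>2 * (1 - d) \<le> 1 / (2 * \<alpha>) * F'\<^sup>2" by simp
  qed
  ultimately have BC: "E0 * d + 1 / \<alpha> * F\<^sup>2 * (1 - d) + k * (d * y 0 + 1 / (2 * \<alpha>) * F'\<^sup>2 * (1 - d))
      \<le> E0 + 1 / \<alpha> * F\<^sup>2 + k * (y 0 + 1 / (2 * \<alpha>) * F'\<^sup>2)" by linarith
  show ?thesis
    unfolding Let_def using AB BC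
    unfolding E0_def z_0 y_0 unfolding z_def G_def d_def F_def F'_def k_def \<beta>_def by simp
qed

end
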